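(* Let $p:(A,\Sigma_A)\to(X,\Sigma_X)$ be a Whitney A stratified vector bundle and $F$ a covariant orthogonalizable linear functor. Then $p_F:F(A)\to X$, with $F(A)=\bigcup_{x\in X}F(A_x)$, is canonically a Whitney A stratified vector bundle.
   Context: **Stratified vector bundles.** A stratified space is a pair $(X,\Sigma)$ with $X$ a Hausdorff, second countable, paracompact space and $\Sigma$ a locally finite partition of $X$ into connected, locally closed subspaces (strata), each a topological manifold in the subspace topology and equipped with a smooth manifold structure, satisfying the frontier condition: if $S\cap\overline{R}\neq\emptyset$ for strata $S,R$, then $S\subset\overline{R}$ (also written $S\le R$). A stratified morphism is a continuous map sending each stratum into a stratum, smoothly. A stratified vector bundle is a stratified morphism $p:(A,\Sigma_A)\to(X,\Sigma_X)$ such that for each $S\in\Sigma_X$, $A|_S:=p^{-1}(S)\in\Sigma_A$ and $p:A|_S\to S$ is a smooth vector bundle, and such that scalar multiplication $\mathbb{R}\times A\to A$ is a stratified morphism. A morphism of stratified vector bundles is a pair of stratified maps (total spaces, bases) commuting with projections and restricting over each stratum to a morphism of smooth vector bundles. $X\times\mathbb{R}^n$ is a stratified vector bundle with strata $S\times\mathbb{R}^n$. **Injective structures.** A trivialization of $p:A\to X$ is an injective stratified vector bundle morphism $\phi:A\to X\times\mathbb{R}^n$ over $\mathrm{Id}_X$, for some $n$, that is a topological embedding; a local trivialization is a trivialization $\phi:p^{-1}(U)\to U\times\mathbb{R}^n$ of the restriction to an open $U\subset X$. Two local trivializations $\phi:p^{-1}(U)\to U\times\mathbb{R}^n$, $\psi:p^{-1}(V)\to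 V\times\mathbb{R}^m$ are compatible if, with $N=\max\{n,m\}$, each $x\in U\cap V$ has an open neighbourhood $W\subset U\cap V$ and a vector bundle isomorphism $H:W\times\mathbb{R}^N\to W\times\mathbb{R}^N$ with $H\circ\iota_n^N\circ\phi=\iota_m^N\circ\psi$ on $p^{-1}(W)$, where $\iota_j^N$ is induced by the inclusion $\mathbb{R}^j\hookrightarrow\mathbb{R}^N$ of the first $j$ coordinates. An injective structure is a maximal atlas of compatible local trivializations (whose domains cover $X$); an injective stratified vector bundle is a stratified vector bundle with an injective structure. **Whitney A.** $G_r(V)$ is the Grassmannian of $r$-dimensional subspaces of $V$. A pair of strata $(S,R)$ of $X$ with $S\le R$ is Whitney A with respect to an injective stratified vector bundle $p:A\to X$ if for each $x_0\in S$ and each local trivialization $\phi:p^{-1}(U)\to U\times\mathbb{R}^k$ (in the injective structure) about $x_0$: whenever $\{x_n\}\subset R$ converges to $x_0$ and $W\subset\{x_0\}\times\mathbb{R}^k$ is a subspace such that $\phi(A_{x_n})\to W$ in $X\times G_r(\mathbb{R}^k)$, $r=\mathrm{rank}(A|_R)$, then $\phi(A_{x_0})\subset W$. $p:A\to X$ is a Whitney A stratified vector bundle if it is injective and all pairs $S\le R$ are Whitney A. **Functors.** A linear functor is a functor $F$ from finite-dimensional real vector spaces to itself such that each $\mathrm{Hom}(V,W)\to\mathrm{Hom}(F(V),F(W))$ is linear. Let $\mathfrak{Inn}_{\mathbb{R}}$ be the category of finite-dimensional real inner product spaces with all linear maps as morphisms. A covariant functor $Q:\mathfrak{Inn}_{\mathbb{R}}\to\mathfrak{Inn}_{\mathbb{R}}$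 is orthogonal if it is linear on Hom spaces and for each inner product space $V$ and subspace $W\subset V$ with orthogonal projection $P_W:V\to V$, $Q(P_W)=P_{Q(W)}$ (with $Q(W)$ regarded as a subspace of $Q(V)$ via the inclusion $W\hookrightarrow V$). A linear functor $F$ is orthogonalizable if there is an orthogonal $Q$ with $U\circ Q=F\circ U$, where $U$ is the forgetful functor to vector spaces. **The bundle $F(A)$.** $p_F:F(A)\to X$ sends $F(A_x)$ to $x$. $F(A)$ has the coarsest topology such that $p_F$ is continuous and, for every local trivialization $\phi:p^{-1}(U)\to U\times\mathbb{R}^k$ in the injective structure, the fibrewise map $F(\phi):p_F^{-1}(U)\to U\times F(\mathbb{R}^k)$ is continuous. Its partition is $\Sigma_{F(A)}=\{F(A)|_S\mid S\in\Sigma_X\}$, where $F(A)|_S=F(A|_S)$ is the smooth vector bundle obtained by applying $F$ fibrewise to $A|_S$. Its injective structure is generated by the maps $F(\phi)$ (with $F(\mathbb{R}^k)$ identified linearly with a Euclidean space). *)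

theory Defs
  imports "HOL-Analysis.Analysis" "HOL-Algebra.Module"
begin

section \<open>Finite-dimensional real vector spaces and functors between them\<close>

text \<open>
  A vector space is a module, in the sense of HOL-Algebra, over the ring of real numbers.
  The fields \<^term>\<open>monoid.mult\<close> and \<^term>\<open>monoid.one\<close> of a module record play no role.
\<close>

definition real_ring :: "real ring"
  where "real_ring = \<lparr>carrier = UNIV, monoid.mult = (*), one = 1, zero = 0, add = (+)\<rparr>"

definition fd_vspace :: "(real, 'v, 'm) module_scheme \<Rightarrow> bool"
  where "fd_vspace V \<longleftrightarrow> module real_ring V \<and>
    (\<exists>B. finite B \<and> B \<subseteq> carrier V \<and>
      (\<forall>v\<in>carrier V. \<exists>c. v = (\<Oplus>\<^bsub>V\<^esub>b\<in>B. c b \<odot>\<^bsub>V\<^esub> b)))"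

definition linear_maps ::
    "(real, 'v, 'm) module_scheme \<Rightarrow> (real, 'w, 'n) module_scheme \<Rightarrow> ('v \<Rightarrow> 'w) set"
  where "linear_maps V W = {f \<in> hom (add_monoid V) (add_monoid W).
    \<forall>c. \<forall>v\<in>carrier V. f (c \<odot>\<^bsub>V\<^esub> v) = c \<odot>\<^bsub>W\<^esub> f v}"

definition linear_iso ::
    "(real, 'v, 'm) module_scheme \<Rightarrow> (real, 'w, 'n) module_scheme \<Rightarrow> ('v \<Rightarrow> 'w) \<Rightarrow> bool"
  where "linear_iso V W f \<longleftrightarrow> f \<in> linear_maps V W \<and> bij_betw f (carrier V) (carrier W)"

text \<open>Morphisms of the categories are extensional, so that equal maps are equal functions.\<close>

definition Hom ::
    "(real, 'v, 'm) module_scheme \<Rightarrow> (real, 'w, 'n) module_scheme \<Rightarrow> ('v \<Rightarrow> 'w) set"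
  where "Hom V W = linear_maps V W \<inter> extensional (carrier V)"

text \<open>
  The objects of the categories are the spaces carried by subsets of a type \<^typ>\<open>'v\<close>,
  which acts as the universe. A function does not determine its domain and codomain, hence
  they are arguments of \<open>fmap\<close>. The record extension \<^typ>\<open>'m\<close> is trivial for
  vector spaces and consists of the inner product for inner product spaces.
\<close>

record ('v, 'm) vs_functor =
  fobj :: "(real, 'v, 'm) module_scheme \<Rightarrow> (real, 'v, 'm) module_scheme"
  fmap :: "(real, 'v, 'm) module_scheme \<Rightarrow> (real, 'v, 'm) module_scheme
    \<Rightarrow> ('v \<Rightarrow> 'v) \<Rightarrow> 'v \<Rightarrow> 'v"

definition linear_functor ::
    "((real, 'v, 'm) module_scheme \<Rightarrow> bool) \<Rightarrow> ('v, 'm) vs_functor \<Rightarrow> bool"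
  where "linear_functor ob F \<longleftrightarrow>
    (\<forall>V. ob V \<longrightarrow> ob (fobj F V)) \<and>
    (\<forall>V W. ob V \<and> ob W \<longrightarrow> fmap F V W \<in> Hom V W \<rightarrow> Hom (fobj F V) (fobj F W)) \<and>
    (\<forall>V. ob V \<longrightarrow> fmap F V V (\<lambda>v\<in>carrier V. v) = (\<lambda>v\<in>carrier (fobj F V). v)) \<and>
    (\<forall>V W Z. ob V \<and> ob W \<and> ob Z \<longrightarrow> (\<forall>f\<in>Hom V W. \<forall>g\<in>Hom W Z.
      fmap F V Z (compose (carrier V) g f)
        = compose (carrier (fobj F V)) (fmap F W Z g) (fmap F V W f))) \<and>
    (\<forall>V W. ob V \<and> ob W \<longrightarrow> (\<forall>f\<in>Hom V W. \<forall>g\<in>Hom V W. \<forall>c. \<forall>v\<in>carrier (fobj F V).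
      fmap F V W (\<lambda>u\<in>carrier V. f u \<oplus>\<^bsub>W\<^esub> g u) v
        = fmap F V W f v \<oplus>\<^bsub>fobj F W\<^esub> fmap F V W g v \<and>
      fmap F V W (\<lambda>u\<in>carrier V. c \<odot>\<^bsub>W\<^esub> f u) v
        = c \<odot>\<^bsub>fobj F W\<^esub> fmap F V W f v))"

record 'v ip_space = "(real, 'v) module" +
  iprod :: "'v \<Rightarrow> 'v \<Rightarrow> real"

definition fd_ip_space :: "'v ip_space \<Rightarrow> bool"
  where "fd_ip_space V \<longleftrightarrow> fd_vspace V \<and>
    (\<forall>u\<in>carrier V. \<forall>v\<in>carrier V. iprod V u v = iprod V v u) \<and>
    (\<forall>u\<in>carrier V. \<forall>v\<in>carrier V. \<forall>w\<in>carrier V.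
      iprod V (u \<oplus>\<^bsub>V\<^esub> v) w = iprod V u w + iprod V v w) \<and>
    (\<forall>c. \<forall>u\<in>carrier V. \<forall>v\<in>carrier V. iprod V (c \<odot>\<^bsub>V\<^esub> u) v = c * iprod V u v) \<and>
    (\<forall>u\<in>carrier V. u \<noteq> \<zero>\<^bsub>V\<^esub> \<longrightarrow> iprod V u u > 0)"

definition orth_proj :: "'v ip_space \<Rightarrow> 'v set \<Rightarrow> 'v \<Rightarrow> 'v"
  where "orth_proj V W = (\<lambda>v\<in>carrier V.
    THE w. w \<in> W \<and> (\<forall>u\<in>W. iprod V (v \<ominus>\<^bsub>V\<^esub> w) u = 0))"

text \<open>
  A subspace \<open>W\<close> of \<open>V\<close> is the object \<open>V\<lparr>carrier := W\<rparr>\<close>; \<open>Q(W)\<close> is regarded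
  as a subspace of \<open>Q(V)\<close> through the image of the inclusion under \<open>Q\<close>.
\<close>

definition orthogonal_functor :: "('v, ('v, unit) ip_space_ext) vs_functor \<Rightarrow> bool"
  where "orthogonal_functor Q \<longleftrightarrow> linear_functor fd_ip_space Q \<and>
    (\<forall>V W. fd_ip_space V \<and> submodule W real_ring V \<longrightarrow>
      fmap Q V V (orth_proj V W) = orth_proj (fobj Q V)
        (fmap Q (V\<lparr>carrier := W\<rparr>) V (\<lambda>w\<in>W. w) ` carrier (fobj Q (V\<lparr>carrier := W\<rparr>))))"

text \<open>\<^term>\<open>module.truncate\<close> drops the inner product: it is the forgetful functor.\<close>

definition orthogonalizable :: "('v, unit) vs_functor \<Rightarrow> bool"
  where "orthogonalizable F \<longleftrightarrow> (\<exists>Q. orthogonal_functor Q \<and>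
    (\<forall>V. fd_ip_space V \<longrightarrow> module.truncate (fobj Q V) = fobj F (module.truncate V)) \<and>
    (\<forall>V W. fd_ip_space V \<and> fd_ip_space W \<longrightarrow> (\<forall>f\<in>Hom V W.
      fmap Q V W f = fmap F (module.truncate V) (module.truncate W) f)))"

text \<open>
  \<open>\<real>\<^sup>k\<close> consists of the sequences that vanish from index \<open>k\<close> on, as in
  \<^term>\<open>Euclidean_space\<close>. Hence the inclusion of \<open>\<real>\<^sup>j\<close> into
  \<open>\<real>\<^sup>N\<close> as the first \<open>j\<close> coordinates is an inclusion of sets.
\<close>

definition Euc :: "nat \<Rightarrow> (real, nat \<Rightarrow> real) module"
  where "Euc k = \<lparr>carrier = topspace (Euclidean_space k), monoid.mult = undefined,
    one = undefined, zero = (\<lambda>i. 0), add = (\<lambda>u v i. u i + v i), smult = (\<lambda>c u i. c * u i)\<rparr>"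

text \<open>The copy of \<open>\<real>\<^sup>k\<close> in the universe \<^typ>\<open>'v\<close> along an injection.\<close>

definition euc_obj :: "((nat \<Rightarrow> real) \<Rightarrow> 'v) \<Rightarrow> nat \<Rightarrow> (real, 'v) module"
  where "euc_obj emb k = \<lparr>carrier = emb ` topspace (Euclidean_space k), monoid.mult = undefined,
    one = undefined, zero = emb (\<lambda>i. 0),
    add = (\<lambda>u v. emb (\<lambda>i. inv_into UNIV emb u i + inv_into UNIV emb v i)),
    smult = (\<lambda>c u. emb (\<lambda>i. c * inv_into UNIV emb u i))\<rparr>"


section \<open>Smooth manifolds\<close>

text \<open>\<open>Ck k n D f\<close>: \<open>f\<close> is of class \<open>C\<^sup>k\<close> on the open subset \<open>D\<close> of \<open>\<real>\<^sup>n\<close>, by iterated partial derivatives.\<close>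

primrec Ck :: "nat \<Rightarrow> nat \<Rightarrow> (nat \<Rightarrow> real) set \<Rightarrow> ((nat \<Rightarrow> real) \<Rightarrow> real) \<Rightarrow> bool"
  where
    "Ck 0 n D f = continuous_map (subtopology (Euclidean_space n) D) euclideanreal f"
  | "Ck (Suc k) n D f =
      (continuous_map (subtopology (Euclidean_space n) D) euclideanreal f \<and>
      (\<exists>g. \<forall>i<n. (\<forall>x\<in>D. ((\<lambda>t. f (x(i := t))) has_real_derivative g i x) (at (x i)))
        \<and> Ck k n D (g i)))"

definition smooth_on :: "nat \<Rightarrow> nat \<Rightarrow> (nat \<Rightarrow> real) set \<Rightarrow> ((nat \<Rightarrow> real) \<Rightarrow> nat \<Rightarrow> real) \<Rightarrow> bool"
  where "smooth_on n m D f \<longleftrightarrow> (\<forall>j<m. \<forall>k. Ck k n D (\<lambda>x. f x j))"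

text \<open>
  A chart \<open>(d, U, c)\<close> maps its domain \<open>U\<close> homeomorphically onto an open subset of
  \<open>\<real>\<^sup>d\<close>; the values of \<open>c\<close> outside \<open>U\<close> are irrelevant. The dimension is
  not fixed, but it is constant on connected manifolds.
\<close>

type_synonym 'x chart = "nat \<times> 'x set \<times> ('x \<Rightarrow> nat \<Rightarrow> real)"
type_synonym 'x mfd = "'x topology \<times> 'x chart set"

definition is_chart :: "'x topology \<Rightarrow> 'x chart \<Rightarrow> bool"
  where "is_chart T = (\<lambda>(d, U, c). openin T U \<and> openin (Euclidean_space d) (c ` U) \<and>
    embedding_map (subtopology T U) (Euclidean_space d) c)"

definition smoothly_compatible :: "'x chart \<Rightarrow> 'x chart \<Rightarrow> bool"
  where "smoothly_compatible = (\<lambda>(d, U, c) (e, V, b).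
    smooth_on d e (c ` (U \<inter> V)) (b \<circ> the_inv_into U c) \<and>
    smooth_on e d (b ` (U \<inter> V)) (c \<circ> the_inv_into V b))"

definition max_atlas :: "'x topology \<Rightarrow> 'x chart set \<Rightarrow> 'x chart set"
  where "max_atlas T \<G> = {a. is_chart T a \<and> (\<forall>g\<in>\<G>. smoothly_compatible a g)}"

text \<open>Smooth structures are given by their maximal atlases.\<close>

definition smooth_manifold :: "'x mfd \<Rightarrow> bool"
  where "smooth_manifold = (\<lambda>(T, \<A>). Hausdorff_space T \<and> second_countable T \<and>
    (\<Union>(d, U, c)\<in>\<A>. U) = topspace T \<and> \<A> = max_atlas T \<A>)"

definition smooth_map :: "'x mfd \<Rightarrow> 'y mfd \<Rightarrow> ('x \<Rightarrow> 'y) \<Rightarrow> bool"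
  where "smooth_map = (\<lambda>(T, \<A>) (T', \<B>) f. continuous_map T T' f \<and>
    (\<forall>(d, U, c)\<in>\<A>. \<forall>(e, V, b)\<in>\<B>.
      smooth_on d e (c ` (U \<inter> f -` V)) (b \<circ> f \<circ> the_inv_into U c)))"

definition diffeo :: "'x mfd \<Rightarrow> 'y mfd \<Rightarrow> ('x \<Rightarrow> 'y) \<Rightarrow> bool"
  where "diffeo M N f \<longleftrightarrow> bij_betw f (topspace (fst M)) (topspace (fst N)) \<and>
    smooth_map M N f \<and> smooth_map N M (the_inv_into (topspace (fst M)) f)"

definition euc_mfd :: "nat \<Rightarrow> (nat \<Rightarrow> real) mfd"
  where "euc_mfd n = (Euclidean_space n,
    max_atlas (Euclidean_space n) {(n, topspace (Euclidean_space n), \<lambda>x. x)})"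

definition real_mfd :: "real mfd"
  where "real_mfd = (euclideanreal,
    max_atlas euclideanreal {(1, UNIV, \<lambda>t i. if i = 0 then t else 0)})"

definition append_coords :: "nat \<Rightarrow> (nat \<Rightarrow> real) \<Rightarrow> (nat \<Rightarrow> real) \<Rightarrow> nat \<Rightarrow> real"
  where "append_coords d u v = (\<lambda>i. if i < d then u i else v (i - d))"

definition prod_mfd :: "'x mfd \<Rightarrow> 'y mfd \<Rightarrow> ('x \<times> 'y) mfd"
  where "prod_mfd = (\<lambda>(T, \<A>) (T', \<B>). (prod_topology T T', max_atlas (prod_topology T T')
    {(d + e, U \<times> V, \<lambda>(x, y). append_coords d (c x) (b y)) | d U c e V b.
      (d, U, c) \<in> \<A> \<and> (e, V, b) \<in> \<B>}))"


section \<open>Stratified spaces\<close>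

text \<open>
  The charts of all strata are collected in one set; since strata are disjoint, the smooth
  structure of a stratum, and of its open subsets, consists of the charts with domain in it.
\<close>

record 'x strat =
  stop :: "'x topology"
  strata :: "'x set set"
  charts :: "'x chart set"

abbreviation spt :: "'x strat \<Rightarrow> 'x set"
  where "spt X \<equiv> topspace (stop X)"

definition sub_mfd :: "'x strat \<Rightarrow> 'x set \<Rightarrow> 'x mfd"
  where "sub_mfd X S = (subtopology (stop X) S, {(d, U, c) \<in> charts X. U \<subseteq> S})"

definition paracompact_space :: "'x topology \<Rightarrow> bool"
  where "paracompact_space T \<longleftrightarrow>
    (\<forall>\<U>. (\<forall>U\<in>\<U>. openin T U) \<and> \<Union>\<U> = topspace T \<longrightarrow>
      (\<exists>\<V>. (\<forall>V\<in>\<V>. openin T V \<and> (\<exists>U\<in>\<U>. V \<subseteq> U)) \<and> \<Union>\<V> = topspace T \<and> locally_finite_in T \<V>))"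

definition stratified_space :: "'x strat \<Rightarrow> bool"
  where "stratified_space X \<longleftrightarrow>
    Hausdorff_space (stop X) \<and> second_countable (stop X) \<and> paracompact_space (stop X) \<and>
    partition_on (spt X) (strata X) \<and> locally_finite_in (stop X) (strata X) \<and>
    (\<forall>S\<in>strata X. connectedin (stop X) S \<and>
      (\<exists>U C. openin (stop X) U \<and> closedin (stop X) C \<and> S = U \<inter> C) \<and>
      smooth_manifold (sub_mfd X S)) \<and>
    (\<forall>(d, U, c)\<in>charts X. \<exists>S\<in>strata X. U \<subseteq> S) \<and>
    (\<forall>S\<in>strata X. \<forall>R\<in>strata X. S \<inter> stop X closure_of R \<noteq> {} \<longrightarrow> S \<subseteq> stop X closure_of R)"

definition strat_morphism :: "'x strat \<Rightarrow> 'y strat \<Rightarrow> ('x \<Rightarrow> 'y) \<Rightarrow> bool"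
  where "strat_morphism X Y f \<longleftrightarrow> continuous_map (stop X) (stop Y) f \<and>
    (\<forall>S\<in>strata X. \<exists>T\<in>strata Y. f ` S \<subseteq> T \<and> smooth_map (sub_mfd X S) (sub_mfd Y T) f)"

definition strat_prod :: "'x strat \<Rightarrow> 'y strat \<Rightarrow> ('x \<times> 'y) strat"
  where "strat_prod X Y = \<lparr>stop = prod_topology (stop X) (stop Y),
    strata = {S \<times> T | S T. S \<in> strata X \<and> T \<in> strata Y},
    charts = (\<Union>S\<in>strata X. \<Union>T\<in>strata Y. snd (prod_mfd (sub_mfd X S) (sub_mfd Y T)))\<rparr>"

definition one_stratum :: "'x mfd \<Rightarrow> 'x strat"
  where "one_stratum M = \<lparr>stop = fst M, strata = {topspace (fst M)}, charts = snd M\<rparr>"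

text \<open>
  Restriction to an open subset. The pieces \<open>S \<inter> U\<close> need not be connected; passing to
  their components changes neither continuity nor smoothness on strata, the only
  conditions for which restrictions are used.
\<close>

definition strat_restrict :: "'x strat \<Rightarrow> 'x set \<Rightarrow> 'x strat"
  where "strat_restrict X U = \<lparr>stop = subtopology (stop X) U,
    strata = {S \<inter> U | S. S \<in> strata X \<and> S \<inter> U \<noteq> {}},
    charts = {(d, V, c) \<in> charts X. V \<subseteq> U}\<rparr>"


section \<open>Stratified vector bundles\<close>

record ('a, 'x) svb =
  tot :: "'a strat"
  bas :: "'x strat"
  proj :: "'a \<Rightarrow> 'x"
  fzero :: "'x \<Rightarrow> 'a"
  fadd :: "'a \<Rightarrow> 'a \<Rightarrow> 'a"
  fsmult :: "real \<Rightarrow> 'a \<Rightarrow> 'a"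

definition over :: "('a, 'x) svb \<Rightarrow> 'x set \<Rightarrow> 'a set"
  where "over B S = {a \<in> spt (tot B). proj B a \<in> S}"

definition fibre :: "('a, 'x) svb \<Rightarrow> 'x \<Rightarrow> (real, 'a) module"
  where "fibre B x = \<lparr>carrier = over B {x}, monoid.mult = undefined, one = undefined,
    zero = fzero B x, add = fadd B, smult = fsmult B\<rparr>"

text \<open>A smooth local trivialization \<open>\<tau>\<close> of rank \<open>r\<close>, over the open subset \<open>V\<close> of the stratum \<open>S\<close>.\<close>

definition smooth_local_triv ::
    "('a, 'x) svb \<Rightarrow> 'x set \<Rightarrow> nat \<Rightarrow> 'x set \<Rightarrow> ('a \<Rightarrow> 'x \<times> (nat \<Rightarrow> real)) \<Rightarrow> bool"
  where "smooth_local_triv B S r V \<tau> \<longleftrightarrow>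
    openin (subtopology (stop (bas B)) S) V \<and>
    diffeo (sub_mfd (tot B) (over B V)) (prod_mfd (sub_mfd (bas B) V) (euc_mfd r)) \<tau> \<and>
    (\<forall>a\<in>over B V. fst (\<tau> a) = proj B a) \<and>
    (\<forall>x\<in>V. linear_iso (fibre B x) (Euc r) (snd \<circ> \<tau>))"

definition smooth_vb :: "('a, 'x) svb \<Rightarrow> 'x set \<Rightarrow> nat \<Rightarrow> bool"
  where "smooth_vb B S r \<longleftrightarrow>
    smooth_map (sub_mfd (tot B) (over B S)) (sub_mfd (bas B) S) (proj B) \<and>
    (\<forall>x\<in>S. fd_vspace (fibre B x)) \<and>
    (\<forall>x\<in>S. \<exists>V \<tau>. x \<in> V \<and> smooth_local_triv B S r V \<tau>)"

definition stratified_vector_bundle :: "('a, 'x) svb \<Rightarrow> bool"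
  where "stratified_vector_bundle B \<longleftrightarrow>
    stratified_space (tot B) \<and> stratified_space (bas B) \<and>
    strat_morphism (tot B) (bas B) (proj B) \<and>
    (\<forall>S\<in>strata (bas B). over B S \<in> strata (tot B) \<and> (\<exists>r. smooth_vb B S r)) \<and>
    strat_morphism (strat_prod (one_stratum real_mfd) (tot B)) (tot B) (\<lambda>(c, a). fsmult B c a)"

definition svb_morphism ::
    "('a, 'x) svb \<Rightarrow> ('b, 'y) svb \<Rightarrow> ('a \<Rightarrow> 'b) \<Rightarrow> ('x \<Rightarrow> 'y) \<Rightarrow> bool"
  where "svb_morphism B C f g \<longleftrightarrow>
    strat_morphism (tot B) (tot C) f \<and> strat_morphism (bas B) (bas C) g \<and>
    (\<forall>a\<in>spt (tot B). proj C (f a) = g (proj B a)) \<and>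
    (\<forall>x\<in>spt (bas B). f \<in> linear_maps (fibre B x) (fibre C (g x)))"

definition trivial_svb :: "'x strat \<Rightarrow> nat \<Rightarrow> ('x \<times> (nat \<Rightarrow> real), 'x) svb"
  where "trivial_svb X n = \<lparr>tot = strat_prod X (one_stratum (euc_mfd n)), bas = X, proj = fst,
    fzero = (\<lambda>x. (x, \<lambda>i. 0)),
    fadd = (\<lambda>(x, u) (y, v). (x, \<lambda>i. u i + v i)),
    fsmult = (\<lambda>c (x, u). (x, \<lambda>i. c * u i))\<rparr>"

definition svb_restrict :: "('a, 'x) svb \<Rightarrow> 'x set \<Rightarrow> ('a, 'x) svb"
  where "svb_restrict B U = B\<lparr>tot := strat_restrict (tot B) (over B U),
    bas := strat_restrict (bas B) U\<rparr>"


section \<open>Injective structures\<close>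

definition trivialization :: "('a, 'x) svb \<Rightarrow> nat \<Rightarrow> ('a \<Rightarrow> 'x \<times> (nat \<Rightarrow> real)) \<Rightarrow> bool"
  where "trivialization B n \<phi> \<longleftrightarrow>
    svb_morphism B (trivial_svb (bas B) n) \<phi> (\<lambda>x. x) \<and> inj_on \<phi> (spt (tot B)) \<and>
    embedding_map (stop (tot B)) (stop (tot (trivial_svb (bas B) n))) \<phi>"

type_synonym ('a, 'x) triv = "nat \<times> 'x set \<times> ('a \<Rightarrow> 'x \<times> (nat \<Rightarrow> real))"

definition local_triv :: "('a, 'x) svb \<Rightarrow> ('a, 'x) triv \<Rightarrow> bool"
  where "local_triv B = (\<lambda>(n, U, \<phi>). openin (stop (bas B)) U \<and> trivialization (svb_restrict B U) n \<phi>)"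

text \<open>Isomorphisms, over the identity, of the (topological) vector bundle \<open>T \<times> \<real>\<^sup>N\<close>.\<close>

definition vb_iso :: "'x topology \<Rightarrow> nat \<Rightarrow> ('x \<times> (nat \<Rightarrow> real) \<Rightarrow> 'x \<times> (nat \<Rightarrow> real)) \<Rightarrow> bool"
  where "vb_iso T N H \<longleftrightarrow>
    homeomorphic_map (prod_topology T (Euclidean_space N)) (prod_topology T (Euclidean_space N)) H \<and>
    (\<forall>x\<in>topspace T. (\<forall>v\<in>carrier (Euc N). fst (H (x, v)) = x) \<and>
      (\<lambda>v. snd (H (x, v))) \<in> linear_maps (Euc N) (Euc N))"

text \<open>The inclusions \<open>\<iota>\<close> of \<open>\<real>\<^sup>n\<close> and \<open>\<real>\<^sup>m\<close> into \<open>\<real>\<^sup>N\<close> are identities on representatives.\<close>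

definition compatible :: "('a, 'x) svb \<Rightarrow> ('a, 'x) triv \<Rightarrow> ('a, 'x) triv \<Rightarrow> bool"
  where "compatible B = (\<lambda>(n, U, \<phi>) (m, V, \<psi>). \<forall>x\<in>U \<inter> V. \<exists>W H.
    openin (stop (bas B)) W \<and> x \<in> W \<and> W \<subseteq> U \<inter> V \<and>
    vb_iso (subtopology (stop (bas B)) W) (max n m) H \<and>
    (\<forall>a\<in>over B W. H (\<phi> a) = \<psi> a))"

definition injective_structure :: "('a, 'x) svb \<Rightarrow> ('a, 'x) triv set \<Rightarrow> bool"
  where "injective_structure B \<A> \<longleftrightarrow>
    (\<forall>t\<in>\<A>. local_triv B t) \<and> (\<Union>(n, U, \<phi>)\<in>\<A>. U) = spt (bas B) \<and>
    (\<forall>s\<in>\<A>. \<forall>t\<in>\<A>. compatible B s t) \<and>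
    (\<forall>t. local_triv B t \<and> (\<forall>s\<in>\<A>. compatible B s t) \<longrightarrow> t \<in> \<A>)"

definition generated_structure :: "('a, 'x) svb \<Rightarrow> ('a, 'x) triv set \<Rightarrow> ('a, 'x) triv set"
  where "generated_structure B \<G> = {t. local_triv B t \<and> (\<forall>s\<in>\<G>. compatible B s t)}"


section \<open>Whitney A\<close>

text \<open>The space of linearly independent \<open>r\<close>-tuples in \<open>\<real>\<^sup>k\<close>.\<close>

definition frames :: "nat \<Rightarrow> nat \<Rightarrow> (nat \<Rightarrow> nat \<Rightarrow> real) topology"
  where "frames r k = subtopology (product_topology (\<lambda>_. Euclidean_space k) {..<r})
    {b. \<forall>c. (\<forall>i. (\<Sum>j<r. c j * b j i) = 0) \<longrightarrow> (\<forall>j<r. c j = (0::real))}"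

definition frame_span :: "nat \<Rightarrow> (nat \<Rightarrow> nat \<Rightarrow> real) \<Rightarrow> (nat \<Rightarrow> real) set"
  where "frame_span r b = range (\<lambda>c i. \<Sum>j<r. c j * b j i)"

text \<open>The Grassmannian \<open>G\<^sub>r(\<real>\<^sup>k)\<close>, with the quotient topology from the space of frames.\<close>

definition grassmannian :: "nat \<Rightarrow> nat \<Rightarrow> (nat \<Rightarrow> real) set topology"
  where "grassmannian r k = topology (\<lambda>\<U>. \<U> \<subseteq> frame_span r ` topspace (frames r k) \<and>
    openin (frames r k) {b \<in> topspace (frames r k). frame_span r b \<in> \<U>})"

lemma openin_grassmannian:
  "openin (grassmannian r k) \<U> \<longleftrightarrow> \<U> \<subseteq> frame_span r ` topspace (frames r k) \<and>
    openin (frames r k) {b \<in> topspace (frames r k). frame_span r b \<in> \<U>}"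
proof -
  let ?T = "topspace (frames r k)"
  let ?P = "\<lambda>\<U>. \<U> \<subseteq> frame_span r ` ?T \<and> openin (frames r k) {b \<in> ?T. frame_span r b \<in> \<U>}"
  have "istopology ?P"
    unfolding istopology_def
  proof (intro conjI allI impI)
    fix S T assume *: "?P S" "?P T"
    then have "openin (frames r k) ({b \<in> ?T. frame_span r b \<in> S} \<inter> {b \<in> ?T. frame_span r b \<in> T})"
      by blast
    moreover have "{b \<in> ?T. frame_span r b \<in> S} \<inter> {b \<in> ?T. frame_span r b \<in> T}
        = {b \<in> ?T. frame_span r b \<in> S \<inter> T}"
      by blast
    ultimately show "openin (frames r k) {b \<in> ?T. frame_span r b \<in> S \<inter> T}" by simp
    show "S \<inter> T \<subseteq> frame_span r ` ?T" using * by blast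
  next
    fix \<K> assume *: "\<forall>K\<in>\<K>. ?P K"
    then have "openin (frames r k) (\<Union>K\<in>\<K>. {b \<in> ?T. frame_span r b \<in> K})" by blast
    moreover have "(\<Union>K\<in>\<K>. {b \<in> ?T. frame_span r b \<in> K}) = {b \<in> ?T. frame_span r b \<in> \<Union>\<K>}"
      by blast
    ultimately show "openin (frames r k) {b \<in> ?T. frame_span r b \<in> \<Union>\<K>}" by simp
    show "\<Union>\<K> \<subseteq> frame_span r ` ?T" using * by blast
  qed
  then show ?thesis by (simp add: grassmannian_def)
qed

definition whitney_A_pair ::
    "('a, 'x) svb \<Rightarrow> ('a, 'x) triv set \<Rightarrow> 'x set \<Rightarrow> 'x set \<Rightarrow> bool"
  where "whitney_A_pair B \<A> S R \<longleftrightarrow>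
    (\<forall>x0\<in>S. \<forall>(k, U, \<phi>)\<in>\<A>. x0 \<in> U \<longrightarrow> (\<forall>xs r W.
      smooth_vb B R r \<and> range xs \<subseteq> R \<and> limitin (stop (bas B)) xs x0 sequentially \<and>
      limitin (prod_topology (stop (bas B)) (grassmannian r k))
        (\<lambda>n. (xs n, snd ` \<phi> ` over B {xs n})) (x0, W) sequentially
      \<longrightarrow> snd ` \<phi> ` over B {x0} \<subseteq> W))"

text \<open>Whitney A stratified vector bundles \<open>B\<close>, with their injective structures \<open>\<A>\<close>.\<close>

definition whitney_A_bundle :: "('a, 'x) svb \<Rightarrow> ('a, 'x) triv set \<Rightarrow> bool"
  where "whitney_A_bundle B \<A> \<longleftrightarrow> stratified_vector_bundle B \<and> injective_structure B \<A> \<and>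
    (\<forall>S\<in>strata (bas B). \<forall>R\<in>strata (bas B). S \<subseteq> stop (bas B) closure_of R \<longrightarrow>
      whitney_A_pair B \<A> S R)"


section \<open>The bundle \<open>F(A)\<close>\<close>

text \<open>
  As the spaces \<open>F(A\<^sub>x)\<close> may overlap in the universe, \<open>F(A)\<close> is their disjoint union.
\<close>

definition functor_tot :: "('v, unit) vs_functor \<Rightarrow> ('v, 'x) svb \<Rightarrow> ('x \<times> 'v) set"
  where "functor_tot F B = (SIGMA x:spt (bas B). carrier (fobj F (fibre B x)))"

text \<open>
  \<open>F(\<phi>)\<close>, for a fibrewise linear map \<open>\<phi>\<close> into \<open>U \<times> \<real>\<^sup>k\<close>, followed by an
  identification \<open>\<theta>\<close> of \<open>F(\<real>\<^sup>k)\<close> with a Euclidean space.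
\<close>

definition functor_lift ::
    "((nat \<Rightarrow> real) \<Rightarrow> 'v) \<Rightarrow> ('v, unit) vs_functor \<Rightarrow> ('v, 'x) svb \<Rightarrow> nat
      \<Rightarrow> ('v \<Rightarrow> nat \<Rightarrow> real) \<Rightarrow> ('v \<Rightarrow> 'x \<times> (nat \<Rightarrow> real)) \<Rightarrow> 'x \<times> 'v \<Rightarrow> 'x \<times> (nat \<Rightarrow> real)"
  where "functor_lift emb F B k \<theta> \<phi> = (\<lambda>(x, v). (x, \<theta> (fmap F (fibre B x) (euc_obj emb k)
    (\<lambda>a\<in>carrier (fibre B x). emb (snd (\<phi> a))) v)))"

definition functor_trivs ::
    "((nat \<Rightarrow> real) \<Rightarrow> 'v) \<Rightarrow> ('v, unit) vs_functor \<Rightarrow> ('v, 'x) svb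
      \<Rightarrow> ('v, 'x) triv set \<Rightarrow> ('x \<times> 'v, 'x) triv set"
  where "functor_trivs emb F B \<A> = {(m, U, functor_lift emb F B k \<theta> \<phi>) | m U k \<theta> \<phi>.
    (k, U, \<phi>) \<in> \<A> \<and> linear_iso (fobj F (euc_obj emb k)) (Euc m) \<theta>}"

definition functor_topology ::
    "((nat \<Rightarrow> real) \<Rightarrow> 'v) \<Rightarrow> ('v, unit) vs_functor \<Rightarrow> ('v, 'x) svb
      \<Rightarrow> ('v, 'x) triv set \<Rightarrow> ('x \<times> 'v) topology"
  where "functor_topology emb F B \<A> = topology_generated_by
    ({functor_tot F B \<inter> fst -` G | G. openin (stop (bas B)) G} \<union>
     {functor_tot F B \<inter> fst -` U \<inter> h -` G | m U h G. (m, U, h) \<in> functor_trivs emb F B \<A> \<and>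
        openin (prod_topology (subtopology (stop (bas B)) U) (Euclidean_space m)) G})"

text \<open>
  The smooth structure of \<open>F(A)\<close> over a stratum \<open>S\<close> is generated by the charts that
  combine charts of \<open>S\<close> with the images \<open>F(\<tau>)\<close> of smooth local trivializations.
\<close>

definition functor_charts ::
    "((nat \<Rightarrow> real) \<Rightarrow> 'v) \<Rightarrow> ('v, unit) vs_functor \<Rightarrow> ('v, 'x) svb
      \<Rightarrow> 'x set \<Rightarrow> ('x \<times> 'v) chart set"
  where "functor_charts emb F B S =
    {(d + m, functor_tot F B \<inter> fst -` V,
        \<lambda>(x, v). append_coords d (c x) (snd (functor_lift emb F B r \<theta> \<tau> (x, v))))
      | d V c r \<tau> m \<theta>. (d, V, c) \<in> snd (sub_mfd (bas B) S) \<and>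
          smooth_local_triv B S r V \<tau> \<and> linear_iso (fobj F (euc_obj emb r)) (Euc m) \<theta>}"

definition functor_bundle ::
    "((nat \<Rightarrow> real) \<Rightarrow> 'v) \<Rightarrow> ('v, unit) vs_functor \<Rightarrow> ('v, 'x) svb
      \<Rightarrow> ('v, 'x) triv set \<Rightarrow> ('x \<times> 'v, 'x) svb"
  where "functor_bundle emb F B \<A> = \<lparr>
    tot = \<lparr>stop = functor_topology emb F B \<A>,
      strata = {functor_tot F B \<inter> fst -` S | S. S \<in> strata (bas B)},
      charts = (\<Union>S\<in>strata (bas B).
        max_atlas (subtopology (functor_topology emb F B \<A>) (functor_tot F B \<inter> fst -` S))
          (functor_charts emb F B S))\<rparr>,
    bas = bas B,
    proj = fst,
    fzero = (\<lambda>x. (x, \<zero>\<^bsub>fobj F (fibre B x)\<^esub>)),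
    fadd = (\<lambda>(x, u) (y, v). (x, u \<oplus>\<^bsub>fobj F (fibre B x)\<^esub> v)),
    fsmult = (\<lambda>c (x, u). (x, c \<odot>\<^bsub>fobj F (fibre B x)\<^esub> u))\<rparr>"

end

theory Submission
  imports Defs "HOL-Library.Function_Algebras"
begin

text \<open>
  Identify \<open>F(\<real>\<^sup>k)\<close> with some \<open>\<real>\<^sup>m\<close>. As \<open>F\<close> is linear on Hom spaces, the entries of \<open>F(M)\<close> depend linearly
  on those of the matrix \<open>M\<close>, so \<open>F\<close> preserves continuous and smooth families of linear maps. Compatible local
  trivializations of \<open>A\<close> are related, in both directions, by continuous families of (not necessarily invertible)
  matrices; their images under \<open>F\<close> show that one lifted trivialization determines the topology of \<open>F(A)\<close> over its
  domain and that the lifted trivializations are compatible.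

  For condition A, let \<open>x\<^sub>n \<longlonglongrightarrow> x\<^sub>0\<close> in \<open>R\<close> and let \<open>P\<^sub>n\<close> be the orthogonal projection of \<open>\<real>\<^sup>k\<close> onto \<open>\<phi>(A\<^bsub>x\<^sub>n\<^esub>)\<close>.
  A subsequence converges to a projection \<open>P\<^sub>0\<close>, which fixes \<open>\<phi>(A\<^bsub>x\<^sub>0\<^esub>)\<close> by condition A for \<open>A\<close>. Since \<open>P\<^sub>n\<close> factors
  through \<open>A\<^bsub>x\<^sub>n\<^esub>\<close>, the vectors \<open>F(P\<^sub>n) (F(\<phi>) v)\<close> come from \<open>F(A\<^bsub>x\<^sub>n\<^esub>)\<close>, and they converge to \<open>F(\<phi>) v\<close> for each
  \<open>v \<in> F(A\<^bsub>x\<^sub>0\<^esub>)\<close>. So every point of \<open>F(A)\<close> over \<open>x\<^sub>0\<close> is a limit of points over \<open>x\<^sub>n\<close>, which gives both the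
  frontier condition and condition A for \<open>F(A)\<close>.
\<close>

section \<open>Linear algebra in coordinates\<close>

text \<open>Compatibility is phrased with isomorphisms of \<open>\<real>^max(n,m)\<close>, which
  cannot be carried along as they are: \<open>F\<close> of a coordinate inclusion need not be a
  coordinate inclusion under the chosen identifications, and composing through a third
  trivialization may raise the dimension. Both difficulties vanish for matrix families that need be
  correct only on the image of a trivialization. An isomorphism is recovered at the end from a pair
  of such families, by a correction that is zero on that image. A second obstacle: the topology of
  \<open>F(A)\<close> comes from lifts of injective trivializations, its smooth charts from lifts of
  smooth trivializations over single strata. Over a stratum, the former are the latter followed by
  injective matrices that depend continuously, even smoothly, on the base point. A locally uniform
  lower bound for injective matrices allows them to be cancelled. In condition A for
  \<open>F(A)\<close> the Grassmannian enters through one fact only: a limit subspace contains the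
  limits of vectors taken from the members of the sequence. So no limit of the images of the spaces
  \<open>F(A_x)\<close> is computed, and trivializations that are not lifts need no extra
  care.\<close>

type_synonym vec = "nat \<Rightarrow> real"

abbreviation Eu :: "nat \<Rightarrow> vec topology"
  where "Eu \<equiv> Euclidean_space"

abbreviation cont_real :: "'a topology \<Rightarrow> ('a \<Rightarrow> real) \<Rightarrow> bool"
  where "cont_real T \<equiv> continuous_map T euclideanreal"

abbreviation E :: "nat \<Rightarrow> vec set"
  where "E n \<equiv> topspace (Eu n)"

definition unit_vec :: "nat \<Rightarrow> vec"
  where "unit_vec j = (\<lambda>i. if i = j then 1 else 0)"

text \<open>The linear map with columns \<open>A 0, \<dots>, A (p - 1)\<close>.\<close>

definition lmap :: "nat \<Rightarrow> (nat \<Rightarrow> vec) \<Rightarrow> vec \<Rightarrow> vec"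
  where "lmap p A v = (\<lambda>i. \<Sum>j<p. v j * A j i)"

abbreviation scale :: "real \<Rightarrow> vec \<Rightarrow> vec"
  where "scale c u \<equiv> \<lambda>i. c * u i"

text \<open>All the spaces \<open>E n\<close> lie in the space of all real sequences, where they
  form an increasing chain of subspaces; bases and independence are taken there.\<close>

interpretation fun_vs: vector_space scale
  by unfold_locales (auto simp: algebra_simps plus_fun_def)

interpretation fun_vsp: vector_space_pair
    scale scale ..

lemma E_iff: "v \<in> E n \<longleftrightarrow> (\<forall>i\<ge>n. v i = 0)"
  by (simp add: topspace_Euclidean_space)

lemma E_zero: "v \<in> E n \<Longrightarrow> n \<le> i \<Longrightarrow> v i = 0"
  by (simp add: E_iff)

lemma E_eqI: "\<lbrakk>u \<in> E n; v \<in> E n; \<And>i. i < n \<Longrightarrow> u i = v i\<rbrakk> \<Longrightarrow> u = v"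
  by (rule ext) (metis E_zero linorder_not_le)

lemma E_mono: "m \<le> n \<Longrightarrow> v \<in> E m \<Longrightarrow> v \<in> E n"
  by (simp add: E_iff)

lemma zero_E [simp]: "(\<lambda>i. 0) \<in> E n"
  by (simp add: E_iff)

lemma unit_vec_E [simp]: "unit_vec j \<in> E n \<longleftrightarrow> j < n"
  by (auto simp: E_iff unit_vec_def not_le)

lemma E_add: "u \<in> E n \<Longrightarrow> v \<in> E n \<Longrightarrow> (\<lambda>i. u i + v i) \<in> E n"
  by (simp add: E_iff)

lemma E_diff: "u \<in> E n \<Longrightarrow> v \<in> E n \<Longrightarrow> (\<lambda>i. u i - v i) \<in> E n"
  by (simp add: E_iff)

lemma E_scale: "v \<in> E n \<Longrightarrow> (\<lambda>i. c * v i) \<in> E n"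
  by (simp add: E_iff)

lemma E_sum: "(\<And>j. j \<in> J \<Longrightarrow> A j \<in> E n) \<Longrightarrow> (\<lambda>i. \<Sum>j\<in>J. c j * A j i) \<in> E n"
  by (simp add: E_iff)

lemma subspace_E: "fun_vs.subspace (E n)"
  unfolding fun_vs.subspace_def by (auto simp: E_iff zero_fun_def plus_fun_def)

lemma lmap_E: "(\<And>j. j < p \<Longrightarrow> A j \<in> E q) \<Longrightarrow> lmap p A v \<in> E q"
  by (auto simp: lmap_def E_iff)

lemma linear_lmap: "Vector_Spaces.linear scale scale (lmap p A)"
  by unfold_locales
    (auto simp: lmap_def fun_eq_iff algebra_simps sum.distrib sum_distrib_left)

lemma lmap_add: "lmap p A (\<lambda>i. u i + v i) = (\<lambda>i. lmap p A u i + lmap p A v i)"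
  by (simp add: lmap_def algebra_simps sum.distrib)

lemma lmap_diff: "lmap p A (\<lambda>i. u i - v i) = (\<lambda>i. lmap p A u i - lmap p A v i)"
  by (simp add: lmap_def algebra_simps sum_subtractf)

lemma lmap_scale: "lmap p A (\<lambda>i. c * v i) = (\<lambda>i. c * lmap p A v i)"
  by (simp add: lmap_def algebra_simps sum_distrib_left)

lemma lmap_zero [simp]: "lmap p A (\<lambda>i. 0) = (\<lambda>i. 0)"
  by (simp add: lmap_def)

lemma lmap_unit_vec: "j < p \<Longrightarrow> lmap p A (unit_vec j) = A j"
  by (simp add: lmap_def unit_vec_def fun_eq_iff if_distrib [of "\<lambda>x. x * _"] sum.delta
      cong: if_cong)

lemma lmap_cong: "(\<And>j. j < p \<Longrightarrow> A j = A' j) \<Longrightarrow> lmap p A = lmap p A'"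
  by (auto simp: lmap_def fun_eq_iff intro!: sum.cong)

lemma linear_maps_Euc_iff:
  "M \<in> linear_maps (Euc p) (Euc q) \<longleftrightarrow> (\<forall>v\<in>E p. M v \<in> E q) \<and>
    (\<forall>u\<in>E p. \<forall>v\<in>E p. M (\<lambda>i. u i + v i) = (\<lambda>i. M u i + M v i)) \<and>
    (\<forall>c. \<forall>v\<in>E p. M (\<lambda>i. c * v i) = (\<lambda>i. c * M v i))"
  by (auto simp: linear_maps_def hom_def Euc_def Pi_iff)

lemma lmap_linear_maps: "(\<And>j. j < p \<Longrightarrow> A j \<in> E q) \<Longrightarrow> lmap p A \<in> linear_maps (Euc p) (Euc q)"
  by (simp add: linear_maps_Euc_iff lmap_E lmap_add lmap_scale)

lemma linear_maps_E: "M \<in> linear_maps (Euc p) (Euc q) \<Longrightarrow> v \<in> E p \<Longrightarrow> M v \<in> E q"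
  by (simp add: linear_maps_Euc_iff)

lemma linear_maps_add:
  "\<lbrakk>M \<in> linear_maps (Euc p) (Euc q); u \<in> E p; v \<in> E p\<rbrakk> \<Longrightarrow> M (\<lambda>i. u i + v i) = (\<lambda>i. M u i + M v i)"
  unfolding linear_maps_Euc_iff by blast

lemma linear_maps_scale:
  "\<lbrakk>M \<in> linear_maps (Euc p) (Euc q); v \<in> E p\<rbrakk> \<Longrightarrow> M (\<lambda>i. c * v i) = (\<lambda>i. c * M v i)"
  unfolding linear_maps_Euc_iff by blast

lemma linear_maps_0: "M \<in> linear_maps (Euc p) (Euc q) \<Longrightarrow> M (\<lambda>i. 0) = (\<lambda>i. 0)"
  using linear_maps_scale [of M p q "\<lambda>i. 0" 0] by simp

lemma E_decomp: "v \<in> E p \<Longrightarrow> v = lmap p unit_vec v"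
  by (rule ext) (auto simp: lmap_def unit_vec_def E_iff if_distrib [of "\<lambda>x. _ * x"] sum.delta
      cong: if_cong)

text \<open>\<open>M\<close> is additive only on \<open>E p\<close> and arbitrary elsewhere, so the
  expansion goes by induction over the partial sums, all of which stay in
  \<open>E p\<close>.\<close>

lemma linear_maps_eq_lmap:
  assumes M: "M \<in> linear_maps (Euc p) (Euc q)" and v: "v \<in> E p"
  shows "M v = lmap p (\<lambda>j. M (unit_vec j)) v"
proof -
  have "M (\<lambda>i. \<Sum>j<n. v j * unit_vec j i) = (\<lambda>i. \<Sum>j<n. v j * M (unit_vec j) i)" if "n \<le> p" for n
    using that
  proof (induction n)
    case 0
    show ?case using linear_maps_0 [OF M] by simp
  next
    case (Suc n)
    have 1: "(\<lambda>i. \<Sum>j<n. v j * unit_vec j i) \<in> E p"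
      using Suc.prems by (intro E_sum) auto
    have 2: "unit_vec n \<in> E p" using Suc.prems by simp
    have "M (\<lambda>i. (\<Sum>j<n. v j * unit_vec j i) + v n * unit_vec n i)
        = (\<lambda>i. M (\<lambda>i. \<Sum>j<n. v j * unit_vec j i) i + v n * M (unit_vec n) i)"
      unfolding linear_maps_add [OF M 1 E_scale [OF 2]] linear_maps_scale [OF M 2] ..
    moreover have "M (\<lambda>i. \<Sum>j<n. v j * unit_vec j i) = (\<lambda>i. \<Sum>j<n. v j * M (unit_vec j) i)"
      using Suc by simp
    ultimately show ?case by (simp only: sum.lessThan_Suc)
  qed
  from this [of p] have "M (lmap p unit_vec v) = lmap p (\<lambda>j. M (unit_vec j)) v"
    unfolding lmap_def by simp
  then show ?thesis unfolding E_decomp [OF v, symmetric] .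
qed

lemma lmap_lmap:
  assumes "\<And>j. j < p \<Longrightarrow> A j \<in> E q"
  shows "lmap q C (lmap p A v) = lmap p (\<lambda>j. lmap q C (A j)) v"
  by (auto simp: lmap_def fun_eq_iff sum_distrib_left sum_distrib_right mult.assoc intro: sum.swap)

lemma inj_on_lmap:
  assumes "\<And>v. v \<in> E p \<Longrightarrow> lmap p A v = (\<lambda>i. 0) \<Longrightarrow> v = (\<lambda>i. 0)"
  shows "inj_on (lmap p A) (E p)"
proof (rule inj_onI)
  fix u v assume uv: "u \<in> E p" "v \<in> E p" "lmap p A u = lmap p A v"
  have "lmap p A (\<lambda>i. u i - v i) = (\<lambda>i. 0)" unfolding lmap_diff uv(3) by simp
  from assms [OF E_diff [OF uv(1,2)] this] show "u = v" by (simp add: fun_eq_iff)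
qed

lemma linear_imp_linear_maps:
  assumes "Vector_Spaces.linear scale scale g"
    and "\<And>v. v \<in> E q \<Longrightarrow> g v \<in> E p"
  shows "g \<in> linear_maps (Euc q) (Euc p)"
proof -
  interpret g: Vector_Spaces.linear scale scale g
    by (rule assms(1))
  show ?thesis
    unfolding linear_maps_Euc_iff using assms(2) g.add [unfolded plus_fun_def] g.scale by blast
qed

text \<open>The left inverse is delivered as a matrix \<open>C\<close>. This serves two purposes:
  its columns give a norm bound, and \<open>F\<close> can be applied to it, so that injectivity
  survives under \<open>F\<close>.\<close>

lemma lmap_left_inverse:
  assumes A: "\<And>j. j < p \<Longrightarrow> A j \<in> E q"
    and inj: "\<And>v. v \<in> E p \<Longrightarrow> lmap p A v = (\<lambda>i. 0) \<Longrightarrow> v = (\<lambda>i. 0)"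
  shows "\<exists>C. (\<forall>l. C l \<in> E p) \<and> (\<forall>v\<in>E p. lmap q C (lmap p A v) = v)"
proof -
  from fun_vsp.linear_exists_left_inverse_on [OF linear_lmap subspace_E inj_on_lmap [OF inj]]
  obtain g where g: "range g \<subseteq> E p \<and> Vector_Spaces.linear (\<lambda>c u i. c * u i) (\<lambda>c u i. c * u i) g \<and>
      (\<forall>v\<in>E p. g (lmap p A v) = v)"
    by (rule exE)
  have gE: "g v \<in> E p" for v using conjunct1 [OF g] by (simp add: image_subset_iff)
  have gl: "g \<in> linear_maps (Euc q) (Euc p)"
    by (rule linear_imp_linear_maps [OF conjunct1 [OF conjunct2 [OF g]] gE])
  have "lmap q (\<lambda>l. g (unit_vec l)) (lmap p A v) = v" if "v \<in> E p" for v
  proof -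
    have "lmap p A v \<in> E q" by (rule lmap_E [OF A])
    from linear_maps_eq_lmap [OF gl this] show ?thesis
      using conjunct2 [OF conjunct2 [OF g]] that by (metis (lifting))
  qed
  with gE show ?thesis by (intro exI [of _ "\<lambda>l. g (unit_vec l)"]) simp
qed

section \<open>Bases and dimension of the spaces \<open>E n\<close>\<close>

lemma independent_unit_vec: "fun_vs.independent (unit_vec ` {..<n})"
  and inj_unit_vec: "inj unit_vec"
proof -
  show inj: "inj unit_vec"
  proof (rule injI)
    fix j l assume "unit_vec j = unit_vec l"
    from fun_cong [OF this, of j] show "j = l" by (simp add: unit_vec_def split: if_splits)
  qed
  have *: "v \<in> E n" if "v \<in> fun_vs.span (unit_vec ` {..<n})" for v n
  proof -
    have "unit_vec ` {..<n} \<subseteq> E n" by auto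
    from fun_vs.span_minimal [OF this subspace_E] that show ?thesis by blast
  qed
  show "fun_vs.independent (unit_vec ` {..<n})"
  proof (induction n)
    case 0
    then show ?case by (simp add: fun_vs.independent_empty)
  next
    case (Suc n)
    have "unit_vec n \<notin> fun_vs.span (unit_vec ` {..<n})" using * [of "unit_vec n" n] by auto
    with Suc show ?case by (simp add: lessThan_Suc fun_vs.independent_insertI)
  qed
qed

lemma span_unit_vec: "fun_vs.span (unit_vec ` {..<n}) = E n"
proof
  show "fun_vs.span (unit_vec ` {..<n}) \<subseteq> E n"
    by (rule fun_vs.span_minimal [OF _ subspace_E]) auto
  show "E n \<subseteq> fun_vs.span (unit_vec ` {..<n})"
  proof
    fix v assume "v \<in> E n"
    have "(\<lambda>i. \<Sum>j<m. v j * unit_vec j i) \<in> fun_vs.span (unit_vec ` {..<n})" if "m \<le> n" for m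
      using that
    proof (induction m)
      case 0
      show ?case using fun_vs.span_zero by (simp add: zero_fun_def)
    next
      case (Suc m)
      then have "(\<lambda>i. \<Sum>j<m. v j * unit_vec j i) + (\<lambda>i. v m * unit_vec m i)
          \<in> fun_vs.span (unit_vec ` {..<n})"
        using fun_vs.span_scale [OF fun_vs.span_base, of "unit_vec m" "unit_vec ` {..<n}" "v m"]
        by (intro fun_vs.span_add) auto
      then show ?case by (simp add: plus_fun_def)
    qed
    from this [OF order_refl] have "lmap n unit_vec v \<in> fun_vs.span (unit_vec ` {..<n})"
      unfolding lmap_def .
    then show "v \<in> fun_vs.span (unit_vec ` {..<n})"
      unfolding E_decomp [OF \<open>v \<in> E n\<close>, symmetric] .
  qed
qed

lemma card_unit_vec: "card (unit_vec ` {..<n}) = n"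
  by (simp add: card_image inj_on_subset [OF inj_unit_vec])

text \<open>The dimension theory of \<open>E n\<close>, from the exchange bound applied in both
  directions between \<open>S\<close> and the unit vectors.\<close>

lemma basis_of_E:
  assumes "fun_vs.independent S" "S \<subseteq> E n"
  shows "finite S" "card S \<le> n" "card S = n \<Longrightarrow> fun_vs.span S = E n"
    "E n \<subseteq> fun_vs.span S \<Longrightarrow> card S = n"
proof -
  have S: "S \<subseteq> fun_vs.span (unit_vec ` {..<n})" using assms by (simp add: span_unit_vec)
  show fin: "finite S" and le: "card S \<le> n"
    using fun_vs.independent_span_bound [OF _ assms(1) S] by (auto simp: card_unit_vec)
  show "card S = n" if "E n \<subseteq> fun_vs.span S"
  proof -
    have "unit_vec ` {..<n} \<subseteq> fun_vs.span S" using that by auto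
    from fun_vs.independent_span_bound [OF fin independent_unit_vec this] le
    show ?thesis by (simp add: card_unit_vec)
  qed
  show "fun_vs.span S = E n" if "card S = n"
  proof -
    have "v \<in> fun_vs.span S" if v: "v \<in> E n" for v
    proof (rule ccontr)
      assume nv: "v \<notin> fun_vs.span S"
      then have "fun_vs.independent (insert v S)" "v \<notin> S"
        using assms fun_vs.span_base fun_vs.independent_insertI [OF nv] by blast+
      moreover have "insert v S \<subseteq> fun_vs.span (unit_vec ` {..<n})"
        using S v by (simp add: span_unit_vec)
      ultimately have "card (insert v S) \<le> n"
        using fun_vs.independent_span_bound [of "unit_vec ` {..<n}" "insert v S"]
        by (auto simp: card_unit_vec)
      with \<open>v \<notin> S\<close> fin \<open>card S = n\<close> show False by simp
    qed
    moreover have "fun_vs.span S \<subseteq> E n" by (rule fun_vs.span_minimal [OF assms(2) subspace_E])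
    ultimately show ?thesis by blast
  qed
qed

text \<open>An injective map sends the unit vectors to \<open>n\<close> independent vectors of
  \<open>E n\<close>, and these already span.\<close>

lemma lmap_surj:
  assumes A: "\<And>j. j < n \<Longrightarrow> A j \<in> E n"
    and inj: "\<And>v. v \<in> E n \<Longrightarrow> lmap n A v = (\<lambda>i. 0) \<Longrightarrow> v = (\<lambda>i. 0)"
  shows "lmap n A ` E n = E n"
proof -
  interpret l: Vector_Spaces.linear scale scale "lmap n A"
    by (rule linear_lmap)
  let ?B = "unit_vec ` {..<n}"
  have injE: "inj_on (lmap n A) (E n)" by (rule inj_on_lmap [OF inj])
  have "fun_vs.independent (lmap n A ` ?B)"
    by (rule l.independent_injective_image [OF independent_unit_vec])
      (simp add: span_unit_vec injE)
  moreover have "lmap n A ` ?B \<subseteq> E n" using lmap_E [of n A n, OF A] by blast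
  moreover have "card (lmap n A ` ?B) = n"
    by (subst card_image) (auto simp: card_unit_vec intro!: inj_on_subset [OF injE])
  ultimately have "fun_vs.span (lmap n A ` ?B) = E n" by (rule basis_of_E(3))
  then show ?thesis by (simp add: l.span_image span_unit_vec)
qed

text \<open>Coordinates with respect to \<open>B\<close> are unique; those of \<open>v\<close>
  vanish outside \<open>B1\<close> and also on \<open>B1\<close>.\<close>

lemma span_Int_independent:
  assumes B: "fun_vs.independent B" and "B1 \<subseteq> B" and v: "v \<in> fun_vs.span B1" "v \<in> fun_vs.span (B - B1)"
  shows "v = 0"
proof -
  have 1: "fun_vs.representation B v = fun_vs.representation B1 v"
    using fun_vs.representation_extend [OF B v(1) \<open>B1 \<subseteq> B\<close>] .
  have 2: "fun_vs.representation B v = fun_vs.representation (B - B1) v"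
    using fun_vs.representation_extend [OF B v(2)] by blast
  have "fun_vs.representation B v b = 0" for b
    using 1 2 fun_vs.representation_ne_zero [of B1 v b] fun_vs.representation_ne_zero [of "B - B1" v b]
    by fastforce
  moreover have "v \<in> fun_vs.span B" using v(1) fun_vs.span_mono [OF \<open>B1 \<subseteq> B\<close>] by blast
  ultimately show ?thesis using fun_vs.sum_nonzero_representation_eq [OF B, of v] by simp
qed

text \<open>If \<open>K v = 0\<close> then \<open>v - L (K v) = v\<close>, so it suffices that \<open>Z\<close> maps the kernel of \<open>K\<close>
  injectively to a complement of the image of \<open>K\<close>.\<close>

lemma invertible_correction:
  assumes K: "\<And>j. j < n \<Longrightarrow> K j \<in> E n" and L: "\<And>j. j < n \<Longrightarrow> L j \<in> E n"
  shows "\<exists>Z. (\<forall>j. Z j \<in> E n) \<and> (\<forall>v\<in>E n.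
    (\<forall>i. lmap n K v i + lmap n Z (\<lambda>i. v i - lmap n L (lmap n K v) i) i = 0) \<longrightarrow> v = (\<lambda>i. 0))"
proof -
  interpret K: Vector_Spaces.linear scale scale "lmap n K"
    by (rule linear_lmap)
  define U where "U = {v \<in> E n. lmap n K v = 0}"
  have subU: "fun_vs.subspace U"
    unfolding fun_vs.subspace_def U_def
    using fun_vs.subspace_0 [OF subspace_E [of n]] fun_vs.subspace_add [OF subspace_E [of n]]
      fun_vs.subspace_scale [OF subspace_E [of n]]
    by (auto simp: K.add K.scale K.zero zero_fun_def)
  obtain B1 where B1: "B1 \<subseteq> U" "fun_vs.independent B1" "U \<subseteq> fun_vs.span B1"
    using fun_vs.maximal_independent_subset [of U] by blast
  have spB1: "fun_vs.span B1 = U"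
    using B1 fun_vs.span_minimal [OF B1(1) subU] by blast
  have "B1 \<subseteq> E n" using B1 by (auto simp: U_def)
  then obtain B where B: "B1 \<subseteq> B" "B \<subseteq> E n" "fun_vs.independent B" "E n \<subseteq> fun_vs.span B"
    using fun_vs.maximal_independent_subset_extend [OF _ B1(2), of "E n"] by metis
  have finB: "finite B" and cardB: "card B = n"
    using basis_of_E [OF B(3,2)] B(4) by auto
  have spE: "fun_vs.span B = E n" using basis_of_E(3) [OF B(3,2) cardB] .
  have inj1: "inj_on (lmap n K) (fun_vs.span (B - B1))"
  proof (subst K.inj_on_iff_eq_0)
    show "fun_vs.subspace (fun_vs.span (B - B1))" by simp
    show "\<forall>x\<in>fun_vs.span (B - B1). lmap n K x = 0 \<longrightarrow> x = 0"
    proof (intro ballI impI)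
      fix x assume x: "x \<in> fun_vs.span (B - B1)" "lmap n K x = 0"
      then have "x \<in> E n" using spE fun_vs.span_mono [of "B - B1" B] by blast
      then have "x \<in> fun_vs.span B1" using x spB1 by (simp add: U_def)
      then show "x = 0" using span_Int_independent [OF B(3,1)] x by blast
    qed
  qed
  define C1 where "C1 = lmap n K ` (B - B1)"
  have C1: "fun_vs.independent C1"
    unfolding C1_def
    by (rule K.independent_injective_image [OF fun_vs.independent_mono [OF B(3)] inj1]) auto
  have "C1 \<subseteq> E n" unfolding C1_def using lmap_E [of n K n] K by blast
  then obtain C where C: "C1 \<subseteq> C" "C \<subseteq> E n" "fun_vs.independent C" "E n \<subseteq> fun_vs.span C"
    using fun_vs.maximal_independent_subset_extend [OF _ C1, of "E n"] by metis
  have finC: "finite C" and cardC: "card C = n" using basis_of_E [OF C(3,2)] C(4) by auto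
  have "inj_on (lmap n K) (B - B1)"
    using inj1 by (rule inj_on_subset) (rule fun_vs.span_superset)
  then have "card C1 = n - card B1"
    unfolding C1_def using finB cardB B(1)
    by (simp add: card_image card_Diff_subset finite_subset)
  moreover have "card B1 \<le> n" using card_mono [OF finB B(1)] cardB by simp
  \<comment> \<open>Rank and nullity: \<open>B1\<close> is a basis of the kernel of
    \<open>K\<close>, the rest of \<open>B\<close> is mapped to the basis \<open>C1\<close> of the
    image, and \<open>B\<close> and \<open>C\<close> both have \<open>n\<close> elements. Hence
    \<open>g\<close> can pair the kernel basis with the basis of a complement of the image, and
    \<open>z\<close> is \<open>g\<close> on \<open>B1\<close> and zero on the rest of
    \<open>B\<close>.\<close>
  ultimately have "card (C - C1) = card B1"
    using finC cardC C(1) by (simp add: card_Diff_subset finite_subset)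
  then obtain g where g: "bij_betw g B1 (C - C1)"
    using finite_same_card_bij [of B1 "C - C1"] finB finC B(1) by (metis finite_Diff finite_subset)
  obtain z where z: "Vector_Spaces.linear scale scale z"
      and zg: "\<And>x. x \<in> B \<Longrightarrow> z x = (if x \<in> B1 then g x else 0)"
    using fun_vsp.linear_independent_extend [OF B(3), of "\<lambda>x. if x \<in> B1 then g x else 0"] by blast
  interpret z: Vector_Spaces.linear scale scale z
    by (rule z)
  have "g ` B1 = C - C1" using g by (simp add: bij_betw_def)
  then have zB: "z ` B \<subseteq> insert 0 (C - C1)" using zg by auto
  have zE: "z v \<in> fun_vs.span (C - C1)" if "v \<in> E n" for v
  proof -
    have "z v \<in> fun_vs.span (z ` B)" unfolding z.span_image spE using that by blast
    with fun_vs.span_mono [OF zB] have "z v \<in> fun_vs.span (insert 0 (C - C1))" by blast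
    then show ?thesis by (simp only: fun_vs.span_insert_0)
  qed
  have z_inj: "inj_on z (fun_vs.span B1)"
  proof (rule z.inj_on_span_independent_image)
    have zg': "z x = g x" if "x \<in> B1" for x using zg [of x] B(1) that by auto
    have "z ` B1 = g ` B1" by (rule image_cong [OF refl zg'])
    also have "\<dots> = C - C1" using g by (simp add: bij_betw_def)
    finally show "fun_vs.independent (z ` B1)"
      using fun_vs.independent_mono [OF C(3)] by blast
    have "inj_on g B1" using g by (simp add: bij_betw_def)
    then show "inj_on z B1" using inj_on_cong [of B1 z g] zg' by blast
  qed
  have spCE: "fun_vs.span (C - C1) \<subseteq> E n"
    by (rule fun_vs.span_minimal [OF _ subspace_E]) (use C in auto)
  have zl: "z \<in> linear_maps (Euc n) (Euc n)"
    using zE spCE by (intro linear_imp_linear_maps [OF z]) blast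
  define Z where "Z j = (if j < n then z (unit_vec j) else (\<lambda>i. 0))" for j
  have Zz: "lmap n Z v = z v" if "v \<in> E n" for v
    using linear_maps_eq_lmap [OF zl that] by (auto simp: Z_def lmap_def)
  have Z2: "v = (\<lambda>i. 0)" if v: "v \<in> E n"
    and eq: "\<forall>i. lmap n K v i + lmap n Z (\<lambda>i. v i - lmap n L (lmap n K v) i) i = 0" for v
  proof -
    define w where "w = (\<lambda>i. v i - lmap n L (lmap n K v) i)"
    have w: "w \<in> E n" unfolding w_def by (intro E_diff v lmap_E L)
    have "v \<in> fun_vs.span B" using v spE by simp
    then have "lmap n K v \<in> fun_vs.span (lmap n K ` B)" by (simp add: K.span_image)
    moreover have "lmap n K ` B \<subseteq> insert 0 C1" using B1(1) by (auto simp: C1_def U_def)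
    ultimately have "lmap n K v \<in> fun_vs.span (insert 0 C1)" using fun_vs.span_mono by blast
    then have Kv: "lmap n K v \<in> fun_vs.span C1" by (simp only: fun_vs.span_insert_0)
    \<comment> \<open>\<open>K v\<close> lies in the image of \<open>K\<close> and
      \<open>z w\<close> in the chosen complement, so both are zero. Then \<open>w = v\<close> is in
      the kernel of \<open>K\<close>, where \<open>z\<close> is injective.\<close>
    have "lmap n K v i = - z w i" for i
      using spec [OF eq, of i] unfolding w_def [symmetric] Zz [OF w] by linarith
    then have Kz: "lmap n K v = - z w" unfolding fun_Compl_def by blast
    then have "lmap n K v \<in> fun_vs.span (C - C1)" by (simp only: fun_vs.span_neg zE w)
    with Kv have K0: "lmap n K v = 0" by (rule span_Int_independent [OF C(3,1)])
    have "lmap n L (lmap n K v) = (\<lambda>i. 0)" unfolding K0 zero_fun_def by (rule lmap_zero)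
    then have "w = v" unfolding w_def by simp
    then have "z v = 0" using Kz K0 by simp
    then have "z v = z 0" by (simp only: z.zero)
    moreover have "v \<in> fun_vs.span B1" unfolding spB1 U_def using K0 v by blast
    ultimately have "v = 0" using fun_vs.span_zero by (rule inj_onD [OF z_inj])
    then show ?thesis unfolding zero_fun_def .
  qed
  have "\<forall>j. Z j \<in> E n" using linear_maps_E [OF zl] by (simp add: Z_def)
  then show ?thesis
    apply (intro exI [of _ Z] conjI)
     apply assumption
    apply (rule ballI)
    apply (rule impI)
    apply (erule Z2)
    apply assumption
    done
qed

text \<open>Gram-Schmidt, by induction on the number of columns.\<close>

lemma orthonormal_frame:
  assumes A: "\<And>j. j < r \<Longrightarrow> A j \<in> E k"
    and inj: "\<And>v. v \<in> E r \<Longrightarrow> lmap r A v = (\<lambda>i. 0) \<Longrightarrow> v = (\<lambda>i. 0)"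
  shows "\<exists>b. (\<forall>j<r. b j \<in> E k) \<and>
    (\<forall>j<r. \<forall>l<r. (\<Sum>i<k. b j i * b l i) = (if j = l then 1 else 0)) \<and>
    frame_span r b = lmap r A ` E r"
  using assms
proof (induction r)
  case 0
  have "lmap 0 A = (\<lambda>v i. 0)" "(\<lambda>c i. \<Sum>j<0. c j * b j i) = (\<lambda>c i. 0)" for b :: "nat \<Rightarrow> vec"
    by (simp_all add: lmap_def fun_eq_iff)
  moreover have "E 0 \<noteq> {}" using zero_E by blast
  ultimately have "frame_span 0 b = lmap 0 A ` E 0" for b
    unfolding frame_span_def by (simp add: image_constant_conv)
  then show ?case by simp
next
  case (Suc r)
  have "v = (\<lambda>i. 0)" if v: "v \<in> E r" "lmap r A v = (\<lambda>i. 0)" for v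
  proof -
    have "lmap (Suc r) A v = (\<lambda>i. 0)" using v by (simp add: lmap_def E_iff fun_eq_iff)
    then show ?thesis using Suc.prems(2) [of v] v E_mono [of r "Suc r"] by simp
  qed
  then obtain b where b: "\<And>j. j < r \<Longrightarrow> b j \<in> E k"
      "\<And>j l. j < r \<Longrightarrow> l < r \<Longrightarrow> (\<Sum>i<k. b j i * b l i) = (if j = l then 1 else 0)"
      "frame_span r b = lmap r A ` E r"
    using Suc.IH Suc.prems(1) by fastforce
  define a where "a j = (\<Sum>i<k. b j i * A r i)" for j
  define w where "w = (\<lambda>i. A r i - (\<Sum>j<r. a j * b j i))"
  have wE: "w \<in> E k" unfolding w_def using b(1) Suc.prems(1) by (intro E_diff E_sum) auto
  have ortho: "(\<Sum>i<k. b l i * w i) = 0" if "l < r" for l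
  proof -
    have "(\<Sum>i<k. b l i * (\<Sum>j<r. a j * b j i)) = (\<Sum>j<r. a j * (\<Sum>i<k. b l i * b j i))"
      by (simp add: sum_distrib_left sum.swap [of _ "{..<r}"] mult.left_commute)
    also have "\<dots> = a l" using that
      by (simp add: b(2) if_distrib [of "\<lambda>x. _ * x"] sum.delta cong: if_cong)
    finally show ?thesis
      unfolding w_def by (simp add: right_diff_distrib sum_subtractf a_def)
  qed
  have "(\<lambda>i. \<Sum>j<r. a j * b j i) \<in> lmap r A ` E r"
    unfolding b(3) [symmetric] by (auto simp: frame_span_def)
  then obtain u where u: "u \<in> E r" "(\<lambda>i. \<Sum>j<r. a j * b j i) = lmap r A u" by blast
  \<comment> \<open>Otherwise \<open>A r\<close> would be a combination of the earlier columns, and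
    \<open>u\<close> with entry -1 put at index \<open>r\<close> would be a nonzero vector of the
    kernel.\<close>
  have "w \<noteq> (\<lambda>i. 0)"
  proof
    assume w0: "w = (\<lambda>i. 0)"
    define v where "v = u(r := -1)"
    have "v \<in> E (Suc r)" using u(1) by (simp add: v_def E_iff)
    moreover have "lmap (Suc r) A v = (\<lambda>i. 0)"
    proof
      fix i
      have "A r i = lmap r A u i" using fun_cong [OF w0, of i] fun_cong [OF u(2), of i] by (simp add: w_def)
      then show "lmap (Suc r) A v i = 0" by (simp add: lmap_def v_def)
    qed
    ultimately have "v = (\<lambda>i. 0)" by (rule Suc.prems(2))
    then show False by (metis fun_upd_same v_def zero_neq_neg_one)
  qed
  then have pos: "(\<Sum>i<k. w i * w i) > 0"
  proof -
    obtain i where "w i \<noteq> 0" using \<open>w \<noteq> (\<lambda>i. 0)\<close> by blast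
    then have "i < k" using wE by (metis E_zero linorder_not_le)
    with \<open>w i \<noteq> 0\<close> show ?thesis by (intro sum_pos2 [of _ i]) (auto simp: zero_less_mult_iff linorder_neq_iff)
  qed
  define s where "s = sqrt (\<Sum>i<k. w i * w i)"
  have s: "s > 0" "s * s = (\<Sum>i<k. w i * w i)" using pos by (simp_all add: s_def)
  define b' where "b' = b(r := \<lambda>i. w i / s)"
  have b'r: "b' r = (\<lambda>i. w i / s)" and b'l: "\<And>l. l < r \<Longrightarrow> b' l = b l" by (auto simp: b'_def)
  have "b' j \<in> E k" if "j < Suc r" for j
    using that b(1) wE by (cases "j = r") (auto simp: b'_def E_iff)
  moreover have "(\<Sum>i<k. b' j i * b' l i) = (if j = l then 1 else 0)" if "j < Suc r" "l < Suc r" for j l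
  proof -
    have rr: "(\<Sum>i<k. w i / s * (w i / s)) = 1"
    proof -
      have "(\<Sum>i<k. w i / s * (w i / s)) = (\<Sum>i<k. w i * w i) / (s * s)"
        unfolding sum_divide_distrib by (rule sum.cong) auto
      then show ?thesis unfolding s(2) using pos by simp
    qed
    have "(\<Sum>i<k. b l i * (w i / s)) = 0" if "l < r" for l
    proof -
      have "(\<Sum>i<k. b l i * (w i / s)) = (\<Sum>i<k. b l i * w i) / s"
        unfolding sum_divide_distrib by (rule sum.cong) auto
      then show ?thesis using ortho [OF that] by simp
    qed
    moreover from this have "(\<Sum>i<k. (w i / s) * b l i) = 0" if "l < r" for l
      using that by (metis (no_types, lifting) mult.commute sum.cong)
    ultimately show ?thesis
      using that rr b(2) by (cases "j = r"; cases "l = r") (auto simp: b'r b'l less_Suc_eq)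
  qed
  moreover have "frame_span (Suc r) b' = lmap (Suc r) A ` E (Suc r)"
  proof (intro equalityI subsetI)
    fix x assume "x \<in> frame_span (Suc r) b'"
    then obtain c where c: "x = (\<lambda>i. (\<Sum>j<r. c j * b j i) + c r * (w i / s))"
      by (auto simp: frame_span_def b'_def)
    \<comment> \<open>The coefficient of \<open>A r\<close>: it occurs only in
      \<open>b' r = w / s\<close>, and \<open>w\<close> is \<open>A r\<close> minus the combination
      of the \<open>b j\<close> with coefficients \<open>a j\<close>, which are shifted
      accordingly.\<close>
    define d where "d = c r / s"
    have "(\<lambda>i. \<Sum>j<r. (c j - d * a j) * b j i) \<in> lmap r A ` E r"
      unfolding b(3) [symmetric] by (auto simp: frame_span_def)
    then obtain v where v: "v \<in> E r" "(\<lambda>i. \<Sum>j<r. (c j - d * a j) * b j i) = lmap r A v" by blast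
    have "x = lmap (Suc r) A (v(r := d))"
    proof
      fix i
      have "x i = (\<Sum>j<r. (c j - d * a j) * b j i) + d * A r i"
        unfolding c w_def using s(1)
        by (simp add: left_diff_distrib right_diff_distrib sum_subtractf sum_distrib_left mult.assoc d_def
            diff_divide_distrib sum_divide_distrib)
      then show "x i = lmap (Suc r) A (v(r := d)) i"
        using fun_cong [OF v(2), of i] by (simp add: lmap_def)
    qed
    moreover have "v(r := d) \<in> E (Suc r)" using v(1) by (simp add: E_iff)
    ultimately show "x \<in> lmap (Suc r) A ` E (Suc r)" by blast
  next
    fix x assume "x \<in> lmap (Suc r) A ` E (Suc r)"
    then obtain v where v: "v \<in> E (Suc r)" "x = lmap (Suc r) A v" by blast
    have "lmap r A (v(r := 0)) \<in> frame_span r b"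
      unfolding b(3) using v(1) by (auto simp: E_iff le_Suc_eq intro!: imageI)
    then obtain c where c: "lmap r A (v(r := 0)) = (\<lambda>i. \<Sum>j<r. c j * b j i)"
      by (auto simp: frame_span_def)
    \<comment> \<open>The inverse substitution: \<open>A r\<close> equals \<open>s\<close> times
      \<open>b' r\<close> plus the projection with coefficients \<open>a j\<close>.\<close>
    have "x = (\<lambda>i. \<Sum>j<Suc r. (if j = r then v r * s else c j + v r * a j) * b' j i)"
    proof
      fix i
      have "x i = (\<Sum>j<r. c j * b j i) + v r * A r i"
        using fun_cong [OF c, of i] v(2) by (simp add: lmap_def)
      also have "\<dots> = (\<Sum>j<r. (c j + v r * a j) * b j i) + v r * w i"
        unfolding w_def by (simp add: algebra_simps sum.distrib sum_distrib_left)
      also have "\<dots> = (\<Sum>j<Suc r. (if j = r then v r * s else c j + v r * a j) * b' j i)"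
        using s by (simp add: b'r b'l)
      finally show "x i = (\<Sum>j<Suc r. (if j = r then v r * s else c j + v r * a j) * b' j i)" .
    qed
    then show "x \<in> frame_span (Suc r) b'" unfolding frame_span_def
      by (rule range_eqI [of _ _ "\<lambda>j. if j = r then v r * s else c j + v r * a j"])
  qed
  ultimately show ?case by blast
qed

section \<open>Continuity and norm estimates for families of matrices\<close>

lemma continuous_map_Euc_iff:
  "continuous_map T (Eu n) f \<longleftrightarrow>
    (\<forall>x\<in>topspace T. f x \<in> E n) \<and> (\<forall>i<n. cont_real T (\<lambda>x. f x i))"
proof -
  have "cont_real T (\<lambda>x. f x i)" if "\<forall>x\<in>topspace T. f x \<in> E n" "n \<le> i" for i
    by (rule continuous_map_eq [of _ _ "\<lambda>x. 0"]) (use that in \<open>auto simp: E_iff\<close>)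
  then show ?thesis
    unfolding Euclidean_space_def continuous_map_in_subtopology continuous_map_componentwise_UNIV
    by (auto simp: image_subset_iff topspace_Euclidean_space Pi_iff) (meson not_le)
qed

lemma continuous_map_coord: "cont_real (Eu n) (\<lambda>v. v i)"
  unfolding Euclidean_space_def
  by (intro continuous_map_from_subtopology) (metis UNIV_I continuous_map_product_coordinates)

lemma continuous_map_real_iff:
  "cont_real Z f \<longleftrightarrow>
    (\<forall>z\<in>topspace Z. \<forall>e>0. \<exists>N. openin Z N \<and> z \<in> N \<and> (\<forall>y\<in>N. \<bar>f y - f z\<bar> < e))"
  using Met_TC.continuous_map_to_metric [of Z f]
  by (simp add: dist_real_def abs_minus_commute)

lemma continuous_map_localI:
  assumes "\<And>z. z \<in> topspace Z \<Longrightarrow> \<exists>N. openin Z N \<and> z \<in> N \<and> continuous_map (subtopology Z N) Y f"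
  shows "continuous_map Z Y f"
  unfolding continuous_map_def
proof (intro conjI allI impI)
  show "f \<in> topspace Z \<rightarrow> topspace Y"
  proof
    fix z assume "z \<in> topspace Z"
    with assms obtain N where "openin Z N" "z \<in> N" "continuous_map (subtopology Z N) Y f" by blast
    with \<open>z \<in> topspace Z\<close> show "f z \<in> topspace Y"
      by (auto simp: continuous_map_def Pi_iff)
  qed
  fix U assume U: "openin Y U"
  show "openin Z {x \<in> topspace Z. f x \<in> U}"
  proof (subst openin_subopen, intro ballI)
    fix z assume z: "z \<in> {x \<in> topspace Z. f x \<in> U}"
    with assms obtain N where N: "openin Z N" "z \<in> N" "continuous_map (subtopology Z N) Y f" by blast
    have "openin (subtopology Z N) {x \<in> topspace (subtopology Z N). f x \<in> U}"
      using N(3) U by (rule openin_continuous_map_preimage)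
    then have "openin Z {x \<in> topspace (subtopology Z N). f x \<in> U}"
      using N(1) openin_trans_full by blast
    with z N show "\<exists>T. openin Z T \<and> z \<in> T \<and> T \<subseteq> {x \<in> topspace Z. f x \<in> U}"
      by (intro exI [of _ "{x \<in> topspace (subtopology Z N). f x \<in> U}"]) auto
  qed
qed

lemma continuous_map_lmap:
  assumes "\<And>j. j < p \<Longrightarrow> cont_real Z (\<lambda>z. A z j i)"
    and "\<And>j. j < p \<Longrightarrow> cont_real Z (\<lambda>z. v z j)"
  shows "cont_real Z (\<lambda>z. lmap p (A z) (v z) i)"
  unfolding lmap_def using assms by (intro continuous_map_sum continuous_map_real_mult) auto

definition nrm :: "nat \<Rightarrow> vec \<Rightarrow> real"
  where "nrm n v = (\<Sum>i<n. \<bar>v i\<bar>)"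

lemma nrm_nonneg [simp]: "0 \<le> nrm n v"
  by (simp add: nrm_def sum_nonneg)

lemma nrm_coord: "i < n \<Longrightarrow> \<bar>v i\<bar> \<le> nrm n v"
  unfolding nrm_def by (rule member_le_sum) auto

lemma nrm_triangle: "nrm n (\<lambda>i. u i + v i) \<le> nrm n u + nrm n v"
  unfolding nrm_def sum.distrib [symmetric] by (rule sum_mono) auto

lemma nrm_triangle_diff: "nrm n u \<le> nrm n (\<lambda>i. u i - v i) + nrm n v"
  using nrm_triangle [of n "\<lambda>i. u i - v i" v] by simp

lemma nrm_lmap_le: "nrm q (lmap p A v) \<le> (\<Sum>j<p. \<bar>v j\<bar> * nrm q (A j))"
proof -
  have "nrm q (lmap p A v) \<le> (\<Sum>i<q. \<Sum>j<p. \<bar>v j\<bar> * \<bar>A j i\<bar>)"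
    unfolding nrm_def lmap_def
    by (intro sum_mono order_trans [OF sum_abs]) (simp add: abs_mult)
  also have "\<dots> = (\<Sum>j<p. \<bar>v j\<bar> * nrm q (A j))"
    unfolding nrm_def sum_distrib_left by (rule sum.swap)
  finally show ?thesis .
qed

text \<open>For the sum norm, a common bound for the columns is already a bound for the
  operator.\<close>

lemma nrm_lmap_bound:
  assumes "\<And>j. j < p \<Longrightarrow> nrm q (A j) \<le> d"
  shows "nrm q (lmap p A v) \<le> d * nrm p v"
proof -
  have "nrm q (lmap p A v) \<le> (\<Sum>j<p. \<bar>v j\<bar> * d)"
    by (intro order_trans [OF nrm_lmap_le] sum_mono mult_left_mono assms) auto
  then show ?thesis by (simp add: nrm_def sum_distrib_left mult.commute)
qed

lemma lmap_diff_matrix: "lmap p (\<lambda>j i. A j i - B j i) v = (\<lambda>i. lmap p A v i - lmap p B v i)"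
  by (simp add: lmap_def algebra_simps sum_subtractf)

lemma continuous_map_nrm:
  "(\<And>i. i < n \<Longrightarrow> cont_real Z (\<lambda>z. v z i))
    \<Longrightarrow> cont_real Z (\<lambda>z. nrm n (v z))"
  unfolding nrm_def by (intro continuous_map_sum continuous_map_real_abs) auto

text \<open>A left inverse of \<open>A z0\<close> with columns of norm at most \<open>K\<close>
  bounds \<open>v\<close> by \<open>K\<close> times \<open>A z0 v\<close>. If the columns of
  \<open>A z\<close> differ from those of \<open>A z0\<close> by less than
  \<open>1 / (2 * K)\<close>, the error takes up at most half of the norm of \<open>v\<close>, and
  the constant \<open>2 * K\<close> works for \<open>A z\<close>. The bound is uniform in
  \<open>z\<close>, which later replaces any formula for inverse matrices.\<close>

lemma injective_lower_bound:
  assumes cont: "\<And>j i. j < p \<Longrightarrow> i < q \<Longrightarrow> cont_real Z (\<lambda>z. A z j i)"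
    and AE: "\<And>j. j < p \<Longrightarrow> A z0 j \<in> E q"
    and z0: "z0 \<in> topspace Z"
    and inj: "\<And>v. v \<in> E p \<Longrightarrow> lmap p (A z0) v = (\<lambda>i. 0) \<Longrightarrow> v = (\<lambda>i. 0)"
  shows "\<exists>N c. openin Z N \<and> z0 \<in> N \<and> 0 < c \<and>
    (\<forall>z\<in>N. \<forall>v\<in>E p. nrm p v \<le> c * nrm q (lmap p (A z) v))"
proof -
  obtain C where C: "\<And>l. C l \<in> E p" "\<And>v. v \<in> E p \<Longrightarrow> lmap q C (lmap p (A z0) v) = v"
    using lmap_left_inverse [of p "A z0" q, OF AE inj] by blast
  \<comment> \<open>The summand 1 makes \<open>K\<close> positive even if all columns of
    \<open>C\<close> vanish or \<open>q\<close> is 0.\<close>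
  define K where "K = (\<Sum>l<q. nrm p (C l)) + 1"
  have Kpos: "K > 0" unfolding K_def by (intro add_nonneg_pos sum_nonneg) auto
  have K: "nrm p (C l) \<le> K" if "l < q" for l
    using member_le_sum [of l "{..<q}" "\<lambda>l. nrm p (C l)"] that by (simp add: K_def)
  define s where "s z = (\<Sum>j<p. nrm q (\<lambda>i. A z0 j i - A z j i))" for z
  have "cont_real Z s"
    unfolding s_def by (intro continuous_map_sum continuous_map_nrm continuous_map_diff cont) auto
  then have "openin Z {z \<in> topspace Z. s z \<in> {..<1 / (2 * K)}}"
    by (rule openin_continuous_map_preimage) auto
  moreover have "s z0 = 0" by (simp add: s_def nrm_def)
  moreover have "nrm p v \<le> 2 * K * nrm q (lmap p (A z) v)" if s: "s z < 1 / (2 * K)" and v: "v \<in> E p" for z v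
  proof -
    have "nrm q (\<lambda>i. A z0 j i - A z j i) \<le> 1 / (2 * K)" if "j < p" for j
      using member_le_sum [of j "{..<p}" "\<lambda>j. nrm q (\<lambda>i. A z0 j i - A z j i)"] that s by (simp add: s_def)
    then have "nrm q (lmap p (\<lambda>j i. A z0 j i - A z j i) v) \<le> 1 / (2 * K) * nrm p v"
      by (rule nrm_lmap_bound)
    then have d: "nrm q (\<lambda>i. lmap p (A z0) v i - lmap p (A z) v i) \<le> 1 / (2 * K) * nrm p v"
      unfolding lmap_diff_matrix .
    have "nrm p v = nrm p (lmap q C (lmap p (A z0) v))" using C(2) [OF v] by simp
    also have "\<dots> \<le> K * nrm q (lmap p (A z0) v)" using K by (rule nrm_lmap_bound)
    also have "\<dots> \<le> K * (1 / (2 * K) * nrm p v + nrm q (lmap p (A z) v))"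
      using nrm_triangle_diff [of q "lmap p (A z0) v" "lmap p (A z) v"] d Kpos
      by (intro mult_left_mono) auto
    also have "\<dots> = nrm p v / 2 + K * nrm q (lmap p (A z) v)" using Kpos by (simp add: field_simps)
    finally show ?thesis by simp
  qed
  ultimately show ?thesis using z0 Kpos
    by (intro exI [of _ "{z \<in> topspace Z. s z \<in> {..<1 / (2 * K)}}"] exI [of _ "2 * K"]) auto
qed

lemma injective_near:
  assumes cont: "\<And>j i. j < p \<Longrightarrow> i < q \<Longrightarrow> cont_real Z (\<lambda>z. A z j i)"
    and AE: "\<And>j. j < p \<Longrightarrow> A z0 j \<in> E q"
    and z0: "z0 \<in> topspace Z"
    and inj: "\<And>v. v \<in> E p \<Longrightarrow> lmap p (A z0) v = (\<lambda>i. 0) \<Longrightarrow> v = (\<lambda>i. 0)"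
  shows "\<exists>N. openin Z N \<and> z0 \<in> N \<and>
    (\<forall>z\<in>N. \<forall>v\<in>E p. lmap p (A z) v = (\<lambda>i. 0) \<longrightarrow> v = (\<lambda>i. 0))"
proof -
  obtain N c where N: "openin Z N" "z0 \<in> N" "\<And>z v. z \<in> N \<Longrightarrow> v \<in> E p \<Longrightarrow> nrm p v \<le> c * nrm q (lmap p (A z) v)"
    using injective_lower_bound [of p q Z A z0, OF cont AE z0 inj] by blast
  have "v = (\<lambda>i. 0)" if "z \<in> N" "v \<in> E p" "lmap p (A z) v = (\<lambda>i. 0)" for z v
  proof -
    have "nrm p v \<le> 0" using N(3) [OF that(1,2)] that(3) by (simp add: nrm_def)
    then have "v i = 0" if "i < p" for i using nrm_coord [OF that, of v] by simp
    then show ?thesis by (intro E_eqI [OF \<open>v \<in> E p\<close>]) auto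
  qed
  with N(1,2) show ?thesis by blast
qed

text \<open>The difference \<open>w z - w z0\<close> is estimated by its image under
  \<open>A z\<close>, with a constant that is uniform near \<open>z0\<close>. That image is
  \<open>A z (w z) - A z (w z0)\<close>, a continuous function of \<open>z\<close> that vanishes at
  \<open>z0\<close>. So continuity of inverse matrices, and of coordinates in a moving frame that
  does not span, is obtained without determinants.\<close>

lemma continuous_map_cancel_injective:
  assumes cont: "\<And>j i. j < p \<Longrightarrow> i < q \<Longrightarrow> cont_real Z (\<lambda>z. A z j i)"
    and AE: "\<And>z j. z \<in> topspace Z \<Longrightarrow> j < p \<Longrightarrow> A z j \<in> E q"
    and inj: "\<And>z v. z \<in> topspace Z \<Longrightarrow> v \<in> E p \<Longrightarrow> lmap p (A z) v = (\<lambda>i. 0) \<Longrightarrow> v = (\<lambda>i. 0)"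
    and w: "\<And>z. z \<in> topspace Z \<Longrightarrow> w z \<in> E p"
    and Aw: "\<And>i. i < q \<Longrightarrow> cont_real Z (\<lambda>z. lmap p (A z) (w z) i)"
    and j: "j < p"
  shows "cont_real Z (\<lambda>z. w z j)"
  unfolding continuous_map_real_iff
proof (intro ballI allI impI)
  fix z0 and e :: real assume z0: "z0 \<in> topspace Z" and e: "e > 0"
  obtain N c where N: "openin Z N" "z0 \<in> N" "c > 0"
      "\<And>z v. z \<in> N \<Longrightarrow> v \<in> E p \<Longrightarrow> nrm p v \<le> c * nrm q (lmap p (A z) v)"
    using injective_lower_bound [of p q Z A z0, OF cont AE [OF z0] z0 inj [OF z0]] by blast
  define h where "h z = c * nrm q (\<lambda>i. lmap p (A z) (w z) i - lmap p (A z) (w z0) i)" for z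
  have "cont_real Z h"
    unfolding h_def
    by (intro continuous_map_real_mult continuous_map_nrm continuous_map_diff Aw continuous_map_lmap cont)
      auto
  moreover have "h z0 = 0" by (simp add: h_def nrm_def)
  ultimately obtain N' where N': "openin Z N'" "z0 \<in> N'" "\<And>z. z \<in> N' \<Longrightarrow> \<bar>h z\<bar> < e"
    unfolding continuous_map_real_iff using z0 e by (metis diff_zero)
  have "\<bar>w z j - w z0 j\<bar> < e" if z: "z \<in> N \<inter> N'" for z
  proof -
    have zt: "z \<in> topspace Z" using z N(1) openin_subset by blast
    have "\<bar>w z j - w z0 j\<bar> \<le> nrm p (\<lambda>i. w z i - w z0 i)"
      using nrm_coord [OF j, of "\<lambda>i. w z i - w z0 i"] .
    also have "\<dots> \<le> h z"
      unfolding h_def lmap_diff [symmetric] using z by (intro N(4) E_diff w zt z0) auto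
    also have "\<dots> < e" using N'(3) z by fastforce
    finally show ?thesis .
  qed
  then show "\<exists>N. openin Z N \<and> z0 \<in> N \<and> (\<forall>y\<in>N. \<bar>w y j - w z0 j\<bar> < e)"
    using N(1,2) N'(1,2) by (intro exI [of _ "N \<inter> N'"]) auto
qed

text \<open>Bolzano-Weierstrass for one index at a time; passing to a further subsequence keeps the
  limits found before.\<close>

lemma convergent_subsequence_finite:
  fixes f :: "nat \<Rightarrow> 'i \<Rightarrow> real"
  assumes "finite I" "\<And>n i. i \<in> I \<Longrightarrow> \<bar>f n i\<bar> \<le> c"
  shows "\<exists>s. strict_mono s \<and> (\<forall>i\<in>I. \<exists>l. (\<lambda>n. f (s n) i) \<longlonglongrightarrow> l)"
  using assms
proof (induction I)
  case empty
  show ?case by (intro exI [of _ "\<lambda>n. n"]) (simp add: strict_mono_def)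
next
  case (insert a I)
  then obtain s where s: "strict_mono s" "\<forall>i\<in>I. \<exists>l. (\<lambda>n. f (s n) i) \<longlonglongrightarrow> l" by auto
  have "bounded (range (\<lambda>n. f (s n) a))"
    unfolding bounded_iff using insert.prems by auto
  then obtain l r where r: "strict_mono r" "((\<lambda>n. f (s n) a) \<circ> r) \<longlonglongrightarrow> l"
    using bounded_imp_convergent_subsequence by metis
  have "\<exists>l. (\<lambda>n. f ((s \<circ> r) n) i) \<longlonglongrightarrow> l" if i: "i \<in> insert a I" for i
  proof (cases "i = a")
    case True
    then show ?thesis using r(2) by (auto simp: o_def)
  next
    case False
    then obtain l where "(\<lambda>n. f (s n) i) \<longlonglongrightarrow> l" using s(2) i by auto
    from LIMSEQ_subseq_LIMSEQ [OF this r(1)] show ?thesis by (auto simp: o_def)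
  qed
  with strict_mono_compose [OF s(1) r(1)] show ?case
    by (intro exI [of _ "s \<circ> r"]) (simp add: o_def)
qed

section \<open>Limits in the Grassmannian\<close>

text \<open>The coefficients in \<open>frames\<close> are arbitrary functions of which only the
  first \<open>r\<close> values count; cut off at \<open>r\<close> they become vectors of
  \<open>E r\<close>, and independence becomes injectivity of \<open>lmap r b\<close>.\<close>

lemma topspace_frames:
  "topspace (frames r k) = {b \<in> (\<Pi>\<^sub>E j\<in>{..<r}. E k).
    \<forall>v\<in>E r. lmap r b v = (\<lambda>i. 0) \<longrightarrow> v = (\<lambda>i. 0)}"
proof -
  have "(\<forall>c. (\<forall>i. (\<Sum>j<r. c j * b j i) = 0) \<longrightarrow> (\<forall>j<r. c j = 0)) \<longleftrightarrow>
      (\<forall>v\<in>E r. lmap r b v = (\<lambda>i. 0) \<longrightarrow> v = (\<lambda>i. 0))" (is "?L = ?R") for b :: "nat \<Rightarrow> vec"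
  proof
    assume L: ?L
    show ?R
    proof (intro ballI impI)
      fix v assume v: "v \<in> E r" "lmap r b v = (\<lambda>i. 0)"
      then have "\<forall>j<r. v j = 0" using L by (auto simp: lmap_def fun_eq_iff)
      then show "v = (\<lambda>i. 0)" by (intro E_eqI [OF v(1)]) auto
    qed
  next
    assume R: ?R
    show ?L
    proof (intro allI impI)
      fix c j assume c: "\<forall>i. (\<Sum>j<r. c j * b j i) = 0" and j: "j < r"
      have "lmap r b (\<lambda>j. if j < r then c j else 0) = (\<lambda>i. 0)"
        using c by (simp add: lmap_def)
      moreover have "(\<lambda>j. if j < r then c j else 0) \<in> E r" by (simp add: E_iff)
      ultimately have "(\<lambda>j. if j < r then c j else 0) = (\<lambda>i. 0)" using R by blast
      from fun_cong [OF this, of j] j show "c j = 0" by simp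
    qed
  qed
  then show ?thesis by (auto simp: frames_def)
qed

lemma frame_span_eq: "frame_span r b = lmap r b ` E r"
proof (intro equalityI subsetI)
  fix x assume "x \<in> frame_span r b"
  then obtain c where "x = (\<lambda>i. \<Sum>j<r. c j * b j i)" by (auto simp: frame_span_def)
  then have "x = lmap r b (\<lambda>j. if j < r then c j else 0)" by (simp add: lmap_def)
  moreover have "(\<lambda>j. if j < r then c j else 0) \<in> E r" by (simp add: E_iff)
  ultimately show "x \<in> lmap r b ` E r" by blast
next
  fix x assume "x \<in> lmap r b ` E r"
  then show "x \<in> frame_span r b" by (auto simp: frame_span_def lmap_def)
qed

lemma topspace_grassmannian: "topspace (grassmannian r k) = frame_span r ` topspace (frames r k)"
proof
  show "topspace (grassmannian r k) \<subseteq> frame_span r ` topspace (frames r k)"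
    using openin_topspace [of "grassmannian r k"] unfolding openin_grassmannian by blast
  have "{b \<in> topspace (frames r k). frame_span r b \<in> frame_span r ` topspace (frames r k)} = topspace (frames r k)"
    by blast
  then have "openin (grassmannian r k) (frame_span r ` topspace (frames r k))"
    unfolding openin_grassmannian by simp
  then show "frame_span r ` topspace (frames r k) \<subseteq> topspace (grassmannian r k)"
    by (rule openin_subset)
qed

lemma continuous_map_frames_coord:
  assumes "j < r"
  shows "cont_real (frames r k) (\<lambda>b. b j i)"
proof -
  have "continuous_map (frames r k) (Eu k) (\<lambda>b. b j)"
    unfolding frames_def using assms
    by (intro continuous_map_from_subtopology continuous_map_product_coordinates) auto
  from continuous_map_compose [OF this continuous_map_coord] show ?thesis by (simp add: o_def)
qed

text \<open>A vector outside the span extends the frame to an independent tuple. The lower bound for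
  the extended matrix is applied to \<open>d(r := -1)\<close>, whose norm is at least 1 and whose
  image is \<open>u - v\<close>.\<close>

lemma frame_span_dist:
  assumes b: "b \<in> topspace (frames r k)" and v: "v \<in> E k" "v \<notin> frame_span r b"
  shows "\<exists>e>0. \<forall>u\<in>frame_span r b. e \<le> nrm k (\<lambda>i. u i - v i)"
proof -
  \<comment> \<open>The extended frame as a constant family over a one-point space, so that
    \<open>injective_lower_bound\<close> applies to it.\<close>
  let ?A = "\<lambda>(z::unit) j. if j = r then v else b j"
  have bE: "b j \<in> E k" if "j < r" for j using b that by (auto simp: topspace_frames PiE_iff)
  have "w = (\<lambda>i. 0)" if w: "w \<in> E (Suc r)" "lmap (Suc r) (?A ()) w = (\<lambda>i. 0)" for w
  proof -
    have eq: "(\<Sum>j<r. w j * b j i) + w r * v i = 0" for i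
      using fun_cong [OF w(2), of i] by (simp add: lmap_def)
    have wr: "w r = 0"
    proof (rule ccontr)
      assume nz: "w r \<noteq> 0"
      have "v i = (\<Sum>j<r. (- w j / w r) * b j i)" for i
      proof -
        have "v i = - (\<Sum>j<r. w j * b j i) / w r" using eq [of i] nz by (simp add: field_simps)
        also have "\<dots> = (\<Sum>j<r. (- w j / w r) * b j i)"
          by (simp add: sum_divide_distrib sum_negf)
        finally show ?thesis .
      qed
      then have "v = (\<lambda>i. \<Sum>j<r. (- w j / w r) * b j i)" by (rule ext)
      then have "v \<in> frame_span r b" unfolding frame_span_def
        by (rule range_eqI [of _ _ "\<lambda>j. - w j / w r"])
      with v(2) show False by blast
    qed
    have "w \<in> E r" using w(1) wr by (auto simp: E_iff le_Suc_eq) (metis le_antisym not_less_eq_eq)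
    moreover have "lmap r b w = (\<lambda>i. 0)" using eq wr by (simp add: lmap_def)
    ultimately show ?thesis using b by (simp add: topspace_frames)
  qed
  moreover have "?A () j \<in> E k" if "j < Suc r" for j using that bE v(1) by (auto simp: less_Suc_eq)
  ultimately obtain N c where "() \<in> N" "c > 0"
      "\<forall>z\<in>N. \<forall>v\<in>E (Suc r). nrm (Suc r) v \<le> c * nrm k (lmap (Suc r) (?A z) v)"
    using injective_lower_bound [of "Suc r" k "discrete_topology UNIV" ?A "()"] by auto
  then obtain c where c: "c > 0" "\<And>w. w \<in> E (Suc r) \<Longrightarrow> nrm (Suc r) w \<le> c * nrm k (lmap (Suc r) (?A ()) w)"
    by blast
  have "1 / c \<le> nrm k (\<lambda>i. u i - v i)" if u: "u \<in> frame_span r b" for u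
  proof -
    obtain d where d: "d \<in> E r" "u = lmap r b d" using u unfolding frame_span_eq by blast
    have dE: "d(r := -1) \<in> E (Suc r)" using d(1) by (simp add: E_iff)
    have "lmap (Suc r) (?A ()) (d(r := -1)) = (\<lambda>i. u i - v i)"
      unfolding d(2) by (simp add: lmap_def)
    then have "nrm (Suc r) (d(r := -1)) \<le> c * nrm k (\<lambda>i. u i - v i)" using c(2) [OF dE] by simp
    moreover have "1 \<le> nrm (Suc r) (d(r := -1))" using nrm_coord [of r "Suc r" "d(r := -1)"] by simp
    ultimately show ?thesis using c(1) by (simp add: field_simps)
  qed
  with c(1) show ?thesis by (intro exI [of _ "1 / c"]) auto
qed

text \<open>Only vectors \<open>u\<close> within \<open>e'\<close> of \<open>v\<close> could violate
  the claim. For frames \<open>z\<close> near \<open>b\<close> their coefficient vectors have norm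
  at most \<open>M\<close>, uniformly in \<open>z\<close>, so exchanging \<open>z\<close> for
  \<open>b\<close> moves \<open>u\<close> by less than \<open>e - e'\<close>, and the distance
  \<open>e\<close> for the span of \<open>b\<close> is contradicted.\<close>

lemma frame_span_dist_near:
  assumes b: "b \<in> topspace (frames r k)" and d: "\<And>u. u \<in> frame_span r b \<Longrightarrow> e \<le> nrm k (\<lambda>i. u i - v i)"
    and e': "0 < e'" "e' < e"
  shows "\<exists>N. openin (frames r k) N \<and> b \<in> N \<and> (\<forall>b'\<in>N. \<forall>u\<in>frame_span r b'. e' \<le> nrm k (\<lambda>i. u i - v i))"
proof -
  have bE: "b j \<in> E k" if "j < r" for j using b that by (auto simp: topspace_frames PiE_iff)
  obtain N c where N: "openin (frames r k) N" "b \<in> N" "c > 0"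
      "\<And>z v. z \<in> N \<Longrightarrow> v \<in> E r \<Longrightarrow> nrm r v \<le> c * nrm k (lmap r z v)"
    using injective_lower_bound [of r k "frames r k" "\<lambda>b. b" b] continuous_map_frames_coord bE b
    by (auto simp: topspace_frames)
  define M where "M = c * (nrm k v + e')"
  have M: "M > 0" unfolding M_def using N(3) e' by (intro mult_pos_pos add_nonneg_pos) auto
  define s where "s z = (\<Sum>j<r. nrm k (\<lambda>i. b j i - z j i))" for z
  have "cont_real (frames r k) s"
    unfolding s_def
    by (intro continuous_map_sum continuous_map_nrm continuous_map_diff continuous_map_frames_coord) auto
  then have "openin (frames r k) {z \<in> topspace (frames r k). s z \<in> {..<(e - e') / M}}"
    by (rule openin_continuous_map_preimage) auto
  moreover have "s b = 0" by (simp add: s_def nrm_def)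
  moreover have "e' \<le> nrm k (\<lambda>i. u i - v i)"
    if z: "z \<in> N" "s z < (e - e') / M" and u: "u \<in> frame_span r z" for z u
  proof (rule ccontr)
    assume n: "\<not> e' \<le> nrm k (\<lambda>i. u i - v i)"
    obtain d' where d': "d' \<in> E r" "u = lmap r z d'" using u unfolding frame_span_eq by blast
    have "nrm k u \<le> nrm k v + e'" using nrm_triangle_diff [of k u v] n by simp
    then have dM: "nrm r d' \<le> M"
      unfolding M_def using N(3) d'(2) by (intro order_trans [OF N(4) [OF z(1) d'(1)]] mult_left_mono) auto
    have "nrm k (\<lambda>i. b j i - z j i) \<le> s z" if "j < r" for j
      using member_le_sum [of j "{..<r}" "\<lambda>j. nrm k (\<lambda>i. b j i - z j i)"] that by (simp add: s_def)
    then have "nrm k (lmap r (\<lambda>j i. b j i - z j i) d') \<le> s z * nrm r d'" by (rule nrm_lmap_bound)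
    moreover have "s z * nrm r d' \<le> s z * M"
      using dM by (intro mult_left_mono) (auto simp: s_def intro: sum_nonneg)
    moreover have "s z * M < e - e'" using z(2) M by (simp add: field_simps)
    ultimately have "nrm k (\<lambda>i. lmap r b d' i - u i) < e - e'"
      unfolding lmap_diff_matrix d'(2) by simp
    moreover have "e \<le> nrm k (\<lambda>i. lmap r b d' i - v i)"
      by (rule d) (simp add: frame_span_eq d'(1))
    moreover have "nrm k (\<lambda>i. lmap r b d' i - v i) \<le> nrm k (\<lambda>i. lmap r b d' i - u i) + nrm k (\<lambda>i. u i - v i)"
      using nrm_triangle [of k "\<lambda>i. lmap r b d' i - u i" "\<lambda>i. u i - v i"] by simp
    ultimately show False using n by simp
  qed
  ultimately show ?thesis using N(1,2) b e' M
    by (intro exI [of _ "N \<inter> {z \<in> topspace (frames r k). s z \<in> {..<(e - e') / M}}"]) auto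
qed

text \<open>If \<open>v\<close> had positive distance from \<open>W\<close>, the subspaces that keep
  away from \<open>v\<close> would form a neighbourhood of \<open>W\<close>. Eventually it contains
  \<open>Ws n\<close>, although \<open>u n\<close> in \<open>Ws n\<close> comes arbitrarily close to
  \<open>v\<close>.\<close>

lemma grassmannian_limit:
  assumes lim: "limitin (grassmannian r k) Ws W sequentially"
    and u: "\<And>n. u n \<in> Ws n" "\<And>i. i < k \<Longrightarrow> (\<lambda>n. u n i) \<longlonglongrightarrow> v i" and v: "v \<in> E k"
  shows "v \<in> W"
proof (rule ccontr)
  assume "v \<notin> W"
  have "W \<in> topspace (grassmannian r k)" using lim by (rule limitin_topspace)
  then obtain b where b: "b \<in> topspace (frames r k)" "W = frame_span r b"
    unfolding topspace_grassmannian by blast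
  obtain e where e: "e > 0" "\<And>u. u \<in> W \<Longrightarrow> e \<le> nrm k (\<lambda>i. u i - v i)"
    using frame_span_dist [OF b(1) v] \<open>v \<notin> W\<close> b(2) by blast
  \<comment> \<open>The bound \<open>d\<close> strictly above \<open>e / 2\<close> leaves room for a
    small change of the frame, which makes this set open.\<close>
  define \<U> where "\<U> = {U \<in> frame_span r ` topspace (frames r k).
    \<exists>d>e / 2. \<forall>u\<in>U. d \<le> nrm k (\<lambda>i. u i - v i)}"
  have "openin (grassmannian r k) \<U>"
    unfolding openin_grassmannian
  proof
    show "\<U> \<subseteq> frame_span r ` topspace (frames r k)" by (auto simp: \<U>_def)
    show "openin (frames r k) {b \<in> topspace (frames r k). frame_span r b \<in> \<U>}"
    proof (subst openin_subopen, intro ballI)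
      fix b assume "b \<in> {b \<in> topspace (frames r k). frame_span r b \<in> \<U>}"
      then obtain d where bd: "b \<in> topspace (frames r k)" "d > e / 2"
          "\<And>u. u \<in> frame_span r b \<Longrightarrow> d \<le> nrm k (\<lambda>i. u i - v i)"
        by (auto simp: \<U>_def)
      obtain N where N: "openin (frames r k) N" "b \<in> N"
          "\<And>b' u. b' \<in> N \<Longrightarrow> u \<in> frame_span r b' \<Longrightarrow> (d + e / 2) / 2 \<le> nrm k (\<lambda>i. u i - v i)"
        using frame_span_dist_near [OF bd(1,3), of "(d + e / 2) / 2"] bd(2) e(1) by auto
      have "N \<subseteq> {b \<in> topspace (frames r k). frame_span r b \<in> \<U>}"
      proof
        fix b' assume b': "b' \<in> N"
        then have "b' \<in> topspace (frames r k)" using N(1) openin_subset by blast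
        moreover have "(d + e / 2) / 2 > e / 2" using bd(2) by simp
        ultimately show "b' \<in> {b \<in> topspace (frames r k). frame_span r b \<in> \<U>}"
          unfolding \<U>_def using N(3) [OF b'] by (auto intro!: exI [of _ "(d + e / 2) / 2"])
      qed
      with N(1,2) show "\<exists>T. openin (frames r k) T \<and> b \<in> T \<and> T \<subseteq> {b \<in> topspace (frames r k). frame_span r b \<in> \<U>}"
        by blast
    qed
  qed
  moreover have "W \<in> \<U>" using b e by (auto simp: \<U>_def intro!: exI [of _ e])
  ultimately have "\<forall>\<^sub>F n in sequentially. Ws n \<in> \<U>" using lim by (simp add: limitin_def)
  then have "\<forall>\<^sub>F n in sequentially. e / 2 < nrm k (\<lambda>i. u n i - v i)"
  proof (rule eventually_mono)
    fix n assume "Ws n \<in> \<U>"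
    with u(1) [of n] show "e / 2 < nrm k (\<lambda>i. u n i - v i)" by (auto simp: \<U>_def)
  qed
  moreover have "(\<lambda>n. nrm k (\<lambda>i. u n i - v i)) \<longlonglongrightarrow> (\<Sum>i<k. \<bar>v i - v i\<bar>)"
    unfolding nrm_def by (intro tendsto_intros u(2)) simp
  then have "\<forall>\<^sub>F n in sequentially. nrm k (\<lambda>i. u n i - v i) < e / 2"
    using e(1) by (intro order_tendstoD(2)) auto
  ultimately have "\<forall>\<^sub>F n in sequentially. False" by eventually_elim simp
  then show False by simp
qed

text \<open>Taking spans is the quotient map that defines the topology, hence continuous; the work
  lies in reading coordinatewise convergence as convergence in \<open>frames\<close>.\<close>

lemma frame_span_limit:
  assumes b: "\<And>n. b n \<in> topspace (frames r k)" "b0 \<in> topspace (frames r k)"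
    and lim: "\<And>j i. j < r \<Longrightarrow> i < k \<Longrightarrow> (\<lambda>n. b n j i) \<longlonglongrightarrow> b0 j i"
  shows "limitin (grassmannian r k) (\<lambda>n. frame_span r (b n)) (frame_span r b0) sequentially"
proof -
  have coord: "limitin (Eu k) (\<lambda>n. b n j) (b0 j) sequentially" if j: "j < r" for j
  proof -
    have "limitin euclideanreal (\<lambda>n. b n j i) (b0 j i) sequentially" for i
    proof (cases "i < k")
      case True
      then show ?thesis using lim j by simp
    next
      case False
      then have "b n j i = 0" "b0 j i = 0" for n
        using b j by (auto simp: topspace_frames PiE_iff E_iff)
      then show ?thesis by simp
    qed
    moreover have "b n j \<in> E k" "b0 j \<in> E k" for n using b j by (auto simp: topspace_frames PiE_iff)
    ultimately show ?thesis
      unfolding Euclidean_space_def limitin_subtopology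
      by (auto simp: limitin_componentwise topspace_Euclidean_space)
  qed
  have "limitin (frames r k) b b0 sequentially"
    unfolding frames_def limitin_subtopology limitin_componentwise
    using coord b by (auto simp: frames_def PiE_iff)
  then have fr: "openin (frames r k) U \<Longrightarrow> b0 \<in> U \<Longrightarrow> \<forall>\<^sub>F n in sequentially. b n \<in> U" for U
    by (simp add: limitin_def)
  show ?thesis
    unfolding limitin_def
  proof (intro conjI allI impI)
    show "frame_span r b0 \<in> topspace (grassmannian r k)" using b(2) by (simp add: topspace_grassmannian)
    fix U assume U: "openin (grassmannian r k) U \<and> frame_span r b0 \<in> U"
    then have "\<forall>\<^sub>F n in sequentially. b n \<in> {b \<in> topspace (frames r k). frame_span r b \<in> U}"
      using b(2) by (intro fr) (auto simp: openin_grassmannian)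
    then show "\<forall>\<^sub>F n in sequentially. frame_span r (b n) \<in> U" by (rule eventually_mono) auto
  qed
qed

section \<open>Functions of class \<open>C\<^sup>k\<close>\<close>

text \<open>A choice of partial derivatives that does not depend on the domain. It replaces the
  existentially quantified \<open>g\<close> of \<open>Ck\<close>, so that statements on small open
  sets fit together.\<close>

definition pderiv_at :: "nat \<Rightarrow> (vec \<Rightarrow> real) \<Rightarrow> vec \<Rightarrow> real"
  where "pderiv_at i f x = deriv (\<lambda>t. f (x(i := t))) (x i)"

lemma openin_E_subset: "openin (Eu n) D \<Longrightarrow> D \<subseteq> E n"
  by (rule openin_subset)

lemma open_line:
  assumes D: "openin (Eu n) D" and x: "x \<in> E n" and i: "i < n"
  shows "open {t. x(i := t) \<in> D}"
proof -
  have "continuous_map euclideanreal (Eu n) (\<lambda>t. x(i := t))"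
    unfolding continuous_map_Euc_iff
  proof (intro conjI ballI allI impI)
    show "x(i := t) \<in> E n" for t using x i by (simp add: E_iff)
    show "cont_real euclideanreal (\<lambda>t. (x(i := t)) j)" for j
      by (cases "j = i") auto
  qed
  from openin_continuous_map_preimage [OF this D] show ?thesis by simp
qed

lemma Ck_cont: "Ck k n D f \<Longrightarrow> cont_real (subtopology (Eu n) D) f"
  by (cases k) auto

lemma Ck_Suc_imp: "Ck (Suc k) n D f \<Longrightarrow> Ck k n D f"
proof (induction k arbitrary: f)
  case 0
  then show ?case by (auto dest: Ck_cont)
next
  case (Suc k)
  from Suc.prems obtain g where g: "\<forall>i<n. (\<forall>x\<in>D. ((\<lambda>t. f (x(i := t))) has_real_derivative g i x) (at (x i)))
        \<and> Ck (Suc k) n D (g i)" by auto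
  then have "\<forall>i<n. (\<forall>x\<in>D. ((\<lambda>t. f (x(i := t))) has_real_derivative g i x) (at (x i)))
        \<and> Ck k n D (g i)" using Suc.IH by blast
  with Ck_cont [OF Suc.prems] show ?case by auto
qed

lemma Ck_subset: "Ck k n D f \<Longrightarrow> D' \<subseteq> D \<Longrightarrow> Ck k n D' f"
proof (induction k arbitrary: f)
  case 0
  then show ?case by (auto intro: continuous_map_from_subtopology_mono)
next
  case (Suc k)
  from Suc.prems obtain g where g: "\<forall>i<n. (\<forall>x\<in>D. ((\<lambda>t. f (x(i := t))) has_real_derivative g i x) (at (x i)))
        \<and> Ck k n D (g i)" by auto
  then have "\<forall>i<n. (\<forall>x\<in>D'. ((\<lambda>t. f (x(i := t))) has_real_derivative g i x) (at (x i)))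
        \<and> Ck k n D' (g i)" using Suc by blast
  with continuous_map_from_subtopology_mono [OF Ck_cont [OF Suc.prems(1)] Suc.prems(2)] show ?case by auto
qed

text \<open>A derivative at a point of \<open>D\<close> involves values at nearby points; as
  \<open>D\<close> is open, its trace on each coordinate line is open, and the values there
  suffice.\<close>

lemma Ck_cong:
  assumes D: "openin (Eu n) D" and f: "Ck k n D f" and eq: "\<And>x. x \<in> D \<Longrightarrow> f x = g x"
  shows "Ck k n D g"
proof -
  have cont: "cont_real (subtopology (Eu n) D) g"
    using Ck_cont [OF f] by (rule continuous_map_eq) (use eq in auto)
  show ?thesis
  proof (cases k)
    case 0
    then show ?thesis using cont by simp
  next
    case (Suc l)
    from f obtain h where h: "\<And>i x. i < n \<Longrightarrow> x \<in> D \<Longrightarrow> ((\<lambda>t. f (x(i := t))) has_real_derivative h i x) (at (x i))"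
        "\<And>i. i < n \<Longrightarrow> Ck l n D (h i)" unfolding Suc by auto
    have "((\<lambda>t. g (x(i := t))) has_real_derivative h i x) (at (x i))" if i: "i < n" and x: "x \<in> D" for i x
    proof (rule has_field_derivative_transform_within_open [OF h(1) [OF i x]])
      show "open {t. x(i := t) \<in> D}" using D openin_E_subset [OF D] x i by (intro open_line) auto
      show "x i \<in> {t. x(i := t) \<in> D}" using x by simp
      show "f (x(i := t)) = g (x(i := t))" if "t \<in> {t. x(i := t) \<in> D}" for t using that eq by simp
    qed
    with h(2) cont show ?thesis unfolding Suc by auto
  qed
qed

lemma Ck_Suc_iff:
  assumes D: "openin (Eu n) D"
  shows "Ck (Suc k) n D f \<longleftrightarrow> cont_real (subtopology (Eu n) D) f \<and>
    (\<forall>i<n. (\<forall>x\<in>D. ((\<lambda>t. f (x(i := t))) has_real_derivative pderiv_at i f x) (at (x i))) \<and>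
      Ck k n D (pderiv_at i f))" (is "?L = ?R")
proof
  assume L: ?L
  then obtain g where g: "\<And>i x. i < n \<Longrightarrow> x \<in> D \<Longrightarrow> ((\<lambda>t. f (x(i := t))) has_real_derivative g i x) (at (x i))"
        "\<And>i. i < n \<Longrightarrow> Ck k n D (g i)" by auto
  have eq: "g i x = pderiv_at i f x" if "i < n" "x \<in> D" for i x
    unfolding pderiv_at_def using DERIV_imp_deriv [OF g(1) [OF that]] by simp
  have "((\<lambda>t. f (x(i := t))) has_real_derivative pderiv_at i f x) (at (x i))" if "i < n" "x \<in> D" for i x
    using g(1) [OF that] unfolding eq [OF that] .
  moreover have "Ck k n D (pderiv_at i f)" if "i < n" for i
    using D g(2) [OF that] eq [OF that] by (rule Ck_cong)
  ultimately show ?R using Ck_cont [OF L] by blast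
next
  assume ?R
  then show ?L unfolding Ck.simps by (intro conjI exI [of _ "\<lambda>i. pderiv_at i f"]) blast+
qed

text \<open>All the small sets share the derivative functions \<open>pderiv_at i f\<close>, to which
  the induction hypothesis applies.\<close>

lemma Ck_local:
  assumes D: "openin (Eu n) D"
    and loc: "\<And>x. x \<in> D \<Longrightarrow> \<exists>D'. openin (Eu n) D' \<and> x \<in> D' \<and> D' \<subseteq> D \<and> Ck k n D' f"
  shows "Ck k n D f"
  using loc
proof (induction k arbitrary: f)
  have *: "cont_real (subtopology (Eu n) D) f"
    if loc: "\<And>x. x \<in> D \<Longrightarrow> \<exists>D'. openin (Eu n) D' \<and> x \<in> D' \<and> D' \<subseteq> D \<and> Ck k n D' f" for k f
  proof (rule continuous_map_localI)
    fix x assume "x \<in> topspace (subtopology (Eu n) D)"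
    then have "x \<in> D" by simp
    then obtain D' where D': "openin (Eu n) D'" "x \<in> D'" "D' \<subseteq> D" "Ck k n D' f"
      using loc by blast
    have "cont_real (subtopology (subtopology (Eu n) D) D') f"
      using Ck_cont [OF D'(4)] D'(3) by (simp add: subtopology_subtopology Int_absorb1)
    moreover have "openin (subtopology (Eu n) D) D'"
      using D'(1,3) D by (simp add: openin_open_subtopology)
    ultimately show "\<exists>N. openin (subtopology (Eu n) D) N \<and> x \<in> N \<and>
        cont_real (subtopology (subtopology (Eu n) D) N) f"
      using D'(2) by blast
  qed
  {
    case 0
    then show ?case using * [of 0 f] by simp
  next
    case (Suc k)
    have "((\<lambda>t. f (x(i := t))) has_real_derivative pderiv_at i f x) (at (x i))" if i: "i < n" and x: "x \<in> D" for i x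
    proof -
      obtain D' where "openin (Eu n) D'" "x \<in> D'" "Ck (Suc k) n D' f"
        using Suc.prems [OF x] by (elim exE conjE)
      then show ?thesis using i Ck_Suc_iff [of n D' k f] by blast
    qed
    note der = this
    have "Ck k n D (pderiv_at i f)" if "i < n" for i
    proof (rule Suc.IH)
      fix x assume "x \<in> D"
      from Suc.prems [OF this] obtain D' where "openin (Eu n) D'" "x \<in> D'" "D' \<subseteq> D" "Ck (Suc k) n D' f"
        by (elim exE conjE)
      moreover from this have "Ck k n D' (pderiv_at i f)"
        using \<open>i < n\<close> Ck_Suc_iff [of n D' k f] by blast
      ultimately show "\<exists>D'. openin (Eu n) D' \<and> x \<in> D' \<and> D' \<subseteq> D \<and> Ck k n D' (pderiv_at i f)"
        by (intro exI conjI)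
    qed
    note dk = this
    have "cont_real (subtopology (Eu n) D) f"
      by (rule * [OF Suc.prems])
    then show ?case unfolding Ck_Suc_iff [OF D]
      by (intro conjI allI impI ballI der dk)
  }
qed

lemma Ck_const: "Ck k n D (\<lambda>x. c)"
proof (induction k arbitrary: c)
  case (Suc k)
  then show ?case by (auto intro!: exI [of _ "\<lambda>i x. 0"])
qed simp

lemma Ck_coord: "Ck k n D (\<lambda>x. x j)"
proof (cases k)
  case 0
  then show ?thesis by (simp add: continuous_map_from_subtopology continuous_map_coord)
next
  case (Suc l)
  have "((\<lambda>t. (x(i := t)) j) has_real_derivative (if i = j then 1 else 0)) (at (x i))" for i and x :: "vec"
    by (cases "i = j") auto
  then show ?thesis unfolding Suc
    by (auto simp: continuous_map_from_subtopology continuous_map_coord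
        intro!: exI [of _ "\<lambda>i x. if i = j then 1 else 0"] Ck_const)
qed

lemma Ck_add: "Ck k n D f \<Longrightarrow> Ck k n D g \<Longrightarrow> Ck k n D (\<lambda>x. f x + g x)"
proof (induction k arbitrary: f g)
  case 0
  then show ?case by (simp add: continuous_map_add)
next
  case (Suc k)
  from Suc.prems(1) obtain f' where f': "\<And>i x. i < n \<Longrightarrow> x \<in> D \<Longrightarrow> ((\<lambda>t. f (x(i := t))) has_real_derivative f' i x) (at (x i))"
        "\<And>i. i < n \<Longrightarrow> Ck k n D (f' i)" by auto
  from Suc.prems(2) obtain g' where g': "\<And>i x. i < n \<Longrightarrow> x \<in> D \<Longrightarrow> ((\<lambda>t. g (x(i := t))) has_real_derivative g' i x) (at (x i))"
        "\<And>i. i < n \<Longrightarrow> Ck k n D (g' i)" by auto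
  have "cont_real (subtopology (Eu n) D) (\<lambda>x. f x + g x)"
    using Suc.prems by (intro continuous_map_add Ck_cont)
  moreover have "Ck k n D (\<lambda>x. f' i x + g' i x)" if "i < n" for i
    using Suc.IH f'(2) g'(2) that by blast
  ultimately show ?case
    using f'(1) g'(1) by (auto intro!: exI [of _ "\<lambda>i x. f' i x + g' i x"] DERIV_add)
qed

lemma Ck_mult: "Ck k n D f \<Longrightarrow> Ck k n D g \<Longrightarrow> Ck k n D (\<lambda>x. f x * g x)"
proof (induction k arbitrary: f g)
  case 0
  then show ?case by (simp add: continuous_map_real_mult)
next
  case (Suc k)
  from Suc.prems(1) obtain f' where f': "\<And>i x. i < n \<Longrightarrow> x \<in> D \<Longrightarrow> ((\<lambda>t. f (x(i := t))) has_real_derivative f' i x) (at (x i))"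
        "\<And>i. i < n \<Longrightarrow> Ck k n D (f' i)" by auto
  from Suc.prems(2) obtain g' where g': "\<And>i x. i < n \<Longrightarrow> x \<in> D \<Longrightarrow> ((\<lambda>t. g (x(i := t))) has_real_derivative g' i x) (at (x i))"
        "\<And>i. i < n \<Longrightarrow> Ck k n D (g' i)" by auto
  have "cont_real (subtopology (Eu n) D) (\<lambda>x. f x * g x)"
    using Suc.prems by (intro continuous_map_real_mult Ck_cont)
  moreover have "Ck k n D (\<lambda>x. f' i x * g x + g' i x * f x)" if "i < n" for i
    by (rule Ck_add [OF Suc.IH [OF f'(2) [OF that] Ck_Suc_imp [OF Suc.prems(2)]]
          Suc.IH [OF g'(2) [OF that] Ck_Suc_imp [OF Suc.prems(1)]]])
  moreover have "((\<lambda>t. f (x(i := t)) * g (x(i := t))) has_real_derivative f' i x * g x + g' i x * f x) (at (x i))"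
    if "i < n" "x \<in> D" for i x
    using DERIV_mult [OF f'(1) [OF that] g'(1) [OF that]] by simp
  ultimately show ?case
    by (auto intro!: exI [of _ "\<lambda>i x. f' i x * g x + g' i x * f x"])
qed

lemma Ck_sum: "(\<And>j. j \<in> J \<Longrightarrow> Ck k n D (f j)) \<Longrightarrow> Ck k n D (\<lambda>x. \<Sum>j\<in>J. f j x)"
proof (induction J rule: infinite_finite_induct)
  case (insert j J)
  then show ?case by (simp add: Ck_add)
qed (simp_all add: Ck_const)

section \<open>First-order expansion and the chain rule\<close>

lemma openin_Euclidean_box:
  assumes D: "openin (Eu m) D" and x: "x \<in> D"
  shows "\<exists>e>0. \<forall>y\<in>E m. (\<forall>i<m. \<bar>y i - x i\<bar> < e) \<longrightarrow> y \<in> D"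
proof -
  obtain D' where D': "openin (powertop_real UNIV) D'" "D = D' \<inter> E m"
    using D unfolding Euclidean_space_def openin_subtopology by (auto simp: topspace_Euclidean_space)
  then obtain U where U: "finite {i. U i \<noteq> UNIV}" "\<And>i. open (U i)" "\<And>i. x i \<in> U i" "PiE UNIV U \<subseteq> D'"
    using x unfolding openin_product_topology_alt by (fastforce simp: PiE_iff)
  have "\<exists>e>0. \<forall>t. \<bar>t - x i\<bar> < e \<longrightarrow> t \<in> U i" for i
    using U(2,3) [of i] unfolding open_dist dist_real_def by (metis)
  then obtain e where e: "\<And>i. e i > 0" "\<And>i t. \<bar>t - x i\<bar> < e i \<Longrightarrow> t \<in> U i" by metis
  define d where "d = Min (insert 1 (e ` {..<m}))"
  have d: "d > 0" "\<And>i. i < m \<Longrightarrow> d \<le> e i" using e(1) by (auto simp: d_def)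
  have "y \<in> D" if y: "y \<in> E m" "\<forall>i<m. \<bar>y i - x i\<bar> < d" for y
  proof -
    have "y i \<in> U i" for i
    proof (cases "i < m")
      case True
      then show ?thesis using y(2) d(2) [of i] by (intro e(2)) auto
    next
      case False
      \<comment> \<open>From index \<open>m\<close> on both points are zero, so only
        \<open>m\<close> of the radii \<open>e i\<close> have to be respected and their minimum is
        positive.\<close>
      then have "y i = x i" using y(1) x D'(2) by (simp add: E_iff)
      then show ?thesis using U(3) by simp
    qed
    then show ?thesis using U(4) D'(2) y(1) by (auto simp: PiE_iff)
  qed
  with d(1) show ?thesis by blast
qed

text \<open>The increment is split along the coordinate axes and each part is estimated by the mean value theorem.\<close>

lemma C1_remainder:
  assumes D: "openin (Eu m) D" and x: "x \<in> D"
    and der: "\<And>j y. j < m \<Longrightarrow> y \<in> D \<Longrightarrow> ((\<lambda>t. f (y(j := t))) has_real_derivative g j y) (at (y j))"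
    and cont: "\<And>j. j < m \<Longrightarrow> cont_real (subtopology (Eu m) D) (g j)"
    and e: "e > 0"
  shows "\<exists>d>0. \<forall>y\<in>E m. (\<forall>i<m. \<bar>y i - x i\<bar> < d) \<longrightarrow>
    \<bar>f y - f x - (\<Sum>j<m. g j x * (y j - x j))\<bar> \<le> e * (\<Sum>j<m. \<bar>y j - x j\<bar>)"
proof -
  have xE: "x \<in> E m" using x openin_E_subset [OF D] by blast
  have "\<exists>d>0. \<forall>y\<in>E m. (\<forall>i<m. \<bar>y i - x i\<bar> < d) \<longrightarrow> y \<in> D \<and> \<bar>g j y - g j x\<bar> < e" if j: "j < m" for j
  proof -
    have "openin (subtopology (Eu m) D)
        {y \<in> topspace (subtopology (Eu m) D). g j y \<in> {t. \<bar>t - g j x\<bar> < e}}"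
    proof (rule openin_continuous_map_preimage [OF cont [OF j]])
      have "{t. \<bar>t - g j x\<bar> < e} = ball (g j x) e" by (auto simp: dist_real_def)
      then show "openin euclideanreal {t. \<bar>t - g j x\<bar> < e}" by simp
    qed
    moreover have "{y \<in> topspace (subtopology (Eu m) D). g j y \<in> {t. \<bar>t - g j x\<bar> < e}}
        = {y \<in> D. \<bar>g j y - g j x\<bar> < e}"
      using openin_E_subset [OF D] by auto
    ultimately have "openin (Eu m) {y \<in> D. \<bar>g j y - g j x\<bar> < e}"
      using D by (simp add: openin_open_subtopology)
    from openin_Euclidean_box [OF this, of x] x e show ?thesis by auto
  qed
  then obtain d where d: "\<And>j. j < m \<Longrightarrow> d j > 0"
      "\<And>j y. j < m \<Longrightarrow> y \<in> E m \<Longrightarrow> (\<forall>i<m. \<bar>y i - x i\<bar> < d j) \<Longrightarrow> y \<in> D \<and> \<bar>g j y - g j x\<bar> < e"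
    by metis
  define c where "c = Min (insert 1 (d ` {..<m}))"
  have c: "c > 0" "\<And>j. j < m \<Longrightarrow> c \<le> d j" using d(1) by (auto simp: c_def)
  have near: "y \<in> D" "\<bar>g j y - g j x\<bar> < e" if "j < m" "y \<in> E m" "\<And>i. i < m \<Longrightarrow> \<bar>y i - x i\<bar> < c" for j y
    using d(2) [OF that(1,2)] that(3) c(2) [OF that(1)] by force+
  have "\<bar>f y - f x - (\<Sum>j<m. g j x * (y j - x j))\<bar> \<le> e * (\<Sum>j<m. \<bar>y j - x j\<bar>)"
    if y: "y \<in> E m" "\<And>i. i < m \<Longrightarrow> \<bar>y i - x i\<bar> < c" for y
  proof -
    \<comment> \<open>A path from \<open>x\<close> to \<open>y\<close> along the axes:
      \<open>h (Suc l)\<close> differs from \<open>h l\<close> in coordinate \<open>l\<close> only,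
      and all corners stay in the box around \<open>x\<close>.\<close>
    define h where "h l = (\<lambda>i. if i < l then y i else x i)" for l
    have step: "\<bar>f (h (Suc l)) - f (h l) - g l x * (y l - x l)\<bar> \<le> e * \<bar>y l - x l\<bar>" if l: "l < m" for l
    proof (cases "y l = x l")
      case True
      then have "h (Suc l) = h l" by (auto simp: h_def fun_eq_iff less_Suc_eq)
      then show ?thesis using True by simp
    next
      case False
      \<comment> \<open>The mean value theorem wants an increasing interval, while
        \<open>x l\<close> and \<open>y l\<close> may come in either order.\<close>
      define a b where "a = min (x l) (y l)" and "b = max (x l) (y l)"
      have ab: "a < b" using False by (auto simp: a_def b_def)
      have inD: "(h l)(l := t) \<in> D" "\<bar>g l ((h l)(l := t)) - g l x\<bar> < e" if t: "a \<le> t" "t \<le> b" for t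
      proof -
        have 1: "(h l)(l := t) \<in> E m" using y(1) xE l by (auto simp: E_iff h_def)
        have 2: "\<bar>((h l)(l := t)) i - x i\<bar> < c" if "i < m" for i
          using y(2) [OF that] y(2) [OF l] c(1) t by (auto simp: h_def a_def b_def min_def max_def split: if_splits)
        show "(h l)(l := t) \<in> D" "\<bar>g l ((h l)(l := t)) - g l x\<bar> < e" using near [OF l 1 2] by blast+
      qed
      have dt: "((\<lambda>t. f ((h l)(l := t))) has_real_derivative g l ((h l)(l := t))) (at t)"
        if "a \<le> t" "t \<le> b" for t
        using der [OF l inD(1) [OF that]] by simp
      obtain z where z: "a < z" "z < b" "f ((h l)(l := b)) - f ((h l)(l := a)) = (b - a) * g l ((h l)(l := z))"
        using MVT2 [OF ab, of "\<lambda>t. f ((h l)(l := t))" "\<lambda>t. g l ((h l)(l := t))"] dt by auto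
      have hl: "(h l)(l := x l) = h l" "(h l)(l := y l) = h (Suc l)"
        by (auto simp: h_def fun_eq_iff less_Suc_eq)
      have "f (h (Suc l)) - f (h l) = (y l - x l) * g l ((h l)(l := z))"
      proof (cases "x l < y l")
        case True
        then show ?thesis using z(3) by (simp add: a_def b_def hl)
      next
        case False
        then have "f (h l) - f (h (Suc l)) = (x l - y l) * g l ((h l)(l := z))"
          using z(3) by (simp add: a_def b_def hl min_absorb2 max_absorb1)
        then show ?thesis by (simp add: algebra_simps)
      qed
      then have "f (h (Suc l)) - f (h l) - g l x * (y l - x l) = (g l ((h l)(l := z)) - g l x) * (y l - x l)"
        by (simp add: algebra_simps)
      then show ?thesis
        using inD(2) [of z] z by (simp add: abs_mult mult_right_mono)
    qed
    have "h m = y" "h 0 = x" using y(1) xE by (auto simp: h_def E_iff fun_eq_iff)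
    then have "(\<Sum>l<m. f (h (Suc l)) - f (h l)) = f y - f x"
      using sum_lessThan_telescope [of "\<lambda>l. f (h l)" m] by simp
    then have "f y - f x - (\<Sum>j<m. g j x * (y j - x j))
        = (\<Sum>l<m. f (h (Suc l)) - f (h l) - g l x * (y l - x l))"
      by (simp add: sum_subtractf)
    also have "\<bar>\<dots>\<bar> \<le> (\<Sum>l<m. e * \<bar>y l - x l\<bar>)"
      by (intro order_trans [OF sum_abs] sum_mono step) auto
    finally show ?thesis by (simp add: sum_distrib_left)
  qed
  with c(1) show ?thesis by blast
qed

text \<open>The remainder \<open>r\<close> of the linear expansion at \<open>\<gamma> t0\<close> has
  derivative 0: by \<open>C1_remainder\<close> it is an arbitrarily small multiple of the increments
  of \<gamma>, whose difference quotients stay bounded. What is left of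
  \<open>f (\<gamma> t)\<close> is linear in the coordinates of \<gamma>.\<close>

lemma chain_rule_curve:
  assumes D: "openin (Eu m) D" and x: "\<gamma> t0 \<in> D"
    and der: "\<And>j y. j < m \<Longrightarrow> y \<in> D \<Longrightarrow> ((\<lambda>t. f (y(j := t))) has_real_derivative g j y) (at (y j))"
    and cont: "\<And>j. j < m \<Longrightarrow> cont_real (subtopology (Eu m) D) (g j)"
    and \<gamma>: "\<forall>\<^sub>F t in at t0. \<gamma> t \<in> E m"
    and \<gamma>': "\<And>j. j < m \<Longrightarrow> ((\<lambda>t. \<gamma> t j) has_real_derivative d j) (at t0)"
  shows "((\<lambda>t. f (\<gamma> t)) has_real_derivative (\<Sum>j<m. g j (\<gamma> t0) * d j)) (at t0)"
proof -
  define x where "x = \<gamma> t0"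
  define r where "r t = f (\<gamma> t) - f x - (\<Sum>j<m. g j x * (\<gamma> t j - x j))" for t
  have r0: "r t0 = 0" by (simp add: r_def x_def)
  have "(r has_real_derivative 0) (at t0)"
    unfolding has_field_derivative_iff
  proof (rule tendstoI)
    fix e :: real assume e: "e > 0"
    \<comment> \<open>The summand 1 puts \<open>M\<close> strictly above the limit of the difference
      quotients \<open>q\<close>, so that \<open>q t < M\<close> holds eventually.\<close>
    define M where "M = (\<Sum>j<m. \<bar>d j\<bar>) + 1"
    have M: "M > 0" unfolding M_def by (intro add_nonneg_pos sum_nonneg) auto
    define q where "q t = (\<Sum>j<m. \<bar>(\<gamma> t j - x j) / (t - t0)\<bar>)" for t
    have "(q \<longlongrightarrow> (\<Sum>j<m. \<bar>d j\<bar>)) (at t0)"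
      unfolding q_def x_def using \<gamma>' by (intro tendsto_intros) (auto simp: has_field_derivative_iff)
    then have q: "\<forall>\<^sub>F t in at t0. q t < M" unfolding M_def by (rule order_tendstoD) simp
    define e' where "e' = e / (2 * M)"
    have e': "e' > 0" "e' * M < e" using e M by (auto simp: e'_def)
    obtain c where c: "c > 0" "\<And>y. y \<in> E m \<Longrightarrow> (\<forall>i<m. \<bar>y i - x i\<bar> < c) \<Longrightarrow>
        \<bar>f y - f x - (\<Sum>j<m. g j x * (y j - x j))\<bar> \<le> e' * (\<Sum>j<m. \<bar>y j - x j\<bar>)"
      using C1_remainder [of m D x f g e', OF D _ der cont e'(1)] x by (auto simp: x_def)
    have "\<forall>\<^sub>F t in at t0. \<bar>\<gamma> t i - x i\<bar> < c" if "i < m" for i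
    proof -
      have "((\<lambda>t. \<gamma> t i) \<longlongrightarrow> x i) (at t0)"
        using DERIV_isCont [OF \<gamma>' [OF that]] by (simp add: isCont_def x_def)
      from tendstoD [OF this c(1)] show ?thesis by (simp add: dist_real_def)
    qed
    then have "\<forall>\<^sub>F t in at t0. \<forall>i\<in>{..<m}. \<bar>\<gamma> t i - x i\<bar> < c"
      by (intro eventually_ball_finite) auto
    with \<gamma> q eventually_neq_at_within [of t0 t0 UNIV]
    show "\<forall>\<^sub>F t in at t0. dist ((r t - r t0) / (t - t0)) 0 < e"
    proof eventually_elim
      case (elim t)
      have "\<bar>r t\<bar> \<le> e' * (\<Sum>j<m. \<bar>\<gamma> t j - x j\<bar>)" unfolding r_def using elim by (intro c(2)) auto
      then have "\<bar>r t\<bar> / \<bar>t - t0\<bar> \<le> e' * (\<Sum>j<m. \<bar>\<gamma> t j - x j\<bar>) / \<bar>t - t0\<bar>"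
        by (rule divide_right_mono) simp
      also have "\<dots> = e' * q t" by (simp add: q_def sum_divide_distrib [symmetric] abs_divide)
      also have "\<dots> \<le> e' * M" using elim e' by (intro mult_left_mono) auto
      also have "\<dots> < e" by (rule e')
      finally show ?case by (simp add: r0 abs_divide)
    qed
  qed
  moreover have "((\<lambda>t. \<Sum>j<m. g j x * (\<gamma> t j - x j)) has_real_derivative (\<Sum>j<m. g j x * d j)) (at t0)"
  proof (rule DERIV_sum)
    fix j assume "j \<in> {..<m}"
    then have "((\<lambda>t. \<gamma> t j) has_real_derivative d j) (at t0)" using \<gamma>' by simp
    then show "((\<lambda>t. g j x * (\<gamma> t j - x j)) has_real_derivative g j x * d j) (at t0)"
      by (auto intro!: derivative_eq_intros)
  qed
  ultimately have "((\<lambda>t. r t + (\<Sum>j<m. g j x * (\<gamma> t j - x j)) + f x) has_real_derivative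
      0 + (\<Sum>j<m. g j x * d j) + 0) (at t0)"
    by (intro DERIV_add DERIV_const)
  then show ?thesis by (simp add: r_def x_def)
qed

text \<open>The chain rule along coordinate lines expresses the derivatives as sums of products in
  which \<open>f\<close> occurs only through \<open>pderiv_at j f\<close> composed with
  \<open>h\<close>, one class lower.\<close>

lemma Ck_compose:
  assumes D: "openin (Eu n) D" and D': "openin (Eu m) D'"
    and h: "\<And>x. x \<in> D \<Longrightarrow> h x \<in> D'"
    and hk: "\<And>j. j < m \<Longrightarrow> Ck k n D (\<lambda>x. h x j)" and f: "Ck k m D' f"
  shows "Ck k n D (\<lambda>x. f (h x))"
  using hk f
proof (induction k arbitrary: f)
  have *: "cont_real (subtopology (Eu n) D) (\<lambda>x. f (h x))"
    if hk: "\<And>j. j < m \<Longrightarrow> Ck k n D (\<lambda>x. h x j)" and f: "Ck k m D' f" for k f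
  proof -
    have "continuous_map (subtopology (Eu n) D) (Eu m) h"
      unfolding continuous_map_Euc_iff using h openin_E_subset [OF D'] Ck_cont [OF hk] by auto
    then have "continuous_map (subtopology (Eu n) D) (subtopology (Eu m) D') h"
      using h by (auto simp: continuous_map_in_subtopology)
    from continuous_map_compose [OF this Ck_cont [OF f]] show ?thesis by (simp add: o_def)
  qed
  {
    case 0
    then show ?case using * [of 0 f] by simp
  next
    case (Suc k)
    note f = iffD1 [OF Ck_Suc_iff [OF D'] Suc.prems(2)]
    note hk = iffD1 [OF Ck_Suc_iff [OF D] Suc.prems(1)]
    let ?d = "\<lambda>i x. \<Sum>j<m. pderiv_at j f (h x) * pderiv_at i (\<lambda>x. h x j) x"
    have "((\<lambda>t. f (h (x(i := t)))) has_real_derivative ?d i x) (at (x i))" if i: "i < n" and x: "x \<in> D" for i x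
    proof -
      have "((\<lambda>t. f (h (x(i := t)))) has_real_derivative
          (\<Sum>j<m. pderiv_at j f (h (x(i := x i))) * pderiv_at i (\<lambda>x. h x j) x)) (at (x i))"
      proof (rule chain_rule_curve [OF D'])
        show "h (x(i := x i)) \<in> D'" using h x by simp
        show "((\<lambda>t. f (y(j := t))) has_real_derivative pderiv_at j f y) (at (y j))" if "j < m" "y \<in> D'" for j y
          using f that by blast
        show "cont_real (subtopology (Eu m) D') (pderiv_at j f)" if "j < m" for j
          using f that Ck_cont by blast
        have "open {t. x(i := t) \<in> D}" using D openin_E_subset [OF D] x i by (intro open_line) auto
        then have "\<forall>\<^sub>F t in at (x i). x(i := t) \<in> D"
          using eventually_at_in_open' [of "{t. x(i := t) \<in> D}" "x i"] x by simp
        then show "\<forall>\<^sub>F t in at (x i). h (x(i := t)) \<in> E m"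
          by (rule eventually_mono) (use h openin_E_subset [OF D'] in blast)
        show "((\<lambda>t. h (x(i := t)) j) has_real_derivative pderiv_at i (\<lambda>x. h x j) x) (at (x i))" if "j < m" for j
          using hk [OF that] i x by blast
      qed
      then show ?thesis by simp
    qed
    note der = this
    have "Ck k n D (?d i)" if i: "i < n" for i
    proof (intro Ck_sum Ck_mult)
      fix j assume "j \<in> {..<m}"
      then have j: "j < m" by simp
      show "Ck k n D (\<lambda>x. pderiv_at j f (h x))"
      proof (rule Suc.IH)
        show "Ck k n D (\<lambda>x. h x i)" if "i < m" for i
          by (rule Ck_Suc_imp [OF Suc.prems(1) [OF that]])
        show "Ck k m D' (pderiv_at j f)" using f j by blast
      qed
      show "Ck k n D (pderiv_at i (\<lambda>x. h x j))" using hk [OF j] i by blast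
    qed
    note dk = this
    show ?case
      unfolding Ck.simps
    proof (intro conjI exI [of _ ?d] allI impI ballI)
      show "cont_real (subtopology (Eu n) D) (\<lambda>x. f (h x))"
        by (rule * [OF Suc.prems])
    qed (fact der, fact dk)
  }
qed

lemma smooth_on_subset: "smooth_on n m D f \<Longrightarrow> D' \<subseteq> D \<Longrightarrow> smooth_on n m D' f"
  unfolding smooth_on_def using Ck_subset by blast

lemma smooth_on_cong:
  assumes "openin (Eu n) D" "smooth_on n m D f" "\<And>x j. x \<in> D \<Longrightarrow> j < m \<Longrightarrow> f x j = g x j"
  shows "smooth_on n m D g"
  unfolding smooth_on_def
proof (intro allI impI)
  fix j k assume j: "j < m"
  then have "Ck k n D (\<lambda>x. f x j)" using assms(2) by (simp add: smooth_on_def)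
  with assms(1) show "Ck k n D (\<lambda>x. g x j)" by (rule Ck_cong) (use assms(3) j in simp)
qed

lemma smooth_on_local:
  assumes "openin (Eu n) D"
    and loc: "\<And>x. x \<in> D \<Longrightarrow> \<exists>D'. openin (Eu n) D' \<and> x \<in> D' \<and> D' \<subseteq> D \<and> smooth_on n m D' f"
  shows "smooth_on n m D f"
  unfolding smooth_on_def
proof (intro allI impI)
  fix j k assume j: "j < m"
  show "Ck k n D (\<lambda>x. f x j)"
  proof (rule Ck_local [OF assms(1)])
    fix x assume "x \<in> D"
    from loc [OF this] obtain D' where D': "openin (Eu n) D'" "x \<in> D'" "D' \<subseteq> D" "smooth_on n m D' f"
      by (elim exE conjE)
    then have "Ck k n D' (\<lambda>x. f x j)" using j by (simp add: smooth_on_def)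
    with D'(1-3) show "\<exists>D'. openin (Eu n) D' \<and> x \<in> D' \<and> D' \<subseteq> D \<and> Ck k n D' (\<lambda>x. f x j)"
      by (intro exI conjI)
  qed
qed

lemma smooth_on_compose:
  assumes "openin (Eu n) D" "openin (Eu m) D'" "\<And>x. x \<in> D \<Longrightarrow> h x \<in> D'"
    and "smooth_on n m D h" "smooth_on m p D' f"
  shows "smooth_on n p D (\<lambda>x. f (h x))"
  unfolding smooth_on_def
proof (intro allI impI)
  fix j k assume "j < p"
  then have "Ck k m D' (\<lambda>x. f x j)" using assms(5) by (simp add: smooth_on_def)
  with assms(4) show "Ck k n D (\<lambda>x. f (h x) j)"
    by (intro Ck_compose [OF assms(1-3), where f = "\<lambda>y. f y j"]) (auto simp: smooth_on_def)
qed

section \<open>Finite-dimensional spaces in coordinates\<close>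

lemma real_ring_simps [simp]: "carrier real_ring = UNIV" "\<one>\<^bsub>real_ring\<^esub> = 1" "\<zero>\<^bsub>real_ring\<^esub> = 0"
  "x \<otimes>\<^bsub>real_ring\<^esub> y = x * y" "x \<oplus>\<^bsub>real_ring\<^esub> y = x + y"
  by (simp_all add: real_ring_def)

lemma cring_real_ring: "cring real_ring"
proof (rule cringI)
  show "abelian_group real_ring"
    by (rule abelian_groupI) (auto simp: algebra_simps intro: exI [of _ "- x" for x])
  show "Group.comm_monoid real_ring"
    by (rule Group.comm_monoidI) (auto simp: algebra_simps)
qed (simp add: algebra_simps)

text \<open>Additive inverses are not assumed: since \<open>0 \<odot> v\<close> is zero,
  \<open>(-1) \<odot> v\<close> is one.\<close>

lemma module_real_ringI:
  fixes V (structure)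
  assumes "\<zero> \<in> carrier V"
    and add: "\<And>u v. u \<in> carrier V \<Longrightarrow> v \<in> carrier V \<Longrightarrow> u \<oplus> v \<in> carrier V"
    and "\<And>u v w. u \<in> carrier V \<Longrightarrow> v \<in> carrier V \<Longrightarrow> w \<in> carrier V
      \<Longrightarrow> (u \<oplus> v) \<oplus> w = u \<oplus> (v \<oplus> w)"
    and comm: "\<And>u v. u \<in> carrier V \<Longrightarrow> v \<in> carrier V \<Longrightarrow> u \<oplus> v = v \<oplus> u"
    and "\<And>v. v \<in> carrier V \<Longrightarrow> \<zero> \<oplus> v = v"
    and sm: "\<And>c v. v \<in> carrier V \<Longrightarrow> c \<odot> v \<in> carrier V"
    and ldistr: "\<And>a b v. v \<in> carrier V \<Longrightarrow> (a + b) \<odot> v = a \<odot> v \<oplus> b \<odot> v"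
    and "\<And>a u v. u \<in> carrier V \<Longrightarrow> v \<in> carrier V \<Longrightarrow> a \<odot> (u \<oplus> v) = a \<odot> u \<oplus> a \<odot> v"
    and "\<And>a b v. v \<in> carrier V \<Longrightarrow> (a * b) \<odot> v = a \<odot> (b \<odot> v)"
    and one: "\<And>v. v \<in> carrier V \<Longrightarrow> 1 \<odot> v = v"
    and zero: "\<And>v. v \<in> carrier V \<Longrightarrow> 0 \<odot> v = \<zero>"
  shows "module real_ring V"
proof (rule moduleI [OF cring_real_ring])
  show "abelian_group V"
  proof (rule abelian_groupI)
    fix v assume v: "v \<in> carrier V"
    have "(-1) \<odot> v \<oplus> v = \<zero>"
      using ldistr [OF v, of "-1" 1] zero [OF v] one [OF v] by simp
    then show "\<exists>u\<in>carrier V. u \<oplus> v = \<zero>" using sm [OF v] by blast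
  qed (use assms in auto)
qed (use assms in auto)

lemmas module_abelian_monoid = abelian_group.axioms(1) [OF module.axioms(2) [of real_ring]]

lemmas module_zero_closed = abelian_monoid.zero_closed [OF module_abelian_monoid]
  and module_add_closed = abelian_monoid.a_closed [OF module_abelian_monoid]
  and module_add_assoc = abelian_monoid.a_assoc [OF module_abelian_monoid]
  and module_add_comm = abelian_monoid.a_comm [OF module_abelian_monoid]
  and module_l_zero = abelian_monoid.l_zero [OF module_abelian_monoid]
  and module_smult_closed = module.smult_closed [of real_ring, simplified]
  and module_ldistr = module.smult_l_distr [of real_ring, simplified]
  and module_rdistr = module.smult_r_distr [of real_ring, simplified]
  and module_smult_assoc = module.smult_assoc1 [of real_ring, simplified]
  and module_smult_one = module.smult_one [of real_ring, simplified]
  and module_smult_zero = module.smult_l_null [of real_ring, simplified]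

lemma linear_maps_iff:
  "f \<in> linear_maps V W \<longleftrightarrow> (\<forall>v\<in>carrier V. f v \<in> carrier W) \<and>
    (\<forall>u\<in>carrier V. \<forall>v\<in>carrier V. f (u \<oplus>\<^bsub>V\<^esub> v) = f u \<oplus>\<^bsub>W\<^esub> f v) \<and>
    (\<forall>c. \<forall>v\<in>carrier V. f (c \<odot>\<^bsub>V\<^esub> v) = c \<odot>\<^bsub>W\<^esub> f v)"
  by (auto simp: linear_maps_def hom_def)

lemma linear_maps_closed: "f \<in> linear_maps V W \<Longrightarrow> v \<in> carrier V \<Longrightarrow> f v \<in> carrier W"
  by (simp add: linear_maps_iff)

lemma linear_maps_zero:
  assumes "f \<in> linear_maps V W" "module real_ring V" "module real_ring W"
  shows "f \<zero>\<^bsub>V\<^esub> = \<zero>\<^bsub>W\<^esub>"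
proof -
  have "f (0 \<odot>\<^bsub>V\<^esub> \<zero>\<^bsub>V\<^esub>) = 0 \<odot>\<^bsub>W\<^esub> f \<zero>\<^bsub>V\<^esub>"
    using assms(1) module_zero_closed [OF assms(2)] unfolding linear_maps_iff by blast
  then show ?thesis
    using module_zero_closed [OF assms(2)] linear_maps_closed [OF assms(1)]
    by (simp add: module_smult_zero [OF assms(2)] module_smult_zero [OF assms(3)])
qed

lemma linear_maps_comp:
  "f \<in> linear_maps V W \<Longrightarrow> g \<in> linear_maps W Z \<Longrightarrow> (\<lambda>v. g (f v)) \<in> linear_maps V Z"
  by (auto simp: linear_maps_iff)

lemma linear_maps_id: "(\<lambda>v. v) \<in> linear_maps V V"
  by (auto simp: linear_maps_iff)

lemma linear_maps_cong:
  assumes "f \<in> linear_maps V W" "module real_ring V" "\<And>v. v \<in> carrier V \<Longrightarrow> f v = g v"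
  shows "g \<in> linear_maps V W"
  unfolding linear_maps_iff
proof (intro conjI ballI allI)
  show "g v \<in> carrier W" if "v \<in> carrier V" for v
    using assms that by (metis linear_maps_closed)
  show "g (u \<oplus>\<^bsub>V\<^esub> v) = g u \<oplus>\<^bsub>W\<^esub> g v" if "u \<in> carrier V" "v \<in> carrier V" for u v
    using assms(1) that assms(3) [of "u \<oplus>\<^bsub>V\<^esub> v"] assms(3) [of u] assms(3) [of v]
      module_add_closed [OF assms(2) that] unfolding linear_maps_iff by simp
  show "g (c \<odot>\<^bsub>V\<^esub> v) = c \<odot>\<^bsub>W\<^esub> g v" if "v \<in> carrier V" for c v
    using assms(1) that assms(3) [of "c \<odot>\<^bsub>V\<^esub> v"] assms(3) [of v]
      module_smult_closed [OF assms(2) that] unfolding linear_maps_iff by simp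
qed

lemma linear_iso_inverse:
  assumes f: "linear_iso V W f" and V: "module real_ring V" and W: "module real_ring W"
  shows "linear_iso W V (inv_into (carrier V) f)"
proof -
  let ?g = "inv_into (carrier V) f"
  have bij: "bij_betw f (carrier V) (carrier W)" and lin: "f \<in> linear_maps V W"
    using f by (auto simp: linear_iso_def)
  have g: "?g w \<in> carrier V" "f (?g w) = w" if "w \<in> carrier W" for w
    using bij_betw_apply [OF bij_betw_inv_into [OF bij] that] bij_betw_inv_into_right [OF bij that] by auto
  have gf: "?g (f v) = v" if "v \<in> carrier V" for v using bij_betw_inv_into_left [OF bij that] .
  have "?g \<in> linear_maps W V"
    unfolding linear_maps_iff
  proof (intro conjI ballI allI)
    show "?g w \<in> carrier V" if "w \<in> carrier W" for w by (rule g(1) [OF that])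
    show "?g (u \<oplus>\<^bsub>W\<^esub> w) = ?g u \<oplus>\<^bsub>V\<^esub> ?g w" if "u \<in> carrier W" "w \<in> carrier W" for u w
    proof -
      have "f (?g u \<oplus>\<^bsub>V\<^esub> ?g w) = u \<oplus>\<^bsub>W\<^esub> w"
        using lin g [OF that(1)] g [OF that(2)] by (simp add: linear_maps_iff)
      then show ?thesis using gf [OF module_add_closed [OF V g(1) [OF that(1)] g(1) [OF that(2)]]] by simp
    qed
    show "?g (c \<odot>\<^bsub>W\<^esub> w) = c \<odot>\<^bsub>V\<^esub> ?g w" if "w \<in> carrier W" for c w
    proof -
      have "f (c \<odot>\<^bsub>V\<^esub> ?g w) = c \<odot>\<^bsub>W\<^esub> w" using lin g [OF that] by (simp add: linear_maps_iff)
      then show ?thesis using gf [OF module_smult_closed [OF V g(1) [OF that], of c]] by simp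
    qed
  qed
  then show ?thesis using bij_betw_inv_into [OF bij] by (simp add: linear_iso_def)
qed

lemma linear_iso_comp: "linear_iso V W f \<Longrightarrow> linear_iso W Z g \<Longrightarrow> linear_iso V Z (\<lambda>v. g (f v))"
  unfolding linear_iso_def using linear_maps_comp bij_betw_trans [of f "carrier V" "carrier W" g "carrier Z"]
  by (fastforce simp: o_def)

lemma Euc_simps [simp]: "carrier (Euc n) = E n" "u \<oplus>\<^bsub>Euc n\<^esub> v = (\<lambda>i. u i + v i)"
  "c \<odot>\<^bsub>Euc n\<^esub> v = (\<lambda>i. c * v i)" "\<zero>\<^bsub>Euc n\<^esub> = (\<lambda>i. 0)"
  by (simp_all add: Euc_def)

lemma module_Euc: "module real_ring (Euc n)"
  by (rule module_real_ringI)
    (simp_all add: E_add E_scale fun_eq_iff distrib_left distrib_right add.commute add.left_commute)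

text \<open>A map that respects the operations carries the module axioms along, even if the target
  is not known to be a module yet.\<close>

lemma module_transport:
  fixes V (structure)
  assumes V: "module real_ring V" and f: "f \<in> linear_maps V W" and surj: "f ` carrier V = carrier W"
    and zero: "f \<zero> = \<zero>\<^bsub>W\<^esub>"
  shows "module real_ring W"
proof -
  have ex: "\<exists>v\<in>carrier V. w = f v" if "w \<in> carrier W" for w using that surj by blast
  have fa: "f (u \<oplus> v) = f u \<oplus>\<^bsub>W\<^esub> f v" if "u \<in> carrier V" "v \<in> carrier V" for u v
    using f that by (simp add: linear_maps_iff)
  have fs: "f (c \<odot> v) = c \<odot>\<^bsub>W\<^esub> f v" if "v \<in> carrier V" for c v
    using f that by (simp add: linear_maps_iff)
  note cl = module_zero_closed [OF V] module_add_closed [OF V] module_smult_closed [OF V]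
  show ?thesis
  proof (rule module_real_ringI)
    show "\<zero>\<^bsub>W\<^esub> \<in> carrier W" using zero cl(1) linear_maps_closed [OF f] by metis
  next
    fix u v assume "u \<in> carrier W" "v \<in> carrier W"
    then obtain u' v' where uv: "u' \<in> carrier V" "u = f u'" "v' \<in> carrier V" "v = f v'" using ex by metis
    show "u \<oplus>\<^bsub>W\<^esub> v \<in> carrier W"
      unfolding uv fa [OF uv(1,3), symmetric] using uv cl by (intro linear_maps_closed [OF f])
    show "u \<oplus>\<^bsub>W\<^esub> v = v \<oplus>\<^bsub>W\<^esub> u"
      unfolding uv fa [OF uv(1,3), symmetric] fa [OF uv(3,1), symmetric]
      by (simp add: module_add_comm [OF V uv(1,3)])
    fix a
    show "a \<odot>\<^bsub>W\<^esub> (u \<oplus>\<^bsub>W\<^esub> v) = a \<odot>\<^bsub>W\<^esub> u \<oplus>\<^bsub>W\<^esub> a \<odot>\<^bsub>W\<^esub> v"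
      using uv cl by (simp add: module_rdistr [OF V] flip: fa fs)
  next
    fix u v w assume "u \<in> carrier W" "v \<in> carrier W" "w \<in> carrier W"
    then obtain u' v' w' where uv: "u' \<in> carrier V" "u = f u'" "v' \<in> carrier V" "v = f v'"
      "w' \<in> carrier V" "w = f w'" using ex by metis
    then show "(u \<oplus>\<^bsub>W\<^esub> v) \<oplus>\<^bsub>W\<^esub> w = u \<oplus>\<^bsub>W\<^esub> (v \<oplus>\<^bsub>W\<^esub> w)"
      using cl by (simp add: module_add_assoc [OF V] flip: fa)
  next
    fix v assume "v \<in> carrier W"
    then obtain v' where v: "v' \<in> carrier V" "v = f v'" using ex by metis
    show "\<zero>\<^bsub>W\<^esub> \<oplus>\<^bsub>W\<^esub> v = v" using v cl by (simp add: module_l_zero [OF V] flip: fa zero)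
    show "1 \<odot>\<^bsub>W\<^esub> v = v" using v cl by (simp add: module_smult_one [OF V] flip: fs)
    show "0 \<odot>\<^bsub>W\<^esub> v = \<zero>\<^bsub>W\<^esub>" using v cl by (simp add: module_smult_zero [OF V] flip: fs zero)
    fix c
    show "c \<odot>\<^bsub>W\<^esub> v \<in> carrier W"
      unfolding v fs [OF v(1), symmetric] using v cl by (intro linear_maps_closed [OF f])
    fix b
    show "(c + b) \<odot>\<^bsub>W\<^esub> v = c \<odot>\<^bsub>W\<^esub> v \<oplus>\<^bsub>W\<^esub> b \<odot>\<^bsub>W\<^esub> v"
      using v cl by (simp add: module_ldistr [OF V] flip: fs fa)
    show "(c * b) \<odot>\<^bsub>W\<^esub> v = c \<odot>\<^bsub>W\<^esub> (b \<odot>\<^bsub>W\<^esub> v)"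
      using v cl by (simp add: module_smult_assoc [OF V] flip: fs)
  qed
qed

lemma fd_vspace_module: "fd_vspace V \<Longrightarrow> module real_ring V"
  by (simp add: fd_vspace_def)

lemma fd_vspace_surj:
  fixes V (structure)
  assumes "fd_vspace V"
  shows "\<exists>n. \<exists>\<psi>\<in>linear_maps (Euc n) V. \<psi> ` E n = carrier V"
proof -
  obtain B where B: "finite B" "B \<subseteq> carrier V" "\<And>v. v \<in> carrier V \<Longrightarrow> \<exists>c. v = (\<Oplus>b\<in>B. c b \<odot> b)"
    using assms unfolding fd_vspace_def by blast
  have M: "module real_ring V" using assms by (rule fd_vspace_module)
  interpret V: module real_ring V by (rule M)
  obtain h where h: "bij_betw h {..<card B} B" using ex_bij_betw_nat_finite [OF B(1)] by (auto simp: atLeast0LessThan)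
  define \<psi> where "\<psi> u = (\<Oplus>j\<in>{..<card B}. u j \<odot> h j)" for u
  have hV: "h j \<in> carrier V" if "j < card B" for j using h B(2) that by (auto simp: bij_betw_def)
  note sc = module_smult_closed [OF M]
  have "\<psi> \<in> linear_maps (Euc (card B)) V"
    unfolding linear_maps_iff
  proof (intro conjI ballI allI)
    show "\<psi> v \<in> carrier V" for v
      unfolding \<psi>_def by (intro V.finsum_closed) (auto intro: sc hV)
    show "\<psi> (u \<oplus>\<^bsub>Euc (card B)\<^esub> v) = \<psi> u \<oplus> \<psi> v" for u v
    proof -
      have "\<psi> (u \<oplus>\<^bsub>Euc (card B)\<^esub> v) = (\<Oplus>j\<in>{..<card B}. u j \<odot> h j \<oplus> v j \<odot> h j)"
        unfolding \<psi>_def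
        by (rule V.finsum_cong') (auto simp: module_ldistr [OF M hV] intro!: sc hV module_add_closed [OF M])
      also have "\<dots> = \<psi> u \<oplus> \<psi> v"
        unfolding \<psi>_def by (rule V.finsum_addf) (auto intro: sc hV)
      finally show ?thesis .
    qed
    show "\<psi> (c \<odot>\<^bsub>Euc (card B)\<^esub> v) = c \<odot> \<psi> v" for c v
    proof -
      have "c \<odot> \<psi> v = (\<Oplus>j\<in>{..<card B}. c \<odot> (v j \<odot> h j))"
        unfolding \<psi>_def by (rule V.finsum_smult_ldistr) (auto intro: sc hV)
      also have "\<dots> = \<psi> (c \<odot>\<^bsub>Euc (card B)\<^esub> v)"
        unfolding \<psi>_def
        by (rule V.finsum_cong') (auto simp: module_smult_assoc [OF M hV] intro!: sc hV)
      finally show ?thesis ..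
    qed
  qed
  moreover have "\<psi> ` E (card B) = carrier V"
  proof
    show "\<psi> ` E (card B) \<subseteq> carrier V"
      unfolding \<psi>_def by (auto intro!: V.finsum_closed sc hV)
    show "carrier V \<subseteq> \<psi> ` E (card B)"
    proof
      fix v assume "v \<in> carrier V"
      then obtain c where c: "v = (\<Oplus>b\<in>B. c b \<odot> b)" using B(3) by blast
      have Bh: "B = h ` {..<card B}" and ih: "inj_on h {..<card B}" using h by (auto simp: bij_betw_def)
      have "v = (\<Oplus>b\<in>h ` {..<card B}. c b \<odot> b)" using c Bh by metis
      also have "\<dots> = (\<Oplus>j\<in>{..<card B}. c (h j) \<odot> h j)"
        using ih by (intro V.finsum_reindex) (auto intro!: sc hV)
      also have "\<dots> = \<psi> (\<lambda>j. if j < card B then c (h j) else 0)"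
        unfolding \<psi>_def by (rule V.finsum_cong') (auto intro!: sc hV)
      finally show "v \<in> \<psi> ` E (card B)"
        by (rule image_eqI [of _ _ "\<lambda>j. if j < card B then c (h j) else 0"]) (simp add: E_iff)
    qed
  qed
  ultimately show ?thesis by blast
qed

text \<open>A linear surjection from \<open>\<real>^n\<close> with \<open>n\<close> least is
  injective: a kernel vector with \<open>u j\<close> nonzero would make coordinate \<open>j\<close>
  dispensable and give a surjection from \<open>\<real>^(n-1)\<close>.\<close>

lemma fd_vspace_iso_Euc:
  fixes V (structure)
  assumes "fd_vspace V"
  shows "\<exists>n \<psi>. linear_iso (Euc n) V \<psi>"
proof -
  let ?P = "\<lambda>n. \<exists>\<psi>\<in>linear_maps (Euc n) V. \<psi> ` E n = carrier V"
  define n where "n = (LEAST n. ?P n)"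
  have "?P n" unfolding n_def using fd_vspace_surj [OF assms] by (rule LeastI_ex)
  then obtain \<psi> where \<psi>: "\<psi> \<in> linear_maps (Euc n) V" "\<psi> ` E n = carrier V" by blast
  have M: "module real_ring V" using assms by (rule fd_vspace_module)
  have add: "\<psi> (\<lambda>i. u i + v i) = \<psi> u \<oplus> \<psi> v" if "u \<in> E n" "v \<in> E n" for u v
    using \<psi>(1) that by (simp add: linear_maps_iff)
  have scale: "\<psi> (\<lambda>i. c * v i) = c \<odot> \<psi> v" if "v \<in> E n" for c v
    using \<psi>(1) that by (simp add: linear_maps_iff)
  have cl: "\<psi> v \<in> carrier V" if "v \<in> E n" for v using \<psi>(2) that by blast
  have ker: "u = (\<lambda>i. 0)" if u: "u \<in> E n" "\<psi> u = \<zero>" for u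
  proof (rule ccontr)
    assume "u \<noteq> (\<lambda>i. 0)"
    then obtain j where j: "u j \<noteq> 0" by blast
    then have jn: "j < n" using u(1) by (metis E_zero linorder_not_le)
    \<comment> \<open>The inclusion of \<open>\<real>^(n-1)\<close> as the hyperplane where
      coordinate \<open>j\<close> is zero.\<close>
    define \<rho> where "\<rho> w = (\<lambda>i. if i < j then w i else if i = j then 0 else w (i - 1))" for w :: "vec"
    have \<rho>E: "\<rho> w \<in> E n" if "w \<in> E (n - 1)" for w using that jn by (auto simp: \<rho>_def E_iff)
    have "\<rho> \<in> linear_maps (Euc (n - 1)) (Euc n)"
      unfolding linear_maps_Euc_iff using \<rho>E by (auto simp: \<rho>_def)
    then have "(\<lambda>w. \<psi> (\<rho> w)) \<in> linear_maps (Euc (n - 1)) V" by (rule linear_maps_comp [OF _ \<psi>(1)])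
    moreover have "(\<lambda>w. \<psi> (\<rho> w)) ` E (n - 1) = carrier V"
    proof
      show "(\<lambda>w. \<psi> (\<rho> w)) ` E (n - 1) \<subseteq> carrier V" using cl \<rho>E by blast
      show "carrier V \<subseteq> (\<lambda>w. \<psi> (\<rho> w)) ` E (n - 1)"
      proof
        fix v assume "v \<in> carrier V"
        then obtain a where a: "a \<in> E n" "v = \<psi> a" using \<psi>(2) by blast
        \<comment> \<open>Adding this multiple of the kernel vector \<open>u\<close> cancels
          coordinate \<open>j\<close> of \<open>a\<close> without changing the value of \<psi>;
          \<open>w\<close> is the sum with that coordinate dropped.\<close>
        define d where "d = - a j / u j"
        define w where "w = (\<lambda>i. if i < j then a i + d * u i else a (i + 1) + d * u (i + 1))"
        have eq: "\<rho> w = (\<lambda>i. a i + d * u i)"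
        proof
          fix i
          consider "i < j" | "i = j" | "i > j" by linarith
          then show "\<rho> w i = a i + d * u i"
            by cases (use j in \<open>auto simp: \<rho>_def w_def d_def\<close>)
        qed
        have "\<psi> (\<lambda>i. a i + d * u i) = \<psi> a \<oplus> d \<odot> \<psi> u"
          using add [OF a(1) E_scale [OF u(1)]] scale [OF u(1)] by simp
        also have "d \<odot> \<psi> u = \<zero>"
        proof -
          have "d \<odot> (0 \<odot> \<zero>) = 0 \<odot> \<zero>"
            using module_smult_assoc [OF M module_zero_closed [OF M], of d 0] by simp
          then show ?thesis
            unfolding u(2) module_smult_zero [OF M module_zero_closed [OF M]] .
        qed
        also have "\<psi> a \<oplus> \<zero> = v"
          using module_l_zero [OF M cl [OF a(1)]] module_add_comm [OF M cl [OF a(1)] module_zero_closed [OF M]] a(2)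
          by simp
        finally have "\<psi> (\<rho> w) = v" unfolding eq .
        moreover have "w \<in> E (n - 1)" using a(1) u(1) jn by (auto simp: w_def E_iff)
        ultimately show "v \<in> (\<lambda>w. \<psi> (\<rho> w)) ` E (n - 1)" by blast
      qed
    qed
    ultimately have "n \<le> n - 1" unfolding n_def by (intro Least_le) blast
    with jn show False by simp
  qed
  have "inj_on \<psi> (E n)"
  proof (rule inj_onI)
    fix u v assume uv: "u \<in> E n" "v \<in> E n" "\<psi> u = \<psi> v"
    have "\<psi> (\<lambda>i. u i + (-1) * v i) = \<psi> u \<oplus> (-1) \<odot> \<psi> v"
      using add [OF uv(1) E_scale [OF uv(2), of "-1"]] scale [OF uv(2), of "-1"] by simp
    also have "\<dots> = (1 + -1) \<odot> \<psi> v"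
      unfolding module_ldistr [OF M cl [OF uv(2)]] module_smult_one [OF M cl [OF uv(2)]] uv(3) ..
    also have "\<dots> = \<zero>" using module_smult_zero [OF M cl [OF uv(2)]] by simp
    finally have "(\<lambda>i. u i + (-1) * v i) = (\<lambda>i. 0)"
      by (intro ker E_add [OF uv(1) E_scale [OF uv(2)]])
    then show "u = v" by (simp add: fun_eq_iff)
  qed
  then have "linear_iso (Euc n) V \<psi>" using \<psi> by (simp add: linear_iso_def bij_betw_def)
  then show ?thesis by blast
qed

lemma fd_vspaceI_iso:
  fixes V (structure)
  assumes M: "module real_ring V" and iso: "linear_iso (Euc n) V \<psi>"
  shows "fd_vspace V"
proof -
  interpret V: module real_ring V by (rule M)
  have lin: "\<psi> \<in> linear_maps (Euc n) V" and bij: "bij_betw \<psi> (E n) (carrier V)"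
    using iso by (auto simp: linear_iso_def)
  have cl: "\<psi> v \<in> carrier V" if "v \<in> E n" for v using bij_betw_apply [OF bij that] .
  note sc = module_smult_closed [OF M]
  have sum: "\<psi> (\<lambda>i. \<Sum>j<m. v j * unit_vec j i) = (\<Oplus>j\<in>{..<m}. v j \<odot> \<psi> (unit_vec j))" if "m \<le> n" for m v
    using that
  proof (induction m)
    case 0
    then show ?case using linear_maps_zero [OF lin module_Euc M] by simp
  next
    case (Suc m)
    have "\<psi> (\<lambda>i. (\<Sum>j<m. v j * unit_vec j i) + v m * unit_vec m i)
        = \<psi> (\<lambda>i. \<Sum>j<m. v j * unit_vec j i) \<oplus> v m \<odot> \<psi> (unit_vec m)"
    proof -
      have 1: "(\<lambda>i. \<Sum>j<m. v j * unit_vec j i) \<in> E n" using Suc.prems by (intro E_sum) auto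
      have 2: "unit_vec m \<in> E n" using Suc.prems by simp
      show ?thesis using lin 1 2 E_scale [OF 2, of "v m"] by (simp add: linear_maps_iff)
    qed
    also have "\<dots> = v m \<odot> \<psi> (unit_vec m) \<oplus> (\<Oplus>j\<in>{..<m}. v j \<odot> \<psi> (unit_vec j))"
      using Suc by (subst module_add_comm [OF M]) (auto intro!: sc cl E_sum V.finsum_closed)
    also have "\<dots> = (\<Oplus>j\<in>insert m {..<m}. v j \<odot> \<psi> (unit_vec j))"
      using Suc.prems by (intro V.finsum_insert [symmetric]) (auto intro!: sc cl)
    finally show ?case by (simp add: lessThan_Suc add.commute)
  qed
  define B where "B = (\<lambda>j. \<psi> (unit_vec j)) ` {..<n}"
  have inj: "inj_on (\<lambda>j. \<psi> (unit_vec j)) {..<n}"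
    using bij inj_unit_vec by (auto simp: bij_betw_def inj_on_def)
  have "\<exists>c. v = (\<Oplus>b\<in>B. c b \<odot> b)" if v: "v \<in> carrier V" for v
  proof -
    obtain u where u: "u \<in> E n" "v = \<psi> u" using bij v by (auto simp: bij_betw_def)
    define c where "c b = u (inv_into {..<n} (\<lambda>j. \<psi> (unit_vec j)) b)" for b
    have "v = \<psi> (lmap n unit_vec u)" unfolding E_decomp [OF u(1), symmetric] by (rule u(2))
    also have "\<dots> = (\<Oplus>j\<in>{..<n}. u j \<odot> \<psi> (unit_vec j))" unfolding lmap_def by (rule sum) simp
    also have "\<dots> = (\<Oplus>j\<in>{..<n}. c (\<psi> (unit_vec j)) \<odot> \<psi> (unit_vec j))"
      by (rule V.finsum_cong') (auto simp: c_def inv_into_f_f [OF inj] intro!: sc cl)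
    also have "\<dots> = (\<Oplus>b\<in>B. c b \<odot> b)"
      unfolding B_def by (rule V.finsum_reindex [symmetric, OF _ inj]) (auto intro!: sc cl)
    finally show ?thesis by blast
  qed
  moreover have "finite B" "B \<subseteq> carrier V" using cl by (auto simp: B_def)
  ultimately show ?thesis unfolding fd_vspace_def using M by blast
qed

lemma fd_vspace_Euc: "fd_vspace (Euc n)"
  by (rule fd_vspaceI_iso [OF module_Euc, where \<psi> = "\<lambda>v. v" and n = n]) (simp add: linear_iso_def linear_maps_id bij_betw_def)

lemma fd_vspace_transport:
  assumes V: "fd_vspace V" and f: "linear_iso V W f" and "f \<zero>\<^bsub>V\<^esub> = \<zero>\<^bsub>W\<^esub>"
  shows "fd_vspace W"
proof -
  have "module real_ring W"
    using module_transport [OF fd_vspace_module [OF V]] f assms(3) by (auto simp: linear_iso_def bij_betw_def)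
  moreover obtain n \<psi> where "linear_iso (Euc n) V \<psi>" using fd_vspace_iso_Euc [OF V] by blast
  from linear_iso_comp [OF this f] have "linear_iso (Euc n) W (\<lambda>v. f (\<psi> v))" .
  ultimately show ?thesis by (rule fd_vspaceI_iso)
qed

section \<open>Linear functors in coordinates\<close>

lemma linear_maps_Euc_scale:
  assumes M: "M \<in> linear_maps (Euc p) (Euc q)"
  shows "(\<lambda>u i. c * M u i) \<in> linear_maps (Euc p) (Euc q)"
  unfolding linear_maps_Euc_iff
proof (intro conjI ballI allI)
  show "(\<lambda>i. c * M v i) \<in> E q" if "v \<in> E p" for v
    by (rule E_scale [OF linear_maps_E [OF M that]])
  show "(\<lambda>i. c * M (\<lambda>i. u i + v i) i) = (\<lambda>i. c * M u i + c * M v i)" if "u \<in> E p" "v \<in> E p" for u v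
    by (simp only: linear_maps_add [OF M that] distrib_left)
  show "(\<lambda>i. c * M (\<lambda>i. d * v i) i) = (\<lambda>i. d * (c * M v i))" if "v \<in> E p" for d v
    by (simp only: linear_maps_scale [OF M that] mult.left_commute)
qed

lemma linear_maps_Euc_add:
  assumes M: "M \<in> linear_maps (Euc p) (Euc q)" and N: "N \<in> linear_maps (Euc p) (Euc q)"
  shows "(\<lambda>u i. M u i + N u i) \<in> linear_maps (Euc p) (Euc q)"
  unfolding linear_maps_Euc_iff
proof (intro conjI ballI allI)
  show "(\<lambda>i. M v i + N v i) \<in> E q" if "v \<in> E p" for v
    by (rule E_add [OF linear_maps_E [OF M that] linear_maps_E [OF N that]])
  show "(\<lambda>i. M (\<lambda>i. u i + v i) i + N (\<lambda>i. u i + v i) i) = (\<lambda>i. (M u i + N u i) + (M v i + N v i))"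
    if "u \<in> E p" "v \<in> E p" for u v
    by (simp only: linear_maps_add [OF M that] linear_maps_add [OF N that] add.assoc add.left_commute)
  show "(\<lambda>i. M (\<lambda>i. d * v i) i + N (\<lambda>i. d * v i) i) = (\<lambda>i. d * (M v i + N v i))" if "v \<in> E p" for d v
    by (simp only: linear_maps_scale [OF M that] linear_maps_scale [OF N that] distrib_left)
qed

text \<open>No bundle occurs here: the locale isolates what a linear functor does to matrices, and
  the bundle enters later, fibre by fibre.\<close>

locale coordinate_functor =
  fixes emb :: "vec \<Rightarrow> 'v" and F :: "('v, unit) vs_functor"
  assumes inj_emb: "inj emb" and functorial: "linear_functor fd_vspace F"
begin

abbreviation "eo \<equiv> euc_obj emb"

definition iemb :: "'v \<Rightarrow> vec"
  where "iemb = inv_into UNIV emb"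

lemma iemb_emb [simp]: "iemb (emb u) = u"
  unfolding iemb_def by (rule inv_into_f_f [OF inj_emb UNIV_I])

lemma eo_simps [simp]: "carrier (eo k) = emb ` E k" "\<zero>\<^bsub>eo k\<^esub> = emb (\<lambda>i. 0)"
  "u \<oplus>\<^bsub>eo k\<^esub> v = emb (\<lambda>i. iemb u i + iemb v i)" "c \<odot>\<^bsub>eo k\<^esub> v = emb (\<lambda>i. c * iemb v i)"
  by (simp_all add: euc_obj_def iemb_def)

lemma emb_linear: "emb \<in> linear_maps (Euc k) (eo k)"
  by (simp add: linear_maps_iff)

lemma emb_iso: "linear_iso (Euc k) (eo k) emb"
  using emb_linear inj_emb by (auto simp: linear_iso_def bij_betw_def inj_on_def)

lemma iemb_linear: "iemb \<in> linear_maps (eo k) (Euc k)"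
  by (auto simp: linear_maps_iff E_add E_scale)

lemma fd_eo: "fd_vspace (eo k)"
  using fd_vspace_Euc emb_iso by (rule fd_vspace_transport) simp

text \<open>The restriction to the carrier is built in, because morphisms are extensional; ordinary
  functions can then be composed without tracking their values elsewhere.\<close>

definition ap :: "(real, 'v) module \<Rightarrow> (real, 'v) module \<Rightarrow> ('v \<Rightarrow> 'v) \<Rightarrow> 'v \<Rightarrow> 'v"
  where "ap V W f = fmap F V W (\<lambda>v\<in>carrier V. f v)"

lemmas functor_laws = functorial [unfolded linear_functor_def]

lemmas fd_fobj = functor_laws [THEN conjunct1, rule_format]
  and fmap_Hom = functor_laws [THEN conjunct2, THEN conjunct1, rule_format, OF conjI]
  and fmap_id = functor_laws [THEN conjunct2, THEN conjunct2, THEN conjunct1, rule_format]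
  and fmap_comp = functor_laws [THEN conjunct2, THEN conjunct2, THEN conjunct2, THEN conjunct1,
    rule_format, OF conjI, OF _ conjI]
  and fmap_linear = functor_laws [THEN conjunct2, THEN conjunct2, THEN conjunct2, THEN conjunct2,
    rule_format, OF conjI]

lemma restrict_Hom:
  assumes "fd_vspace V" "f \<in> linear_maps V W"
  shows "(\<lambda>v\<in>carrier V. f v) \<in> Hom V W"
  unfolding Hom_def using linear_maps_cong [OF assms(2) fd_vspace_module [OF assms(1)], of "\<lambda>v\<in>carrier V. f v"]
  by simp

lemma ap_linear:
  assumes "fd_vspace V" "fd_vspace W" "f \<in> linear_maps V W"
  shows "ap V W f \<in> linear_maps (fobj F V) (fobj F W)"
proof -
  have "fmap F V W \<in> Hom V W \<rightarrow> Hom (fobj F V) (fobj F W)"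
    by (rule fmap_Hom [OF assms(1,2)])
  with restrict_Hom [OF assms(1,3)] show ?thesis by (auto simp: ap_def Hom_def)
qed

lemma ap_cong: "(\<And>v. v \<in> carrier V \<Longrightarrow> f v = g v) \<Longrightarrow> ap V W f = ap V W g"
  unfolding ap_def by (metis restrict_ext)

lemma ap_id:
  assumes "fd_vspace V" "\<And>v. v \<in> carrier V \<Longrightarrow> f v = v" "v \<in> carrier (fobj F V)"
  shows "ap V V f v = v"
proof -
  have "fmap F V V (\<lambda>v\<in>carrier V. v) = (\<lambda>v\<in>carrier (fobj F V). v)"
    by (rule fmap_id [OF assms(1)])
  moreover have "ap V V f = fmap F V V (\<lambda>v\<in>carrier V. v)"
    unfolding ap_def by (rule arg_cong [OF restrict_ext]) (rule assms(2))
  ultimately show ?thesis using assms(3) by simp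
qed

lemma ap_comp:
  assumes V: "fd_vspace V" and W: "fd_vspace W" and Z: "fd_vspace Z"
    and f: "f \<in> linear_maps V W" and g: "g \<in> linear_maps W Z" and v: "v \<in> carrier (fobj F V)"
  shows "ap W Z g (ap V W f v) = ap V Z (\<lambda>v. g (f v)) v"
proof -
  let ?f = "\<lambda>v\<in>carrier V. f v" and ?g = "\<lambda>v\<in>carrier W. g v"
  have "fmap F V Z (compose (carrier V) ?g ?f) = compose (carrier (fobj F V)) (fmap F W Z ?g) (fmap F V W ?f)"
    by (rule fmap_comp [OF V W Z restrict_Hom [OF V f] restrict_Hom [OF W g]])
  moreover have "compose (carrier V) ?g ?f = (\<lambda>v\<in>carrier V. g (f v))"
    using linear_maps_closed [OF f] by (auto simp: compose_def fun_eq_iff)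
  ultimately show ?thesis using v by (simp add: ap_def compose_def)
qed

lemma ap_add_scale:
  assumes V: "fd_vspace V" and W: "fd_vspace W" and f: "f \<in> linear_maps V W" and g: "g \<in> linear_maps V W"
    and v: "v \<in> carrier (fobj F V)"
  shows ap_add: "ap V W (\<lambda>u. f u \<oplus>\<^bsub>W\<^esub> g u) v = ap V W f v \<oplus>\<^bsub>fobj F W\<^esub> ap V W g v"
    and ap_scale: "ap V W (\<lambda>u. c \<odot>\<^bsub>W\<^esub> f u) v = c \<odot>\<^bsub>fobj F W\<^esub> ap V W f v"
proof -
  let ?f = "\<lambda>v\<in>carrier V. f v" and ?g = "\<lambda>v\<in>carrier V. g v"
  have *: "fmap F V W (\<lambda>u\<in>carrier V. ?f u \<oplus>\<^bsub>W\<^esub> ?g u) v = fmap F V W ?f v \<oplus>\<^bsub>fobj F W\<^esub> fmap F V W ?g v \<and>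
      fmap F V W (\<lambda>u\<in>carrier V. c \<odot>\<^bsub>W\<^esub> ?f u) v = c \<odot>\<^bsub>fobj F W\<^esub> fmap F V W ?f v"
    by (rule fmap_linear [OF V W restrict_Hom [OF V f] restrict_Hom [OF V g] v])
  have "(\<lambda>u\<in>carrier V. ?f u \<oplus>\<^bsub>W\<^esub> ?g u) = (\<lambda>u\<in>carrier V. f u \<oplus>\<^bsub>W\<^esub> g u)"
    "(\<lambda>u\<in>carrier V. c \<odot>\<^bsub>W\<^esub> ?f u) = (\<lambda>u\<in>carrier V. c \<odot>\<^bsub>W\<^esub> f u)"
    by (auto simp: fun_eq_iff)
  with * show "ap V W (\<lambda>u. f u \<oplus>\<^bsub>W\<^esub> g u) v = ap V W f v \<oplus>\<^bsub>fobj F W\<^esub> ap V W g v"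
    "ap V W (\<lambda>u. c \<odot>\<^bsub>W\<^esub> f u) v = c \<odot>\<^bsub>fobj F W\<^esub> ap V W f v"
    unfolding ap_def by simp_all
qed

section \<open>The functor read in coordinates\<close>

definition ident :: "nat \<Rightarrow> nat \<Rightarrow> ('v \<Rightarrow> vec) \<Rightarrow> bool"
  where "ident k m I \<longleftrightarrow> linear_iso (fobj F (eo k)) (Euc m) I"

definition unident :: "nat \<Rightarrow> ('v \<Rightarrow> vec) \<Rightarrow> vec \<Rightarrow> 'v"
  where "unident k I = inv_into (carrier (fobj F (eo k))) I"

text \<open>\<open>flift V k I f\<close> is \<open>F(f)\<close> for \<open>f : V \<rightarrow> \<real>\<^sup>k\<close>, and \<open>transf k l I I' M\<close> is \<open>F(M)\<close> for
  \<open>M : \<real>\<^sup>k \<rightarrow> \<real>\<^sup>l\<close>, both read through the identifications.\<close>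

definition flift :: "(real, 'v) module \<Rightarrow> nat \<Rightarrow> ('v \<Rightarrow> vec) \<Rightarrow> ('v \<Rightarrow> vec) \<Rightarrow> 'v \<Rightarrow> vec"
  where "flift V k I f v = I (ap V (eo k) (\<lambda>a. emb (f a)) v)"

definition transf :: "nat \<Rightarrow> nat \<Rightarrow> ('v \<Rightarrow> vec) \<Rightarrow> ('v \<Rightarrow> vec)
    \<Rightarrow> (vec \<Rightarrow> vec) \<Rightarrow> vec \<Rightarrow> vec"
  where "transf k l I I' M w = flift (eo k) l I' (\<lambda>u. M (iemb u)) (unident k I w)"

lemma ident_linear: "ident k m I \<Longrightarrow> I \<in> linear_maps (fobj F (eo k)) (Euc m)"
  by (simp add: ident_def linear_iso_def)

lemma ex_ident: "\<exists>m I. ident k m I"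
proof -
  have fd: "fd_vspace (fobj F (eo k))" by (intro fd_fobj fd_eo)
  then obtain m \<psi> where "linear_iso (Euc m) (fobj F (eo k)) \<psi>" using fd_vspace_iso_Euc by blast
  from linear_iso_inverse [OF this module_Euc fd_vspace_module [OF fd]] show ?thesis
    unfolding ident_def by blast
qed

lemma unident_linear: "ident k m I \<Longrightarrow> unident k I \<in> linear_maps (Euc m) (fobj F (eo k))"
  using linear_iso_inverse [OF _ fd_vspace_module [OF fd_fobj [OF fd_eo]] module_Euc]
  by (auto simp: ident_def unident_def linear_iso_def)

lemma unident_closed: "ident k m I \<Longrightarrow> w \<in> E m \<Longrightarrow> unident k I w \<in> carrier (fobj F (eo k))"
  using linear_maps_closed [OF unident_linear] by simp

lemma ident_unident [simp]: "ident k m I \<Longrightarrow> w \<in> E m \<Longrightarrow> I (unident k I w) = w"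
  unfolding ident_def unident_def linear_iso_def using bij_betw_inv_into_right by fastforce

lemma unident_ident [simp]: "ident k m I \<Longrightarrow> v \<in> carrier (fobj F (eo k)) \<Longrightarrow> unident k I (I v) = v"
  unfolding ident_def unident_def linear_iso_def using bij_betw_inv_into_left by fastforce

lemma emb_comp_linear: "f \<in> linear_maps V (Euc k) \<Longrightarrow> (\<lambda>a. emb (f a)) \<in> linear_maps V (eo k)"
  using linear_maps_comp [OF _ emb_linear] .

lemma comp_iemb_linear: "f \<in> linear_maps (Euc k) V \<Longrightarrow> (\<lambda>a. f (iemb a)) \<in> linear_maps (eo k) V"
  using linear_maps_comp [OF iemb_linear] .

context
  fixes V :: "(real, 'v) module"
  assumes V: "fd_vspace V"
begin

lemma flift_linear:
  assumes "f \<in> linear_maps V (Euc k)" "ident k m I"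
  shows "flift V k I f \<in> linear_maps (fobj F V) (Euc m)"
  unfolding flift_def
  by (rule linear_maps_comp [OF ap_linear [OF V fd_eo emb_comp_linear [OF assms(1)]] ident_linear [OF assms(2)]])

lemma flift_E:
  assumes "f \<in> linear_maps V (Euc k)" "ident k m I" "v \<in> carrier (fobj F V)"
  shows "flift V k I f v \<in> E m"
  using linear_maps_closed [OF flift_linear [OF assms(1,2)] assms(3)] by simp

lemma flift_cong: "(\<And>v. v \<in> carrier V \<Longrightarrow> f v = g v) \<Longrightarrow> flift V k I f = flift V k I g"
proof -
  assume *: "\<And>v. v \<in> carrier V \<Longrightarrow> f v = g v"
  have "ap V (eo k) (\<lambda>a. emb (f a)) = ap V (eo k) (\<lambda>a. emb (g a))"
    by (rule ap_cong) (simp add: *)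
  then show ?thesis unfolding flift_def by simp
qed

text \<open>\<open>F(M) F(f) = F(M f)\<close>: the inverse identification in \<open>transf\<close>
  undoes the identification \<open>I\<close> in \<open>flift\<close>.\<close>

lemma transf_flift:
  assumes f: "f \<in> linear_maps V (Euc k)" and M: "M \<in> linear_maps (Euc k) (Euc l)"
    and I: "ident k m I" and v: "v \<in> carrier (fobj F V)"
  shows "transf k l I I' M (flift V k I f v) = flift V l I' (\<lambda>a. M (f a)) v"
proof -
  have "ap V (eo k) (\<lambda>a. emb (f a)) v \<in> carrier (fobj F (eo k))"
    using linear_maps_closed [OF ap_linear [OF V fd_eo emb_comp_linear [OF f]] v] .
  then have "transf k l I I' M (flift V k I f v)
      = I' (ap (eo k) (eo l) (\<lambda>u. emb (M (iemb u))) (ap V (eo k) (\<lambda>a. emb (f a)) v))"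
    using I by (simp add: transf_def flift_def)
  also have "\<dots> = flift V l I' (\<lambda>a. M (f a)) v"
    using ap_comp [OF V fd_eo fd_eo emb_comp_linear [OF f] emb_comp_linear [OF comp_iemb_linear [OF M]] v]
    by (simp add: flift_def)
  finally show ?thesis .
qed

text \<open>If a map of coordinate spaces factors as \<open>f\<close> after \<open>g\<close> through
  \<open>V\<close>, the value of its image under \<open>F\<close> comes from an element of
  \<open>F(V)\<close>. This is how vectors of the fibres of \<open>F(A)\<close> are produced for
  condition A.\<close>

lemma flift_section:
  assumes f: "f \<in> linear_maps V (Euc k)" and g: "g \<in> linear_maps (Euc l) V"
    and I: "ident l m I" and w: "w \<in> E m"
  shows "transf l k I I' (\<lambda>u. f (g u)) w = flift V k I' f (ap (eo l) V (\<lambda>u. g (iemb u)) (unident l I w))"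
  using ap_comp [OF fd_eo V fd_eo comp_iemb_linear [OF g] emb_comp_linear [OF f] unident_closed [OF I w]]
  by (simp add: transf_def flift_def)

lemma flift_section_closed:
  assumes "g \<in> linear_maps (Euc l) V" "ident l m I" "w \<in> E m"
  shows "ap (eo l) V (\<lambda>u. g (iemb u)) (unident l I w) \<in> carrier (fobj F V)"
  by (rule linear_maps_closed [OF ap_linear [OF fd_eo V comp_iemb_linear [OF assms(1)]] unident_closed [OF assms(2,3)]])

end

lemma transf_linear:
  assumes "M \<in> linear_maps (Euc k) (Euc l)" "ident k m I" "ident l m' I'"
  shows "transf k l I I' M \<in> linear_maps (Euc m) (Euc m')"
  unfolding transf_def
  by (rule linear_maps_comp [OF unident_linear [OF assms(2)] flift_linear [OF fd_eo comp_iemb_linear [OF assms(1)] assms(3)]])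

lemma transf_cong:
  assumes "\<And>u. u \<in> E k \<Longrightarrow> M u = N u"
  shows "transf k l I I' M = transf k l I I' N"
proof -
  have "flift (eo k) l I' (\<lambda>u. M (iemb u)) = flift (eo k) l I' (\<lambda>u. N (iemb u))"
    by (rule flift_cong [OF fd_eo]) (use assms in auto)
  then show ?thesis unfolding transf_def by simp
qed

lemma transf_id:
  assumes "ident k m I" "\<And>u. u \<in> E k \<Longrightarrow> M u = u" "w \<in> E m"
  shows "transf k k I I M w = w"
  unfolding transf_def flift_def using assms unident_closed [OF assms(1,3)]
  by (subst ap_id [OF fd_eo]) auto

lemma transf_add:
  assumes "M \<in> linear_maps (Euc k) (Euc l)" "N \<in> linear_maps (Euc k) (Euc l)"
    and "ident k m I" "ident l m' I'" "w \<in> E m"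
  shows "transf k l I I' (\<lambda>u i. M u i + N u i) w = (\<lambda>i. transf k l I I' M w i + transf k l I I' N w i)"
proof -
  note MN = emb_comp_linear [OF comp_iemb_linear [OF assms(1)]] emb_comp_linear [OF comp_iemb_linear [OF assms(2)]]
  note cl = linear_maps_closed [OF ap_linear [OF fd_eo fd_eo MN(1)] unident_closed [OF assms(3,5)]]
    linear_maps_closed [OF ap_linear [OF fd_eo fd_eo MN(2)] unident_closed [OF assms(3,5)]]
  show ?thesis
    using ap_add [OF fd_eo fd_eo MN unident_closed [OF assms(3,5)]] ident_linear [OF assms(4)] cl
    by (simp add: transf_def flift_def linear_maps_iff)
qed

lemma transf_scale:
  assumes "M \<in> linear_maps (Euc k) (Euc l)" "ident k m I" "ident l m' I'" "w \<in> E m"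
  shows "transf k l I I' (\<lambda>u i. c * M u i) w = (\<lambda>i. c * transf k l I I' M w i)"
proof -
  note M = emb_comp_linear [OF comp_iemb_linear [OF assms(1)]]
  note cl = linear_maps_closed [OF ap_linear [OF fd_eo fd_eo M] unident_closed [OF assms(2,4)]]
  show ?thesis
    using ap_scale [OF fd_eo fd_eo M M unident_closed [OF assms(2,4)], of c] ident_linear [OF assms(3)] cl
    by (simp add: transf_def flift_def linear_maps_iff)
qed

lemma zero_linear: "(\<lambda>u i. 0) \<in> linear_maps (Euc k) (Euc l)"
  by (simp add: linear_maps_Euc_iff)

lemma transf_sum:
  assumes "finite T" "\<And>t. t \<in> T \<Longrightarrow> N t \<in> linear_maps (Euc k) (Euc l)"
    and "ident k m I" "ident l m' I'" "w \<in> E m"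
  shows "(\<lambda>u i. \<Sum>t\<in>T. c t * N t u i) \<in> linear_maps (Euc k) (Euc l) \<and>
    transf k l I I' (\<lambda>u i. \<Sum>t\<in>T. c t * N t u i) w = (\<lambda>i. \<Sum>t\<in>T. c t * transf k l I I' (N t) w i)"
  using assms(1,2)
proof (induction T)
  case empty
  show ?case using transf_scale [OF zero_linear assms(3-5), of 0] by (simp add: zero_linear)
next
  case (insert t T)
  have N: "N t \<in> linear_maps (Euc k) (Euc l)" using insert.prems by simp
  have cN: "(\<lambda>u i. c t * N t u i) \<in> linear_maps (Euc k) (Euc l)"
    by (rule linear_maps_Euc_scale [OF N])
  have S: "(\<lambda>u i. \<Sum>t\<in>T. c t * N t u i) \<in> linear_maps (Euc k) (Euc l)"
    and ST: "transf k l I I' (\<lambda>u i. \<Sum>t\<in>T. c t * N t u i) w = (\<lambda>i. \<Sum>t\<in>T. c t * transf k l I I' (N t) w i)"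
    using insert.IH insert.prems by blast+
  have "(\<lambda>u i. c t * N t u i + (\<Sum>t\<in>T. c t * N t u i)) \<in> linear_maps (Euc k) (Euc l)"
    by (rule linear_maps_Euc_add [OF cN S])
  then show ?case
    using insert.hyps transf_add [OF cN S assms(3-5)] transf_scale [OF N assms(3-5)] ST by simp
qed

text \<open>The elementary matrix with entry 1 in column \<open>j\<close> and row \<open>i\<close>.
  A linear functor is determined on matrices by its values on these.\<close>

definition matrix_unit :: "nat \<times> nat \<Rightarrow> vec \<Rightarrow> vec"
  where "matrix_unit = (\<lambda>(j, i) u. \<lambda>n. u j * unit_vec i n)"

lemma matrix_unit_linear: "i < l \<Longrightarrow> matrix_unit (j, i) \<in> linear_maps (Euc k) (Euc l)"
  unfolding linear_maps_Euc_iff matrix_unit_def prod.case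
  by (intro conjI ballI allI E_scale) (simp_all only: unit_vec_E distrib_right mult.assoc)

text \<open>Hence \<open>F\<close> carries continuous families of matrices to continuous families, and smooth ones to smooth ones.\<close>

lemma transf_matrix:
  assumes M: "M \<in> linear_maps (Euc k) (Euc l)" and I: "ident k m I" "ident l m' I'" and w: "w \<in> E m"
  shows "transf k l I I' M w i = (\<Sum>s<m. w s *
    (\<Sum>t\<in>{..<k} \<times> {..<l}. M (unit_vec (fst t)) (snd t) * transf k l I I' (matrix_unit t) (unit_vec s) i))"
proof -
  let ?T = "{..<k} \<times> {..<l}"
  let ?N = "\<lambda>u n. \<Sum>t\<in>?T. M (unit_vec (fst t)) (snd t) * matrix_unit t u n"
  have "M u = ?N u" if u: "u \<in> E k" for u
  proof
    fix n
    have "M u n = (\<Sum>j<k. u j * M (unit_vec j) n)"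
      using linear_maps_eq_lmap [OF M u] by (simp add: lmap_def)
    also have "\<dots> = (\<Sum>j<k. u j * (\<Sum>i<l. M (unit_vec j) i * unit_vec i n))"
    proof (rule sum.cong [OF refl])
      fix j assume "j \<in> {..<k}"
      then have "M (unit_vec j) \<in> E l" using linear_maps_E [OF M] by simp
      from fun_cong [OF E_decomp [OF this], of n]
      show "u j * M (unit_vec j) n = u j * (\<Sum>i<l. M (unit_vec j) i * unit_vec i n)"
        unfolding lmap_def by (rule arg_cong)
    qed
    also have "\<dots> = ?N u n"
      unfolding sum.cartesian_product' by (simp add: matrix_unit_def sum_distrib_left algebra_simps)
    finally show "M u n = ?N u n" .
  qed
  then have MN: "transf k l I I' M = transf k l I I' ?N" by (rule transf_cong)
  have "transf k l I I' ?N v = (\<lambda>i. \<Sum>t\<in>?T. M (unit_vec (fst t)) (snd t) * transf k l I I' (matrix_unit t) v i)"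
    if "v \<in> E m" for v
    by (rule conjunct2 [OF transf_sum [OF _ _ I that]]) (auto intro: matrix_unit_linear)
  then have *: "transf k l I I' M (unit_vec s) i
      = (\<Sum>t\<in>?T. M (unit_vec (fst t)) (snd t) * transf k l I I' (matrix_unit t) (unit_vec s) i)" if "s < m" for s
    unfolding MN using that by simp
  have "transf k l I I' M w i = lmap m (\<lambda>s. transf k l I I' M (unit_vec s)) w i"
    using fun_cong [OF linear_maps_eq_lmap [OF transf_linear [OF M I] w], of i] .
  then show ?thesis unfolding lmap_def using * by simp
qed

lemma flift_iso:
  assumes V: "fd_vspace V" and f: "linear_iso V (Euc k) f" and I: "ident k m I"
  shows "linear_iso (fobj F V) (Euc m) (flift V k I f)"
proof -
  have fl: "f \<in> linear_maps V (Euc k)" and fb: "bij_betw f (carrier V) (E k)"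
    using f by (auto simp: linear_iso_def)
  let ?g = "inv_into (carrier V) f"
  have gl: "?g \<in> linear_maps (Euc k) V"
    using linear_iso_inverse [OF f fd_vspace_module [OF V] module_Euc] by (simp add: linear_iso_def)
  have fg: "f (?g u) = u" if "u \<in> E k" for u using bij_betw_inv_into_right [OF fb that] .
  have gf: "?g (f v) = v" if "v \<in> carrier V" for v using bij_betw_inv_into_left [OF fb that] .
  have "inj_on (flift V k I f) (carrier (fobj F V))"
  proof (rule inj_on_inverseI)
    fix v assume v: "v \<in> carrier (fobj F V)"
    have cl: "ap V (eo k) (\<lambda>a. emb (f a)) v \<in> carrier (fobj F (eo k))"
      using linear_maps_closed [OF ap_linear [OF V fd_eo emb_comp_linear [OF fl]] v] .
    have "ap (eo k) V (\<lambda>u. ?g (iemb u)) (unident k I (flift V k I f v))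
        = ap (eo k) V (\<lambda>u. ?g (iemb u)) (ap V (eo k) (\<lambda>a. emb (f a)) v)"
      using I cl by (simp add: flift_def)
    also have "\<dots> = ap V V (\<lambda>a. ?g (f a)) v"
      using ap_comp [OF V fd_eo V emb_comp_linear [OF fl] comp_iemb_linear [OF gl] v] by simp
    also have "\<dots> = v" by (rule ap_id [OF V gf v])
    finally show "ap (eo k) V (\<lambda>u. ?g (iemb u)) (unident k I (flift V k I f v)) = v" .
  qed
  moreover have "flift V k I f ` carrier (fobj F V) = E m"
  proof
    show "flift V k I f ` carrier (fobj F V) \<subseteq> E m" using flift_E [OF V fl I] by blast
    show "E m \<subseteq> flift V k I f ` carrier (fobj F V)"
    proof
      fix w assume w: "w \<in> E m"
      have "flift V k I f (ap (eo k) V (\<lambda>u. ?g (iemb u)) (unident k I w)) = transf k k I I (\<lambda>u. f (?g u)) w"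
        using flift_section [OF V fl gl I w] by simp
      also have "\<dots> = w" by (rule transf_id [OF I fg w])
      finally show "w \<in> flift V k I f ` carrier (fobj F V)"
        using flift_section_closed [OF V gl I w] by (metis imageI)
    qed
  qed
  ultimately show ?thesis using flift_linear [OF V fl I] by (simp add: linear_iso_def bij_betw_def)
qed

text \<open>Functors preserve left inverses. In coordinates \<eta> on \<open>V\<close>, the map
  \<open>f\<close> becomes an injective matrix with a left inverse \<open>C\<close>, and
  \<open>F(C)\<close> cancels \<open>F(f)\<close> up to the isomorphism \<open>F\<close> of the
  coordinate map.\<close>

lemma flift_inj:
  assumes V: "fd_vspace V" and f: "f \<in> linear_maps V (Euc k)" and inj: "inj_on f (carrier V)" and I: "ident k m I"
  shows "inj_on (flift V k I f) (carrier (fobj F V))"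
proof -
  obtain r \<eta> where \<eta>: "linear_iso (Euc r) V \<eta>" using fd_vspace_iso_Euc [OF V] by blast
  have \<eta>l: "\<eta> \<in> linear_maps (Euc r) V" and \<eta>b: "bij_betw \<eta> (E r) (carrier V)" using \<eta> by (auto simp: linear_iso_def)
  let ?h = "inv_into (carrier (Euc r)) \<eta>"
  have h: "linear_iso V (Euc r) ?h" by (rule linear_iso_inverse [OF \<eta> module_Euc fd_vspace_module [OF V]])
  have fe: "(\<lambda>u. f (\<eta> u)) \<in> linear_maps (Euc r) (Euc k)" by (rule linear_maps_comp [OF \<eta>l f])
  define A where "A j = f (\<eta> (unit_vec j))" for j
  have A: "A j \<in> E k" if "j < r" for j unfolding A_def using linear_maps_E [OF fe] that by simp
  have Aeq: "lmap r A u = f (\<eta> u)" if "u \<in> E r" for u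
    unfolding A_def using linear_maps_eq_lmap [OF fe that] by simp
  have "u = (\<lambda>i. 0)" if u: "u \<in> E r" "lmap r A u = (\<lambda>i. 0)" for u
  proof -
    have "f (\<eta> u) = f (\<eta> (\<lambda>i. 0))" using u Aeq [OF u(1)] linear_maps_0 [OF fe] by simp
    moreover have "\<eta> u \<in> carrier V" "\<eta> (\<lambda>i. 0) \<in> carrier V" using \<eta>b u(1) zero_E bij_betw_apply by metis+
    ultimately have "\<eta> u = \<eta> (\<lambda>i. 0)" using inj by (simp add: inj_on_def)
    then show ?thesis using \<eta>b u(1) zero_E unfolding bij_betw_def inj_on_def by blast
  qed
  then obtain C where C: "\<And>l. C l \<in> E r" "\<And>u. u \<in> E r \<Longrightarrow> lmap k C (lmap r A u) = u"
    using lmap_left_inverse [of r A k, OF A] by blast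
  obtain m' I' where I': "ident r m' I'" using ex_ident by blast
  \<comment> \<open>\<open>C\<close> after \<open>f\<close> is the coordinate map of
    \<open>V\<close>, and \<open>flift_iso\<close> makes its image under \<open>F\<close>
    injective.\<close>
  have hf: "lmap k C (f v) = ?h v" if "v \<in> carrier V" for v
  proof -
    have "?h v \<in> E r" "\<eta> (?h v) = v"
      using bij_betw_apply [OF bij_betw_inv_into [OF \<eta>b] that] bij_betw_inv_into_right [OF \<eta>b that] by auto
    then show ?thesis using C(2) [of "?h v"] Aeq [of "?h v"] by simp
  qed
  show ?thesis
  proof (rule inj_onI)
    fix u v assume uv: "u \<in> carrier (fobj F V)" "v \<in> carrier (fobj F V)" "flift V k I f u = flift V k I f v"
    have "flift V r I' ?h w = transf k r I I' (lmap k C) (flift V k I f w)" if "w \<in> carrier (fobj F V)" for w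
      using transf_flift [OF V f lmap_linear_maps [of k C r, OF C(1)] I that, where I' = I']
        flift_cong [OF V hf, where k = r and I = I'] by simp
    then have "flift V r I' ?h u = flift V r I' ?h v" using uv by simp
    then show "u = v"
      using flift_iso [OF V h I'] uv(1,2) by (auto simp: linear_iso_def bij_betw_def inj_on_def)
  qed
qed

end

section \<open>Charts, atlases and smooth maps\<close>

lemma embedding_mapI:
  assumes f: "continuous_map T Y f" and g: "continuous_map (subtopology Y (f ` topspace T)) T g"
    and gf: "\<And>x. x \<in> topspace T \<Longrightarrow> g (f x) = x"
  shows "embedding_map T Y f"
proof -
  have "homeomorphic_maps T (subtopology Y (f ` topspace T)) f g"
    unfolding homeomorphic_maps_def
  proof (intro conjI ballI)
    show "continuous_map T (subtopology Y (f ` topspace T)) f" using f by (simp add: continuous_map_in_subtopology)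
    show "f (g y) = y" if "y \<in> topspace (subtopology Y (f ` topspace T))" for y using that gf by auto
  qed (use g gf in auto)
  then show ?thesis unfolding embedding_map_def using homeomorphic_map_maps by blast
qed

lemma is_chart_iff:
  "is_chart T (d, U, c) \<longleftrightarrow> openin T U \<and> openin (Eu d) (c ` U) \<and>
    embedding_map (subtopology T U) (Eu d) c"
  by (simp add: is_chart_def)

lemma is_chart_props:
  assumes "is_chart T (d, U, c)"
  shows chart_open: "openin T U" and chart_inj: "inj_on c U"
    and chart_cont: "continuous_map (subtopology T U) (Eu d) c"
    and chart_inv_cont: "continuous_map (subtopology (Eu d) (c ` U)) (subtopology T U) (the_inv_into U c)"
    and chart_image_open: "openin T N \<Longrightarrow> N \<subseteq> U \<Longrightarrow> openin (Eu d) (c ` N)"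
    and chart_E: "x \<in> U \<Longrightarrow> c x \<in> E d"
proof -
  show U: "openin T U" using assms by (simp add: is_chart_iff)
  have tU: "topspace (subtopology T U) = U" using openin_subset [OF U] by (simp add: inf_absorb2)
  have h: "homeomorphic_map (subtopology T U) (subtopology (Eu d) (c ` U)) c"
    using assms tU by (simp add: is_chart_iff embedding_map_def)
  show inj: "inj_on c U" using homeomorphic_imp_injective_map [OF h] unfolding tU .
  show cont: "continuous_map (subtopology T U) (Eu d) c"
    using homeomorphic_imp_continuous_map [OF h] continuous_map_into_fulltopology by blast
  obtain g where g: "homeomorphic_maps (subtopology T U) (subtopology (Eu d) (c ` U)) c g"
    using h homeomorphic_map_maps by blast
  have op: "openin (Eu d) (c ` U)" using assms by (simp add: is_chart_iff)
  have tc: "topspace (subtopology (Eu d) (c ` U)) = c ` U" using openin_subset [OF op] by (simp add: inf_absorb2)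
  have gc: "g (c x) = x" if "x \<in> U" for x
    using g that unfolding homeomorphic_maps_def tU by blast
  show "continuous_map (subtopology (Eu d) (c ` U)) (subtopology T U) (the_inv_into U c)"
  proof (rule continuous_map_eq)
    show "continuous_map (subtopology (Eu d) (c ` U)) (subtopology T U) g"
      using g by (simp add: homeomorphic_maps_def)
    fix y assume "y \<in> topspace (subtopology (Eu d) (c ` U))"
    then obtain x where "x \<in> U" "y = c x" unfolding tc by blast
    then show "g y = the_inv_into U c y" using gc the_inv_into_f_f [OF inj] by simp
  qed
  show "openin (Eu d) (c ` N)" if N: "openin T N" "N \<subseteq> U"
  proof -
    have "openin (subtopology T U) N" using N U by (simp add: openin_open_subtopology)
    then have "openin (subtopology (Eu d) (c ` U)) (c ` N)"
      using homeomorphic_imp_open_map [OF h] by (simp add: open_map_def)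
    then show ?thesis using op openin_trans_full by blast
  qed
  show "c x \<in> E d" if "x \<in> U" using op openin_subset that by blast
qed

lemma is_chart_restrict:
  assumes a: "is_chart T (d, U, c)" and N: "openin T N" "N \<subseteq> U"
  shows "is_chart T (d, N, c)"
  unfolding is_chart_iff
proof (intro conjI)
  show "openin (Eu d) (c ` N)" by (rule chart_image_open [OF a N])
  have tN: "topspace (subtopology T N) = N" using openin_subset [OF N(1)] by (simp add: inf_absorb2)
  show "embedding_map (subtopology T N) (Eu d) c"
  proof (rule embedding_mapI)
    have "continuous_map (subtopology (subtopology T U) N) (Eu d) c"
      using chart_cont [OF a] by (rule continuous_map_from_subtopology)
    then show "continuous_map (subtopology T N) (Eu d) c"
      using N(2) by (simp add: subtopology_subtopology inf_absorb2)
    have "continuous_map (subtopology (subtopology (Eu d) (c ` U)) (c ` N)) (subtopology T U) (the_inv_into U c)"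
      using chart_inv_cont [OF a] by (rule continuous_map_from_subtopology)
    then have "continuous_map (subtopology (Eu d) (c ` N)) T (the_inv_into U c)"
      using N(2) by (simp add: subtopology_subtopology inf_absorb2 image_mono continuous_map_in_subtopology)
    moreover have inv: "the_inv_into U c (c x) = x" if "x \<in> N" for x
      using the_inv_into_f_f [OF chart_inj [OF a]] that N(2) by blast
    ultimately show "continuous_map (subtopology (Eu d) (c ` topspace (subtopology T N))) (subtopology T N) (the_inv_into U c)"
      unfolding tN continuous_map_in_subtopology by auto
    show "the_inv_into U c (c x) = x" if "x \<in> topspace (subtopology T N)" for x using inv that unfolding tN .
  qed
qed (rule N(1))

text \<open>One notion covers smooth maps and compatible charts, the latter being the case of the
  identity.\<close>

definition chart_smooth :: "('x \<Rightarrow> 'y) \<Rightarrow> 'x chart \<Rightarrow> 'y chart \<Rightarrow> bool"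
  where "chart_smooth f = (\<lambda>(d, U, c) (e, V, b). smooth_on d e (c ` (U \<inter> f -` V)) (b \<circ> f \<circ> the_inv_into U c))"

abbreviation "chart_compat \<equiv> chart_smooth (\<lambda>x. x)"

lemma smoothly_compatible_iff:
  "smoothly_compatible a b \<longleftrightarrow> chart_compat a b \<and> chart_compat b a"
  by (auto simp: smoothly_compatible_def chart_smooth_def o_def Int_commute split: prod.splits)

text \<open>Smoothness in charts only needs some smooth \<open>h\<close> that represents \<open>f\<close> in the first \<open>e\<close> coordinates.\<close>

lemma chart_smoothI:
  assumes a: "is_chart T (d, U, c)" and op: "openin T (U \<inter> f -` V)"
    and h: "smooth_on d e (c ` (U \<inter> f -` V)) h"
    and eq: "\<And>x j. x \<in> U \<Longrightarrow> f x \<in> V \<Longrightarrow> j < e \<Longrightarrow> h (c x) j = b (f x) j"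
  shows "chart_smooth f (d, U, c) (e, V, b)"
  unfolding chart_smooth_def prod.case
proof (rule smooth_on_cong [OF _ h])
  show "openin (Eu d) (c ` (U \<inter> f -` V))" by (rule chart_image_open [OF a op]) blast
  fix y j assume y: "y \<in> c ` (U \<inter> f -` V)" and j: "j < e"
  then obtain x where x: "x \<in> U" "f x \<in> V" "y = c x" by blast
  then show "h y j = (b \<circ> f \<circ> the_inv_into U c) y j"
    using eq [OF x(1,2) j] the_inv_into_f_f [OF chart_inj [OF a] x(1)] by simp
qed

lemma chart_smoothD:
  assumes a: "is_chart T (d, U, c)" and s: "chart_smooth f (d, U, c) (e, V, b)"
  shows "\<exists>h. smooth_on d e (c ` (U \<inter> f -` V)) h \<and> (\<forall>x\<in>U. h (c x) = b (f x))"
  using s the_inv_into_f_f [OF chart_inj [OF a]]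
  by (intro exI [of _ "b \<circ> f \<circ> the_inv_into U c"]) (simp add: chart_smooth_def)

lemma openin_chart_vimage:
  assumes f: "continuous_map T T' f" and a: "is_chart T (d, U, c)" and b: "is_chart T' (e, V, b)"
  shows "openin T (U \<inter> f -` V)"
proof -
  have "openin T {x \<in> topspace T. f x \<in> V}"
    by (rule openin_continuous_map_preimage [OF f chart_open [OF b]])
  then have "openin T (U \<inter> {x \<in> topspace T. f x \<in> V})" by (rule openin_Int [OF chart_open [OF a]])
  moreover have "U \<inter> {x \<in> topspace T. f x \<in> V} = U \<inter> f -` V"
    using openin_subset [OF chart_open [OF a]] by blast
  ultimately show ?thesis by simp
qed

text \<open>Near \<open>x\<close> the representation of \<open>f\<close> in the given charts is a
  composite of three smooth maps: the change from \<open>c\<close> to \<open>c1\<close>,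
  \<open>f\<close> in the charts \<open>c1\<close> and \<open>b1\<close>, and the change from
  \<open>b1\<close> to \<open>b\<close>. So one suitable pair of charts about each point decides
  smoothness.\<close>

lemma chart_smooth_local:
  assumes f: "continuous_map T T' f" and a: "is_chart T (d, U, c)" and b: "is_chart T' (e, V, b)"
    and loc: "\<And>x. x \<in> U \<Longrightarrow> f x \<in> V \<Longrightarrow> \<exists>d1 U1 c1 e1 V1 b1. is_chart T (d1, U1, c1) \<and> x \<in> U1 \<and>
      is_chart T' (e1, V1, b1) \<and> f x \<in> V1 \<and> chart_compat (d, U, c) (d1, U1, c1) \<and>
      chart_smooth f (d1, U1, c1) (e1, V1, b1) \<and> chart_compat (e1, V1, b1) (e, V, b)"
  shows "chart_smooth f (d, U, c) (e, V, b)"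
  unfolding chart_smooth_def prod.case
proof (rule smooth_on_local)
  show "openin (Eu d) (c ` (U \<inter> f -` V))"
    by (rule chart_image_open [OF a openin_chart_vimage [OF f a b]]) blast
  fix y assume "y \<in> c ` (U \<inter> f -` V)"
  then obtain x where x: "x \<in> U" "f x \<in> V" "y = c x" by blast
  from loc [OF x(1,2)] obtain d1 U1 c1 e1 V1 b1 where
    a1: "is_chart T (d1, U1, c1)" "x \<in> U1" and b1: "is_chart T' (e1, V1, b1)" "f x \<in> V1"
    and s: "chart_compat (d, U, c) (d1, U1, c1)" "chart_smooth f (d1, U1, c1) (e1, V1, b1)"
      "chart_compat (e1, V1, b1) (e, V, b)"
    by (elim exE conjE)
  obtain h1 where h1: "smooth_on d d1 (c ` (U \<inter> (\<lambda>x. x) -` U1)) h1" "\<forall>x\<in>U. h1 (c x) = c1 x"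
    using chart_smoothD [OF a s(1)] by (elim exE conjE)
  obtain h2 where h2: "smooth_on d1 e1 (c1 ` (U1 \<inter> f -` V1)) h2" "\<forall>x\<in>U1. h2 (c1 x) = b1 (f x)"
    using chart_smoothD [OF a1(1) s(2)] by (elim exE conjE)
  obtain h3 where h3: "smooth_on e1 e (b1 ` (V1 \<inter> (\<lambda>x. x) -` V)) h3" "\<forall>x\<in>V1. h3 (b1 x) = b x"
    using chart_smoothD [OF b1(1) s(3)] by (elim exE conjE)
  define N where "N = (U \<inter> f -` V) \<inter> (U1 \<inter> f -` V1)"
  have N: "openin T N" unfolding N_def
    by (intro openin_Int openin_chart_vimage [OF f a b] openin_chart_vimage [OF f a1(1) b1(1)])
  have cN: "openin (Eu d) (c ` N)" by (rule chart_image_open [OF a N]) (auto simp: N_def)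
  have o2: "openin (Eu d1) (c1 ` (U1 \<inter> f -` V1))"
    by (rule chart_image_open [OF a1(1) openin_chart_vimage [OF f a1(1) b1(1)]]) blast
  have o3: "openin (Eu e1) (b1 ` (V1 \<inter> V))"
    by (rule chart_image_open [OF b1(1) openin_Int [OF chart_open [OF b1(1)] chart_open [OF b]]]) blast
  have s1: "smooth_on d d1 (c ` N) h1" by (rule smooth_on_subset [OF h1(1)]) (auto simp: N_def)
  have m1: "h1 y \<in> c1 ` (U1 \<inter> f -` V1)" if "y \<in> c ` N" for y
    using that h1(2) by (auto simp: N_def)
  have s2: "smooth_on d e1 (c ` N) (\<lambda>y. h2 (h1 y))"
    by (rule smooth_on_compose [OF cN o2 m1 s1 h2(1)])
  have m2: "h2 (h1 y) \<in> b1 ` (V1 \<inter> V)" if "y \<in> c ` N" for y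
    using that h1(2) h2(2) by (auto simp: N_def)
  have "smooth_on d e (c ` N) (\<lambda>y. h3 (h2 (h1 y)))"
    by (rule smooth_on_compose [OF cN o3 m2 s2 h3(1) [unfolded vimage_ident]])
  then have "smooth_on d e (c ` N) (b \<circ> f \<circ> the_inv_into U c)"
  proof (rule smooth_on_cong [OF cN])
    fix y j assume "y \<in> c ` N"
    then obtain z where "z \<in> N" "y = c z" by blast
    then show "h3 (h2 (h1 y)) j = (b \<circ> f \<circ> the_inv_into U c) y j"
      using h1(2) h2(2) h3(2) the_inv_into_f_f [OF chart_inj [OF a], of z] by (auto simp: N_def)
  qed
  moreover have "y \<in> c ` N" using x a1(2) b1(2) by (auto simp: N_def)
  moreover have "c ` N \<subseteq> c ` (U \<inter> f -` V)" by (auto simp: N_def)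
  ultimately show "\<exists>D'. openin (Eu d) D' \<and> y \<in> D' \<and> D' \<subseteq> c ` (U \<inter> f -` V) \<and>
      smooth_on d e D' (b \<circ> f \<circ> the_inv_into U c)"
    using cN by (intro exI [of _ "c ` N"] conjI)
qed

definition atlas :: "'x topology \<Rightarrow> 'x chart set \<Rightarrow> bool"
  where "atlas T \<A> \<longleftrightarrow> (\<forall>a\<in>\<A>. is_chart T a) \<and> (\<forall>a\<in>\<A>. \<forall>b\<in>\<A>. smoothly_compatible a b) \<and>
    (\<forall>x\<in>topspace T. \<exists>d U c. (d, U, c) \<in> \<A> \<and> x \<in> U)"

lemma atlas_chart: "atlas T \<A> \<Longrightarrow> (d, U, c) \<in> \<A> \<Longrightarrow> is_chart T (d, U, c)"
  unfolding atlas_def by blast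

lemma atlas_compatible: "atlas T \<A> \<Longrightarrow> a \<in> \<A> \<Longrightarrow> b \<in> \<A> \<Longrightarrow> chart_compat a b"
  unfolding atlas_def smoothly_compatible_iff by blast

lemma atlas_cover: "atlas T \<A> \<Longrightarrow> x \<in> topspace T \<Longrightarrow> \<exists>d U c. (d, U, c) \<in> \<A> \<and> x \<in> U"
  unfolding atlas_def by blast

lemma smooth_mapD: "smooth_map M N f \<Longrightarrow> a \<in> snd M \<Longrightarrow> b \<in> snd N \<Longrightarrow> chart_smooth f a b"
  by (cases M; cases N; cases a; cases b) (auto simp: smooth_map_def chart_smooth_def)

lemma smooth_map_cont: "smooth_map M N f \<Longrightarrow> continuous_map (fst M) (fst N) f"
  by (cases M; cases N) (simp add: smooth_map_def)

definition smooth_at :: "'x mfd \<Rightarrow> 'y mfd \<Rightarrow> ('x \<Rightarrow> 'y) \<Rightarrow> 'x \<Rightarrow> bool"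
  where "smooth_at M N f x \<longleftrightarrow> (\<exists>d U c e V b. (d, U, c) \<in> snd M \<and> (e, V, b) \<in> snd N \<and> x \<in> U \<and> f x \<in> V \<and>
    chart_smooth f (d, U, c) (e, V, b))"

lemma smooth_atI: "(d, U, c) \<in> snd M \<Longrightarrow> (e, V, b) \<in> snd N \<Longrightarrow> x \<in> U \<Longrightarrow> f x \<in> V \<Longrightarrow>
    chart_smooth f (d, U, c) (e, V, b) \<Longrightarrow> smooth_at M N f x"
  unfolding smooth_at_def by (intro exI conjI)

lemma smooth_mapI:
  assumes "atlas (fst M) (snd M)" "atlas (fst N) (snd N)" "continuous_map (fst M) (fst N) f"
    and "\<And>x. x \<in> topspace (fst M) \<Longrightarrow> smooth_at M N f x"
  shows "smooth_map M N f"
proof -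
  obtain T \<A> T' \<B> where MN: "M = (T, \<A>)" "N = (T', \<B>)" by (metis surj_pair)
  note A = assms(1) [unfolded MN fst_conv snd_conv] and B = assms(2) [unfolded MN fst_conv snd_conv]
    and f = assms(3) [unfolded MN fst_conv snd_conv] and loc = assms(4) [unfolded MN fst_conv snd_conv smooth_at_def]
  have "chart_smooth f (d, U, c) (e, V, b)" if a: "(d, U, c) \<in> \<A>" and b: "(e, V, b) \<in> \<B>" for d U c e V b
  proof (rule chart_smooth_local [OF f atlas_chart [OF A a] atlas_chart [OF B b]])
    fix x assume x: "x \<in> U" "f x \<in> V"
    then have "x \<in> topspace T" using openin_subset [OF chart_open [OF atlas_chart [OF A a]]] by blast
    from loc [OF this] obtain d1 U1 c1 e1 V1 b1 where *: "(d1, U1, c1) \<in> \<A>" "(e1, V1, b1) \<in> \<B>" "x \<in> U1" "f x \<in> V1"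
      "chart_smooth f (d1, U1, c1) (e1, V1, b1)" by (elim exE conjE)
    show "\<exists>d1 U1 c1 e1 V1 b1. is_chart T (d1, U1, c1) \<and> x \<in> U1 \<and>
      is_chart T' (e1, V1, b1) \<and> f x \<in> V1 \<and> chart_compat (d, U, c) (d1, U1, c1) \<and>
      chart_smooth f (d1, U1, c1) (e1, V1, b1) \<and> chart_compat (e1, V1, b1) (e, V, b)"
      by (intro exI conjI; fact atlas_chart [OF A *(1)] *(3) atlas_chart [OF B *(2)] *(4)
        atlas_compatible [OF A a *(1)] *(5) atlas_compatible [OF B *(2) b])
  qed
  then show ?thesis using f by (auto simp: MN smooth_map_def chart_smooth_def)
qed

text \<open>Two charts that are compatible with every member of the atlas are compatible with each
  other, because around each common point one can pass through a member.\<close>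

lemma max_atlas_atlas:
  assumes G: "atlas T \<G>"
  shows "atlas T (max_atlas T \<G>)" and "\<G> \<subseteq> max_atlas T \<G>"
    and "max_atlas T (max_atlas T \<G>) = max_atlas T \<G>"
proof -
  show sub: "\<G> \<subseteq> max_atlas T \<G>" using G unfolding atlas_def max_atlas_def by blast
  have comp: "chart_compat a b" if a: "a \<in> max_atlas T \<G>" and b: "b \<in> max_atlas T \<G>" for a b
  proof -
    obtain d U c e V b' where ab: "a = (d, U, c)" "b = (e, V, b')" by (metis prod_cases3)
    have ca: "is_chart T (d, U, c)" and cb: "is_chart T (e, V, b')" using a b unfolding ab max_atlas_def by auto
    show ?thesis unfolding ab
    proof (rule chart_smooth_local [OF continuous_map_id [unfolded id_def] ca cb])
      fix x assume "x \<in> U" "x \<in> V"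
      then have "x \<in> topspace T" using openin_subset [OF chart_open [OF ca]] by blast
      then obtain d1 U1 c1 where g: "(d1, U1, c1) \<in> \<G>" "x \<in> U1" using atlas_cover [OF G] by blast
      have "chart_compat a (d1, U1, c1)" "chart_compat (d1, U1, c1) b"
        using a b g(1) unfolding max_atlas_def smoothly_compatible_iff by blast+
      then show "\<exists>d1 U1 c1 e1 V1 b1. is_chart T (d1, U1, c1) \<and> x \<in> U1 \<and>
        is_chart T (e1, V1, b1) \<and> x \<in> V1 \<and> chart_compat (d, U, c) (d1, U1, c1) \<and>
        chart_compat (d1, U1, c1) (e1, V1, b1) \<and> chart_compat (e1, V1, b1) (e, V, b')"
        unfolding ab using g atlas_chart [OF G g(1)] atlas_compatible [OF G g(1) g(1)]
        by (intro exI conjI)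
    qed
  qed
  then show "atlas T (max_atlas T \<G>)"
    unfolding atlas_def smoothly_compatible_iff
  proof (intro conjI ballI)
    show "is_chart T a" if "a \<in> max_atlas T \<G>" for a using that by (simp add: max_atlas_def)
    show "\<exists>d U c. (d, U, c) \<in> max_atlas T \<G> \<and> x \<in> U" if "x \<in> topspace T" for x
      using atlas_cover [OF G that] sub by blast
  qed (blast intro: comp)+
  show "max_atlas T (max_atlas T \<G>) = max_atlas T \<G>"
  proof
    show "max_atlas T (max_atlas T \<G>) \<subseteq> max_atlas T \<G>" using sub unfolding max_atlas_def by blast
    show "max_atlas T \<G> \<subseteq> max_atlas T (max_atlas T \<G>)"
    proof
      fix a assume a: "a \<in> max_atlas T \<G>"
      then have "is_chart T a" by (simp add: max_atlas_def)
      moreover have "\<forall>b\<in>max_atlas T \<G>. smoothly_compatible a b"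
        unfolding smoothly_compatible_iff using comp a by blast
      ultimately show "a \<in> max_atlas T (max_atlas T \<G>)" unfolding max_atlas_def [of T "max_atlas T \<G>"] by blast
    qed
  qed
qed

lemma smooth_manifold_max_atlas:
  assumes "Hausdorff_space T" "second_countable T" "atlas T \<G>"
  shows "smooth_manifold (T, max_atlas T \<G>)"
proof -
  have "(\<Union>(d, U, c)\<in>max_atlas T \<G>. U) = topspace T"
  proof
    show "(\<Union>(d, U, c)\<in>max_atlas T \<G>. U) \<subseteq> topspace T"
    proof
      fix x assume "x \<in> (\<Union>(d, U, c)\<in>max_atlas T \<G>. U)"
      then obtain d U c where "is_chart T (d, U, c)" "x \<in> U" by (auto simp: max_atlas_def)
      then show "x \<in> topspace T" using openin_subset [OF chart_open] by blast
    qed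
    show "topspace T \<subseteq> (\<Union>(d, U, c)\<in>max_atlas T \<G>. U)"
      using atlas_cover [OF max_atlas_atlas(1) [OF assms(3)]] by fastforce
  qed
  then show ?thesis using assms max_atlas_atlas(3) [OF assms(3)] by (simp add: smooth_manifold_def)
qed

lemma smooth_manifold_atlas:
  assumes "smooth_manifold (T, \<A>)"
  shows "atlas T \<A>"
proof -
  have 1: "\<A> = max_atlas T \<A>" and 2: "(\<Union>(d, U, c)\<in>\<A>. U) = topspace T"
    using assms by (simp_all add: smooth_manifold_def)
  have "\<exists>d U c. (d, U, c) \<in> \<A> \<and> x \<in> U" if "x \<in> topspace T" for x
    using that unfolding 2 [symmetric] by auto
  moreover have "is_chart T a" if "a \<in> \<A>" for a using that 1 unfolding max_atlas_def by blast
  moreover have "smoothly_compatible a b" if "a \<in> \<A>" "b \<in> \<A>" for a b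
    using that 1 unfolding max_atlas_def by blast
  ultimately show ?thesis unfolding atlas_def by blast
qed

lemma chart_smooth_restrict:
  assumes a: "is_chart T (d, U, c)" and s: "chart_smooth f (d, U, c) (e, V, b)"
    and N: "openin T N" "N \<subseteq> U" and op: "openin T (N \<inter> f -` V')" and V': "V' \<subseteq> V"
  shows "chart_smooth f (d, N, c) (e, V', b)"
proof -
  obtain h where h: "smooth_on d e (c ` (U \<inter> f -` V)) h" "\<forall>x\<in>U. h (c x) = b (f x)"
    using chart_smoothD [OF a s] by (elim exE conjE)
  show ?thesis
  proof (rule chart_smoothI [OF is_chart_restrict [OF a N] op])
    show "smooth_on d e (c ` (N \<inter> f -` V')) h"
      using h(1) by (rule smooth_on_subset) (use N V' in auto)
    show "h (c x) j = b (f x) j" if "x \<in> N" for x j using h(2) N(2) that by auto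
  qed
qed

text \<open>A smaller domain keeps all compatibilities, so maximality of the atlas puts the
  restricted chart into it.\<close>

lemma smooth_manifold_restrict:
  assumes M: "smooth_manifold (T, \<A>)" and a: "(d, U, c) \<in> \<A>" and N: "openin T N" "N \<subseteq> U"
  shows "(d, N, c) \<in> \<A>"
proof -
  note at = smooth_manifold_atlas [OF M]
  note ca = atlas_chart [OF at a]
  have "smoothly_compatible (d, N, c) g" if g: "g \<in> \<A>" for g
  proof -
    obtain e V b where gb: "g = (e, V, b)" by (metis prod_cases3)
    note cb = atlas_chart [OF at g [unfolded gb]]
    have "chart_compat (d, N, c) (e, V, b)"
      by (rule chart_smooth_restrict [OF ca atlas_compatible [OF at a g [unfolded gb]] N _ subset_refl])
        (use openin_Int [OF N(1) chart_open [OF cb]] in simp)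
    moreover have "chart_compat (e, V, b) (d, N, c)"
      by (rule chart_smooth_restrict [OF cb atlas_compatible [OF at g [unfolded gb] a] chart_open [OF cb] subset_refl _ N(2)])
        (use openin_Int [OF chart_open [OF cb] N(1)] in simp)
    ultimately show ?thesis unfolding smoothly_compatible_iff gb by blast
  qed
  then have "(d, N, c) \<in> max_atlas T \<A>"
    unfolding max_atlas_def using is_chart_restrict [OF ca N] by blast
  then show ?thesis using M by (simp add: smooth_manifold_def)
qed

subsection \<open>Products\<close>

definition pr1 :: "nat \<Rightarrow> vec \<Rightarrow> vec"
  where "pr1 d w = (\<lambda>i. if i < d then w i else 0)"

definition pr2 :: "nat \<Rightarrow> vec \<Rightarrow> vec"
  where "pr2 d w = (\<lambda>i. w (d + i))"

lemma append_coords_E: "v \<in> E e \<Longrightarrow> append_coords d u v \<in> E (d + e)"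
  by (auto simp: append_coords_def E_iff)

lemma pr1_append: "u \<in> E d \<Longrightarrow> pr1 d (append_coords d u v) = u"
  by (auto simp: pr1_def append_coords_def E_iff fun_eq_iff)

lemma pr2_append [simp]: "pr2 d (append_coords d u v) = v"
  by (simp add: pr2_def append_coords_def)

lemma append_pr: "append_coords d (pr1 d w) (pr2 d w) = w"
  by (auto simp: pr1_def pr2_def append_coords_def)

lemma pr1_E: "pr1 d w \<in> E d"
  by (simp add: pr1_def E_iff)

lemma pr2_E: "w \<in> E (d + e) \<Longrightarrow> pr2 d w \<in> E e"
  by (simp add: pr2_def E_iff)

lemma smooth_on_pr1: "smooth_on n d D (pr1 d)"
  unfolding smooth_on_def pr1_def using Ck_coord by auto

lemma smooth_on_pr2: "smooth_on n e D (pr2 d)"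
  unfolding smooth_on_def pr2_def using Ck_coord by auto

lemma smooth_on_append:
  assumes "smooth_on n d D f" "smooth_on n e D g"
  shows "smooth_on n (d + e) D (\<lambda>x. append_coords d (f x) (g x))"
  unfolding smooth_on_def
proof (intro allI impI)
  fix j k assume j: "j < d + e"
  show "Ck k n D (\<lambda>x. append_coords d (f x) (g x) j)"
  proof (cases "j < d")
    case True
    then show ?thesis using assms(1) by (simp add: smooth_on_def append_coords_def)
  next
    case False
    then have "j - d < e" using j by simp
    then show ?thesis using False assms(2) by (simp add: smooth_on_def append_coords_def)
  qed
qed

lemma continuous_map_append:
  assumes "continuous_map Z (Eu d) f" "continuous_map Z (Eu e) g"
  shows "continuous_map Z (Eu (d + e)) (\<lambda>x. append_coords d (f x) (g x))"
  unfolding continuous_map_Euc_iff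
proof (intro conjI ballI allI impI)
  show "append_coords d (f x) (g x) \<in> E (d + e)" if "x \<in> topspace Z" for x
    using assms(2) that by (intro append_coords_E) (auto simp: continuous_map_Euc_iff)
  show "cont_real Z (\<lambda>x. append_coords d (f x) (g x) i)" if "i < d + e" for i
    using assms that by (cases "i < d") (auto simp: continuous_map_Euc_iff append_coords_def)
qed

lemma continuous_map_pr1: "continuous_map (Eu n) (Eu d) (pr1 d)"
  unfolding continuous_map_Euc_iff using pr1_E continuous_map_coord by (auto simp: pr1_def)

lemma continuous_map_pr2: "continuous_map (Eu (d + e)) (Eu e) (pr2 d)"
  unfolding continuous_map_Euc_iff using pr2_E continuous_map_coord by (auto simp: pr2_def)

lemma is_chart_prod:
  assumes a: "is_chart T (d, U, c)" and b: "is_chart T' (e, V, b)"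
  shows "is_chart (prod_topology T T') (d + e, U \<times> V, \<lambda>(x, y). append_coords d (c x) (b y))"
proof -
  let ?f = "\<lambda>(x, y). append_coords d (c x) (b y)"
  have image: "?f ` (U \<times> V) = {w \<in> E (d + e). pr1 d w \<in> c ` U} \<inter> {w \<in> E (d + e). pr2 d w \<in> b ` V}"
  proof (intro equalityI subsetI)
    fix w assume "w \<in> ?f ` (U \<times> V)"
    then show "w \<in> {w \<in> E (d + e). pr1 d w \<in> c ` U} \<inter> {w \<in> E (d + e). pr2 d w \<in> b ` V}"
      using chart_E [OF a] chart_E [OF b] by (auto simp: pr1_append append_coords_E)
  next
    fix w assume w: "w \<in> {w \<in> E (d + e). pr1 d w \<in> c ` U} \<inter> {w \<in> E (d + e). pr2 d w \<in> b ` V}"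
    then obtain x y where "x \<in> U" "y \<in> V" "pr1 d w = c x" "pr2 d w = b y" by blast
    then have "w = ?f (x, y)" using append_pr [of d w] by simp
    with \<open>x \<in> U\<close> \<open>y \<in> V\<close> show "w \<in> ?f ` (U \<times> V)" by blast
  qed
  have op: "openin (Eu (d + e)) (?f ` (U \<times> V))"
    unfolding image
    using openin_continuous_map_preimage [OF continuous_map_pr1 chart_image_open [OF a chart_open [OF a] subset_refl], of "d + e"]
      openin_continuous_map_preimage [OF continuous_map_pr2 chart_image_open [OF b chart_open [OF b] subset_refl], of d]
    by (rule openin_Int)
  have top: "topspace (subtopology (prod_topology T T') (U \<times> V)) = U \<times> V"
    using openin_subset [OF chart_open [OF a]] openin_subset [OF chart_open [OF b]] by auto
  have st: "subtopology (prod_topology T T') (U \<times> V) = prod_topology (subtopology T U) (subtopology T' V)"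
    by (rule subtopology_Times)
  have "embedding_map (subtopology (prod_topology T T') (U \<times> V)) (Eu (d + e)) ?f"
  proof (rule embedding_mapI)
    have "continuous_map (prod_topology (subtopology T U) (subtopology T' V)) (Eu (d + e))
        (\<lambda>z. append_coords d (c (fst z)) (b (snd z)))"
      using continuous_map_compose [OF continuous_map_fst chart_cont [OF a]]
        continuous_map_compose [OF continuous_map_snd chart_cont [OF b]]
      by (intro continuous_map_append) (simp_all add: o_def)
    then show "continuous_map (subtopology (prod_topology T T') (U \<times> V)) (Eu (d + e)) ?f"
      unfolding st by (simp add: case_prod_unfold)
    let ?g = "\<lambda>w. (the_inv_into U c (pr1 d w), the_inv_into V b (pr2 d w))"
    have p1: "continuous_map (subtopology (Eu (d + e)) (?f ` (U \<times> V))) (subtopology (Eu d) (c ` U)) (pr1 d)"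
      using continuous_map_from_subtopology [OF continuous_map_pr1] by (auto simp: continuous_map_in_subtopology image)
    have p2: "continuous_map (subtopology (Eu (d + e)) (?f ` (U \<times> V))) (subtopology (Eu e) (b ` V)) (pr2 d)"
      using continuous_map_from_subtopology [OF continuous_map_pr2] by (auto simp: continuous_map_in_subtopology image)
    show "continuous_map (subtopology (Eu (d + e)) (?f ` topspace (subtopology (prod_topology T T') (U \<times> V))))
       (subtopology (prod_topology T T') (U \<times> V)) ?g"
      unfolding top unfolding st
      using continuous_map_compose [OF p1 chart_inv_cont [OF a]] continuous_map_compose [OF p2 chart_inv_cont [OF b]]
      by (intro continuous_map_pairedI) (simp_all add: o_def)
    fix z assume "z \<in> topspace (subtopology (prod_topology T T') (U \<times> V))"
    then obtain x y where z: "z = (x, y)" "x \<in> U" "y \<in> V" unfolding top by blast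
    then show "?g (?f z) = z"
      using chart_E [OF a] the_inv_into_f_f [OF chart_inj [OF a]] the_inv_into_f_f [OF chart_inj [OF b]]
      by (simp add: pr1_append)
  qed
  with op show ?thesis
    unfolding is_chart_iff using chart_open [OF a] chart_open [OF b] by (simp add: openin_prod_Times_iff)
qed

lemma chart_smooth_prod:
  assumes a: "is_chart T (d, U, c)" and b: "is_chart T' (e, V, b)"
    and a': "is_chart T (d', U', c')" and b': "is_chart T' (e', V', b')"
    and s: "chart_compat (d, U, c) (d', U', c')" "chart_compat (e, V, b) (e', V', b')"
  shows "chart_compat (d + e, U \<times> V, \<lambda>(x, y). append_coords d (c x) (b y))
    (d' + e', U' \<times> V', \<lambda>(x, y). append_coords d' (c' x) (b' y))"
proof -
  let ?f = "\<lambda>(x, y). append_coords d (c x) (b y)"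
  let ?D = "?f ` (U \<times> V \<inter> (\<lambda>x. x) -` (U' \<times> V'))"
  obtain h1 where h1: "smooth_on d d' (c ` (U \<inter> (\<lambda>x. x) -` U')) h1" "\<forall>x\<in>U. h1 (c x) = c' x"
    using chart_smoothD [OF a s(1)] by (elim exE conjE)
  obtain h2 where h2: "smooth_on e e' (b ` (V \<inter> (\<lambda>x. x) -` V')) h2" "\<forall>x\<in>V. h2 (b x) = b' x"
    using chart_smoothD [OF b s(2)] by (elim exE conjE)
  note ab = is_chart_prod [OF a b]
  have op: "openin (prod_topology T T') (U \<times> V \<inter> (\<lambda>x. x) -` (U' \<times> V'))"
    using openin_Int [OF chart_open [OF ab] chart_open [OF is_chart_prod [OF a' b']]] by simp
  have D: "openin (Eu (d + e)) ?D" by (rule chart_image_open [OF ab op]) blast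
  have o1: "openin (Eu d) (c ` (U \<inter> (\<lambda>x. x) -` U'))"
    by (rule chart_image_open [OF a]) (use openin_Int [OF chart_open [OF a] chart_open [OF a']] in auto)
  have o2: "openin (Eu e) (b ` (V \<inter> (\<lambda>x. x) -` V'))"
    by (rule chart_image_open [OF b]) (use openin_Int [OF chart_open [OF b] chart_open [OF b']] in auto)
  have s1: "smooth_on (d + e) d' ?D (\<lambda>w. h1 (pr1 d w))"
    by (rule smooth_on_compose [OF D o1 _ smooth_on_pr1 h1(1)]) (use chart_E [OF a] in \<open>auto simp: pr1_append\<close>)
  have s2: "smooth_on (d + e) e' ?D (\<lambda>w. h2 (pr2 d w))"
    by (rule smooth_on_compose [OF D o2 _ smooth_on_pr2 h2(1)]) auto
  show ?thesis
  proof (rule chart_smoothI [OF ab op smooth_on_append [OF s1 s2]])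
    fix z j assume "z \<in> U \<times> V"
    then obtain x y where "z = (x, y)" "x \<in> U" "y \<in> V" by blast
    then show "append_coords d' (h1 (pr1 d (?f z))) (h2 (pr2 d (?f z))) j
        = (case z of (x, y) \<Rightarrow> append_coords d' (c' x) (b' y)) j"
      using h1(2) h2(2) chart_E [OF a] by (simp add: pr1_append)
  qed
qed

lemma prod_mfd_atlas:
  assumes A: "atlas T \<A>" and B: "atlas T' \<B>"
  defines "\<G> \<equiv> {(d + e, U \<times> V, \<lambda>(x, y). append_coords d (c x) (b y)) | d U c e V b.
      (d, U, c) \<in> \<A> \<and> (e, V, b) \<in> \<B>}"
  shows "atlas (prod_topology T T') \<G>"
    and "prod_mfd (T, \<A>) (T', \<B>) = (prod_topology T T', max_atlas (prod_topology T T') \<G>)"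
proof -
  show "prod_mfd (T, \<A>) (T', \<B>) = (prod_topology T T', max_atlas (prod_topology T T') \<G>)"
    by (simp add: prod_mfd_def \<G>_def)
  have cs: "chart_compat g g'" if g: "g \<in> \<G>" and g': "g' \<in> \<G>" for g g'
  proof -
    obtain d U c e V b where 1: "g = (d + e, U \<times> V, \<lambda>(x, y). append_coords d (c x) (b y))"
      "(d, U, c) \<in> \<A>" "(e, V, b) \<in> \<B>" using g unfolding \<G>_def by blast
    obtain d' U' c' e' V' b' where 2: "g' = (d' + e', U' \<times> V', \<lambda>(x, y). append_coords d' (c' x) (b' y))"
      "(d', U', c') \<in> \<A>" "(e', V', b') \<in> \<B>" using g' unfolding \<G>_def by blast
    show ?thesis unfolding 1(1) 2(1)
      by (rule chart_smooth_prod [OF atlas_chart [OF A 1(2)] atlas_chart [OF B 1(3)] atlas_chart [OF A 2(2)]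
          atlas_chart [OF B 2(3)] atlas_compatible [OF A 1(2) 2(2)] atlas_compatible [OF B 1(3) 2(3)]])
  qed
  have "is_chart (prod_topology T T') g" if "g \<in> \<G>" for g
    using that is_chart_prod [OF atlas_chart [OF A] atlas_chart [OF B]] unfolding \<G>_def by blast
  moreover have "\<exists>d U c. (d, U, c) \<in> \<G> \<and> z \<in> U" if zt: "z \<in> topspace (prod_topology T T')" for z
  proof -
    obtain x y where z: "z = (x, y)" "x \<in> topspace T" "y \<in> topspace T'" using zt by auto
    obtain d U c where 1: "(d, U, c) \<in> \<A>" "x \<in> U" using atlas_cover [OF A z(2)] by blast
    obtain e V b where 2: "(e, V, b) \<in> \<B>" "y \<in> V" using atlas_cover [OF B z(3)] by blast
    show ?thesis using 1 2 z(1) unfolding \<G>_def by blast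
  qed
  ultimately show "atlas (prod_topology T T') \<G>"
    unfolding atlas_def smoothly_compatible_iff using cs by blast
qed

lemma prod_mfd_props:
  assumes A: "atlas T \<A>" and B: "atlas T' \<B>"
  shows fst_prod_mfd: "fst (prod_mfd (T, \<A>) (T', \<B>)) = prod_topology T T'"
    and atlas_prod_mfd: "atlas (prod_topology T T') (snd (prod_mfd (T, \<A>) (T', \<B>)))"
    and prod_chart_mem: "(d, U, c) \<in> \<A> \<Longrightarrow> (e, V, b) \<in> \<B>
      \<Longrightarrow> (d + e, U \<times> V, \<lambda>(x, y). append_coords d (c x) (b y)) \<in> snd (prod_mfd (T, \<A>) (T', \<B>))"
proof -
  note * = prod_mfd_atlas [OF A B]
  show "fst (prod_mfd (T, \<A>) (T', \<B>)) = prod_topology T T'" unfolding *(2) by simp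
  show "atlas (prod_topology T T') (snd (prod_mfd (T, \<A>) (T', \<B>)))"
    unfolding *(2) snd_conv by (rule max_atlas_atlas(1) [OF *(1)])
  show "(d + e, U \<times> V, \<lambda>(x, y). append_coords d (c x) (b y)) \<in> snd (prod_mfd (T, \<A>) (T', \<B>))"
    if "(d, U, c) \<in> \<A>" "(e, V, b) \<in> \<B>"
    unfolding *(2) snd_conv by (rule subsetD [OF max_atlas_atlas(2) [OF *(1)]]) (use that in blast)
qed

lemma atlas_singleton:
  assumes "is_chart T (d, topspace T, c)"
  shows "atlas T {(d, topspace T, c)}"
proof -
  have "chart_compat (d, topspace T, c) (d, topspace T, c)"
    by (rule chart_smoothI [OF assms, where h = "\<lambda>x. x"])
      (use chart_open [OF assms] Ck_coord in \<open>auto simp: smooth_on_def\<close>)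
  then show ?thesis using assms by (simp add: atlas_def smoothly_compatible_iff)
qed

lemma atlas_euc_mfd: "atlas (Eu n) (snd (euc_mfd n))"
  and euc_chart_mem: "(n, E n, \<lambda>x. x) \<in> snd (euc_mfd n)"
proof -
  have "is_chart (Eu n) (n, E n, \<lambda>x. x)"
    unfolding is_chart_iff
    by (auto intro!: embedding_mapI [where g = "\<lambda>x. x"] simp: continuous_map_from_subtopology)
  note * = max_atlas_atlas [OF atlas_singleton [OF this]]
  show "atlas (Eu n) (snd (euc_mfd n))" "(n, E n, \<lambda>x. x) \<in> snd (euc_mfd n)"
    using * by (auto simp: euc_mfd_def)
qed

abbreviation real_coord :: "real \<Rightarrow> vec"
  where "real_coord \<equiv> \<lambda>t i. if i = 0 then t else 0"

lemma atlas_real_mfd: "atlas euclideanreal (snd real_mfd)"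
  and real_chart_mem: "(1, UNIV, real_coord) \<in> snd real_mfd"
proof -
  have rE: "real_coord t \<in> E 1" for t by (simp add: E_iff)
  have image: "range real_coord = E 1"
  proof (intro equalityI subsetI)
    fix x assume "x \<in> E 1"
    then have "x = real_coord (x 0)" by (intro E_eqI [OF _ rE]) auto
    then show "x \<in> range real_coord" by blast
  qed (use rE in blast)
  have "embedding_map euclideanreal (Eu 1) real_coord"
  proof (rule embedding_mapI [where g = "\<lambda>x. x 0"])
    show "continuous_map euclideanreal (Eu 1) real_coord"
      unfolding continuous_map_Euc_iff using rE by auto
    show "cont_real (subtopology (Eu 1) (real_coord ` topspace euclideanreal)) (\<lambda>x. x 0)"
      by (intro continuous_map_from_subtopology continuous_map_coord)
  qed simp
  then have "is_chart euclideanreal (1, topspace euclideanreal, real_coord)"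
    unfolding is_chart_iff using image by (simp add: subtopology_UNIV)
  note * = max_atlas_atlas [OF atlas_singleton [OF this]]
  show "atlas euclideanreal (snd real_mfd)" "(1, UNIV, real_coord) \<in> snd real_mfd"
    using * by (auto simp: real_mfd_def)
qed

subsection \<open>Manifold structures on pieces of a stratified space\<close>

lemma sub_mfd_pair: "sub_mfd X S = (subtopology (stop X) S, snd (sub_mfd X S))"
  by (simp add: sub_mfd_def)

lemma sub_mfd_charts: "(d, U, c) \<in> snd (sub_mfd X S) \<longleftrightarrow> (d, U, c) \<in> charts X \<and> U \<subseteq> S"
  by (auto simp: sub_mfd_def)

text \<open>The charts recorded for \<open>V\<close> are those of \<open>S\<close> whose domain lies
  in \<open>V\<close>; they cover \<open>V\<close> because charts of \<open>S\<close> may be cut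
  down to open subsets.\<close>

lemma atlas_sub_mfd:
  assumes M: "smooth_manifold (sub_mfd X S)" and V: "openin (subtopology (stop X) S) V"
  shows "atlas (subtopology (stop X) V) (snd (sub_mfd X V))"
    and "(d, U, c) \<in> snd (sub_mfd X S) \<Longrightarrow> openin (subtopology (stop X) S) N \<Longrightarrow> N \<subseteq> U \<Longrightarrow> N \<subseteq> V
      \<Longrightarrow> (d, N, c) \<in> snd (sub_mfd X V)"
proof -
  have VS: "V \<subseteq> S" using openin_subset [OF V] by auto
  have M': "smooth_manifold (subtopology (stop X) S, snd (sub_mfd X S))"
    unfolding sub_mfd_pair [symmetric] by (rule M)
  note at = smooth_manifold_atlas [OF M']
  have restr: "(d, N, c) \<in> snd (sub_mfd X V)"
    if "(d, U, c) \<in> snd (sub_mfd X S)" "openin (subtopology (stop X) S) N" "N \<subseteq> U" "N \<subseteq> V" for d U c N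
    using smooth_manifold_restrict [OF M' that(1-3)] that(4) by (simp add: sub_mfd_charts)
  then show "(d, U, c) \<in> snd (sub_mfd X S) \<Longrightarrow> openin (subtopology (stop X) S) N \<Longrightarrow> N \<subseteq> U \<Longrightarrow> N \<subseteq> V
      \<Longrightarrow> (d, N, c) \<in> snd (sub_mfd X V)" .
  have mem: "(d, U, c) \<in> snd (sub_mfd X S)" if "(d, U, c) \<in> snd (sub_mfd X V)" for d U c
    using that VS by (auto simp: sub_mfd_charts)
  have stV: "subtopology (subtopology (stop X) S) V = subtopology (stop X) V"
    using VS by (simp add: subtopology_subtopology inf_absorb2)
  have ch: "is_chart (subtopology (stop X) V) (d, U, c)" if a: "(d, U, c) \<in> snd (sub_mfd X V)" for d U c
  proof -
    have UV: "U \<subseteq> V" using a by (simp add: sub_mfd_charts)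
    note ca = atlas_chart [OF at mem [OF a]]
    have "openin (subtopology (subtopology (stop X) S) V) U"
      using chart_open [OF ca] V UV by (simp add: openin_open_subtopology)
    then have "openin (subtopology (stop X) V) U" by (simp only: stV)
    moreover have "subtopology (subtopology (stop X) V) U = subtopology (subtopology (stop X) S) U"
      using UV VS by (simp add: subtopology_subtopology inf_absorb2)
    ultimately show ?thesis using ca by (simp add: is_chart_iff)
  qed
  have "\<exists>d U c. (d, U, c) \<in> snd (sub_mfd X V) \<and> x \<in> U" if x: "x \<in> topspace (subtopology (stop X) V)" for x
  proof -
    have xV: "x \<in> V" and "x \<in> topspace (subtopology (stop X) S)" using x VS by auto
    then obtain d U c where a: "(d, U, c) \<in> snd (sub_mfd X S)" "x \<in> U" using atlas_cover [OF at] by blast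
    have "openin (subtopology (stop X) S) (U \<inter> V)" by (rule openin_Int [OF chart_open [OF atlas_chart [OF at a(1)]] V])
    from restr [OF a(1) this] a(2) xV show ?thesis by blast
  qed
  moreover have "smoothly_compatible a b" if "a \<in> snd (sub_mfd X V)" "b \<in> snd (sub_mfd X V)" for a b
  proof -
    obtain d U c e U' c' where ab: "a = (d, U, c)" "b = (e, U', c')" by (metis prod_cases3)
    have "a \<in> snd (sub_mfd X S)" "b \<in> snd (sub_mfd X S)" using that mem unfolding ab by blast+
    then show ?thesis using at unfolding atlas_def by blast
  qed
  moreover have "is_chart (subtopology (stop X) V) a" if "a \<in> snd (sub_mfd X V)" for a
    using that ch by (metis prod_cases3)
  ultimately show "atlas (subtopology (stop X) V) (snd (sub_mfd X V))" unfolding atlas_def by blast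
qed

text \<open>Charts with empty domain belong to every maximal atlas. They are the only ones that
  several disjoint pieces share.\<close>

lemma chart_smooth_empty: "chart_compat (d, {}, c) b" "chart_compat b (d, {}, c)"
proof -
  have "Ck k n {} f" for k n f
  proof (induction k arbitrary: f)
    case 0
    then show ?case by (simp add: continuous_map_Euc_iff subtopology_trivial_iff)
  next
    case (Suc k)
    have "cont_real (subtopology (Eu n) {}) f" by (simp add: subtopology_trivial_iff)
    with Suc show ?case by simp
  qed
  then have "smooth_on n m {} f" for n m f by (simp add: smooth_on_def)
  then show "chart_compat (d, {}, c) b" "chart_compat b (d, {}, c)"
    by (auto simp: chart_smooth_def split: prod.splits)
qed

text \<open>\<open>charts X\<close> merges the maximal atlases of all pieces. A nonempty chart
  domain reveals its piece, so nothing foreign is picked up when the atlas of one piece is extracted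
  again. Different indices may describe the same piece with the same generators.\<close>

lemma sub_mfd_disjoint:
  assumes ch: "charts X = (\<Union>i\<in>I. max_atlas (subtopology (stop X) (P i)) (\<G> i))"
    and disj: "\<And>i j. i \<in> I \<Longrightarrow> j \<in> I \<Longrightarrow> P i \<inter> P j \<noteq> {} \<Longrightarrow> P i = P j \<and> \<G> i = \<G> j" and i: "i \<in> I"
  shows "snd (sub_mfd X (P i)) = max_atlas (subtopology (stop X) (P i)) (\<G> i)"
proof (intro equalityI subsetI)
  fix a assume a: "a \<in> snd (sub_mfd X (P i))"
  obtain d U c where a': "a = (d, U, c)" by (metis prod_cases3)
  have U: "U \<subseteq> P i" using a unfolding a' sub_mfd_charts by blast
  obtain j where j: "j \<in> I" "(d, U, c) \<in> max_atlas (subtopology (stop X) (P j)) (\<G> j)"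
    using a unfolding a' sub_mfd_charts ch by blast
  have cj: "is_chart (subtopology (stop X) (P j)) (d, U, c)" using j(2) by (simp add: max_atlas_def)
  then have Uj: "U \<subseteq> P j" using openin_subset [OF chart_open [OF cj]] by auto
  show "a \<in> max_atlas (subtopology (stop X) (P i)) (\<G> i)"
  proof (cases "U = {}")
    case False
    then have "P i = P j \<and> \<G> i = \<G> j" using U Uj disj [OF i j(1)] by blast
    then show ?thesis using j(2) a' by simp
  next
    case True
    have "is_chart (subtopology (stop X) (P i)) (d, U, c)"
      using cj unfolding is_chart_iff True by (simp add: subtopology_subtopology)
    then show ?thesis unfolding a' True max_atlas_def smoothly_compatible_iff using chart_smooth_empty by blast
  qed
next
  fix a assume a: "a \<in> max_atlas (subtopology (stop X) (P i)) (\<G> i)"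
  obtain d U c where a': "a = (d, U, c)" by (metis prod_cases3)
  have "is_chart (subtopology (stop X) (P i)) (d, U, c)" using a unfolding a' by (simp add: max_atlas_def)
  from openin_subset [OF chart_open [OF this]] have "U \<subseteq> P i" by auto
  with a i show "a \<in> snd (sub_mfd X (P i))" unfolding a' sub_mfd_charts ch by blast
qed

text \<open>The case of \<open>sub_mfd_disjoint\<close> in which the pieces are indexed by pairs of
  strata.\<close>

lemma sub_mfd_strat_prod:
  assumes X: "disjoint (strata X)" and Y: "disjoint (strata Y)" and S: "S \<in> strata X" and T: "T \<in> strata Y"
  shows "sub_mfd (strat_prod X Y) (S \<times> T) = prod_mfd (sub_mfd X S) (sub_mfd Y T)"
proof -
  define \<G> where "\<G> = (\<lambda>(S, T). {(d + e, U \<times> V, \<lambda>(x, y). append_coords d (c x) (b y)) | d U c e V b.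
      (d, U, c) \<in> snd (sub_mfd X S) \<and> (e, V, b) \<in> snd (sub_mfd Y T)})"
  have pm: "prod_mfd (sub_mfd X S) (sub_mfd Y T) = (subtopology (stop (strat_prod X Y)) (S \<times> T),
      max_atlas (subtopology (stop (strat_prod X Y)) (S \<times> T)) (\<G> (S, T)))" for S T
    by (simp add: prod_mfd_def \<G>_def strat_prod_def subtopology_Times sub_mfd_def)
  define P where "P = (\<lambda>(S :: 'a set, T :: 'b set). S \<times> T)"
  have ch: "charts (strat_prod X Y) = (\<Union>i\<in>strata X \<times> strata Y. max_atlas (subtopology (stop (strat_prod X Y)) (P i)) (\<G> i))"
  proof -
    have "charts (strat_prod X Y) = (\<Union>S\<in>strata X. \<Union>T\<in>strata Y. snd (prod_mfd (sub_mfd X S) (sub_mfd Y T)))"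
      by (simp add: strat_prod_def)
    then show ?thesis unfolding pm P_def by auto
  qed
  have disj: "P i = P j \<and> \<G> i = \<G> j"
    if i: "i \<in> strata X \<times> strata Y" and j: "j \<in> strata X \<times> strata Y" and ne: "P i \<inter> P j \<noteq> {}" for i j
  proof -
    obtain S T S' T' where ij: "i = (S, T)" "j = (S', T')" by (metis surj_pair)
    have "S \<inter> S' \<noteq> {}" "T \<inter> T' \<noteq> {}" using ne unfolding ij P_def prod.case Times_Int_Times by blast+
    moreover have "S \<in> strata X" "S' \<in> strata X" "T \<in> strata Y" "T' \<in> strata Y" using i j unfolding ij by simp_all
    ultimately have "S = S'" "T = T'" by (metis disjointD [OF X], metis disjointD [OF Y])
    then show ?thesis unfolding ij by simp
  qed
  have ST: "(S, T) \<in> strata X \<times> strata Y" using S T by blast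
  have "sub_mfd (strat_prod X Y) (S \<times> T)
      = (subtopology (stop (strat_prod X Y)) (S \<times> T), snd (sub_mfd (strat_prod X Y) (S \<times> T)))"
    by (rule sub_mfd_pair)
  also have "snd (sub_mfd (strat_prod X Y) (S \<times> T)) = max_atlas (subtopology (stop (strat_prod X Y)) (S \<times> T)) (\<G> (S, T))"
    using sub_mfd_disjoint [OF ch disj ST] by (simp add: P_def)
  finally show ?thesis unfolding pm .
qed

lemma sub_mfd_one_stratum:
  assumes "atlas T \<A>"
  shows "sub_mfd (one_stratum (T, \<A>)) (topspace T) = (T, \<A>)"
proof -
  have "U \<subseteq> topspace T" if "(d, U, c) \<in> \<A>" for d U c
    using openin_subset [OF chart_open [OF atlas_chart [OF assms that]]] .
  then show ?thesis by (auto simp: sub_mfd_def one_stratum_def)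
qed

lemma sub_mfd_strat_restrict:
  assumes "S \<subseteq> U"
  shows "sub_mfd (strat_restrict X U) S = sub_mfd X S"
  using assms by (auto simp: sub_mfd_def strat_restrict_def subtopology_subtopology inf_absorb2)

section \<open>Point-set topology\<close>

text \<open>The space is covered by the complement of \<open>C\<close> and the open sets that some
  neighbourhood of \<open>a\<close> avoids; the Hausdorff property provides one of these about each
  point of \<open>C\<close>. In a locally finite refinement, the members that meet \<open>C\<close>
  form a neighbourhood of \<open>C\<close>, and only finitely many of them come near
  \<open>a\<close>, so finitely many neighbourhoods of \<open>a\<close> are to be
  intersected.\<close>

lemma paracompact_Hausdorff_imp_regular:
  assumes pc: "paracompact_space T" and H: "Hausdorff_space T"
  shows "regular_space T"
  unfolding regular_space_def
proof (intro allI impI)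
  fix C a assume Ca: "closedin T C \<and> a \<in> topspace T - C"
  define \<U> where "\<U> = insert (topspace T - C) {U. openin T U \<and> (\<exists>V. openin T V \<and> a \<in> V \<and> V \<inter> U = {})}"
  have "\<forall>U\<in>\<U>. openin T U" using Ca by (auto simp: \<U>_def)
  moreover have "\<Union>\<U> = topspace T"
  proof
    show "\<Union>\<U> \<subseteq> topspace T" using openin_subset by (auto simp: \<U>_def)
    show "topspace T \<subseteq> \<Union>\<U>"
    proof
      fix y assume y: "y \<in> topspace T"
      show "y \<in> \<Union>\<U>"
      proof (cases "y \<in> C")
        case True
        then have "a \<noteq> y" using Ca by blast
        then obtain V U where "openin T V" "openin T U" "a \<in> V" "y \<in> U" "disjnt V U"
          using H y Ca unfolding Hausdorff_space_def by (metis DiffD1)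
        then show ?thesis unfolding \<U>_def disjnt_def by blast
      qed (use y in \<open>auto simp: \<U>_def\<close>)
    qed
  qed
  ultimately obtain \<V> where \<V>: "\<forall>V\<in>\<V>. openin T V \<and> (\<exists>U\<in>\<U>. V \<subseteq> U)" "\<Union>\<V> = topspace T" "locally_finite_in T \<V>"
    using pc unfolding paracompact_space_def by (elim allE [of _ \<U>] impE) auto
  obtain N where N: "openin T N" "a \<in> N" "finite {V \<in> \<V>. V \<inter> N \<noteq> {}}"
    using \<V>(3) Ca unfolding locally_finite_in_def by (metis DiffD1)
  define \<W> where "\<W> = {V \<in> \<V>. V \<inter> N \<noteq> {} \<and> V \<inter> C \<noteq> {}}"
  have fin: "finite \<W>" by (rule finite_subset [OF _ N(3)]) (auto simp: \<W>_def)
  \<comment> \<open>Since \<open>V\<close> meets \<open>C\<close>, the member of the cover that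
    contains it is not the complement of \<open>C\<close>.\<close>
  have "\<exists>V'. openin T V' \<and> a \<in> V' \<and> V' \<inter> V = {}" if V: "V \<in> \<W>" for V
  proof -
    obtain U where "U \<in> \<U>" "V \<subseteq> U" "V \<inter> C \<noteq> {}" using V \<V>(1) unfolding \<W>_def by blast
    then have "U \<noteq> topspace T - C" by blast
    then obtain V' where "openin T V'" "a \<in> V'" "V' \<inter> U = {}" using \<open>U \<in> \<U>\<close> by (auto simp: \<U>_def)
    with \<open>V \<subseteq> U\<close> show ?thesis by blast
  qed
  then obtain g where g: "\<And>V. V \<in> \<W> \<Longrightarrow> openin T (g V) \<and> a \<in> g V \<and> g V \<inter> V = {}" by metis
  define N' where "N' = (\<Inter>V\<in>insert N (g ` \<W>). V)"
  have "openin T N'" unfolding N'_def image_ident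
    by (rule openin_Inter) (use fin g N(1) in auto)
  moreover have "a \<in> N'" using g N(2) by (auto simp: N'_def)
  moreover have "openin T (\<Union>{V \<in> \<V>. V \<inter> C \<noteq> {}})" using \<V>(1) by (intro openin_Union) auto
  moreover have "C \<subseteq> \<Union>{V \<in> \<V>. V \<inter> C \<noteq> {}}"
    using \<V>(2) closedin_subset [of T C] Ca by blast
  moreover have "disjnt N' (\<Union>{V \<in> \<V>. V \<inter> C \<noteq> {}})"
  proof -
    have "N' \<inter> V = {}" if V: "V \<in> \<V>" "V \<inter> C \<noteq> {}" for V
    proof (cases "V \<inter> N = {}")
      case False
      then have "V \<in> \<W>" using V by (simp add: \<W>_def)
      then have "g V \<inter> V = {}" "N' \<subseteq> g V" using g by (auto simp: N'_def)
      then show ?thesis by blast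
    qed (auto simp: N'_def)
    then show ?thesis unfolding disjnt_def by blast
  qed
  ultimately show "\<exists>U V. openin T U \<and> openin T V \<and> a \<in> U \<and> C \<subseteq> V \<and> disjnt U V" by blast
qed

text \<open>By regularity and the Lindelof property there are countably many open sets
  \<open>V n\<close> that cover the space and whose closures lie in members \<open>U n\<close> of
  the given cover.\<close>

lemma regular_Lindelof_imp_paracompact:
  assumes reg: "regular_space T" and L: "Lindelof_space T"
  shows "paracompact_space T"
  unfolding paracompact_space_def
proof (intro allI impI)
  fix \<U> assume \<U>: "(\<forall>U\<in>\<U>. openin T U) \<and> \<Union>\<U> = topspace T"
  define \<B> where "\<B> = {V. openin T V \<and> (\<exists>U\<in>\<U>. T closure_of V \<subseteq> U)}"
  have "topspace T \<subseteq> \<Union>\<B>"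
  proof
    fix x assume x: "x \<in> topspace T"
    then obtain U where U: "U \<in> \<U>" "x \<in> U" "openin T U" using \<U> by blast
    have "neighbourhood_base_of (closedin T) T" using reg by (simp add: neighbourhood_base_of_closedin)
    then obtain V C where V: "openin T V" "closedin T C" "x \<in> V" "V \<subseteq> C" "C \<subseteq> U"
      using U unfolding neighbourhood_base_of by metis
    then have "T closure_of V \<subseteq> U" using closure_of_minimal [OF V(4,2)] by blast
    with U(1) V show "x \<in> \<Union>\<B>" by (auto simp: \<B>_def)
  qed
  then have "\<Union>\<B> = topspace T" using openin_subset by (fastforce simp: \<B>_def)
  then obtain \<C> where \<C>: "countable \<C>" "\<C> \<subseteq> \<B>" "\<Union>\<C> = topspace T"
    using Lindelof_spaceD [OF L, of \<B>] by (metis (no_types, lifting) \<B>_def mem_Collect_eq)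
  show "\<exists>\<V>. (\<forall>V\<in>\<V>. openin T V \<and> (\<exists>U\<in>\<U>. V \<subseteq> U)) \<and> \<Union>\<V> = topspace T \<and> locally_finite_in T \<V>"
  proof (cases "\<C> = {}")
    case True
    then have "topspace T = {}" using \<C>(3) by simp
    then show ?thesis by (intro exI [of _ "{}"]) (simp add: locally_finite_in_def)
  next
    case False
    define V where "V n = from_nat_into \<C> n" for n
    have rV: "range V = \<C>" unfolding V_def by (rule range_from_nat_into [OF False \<C>(1)])
    have VB: "V n \<in> \<B>" for n using rV \<C>(2) by blast
    then have "\<exists>U\<in>\<U>. T closure_of (V n) \<subseteq> U" for n by (simp add: \<B>_def)
    then obtain U where U: "\<And>n. U n \<in> \<U>" "\<And>n. T closure_of (V n) \<subseteq> U n" by metis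
    have oV: "openin T (V n)" for n using VB by (simp add: \<B>_def)
    have VU: "V n \<subseteq> U n" for n using closure_of_subset [OF openin_subset [OF oV]] U(2) by blast
    \<comment> \<open>Removing the earlier closures leaves a cover, since a point lies in
      \<open>W n\<close> for the least \<open>n\<close> with the point in \<open>U n\<close>. It is
      locally finite because \<open>V n\<close> is disjoint from every \<open>W j\<close> with
      \<open>n < j\<close>.\<close>
    define W where "W n = U n - (\<Union>j\<in>{..<n}. T closure_of V j)" for n
    have oW: "openin T (W n)" for n
      unfolding W_def using \<U> U(1) by (intro openin_diff closedin_Union) auto
    have "\<Union>(range W) = topspace T"
    proof
      show "\<Union>(range W) \<subseteq> topspace T" using oW openin_subset by blast
      show "topspace T \<subseteq> \<Union>(range W)"
      proof
        fix x assume "x \<in> topspace T"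
        then have ex: "\<exists>n. x \<in> U n" using \<C>(3) rV VU by blast
        define n where "n = (LEAST n. x \<in> U n)"
        have "x \<in> U n" unfolding n_def using ex by (rule LeastI_ex)
        moreover have "x \<notin> U j" if "j < n" for j using that not_less_Least unfolding n_def by blast
        ultimately have "x \<in> W n" unfolding W_def using U(2) by blast
        then show "x \<in> \<Union>(range W)" by blast
      qed
    qed
    moreover have "locally_finite_in T (range W)"
      unfolding locally_finite_in_def
    proof (intro conjI ballI)
      show "\<Union>(range W) \<subseteq> topspace T" using oW openin_subset by blast
      fix x assume "x \<in> topspace T"
      then obtain n where n: "x \<in> V n" using \<C>(3) rV by blast
      have "{Y \<in> range W. Y \<inter> V n \<noteq> {}} \<subseteq> W ` {..n}"
      proof
        fix Y assume "Y \<in> {Y \<in> range W. Y \<inter> V n \<noteq> {}}"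
        then obtain j where j: "Y = W j" "W j \<inter> V n \<noteq> {}" by blast
        have "\<not> n < j"
        proof
          assume "n < j"
          then have "W j \<inter> V n = {}" unfolding W_def using closure_of_subset [OF openin_subset [OF oV]] by blast
          with j(2) show False by blast
        qed
        then show "Y \<in> W ` {..n}" using j(1) by simp
      qed
      then have "finite {Y \<in> range W. Y \<inter> V n \<noteq> {}}" by (rule finite_subset) simp
      then show "\<exists>N. openin T N \<and> x \<in> N \<and> finite {Y \<in> range W. Y \<inter> N \<noteq> {}}" using oV n by blast
    qed
    moreover have "\<forall>V\<in>range W. openin T V \<and> (\<exists>U\<in>\<U>. V \<subseteq> U)" using oW U(1) by (auto simp: W_def)
    ultimately show ?thesis by blast
  qed
qed

lemma second_countable_cover:
  assumes "countable \<C>" "\<Union>\<C> = topspace T"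
    and C: "\<And>U. U \<in> \<C> \<Longrightarrow> openin T U \<and> second_countable (subtopology T U)"
  shows "second_countable T"
proof -
  have "\<forall>U\<in>\<C>. \<exists>\<B>. countable \<B> \<and> (\<forall>V\<in>\<B>. openin (subtopology T U) V) \<and>
      (\<forall>O' x. openin (subtopology T U) O' \<and> x \<in> O' \<longrightarrow> (\<exists>V\<in>\<B>. x \<in> V \<and> V \<subseteq> O'))"
    using C unfolding second_countable_def by blast
  from bchoice [OF this] obtain \<B> where \<B>: "\<forall>U\<in>\<C>. countable (\<B> U) \<and> (\<forall>V\<in>\<B> U. openin (subtopology T U) V) \<and>
      (\<forall>O' x. openin (subtopology T U) O' \<and> x \<in> O' \<longrightarrow> (\<exists>V\<in>\<B> U. x \<in> V \<and> V \<subseteq> O'))"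
    by (rule exE)
  show ?thesis
    unfolding second_countable_def
  proof (intro exI [of _ "\<Union>(\<B> ` \<C>)"] conjI allI impI ballI)
    show "countable (\<Union>(\<B> ` \<C>))" using assms(1) \<B> by (intro countable_UN) auto
    show "openin T V" if "V \<in> \<Union>(\<B> ` \<C>)" for V
      using that \<B> C openin_trans_full by blast
    fix U x assume U: "openin T U \<and> x \<in> U"
    then obtain C' where C': "C' \<in> \<C>" "x \<in> C'" using assms(2) openin_subset by blast
    have "openin (subtopology T C') (U \<inter> C')" using U C [OF C'(1)] by (auto simp: openin_subtopology)
    then obtain V where "V \<in> \<B> C'" "x \<in> V" "V \<subseteq> U \<inter> C'" using \<B> C' U by blast
    with C'(1) show "\<exists>V\<in>\<Union>(\<B> ` \<C>). x \<in> V \<and> V \<subseteq> U" by blast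
  qed
qed

section \<open>Local trivializations and their transition maps\<close>

lemma spt_svb_restrict: "spt (tot (svb_restrict B U)) = over B U"
  by (auto simp: svb_restrict_def strat_restrict_def over_def)

lemma local_triv_props:
  assumes "local_triv B (k, U, \<phi>)"
  shows local_triv_open: "openin (stop (bas B)) U"
    and local_triv_embedding: "embedding_map (subtopology (stop (tot B)) (over B U))
      (prod_topology (subtopology (stop (bas B)) U) (Eu k)) \<phi>"
    and local_triv_fst: "a \<in> over B U \<Longrightarrow> fst (\<phi> a) = proj B a"
    and local_triv_linear: "x \<in> U \<Longrightarrow> (\<lambda>a. snd (\<phi> a)) \<in> linear_maps (fibre B x) (Euc k)"
    and local_triv_inj_fibre: "x \<in> U \<Longrightarrow> inj_on (\<lambda>a. snd (\<phi> a)) (carrier (fibre B x))"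
    and local_triv_E: "a \<in> over B U \<Longrightarrow> snd (\<phi> a) \<in> E k"
    and local_triv_morphism: "strat_morphism (strat_restrict (tot B) (over B U))
      (strat_prod (strat_restrict (bas B) U) (one_stratum (euc_mfd k))) \<phi>"
proof -
  have tr: "trivialization (svb_restrict B U) k \<phi>" and U: "openin (stop (bas B)) U"
    using assms by (simp_all add: local_triv_def)
  show "openin (stop (bas B)) U" by (rule U)
  have st: "stop (tot (svb_restrict B U)) = subtopology (stop (tot B)) (over B U)"
    "stop (bas (svb_restrict B U)) = subtopology (stop (bas B)) U"
    by (simp_all add: svb_restrict_def strat_restrict_def)
  have stt: "stop (tot (trivial_svb (bas (svb_restrict B U)) k)) = prod_topology (subtopology (stop (bas B)) U) (Eu k)"
    by (simp add: trivial_svb_def strat_prod_def one_stratum_def euc_mfd_def st)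
  show "embedding_map (subtopology (stop (tot B)) (over B U))
      (prod_topology (subtopology (stop (bas B)) U) (Eu k)) \<phi>"
    using tr by (simp add: trivialization_def st stt)
  have inj: "inj_on \<phi> (over B U)" using tr by (simp add: trivialization_def spt_svb_restrict)
  have m: "svb_morphism (svb_restrict B U) (trivial_svb (bas (svb_restrict B U)) k) \<phi> (\<lambda>x. x)"
    using tr by (simp add: trivialization_def)
  show "strat_morphism (strat_restrict (tot B) (over B U))
      (strat_prod (strat_restrict (bas B) U) (one_stratum (euc_mfd k))) \<phi>"
    using m by (simp add: svb_morphism_def svb_restrict_def trivial_svb_def)
  show fstp: "fst (\<phi> a) = proj B a" if "a \<in> over B U" for a
    using m that unfolding svb_morphism_def spt_svb_restrict by (simp add: trivial_svb_def svb_restrict_def)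
  have fib: "fibre (svb_restrict B U) x = fibre B x" if "x \<in> U" for x
    using that by (auto simp: fibre_def svb_restrict_def over_def strat_restrict_def)
  show lin: "(\<lambda>a. snd (\<phi> a)) \<in> linear_maps (fibre B x) (Euc k)" if x: "x \<in> U" for x
  proof -
    have "x \<in> spt (bas (svb_restrict B U))" using x openin_subset [OF U] by (auto simp: st)
    then have l: "\<phi> \<in> linear_maps (fibre B x) (fibre (trivial_svb (bas (svb_restrict B U)) k) x)"
      using m unfolding svb_morphism_def fib [OF x, symmetric] by blast
    have "fibre (trivial_svb (bas (svb_restrict B U)) k) x = \<lparr>carrier = {x} \<times> E k, monoid.mult = undefined, one = undefined,
        zero = (x, \<lambda>i. 0), add = (\<lambda>(x, u) (y, v). (x, \<lambda>i. u i + v i)), smult = (\<lambda>c (x, u). (x, \<lambda>i. c * u i))\<rparr>"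
      using x openin_subset [OF U]
      by (auto simp: fibre_def over_def trivial_svb_def strat_prod_def one_stratum_def euc_mfd_def st)
    then have *: "\<phi> \<in> linear_maps (fibre B x) \<lparr>carrier = {x} \<times> E k, monoid.mult = undefined, one = undefined,
        zero = (x, \<lambda>i. 0), add = (\<lambda>(x, u) (y, v). (x, \<lambda>i. u i + v i)), smult = (\<lambda>c (x, u). (x, \<lambda>i. c * u i))\<rparr>"
      using l by simp
    show ?thesis
      using * unfolding linear_maps_iff by (auto simp: case_prod_unfold)
  qed
  show "snd (\<phi> a) \<in> E k" if a: "a \<in> over B U" for a
  proof -
    have "proj B a \<in> U" "a \<in> carrier (fibre B (proj B a))" using a by (auto simp: over_def fibre_def)
    from linear_maps_closed [OF lin [OF this(1)] this(2)] show ?thesis by simp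
  qed
  show "inj_on (\<lambda>a. snd (\<phi> a)) (carrier (fibre B x))" if x: "x \<in> U" for x
  proof (rule inj_onI)
    fix a b assume ab: "a \<in> carrier (fibre B x)" "b \<in> carrier (fibre B x)" "snd (\<phi> a) = snd (\<phi> b)"
    then have o: "a \<in> over B U" "b \<in> over B U" "proj B a = proj B b" using x by (auto simp: fibre_def over_def)
    then have "\<phi> a = \<phi> b" using fstp [OF o(1)] fstp [OF o(2)] ab(3) by (simp add: prod_eq_iff)
    then show "a = b" using inj o by (simp add: inj_on_def)
  qed
qed

text \<open>A continuous family \<open>K\<close> of linear maps over \<open>W\<close> that carries \<open>\<phi>\<close> to \<open>\<psi>\<close>; in contrast to the
  isomorphisms \<open>H\<close> of \<^const>\<open>compatible\<close>, such families compose.\<close>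

definition transition ::
    "('a, 'x) svb \<Rightarrow> ('a, 'x) triv \<Rightarrow> ('a, 'x) triv \<Rightarrow> 'x set \<Rightarrow> ('x \<Rightarrow> nat \<Rightarrow> vec) \<Rightarrow> bool"
  where "transition B = (\<lambda>(k, U, \<phi>) (l, V, \<psi>) W K. openin (stop (bas B)) W \<and> W \<subseteq> U \<inter> V \<and>
    (\<forall>y\<in>W. \<forall>j<k. K y j \<in> E l) \<and>
    (\<forall>j<k. \<forall>i<l. cont_real (subtopology (stop (bas B)) W) (\<lambda>y. K y j i)) \<and>
    (\<forall>a\<in>over B W. lmap k (K (proj B a)) (snd (\<phi> a)) = snd (\<psi> a)))"

lemma lmap_extend: "v \<in> E k \<Longrightarrow> k \<le> n \<Longrightarrow> lmap n A v = lmap k A v"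
  unfolding lmap_def fun_eq_iff by (intro allI sum.mono_neutral_right) (auto simp: E_iff)

text \<open>The columns of \<open>H\<close> need not end in \<open>\<real>^l\<close>, as a unit
  vector need not be a value of \<phi>. The truncation \<open>pr1 l\<close> does no harm on the
  image of \<phi>, where the values of \<open>H\<close> are those of \<psi> and lie in
  \<open>E l\<close> anyway.\<close>

lemma transition_of_vb_map:
  assumes W: "openin (stop (bas B)) W" "W \<subseteq> U \<inter> V"
    and H: "continuous_map (prod_topology (subtopology (stop (bas B)) W) (Eu n))
        (prod_topology (subtopology (stop (bas B)) W) (Eu n)) H"
    and lin: "\<And>y. y \<in> W \<Longrightarrow> (\<lambda>v. snd (H (y, v))) \<in> linear_maps (Euc n) (Euc n)"
    and s: "local_triv B (k, U, \<phi>)" and t: "local_triv B (l, V, \<psi>)" and n: "k \<le> n"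
    and eq: "\<And>a. a \<in> over B W \<Longrightarrow> H (\<phi> a) = \<psi> a"
  shows "transition B (k, U, \<phi>) (l, V, \<psi>) W (\<lambda>y j. pr1 l (snd (H (y, unit_vec j))))"
  unfolding transition_def prod.case
proof (intro conjI allI impI ballI)
  show "openin (stop (bas B)) W" "W \<subseteq> U \<inter> V" by (rule W)+
  show "pr1 l (snd (H (y, unit_vec j))) \<in> E l" for y j by (rule pr1_E)
  fix j i assume ji: "j < k" "i < l"
  have "continuous_map (subtopology (stop (bas B)) W) (prod_topology (subtopology (stop (bas B)) W) (Eu n)) (\<lambda>y. (y, unit_vec j))"
    using ji n by (intro continuous_map_pairedI) (auto simp: continuous_map_id [unfolded id_def])
  from continuous_map_compose [OF continuous_map_compose [OF continuous_map_compose [OF this H] continuous_map_snd]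
      continuous_map_coord, of i]
  show "cont_real (subtopology (stop (bas B)) W) (\<lambda>y. pr1 l (snd (H (y, unit_vec j))) i)"
    using ji by (simp add: o_def pr1_def)
next
  fix a assume a: "a \<in> over B W"
  have aU: "a \<in> over B U" "a \<in> over B V" "proj B a \<in> W" using a W(2) by (auto simp: over_def)
  define y v where "y = proj B a" and "v = snd (\<phi> a)"
  have v: "v \<in> E k" unfolding v_def by (rule local_triv_E [OF s aU(1)])
  have "\<phi> a = (y, v)" using local_triv_fst [OF s aU(1)] by (simp add: y_def v_def prod_eq_iff)
  then have \<psi>: "snd (H (y, v)) = snd (\<psi> a)" using eq [OF a] by simp
  have "snd (H (y, v)) = lmap n (\<lambda>j. snd (H (y, unit_vec j))) v"
    using linear_maps_eq_lmap [OF lin E_mono [OF n v]] aU(3) by (simp add: y_def)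
  also have "\<dots> = lmap k (\<lambda>j. snd (H (y, unit_vec j))) v" by (rule lmap_extend [OF v n])
  finally have 1: "lmap k (\<lambda>j. snd (H (y, unit_vec j))) v = snd (\<psi> a)" using \<psi> by simp
  have "lmap k (\<lambda>j. pr1 l (snd (H (y, unit_vec j)))) v i = snd (\<psi> a) i" for i
  proof (cases "i < l")
    case True
    then show ?thesis using fun_cong [OF 1, of i] by (simp add: lmap_def pr1_def)
  next
    case False
    then show ?thesis using E_zero [OF local_triv_E [OF t aU(2)], of i] by (simp add: lmap_def pr1_def)
  qed
  then show "lmap k (\<lambda>j. pr1 l (snd (H (proj B a, unit_vec j)))) (snd (\<phi> a)) = snd (\<psi> a)"
    unfolding y_def v_def by (rule ext)
qed

text \<open>The inverse of the homeomorphism \<open>H\<close> again preserves fibres and is linear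
  on each, so the same extraction of columns also yields the family in the other direction.\<close>

lemma compatible_imp_transition:
  assumes s: "local_triv B (k, U, \<phi>)" and t: "local_triv B (l, V, \<psi>)"
    and c: "compatible B (k, U, \<phi>) (l, V, \<psi>)" and x: "x \<in> U" "x \<in> V"
  shows "\<exists>W K L. x \<in> W \<and> transition B (k, U, \<phi>) (l, V, \<psi>) W K \<and> transition B (l, V, \<psi>) (k, U, \<phi>) W L"
proof -
  let ?n = "max k l"
  obtain W H where W: "openin (stop (bas B)) W" "x \<in> W" "W \<subseteq> U \<inter> V"
    and vb: "vb_iso (subtopology (stop (bas B)) W) ?n H" and eq: "\<And>a. a \<in> over B W \<Longrightarrow> H (\<phi> a) = \<psi> a"
    using c x unfolding compatible_def prod.case by (metis IntI)
  let ?T = "prod_topology (subtopology (stop (bas B)) W) (Eu ?n)"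
  have tW: "topspace (subtopology (stop (bas B)) W) = W" using openin_subset [OF W(1)] by auto
  have top: "topspace ?T = W \<times> E ?n" unfolding topspace_prod_topology tW ..
  have hom: "homeomorphic_map ?T ?T H" and Hf: "\<And>y v. y \<in> W \<Longrightarrow> v \<in> E ?n \<Longrightarrow> fst (H (y, v)) = y"
    and lin: "\<And>y. y \<in> W \<Longrightarrow> (\<lambda>v. snd (H (y, v))) \<in> linear_maps (Euc ?n) (Euc ?n)"
    using vb unfolding vb_iso_def tW by auto
  obtain G where G: "homeomorphic_maps ?T ?T H G" using hom homeomorphic_map_maps by blast
  then have cG: "continuous_map ?T ?T G" and cH: "continuous_map ?T ?T H"
    and GH: "\<And>z. z \<in> W \<times> E ?n \<Longrightarrow> G (H z) = z" and HG: "\<And>z. z \<in> W \<times> E ?n \<Longrightarrow> H (G z) = z"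
    unfolding homeomorphic_maps_def top by auto
  have GT: "G z \<in> W \<times> E ?n" if "z \<in> W \<times> E ?n" for z
    using cG that unfolding continuous_map_def top by blast
  have Gf: "G (y, v) = (y, snd (G (y, v)))" if "y \<in> W" "v \<in> E ?n" for y v
  proof -
    have "G (y, v) \<in> W \<times> E ?n" using GT that by blast
    then have "fst (H (G (y, v))) = fst (G (y, v))" using Hf [of "fst (G (y, v))" "snd (G (y, v))"] by auto
    then show ?thesis using HG [of "(y, v)"] that by (simp add: prod_eq_iff)
  qed
  have linG: "(\<lambda>v. snd (G (y, v))) \<in> linear_maps (Euc ?n) (Euc ?n)" if y: "y \<in> W" for y
  proof -
    define M where "M v = snd (H (y, v))" for v
    have M: "M \<in> linear_maps (Euc ?n) (Euc ?n)" unfolding M_def using lin [OF y] .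
    have "bij_betw M (E ?n) (E ?n)"
    proof (rule bij_betwI [where g = "\<lambda>v. snd (G (y, v))"])
      show "M \<in> E ?n \<rightarrow> E ?n" using linear_maps_E [OF M] by blast
      show "(\<lambda>v. snd (G (y, v))) \<in> E ?n \<rightarrow> E ?n" using GT y by fastforce
      show "snd (G (y, M v)) = v" if "v \<in> E ?n" for v
      proof -
        have "H (y, v) = (y, M v)" using Hf [OF y that] by (simp add: M_def prod_eq_iff)
        then show ?thesis using GH [of "(y, v)"] y that by simp
      qed
      show "M (snd (G (y, v))) = v" if "v \<in> E ?n" for v
        using HG [of "(y, v)"] Gf [OF y that] y that unfolding M_def by (metis SigmaI snd_conv)
    qed
    then have iso: "linear_iso (Euc ?n) (Euc ?n) M" using M by (simp add: linear_iso_def)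
    have "snd (G (y, v)) = inv_into (E ?n) M v" if v: "v \<in> E ?n" for v
    proof -
      have "snd (G (y, v)) \<in> E ?n" using GT [of "(y, v)"] y v by auto
      moreover have "M (snd (G (y, v))) = v"
        using HG [of "(y, v)"] Gf [OF y v] y v unfolding M_def by (metis SigmaI snd_conv)
      ultimately show ?thesis using iso by (metis Euc_simps(1) bij_betw_def inv_into_f_f linear_iso_def)
    qed
    note inv = this
    have "inv_into (E ?n) M \<in> linear_maps (Euc ?n) (Euc ?n)"
      using linear_iso_inverse [OF iso module_Euc module_Euc] unfolding linear_iso_def Euc_simps by (rule conjunct1)
    then show ?thesis by (rule linear_maps_cong [OF _ module_Euc]) (simp add: inv)
  qed
  have eq': "G (\<psi> a) = \<phi> a" if a: "a \<in> over B W" for a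
  proof -
    have aU: "a \<in> over B U" "proj B a \<in> W" using a W(3) by (auto simp: over_def)
    have "\<phi> a \<in> W \<times> E ?n"
      using local_triv_fst [OF s aU(1)] E_mono [OF _ local_triv_E [OF s aU(1)], of ?n] aU(2)
      by (simp add: mem_Times_iff)
    from GH [OF this] show ?thesis unfolding eq [OF a] .
  qed
  have W': "W \<subseteq> V \<inter> U" using W(3) by blast
  show ?thesis
    using W(2) transition_of_vb_map [OF W(1,3) cH lin s t max.cobounded1 eq]
      transition_of_vb_map [OF W(1) W' cG linG t s max.cobounded2 eq']
    by blast
qed

text \<open>Both families are brought to square size by zero columns and zero rows; the values of
  \<phi> have no entries in the added columns.\<close>

lemma transition_extend:
  assumes s: "local_triv B (k, U, \<phi>)" and K: "transition B (k, U, \<phi>) (l, V, \<psi>) W K" and n: "k \<le> n" "l \<le> n"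
  shows "\<exists>K'. (\<forall>y\<in>W. \<forall>j. K' y j \<in> E n) \<and> (\<forall>j i. cont_real (subtopology (stop (bas B)) W) (\<lambda>y. K' y j i)) \<and>
    (\<forall>a\<in>over B W. lmap n (K' (proj B a)) (snd (\<phi> a)) = snd (\<psi> a))"
proof (intro exI conjI ballI allI)
  let ?K = "\<lambda>y j. if j < k then K y j else (\<lambda>i. 0)" and ?X = "subtopology (stop (bas B)) W"
  show "?K y j \<in> E n" if y: "y \<in> W" for y j
    using K y n(2) E_mono [of l n "K y j"] by (auto simp: transition_def)
  show "cont_real ?X (\<lambda>y. ?K y j i)" for j i
  proof (cases "j < k \<and> i < l")
    case True
    then show ?thesis using K by (simp add: transition_def)
  next
    case False
    have "cont_real ?X (\<lambda>y. 0)" by simp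
    then show ?thesis
      by (rule continuous_map_eq) (use False K in \<open>auto simp: transition_def E_iff\<close>)
  qed
  fix a assume a: "a \<in> over B W"
  have "a \<in> over B U" using a K by (auto simp: over_def transition_def)
  then have "lmap n (?K (proj B a)) (snd (\<phi> a)) = lmap k (?K (proj B a)) (snd (\<phi> a))"
    by (rule lmap_extend [OF local_triv_E [OF s] n(1)])
  also have "\<dots> = lmap k (K (proj B a)) (snd (\<phi> a))" by (simp cong: lmap_cong)
  also have "\<dots> = snd (\<psi> a)" using K a by (simp add: transition_def)
  finally show "lmap n (?K (proj B a)) (snd (\<phi> a)) = snd (\<psi> a)" .
qed

text \<open>Neither family has to be invertible. On the image of \<phi>, however, \<open>L\<close>
  undoes \<open>K\<close>, so \<open>K + Z (1 - L K)\<close> carries \<phi> to \<psi> for every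
  matrix \<open>Z\<close>. A suitable \<open>Z\<close> makes this invertible at \<open>x\<close>,
  and then it is invertible near \<open>x\<close>.\<close>

lemma transition_imp_compatible:
  assumes s: "local_triv B (k, U, \<phi>)" and t: "local_triv B (l, V, \<psi>)"
    and tr: "\<And>x. x \<in> U \<Longrightarrow> x \<in> V \<Longrightarrow>
      \<exists>W K L. x \<in> W \<and> transition B (k, U, \<phi>) (l, V, \<psi>) W K \<and> transition B (l, V, \<psi>) (k, U, \<phi>) W L"
  shows "compatible B (k, U, \<phi>) (l, V, \<psi>)"
  unfolding compatible_def prod.case
proof
  fix x assume x: "x \<in> U \<inter> V"
  let ?n = "max k l"
  obtain W K L where xW: "x \<in> W" and K: "transition B (k, U, \<phi>) (l, V, \<psi>) W K"
    and L: "transition B (l, V, \<psi>) (k, U, \<phi>) W L" using tr x by blast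
  have W: "openin (stop (bas B)) W" "W \<subseteq> U \<inter> V" using K by (simp_all add: transition_def)
  let ?X = "subtopology (stop (bas B)) W"
  have tW: "topspace ?X = W" using openin_subset [OF W(1)] by auto
  obtain K' where K': "\<forall>y\<in>W. \<forall>j. K' y j \<in> E ?n" "\<forall>j i. cont_real ?X (\<lambda>y. K' y j i)"
      "\<forall>a\<in>over B W. lmap ?n (K' (proj B a)) (snd (\<phi> a)) = snd (\<psi> a)"
    using transition_extend [OF s K max.cobounded1 max.cobounded2] by (elim exE conjE)
  obtain L' where L': "\<forall>y\<in>W. \<forall>j. L' y j \<in> E ?n" "\<forall>j i. cont_real ?X (\<lambda>y. L' y j i)"
      "\<forall>a\<in>over B W. lmap ?n (L' (proj B a)) (snd (\<psi> a)) = snd (\<phi> a)"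
    using transition_extend [OF t L max.cobounded2 max.cobounded1] by (elim exE conjE)
  note K'E = K'(1) [rule_format] and L'E = L'(1) [rule_format] and K'c = K'(2) [rule_format] and L'c = L'(2) [rule_format]
  \<comment> \<open>\<open>Z\<close> is chosen at \<open>x\<close> only and does not vary with the
    base point, so continuity of \<open>H\<close> is inherited from \<open>K'\<close> and
    \<open>L'\<close>.\<close>
  obtain Z where Z: "\<And>j. Z j \<in> E ?n" and Zi: "\<And>v. v \<in> E ?n \<Longrightarrow>
      (\<forall>i. lmap ?n (K' x) v i + lmap ?n Z (\<lambda>i. v i - lmap ?n (L' x) (lmap ?n (K' x) v) i) i = 0) \<Longrightarrow> v = (\<lambda>i. 0)"
    using invertible_correction [of ?n "K' x" "L' x", OF K'E [OF xW] L'E [OF xW]] by (elim exE conjE) blast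
  define H where "H y v = (\<lambda>i. lmap ?n (K' y) v i + lmap ?n Z (\<lambda>i. v i - lmap ?n (L' y) (lmap ?n (K' y) v) i) i)" for y v
  define M where "M y j = H y (unit_vec j)" for y j
  have Hlin: "H y \<in> linear_maps (Euc ?n) (Euc ?n)" if y: "y \<in> W" for y
  proof -
    have 1: "lmap ?n (K' y) \<in> linear_maps (Euc ?n) (Euc ?n)" "lmap ?n Z \<in> linear_maps (Euc ?n) (Euc ?n)"
      "lmap ?n (L' y) \<in> linear_maps (Euc ?n) (Euc ?n)"
      using K'E [OF y] L'E [OF y] Z by (auto intro: lmap_linear_maps)
    have "(\<lambda>v i. v i + (-1) * lmap ?n (L' y) (lmap ?n (K' y) v) i) \<in> linear_maps (Euc ?n) (Euc ?n)"
      by (rule linear_maps_Euc_add [OF linear_maps_id linear_maps_Euc_scale [OF linear_maps_comp [OF 1(1,3)]]])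
    from linear_maps_Euc_add [OF 1(1) linear_maps_comp [OF this 1(2)]] show ?thesis
      unfolding H_def by simp
  qed
  have ME: "M y j \<in> E ?n" if "y \<in> W" "j < ?n" for y j
    unfolding M_def using linear_maps_E [OF Hlin [OF that(1)]] that(2) by simp
  have HM: "H y v = lmap ?n (M y) v" if "y \<in> W" "v \<in> E ?n" for y v
    unfolding M_def using linear_maps_eq_lmap [OF Hlin [OF that(1)] that(2)] .
  have Mc: "cont_real ?X (\<lambda>y. M y j i)" if "j < ?n" for j i
    unfolding M_def H_def
    by (intro continuous_map_add continuous_map_lmap continuous_map_diff K'c L'c) auto
  have Mx: "v = (\<lambda>i. 0)" if "v \<in> E ?n" "lmap ?n (M x) v = (\<lambda>i. 0)" for v
  proof (rule Zi [OF that(1)])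
    have "H x v = (\<lambda>i. 0)" using HM [OF xW that(1)] that(2) by simp
    then show "\<forall>i. lmap ?n (K' x) v i + lmap ?n Z (\<lambda>i. v i - lmap ?n (L' x) (lmap ?n (K' x) v) i) i = 0"
      unfolding H_def fun_eq_iff .
  qed
  have "x \<in> topspace ?X" using xW tW by simp
  then obtain N where N: "openin ?X N" "x \<in> N" "\<And>y v. y \<in> N \<Longrightarrow> v \<in> E ?n \<Longrightarrow> lmap ?n (M y) v = (\<lambda>i. 0) \<Longrightarrow> v = (\<lambda>i. 0)"
    using injective_near [of ?n ?n ?X M x, OF Mc ME [OF xW] _ Mx] by blast
  have NW: "N \<subseteq> W" using openin_subset [OF N(1)] tW by simp
  have oN: "openin (stop (bas B)) N" using N(1) W(1) openin_trans_full by blast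
  let ?XN = "subtopology (stop (bas B)) N"
  have tN: "topspace ?XN = N" using openin_subset [OF oN] by auto
  let ?T = "prod_topology ?XN (Eu ?n)"
  have top: "topspace ?T = N \<times> E ?n" unfolding topspace_prod_topology tN ..
  have McN: "cont_real ?T (\<lambda>z. M (fst z) j i)" if "j < ?n" for j i
  proof -
    have "cont_real ?XN (\<lambda>y. M y j i)"
      using continuous_map_from_subtopology_mono [OF Mc [OF that] NW] .
    from continuous_map_compose [OF continuous_map_fst this] show ?thesis by (simp add: o_def)
  qed
  have snd_c: "cont_real ?T (\<lambda>z. snd z i)" for i
    using continuous_map_compose [OF continuous_map_snd continuous_map_coord] by (simp add: o_def)
  define G where "G y u = the_inv_into (E ?n) (lmap ?n (M y)) u" for y u
  have inj: "inj_on (lmap ?n (M y)) (E ?n)" if "y \<in> N" for y by (rule inj_on_lmap [OF N(3) [OF that]])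
  have surj: "lmap ?n (M y) ` E ?n = E ?n" if y: "y \<in> N" for y
  proof (rule lmap_surj)
    show "M y j \<in> E ?n" if "j < ?n" for j using y NW that by (intro ME) auto
    show "v = (\<lambda>i. 0)" if "v \<in> E ?n" "lmap ?n (M y) v = (\<lambda>i. 0)" for v by (rule N(3) [OF y that])
  qed
  have GE: "G y u \<in> E ?n" "lmap ?n (M y) (G y u) = u" if "y \<in> N" "u \<in> E ?n" for y u
    unfolding G_def using the_inv_into_into [OF inj [OF that(1)] _ subset_refl] f_the_inv_into_f [OF inj [OF that(1)]]
      surj [OF that(1)] that(2) by auto
  have GM: "G y (lmap ?n (M y) v) = v" if "y \<in> N" "v \<in> E ?n" for y v
    unfolding G_def using the_inv_into_f_f [OF inj [OF that(1)] that(2)] .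
  have ME': "M (fst z) j \<in> E ?n" if "z \<in> topspace ?T" "j < ?n" for z j
    using that NW ME unfolding top by auto
  have c1: "continuous_map ?T ?T (\<lambda>z. (fst z, lmap ?n (M (fst z)) (snd z)))"
  proof (intro continuous_map_pairedI continuous_map_fst)
    show "continuous_map ?T (Eu ?n) (\<lambda>z. lmap ?n (M (fst z)) (snd z))"
      unfolding continuous_map_Euc_iff
      by (intro conjI ballI allI impI lmap_E ME' continuous_map_lmap McN snd_c)
  qed
  have c2: "continuous_map ?T ?T (\<lambda>z. (fst z, G (fst z) (snd z)))"
  proof (intro continuous_map_pairedI continuous_map_fst)
    show "continuous_map ?T (Eu ?n) (\<lambda>z. G (fst z) (snd z))"
      unfolding continuous_map_Euc_iff
    proof (intro conjI ballI allI impI)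
      show "G (fst z) (snd z) \<in> E ?n" if "z \<in> topspace ?T" for z using that GE(1) unfolding top by auto
      fix j assume j: "j < ?n"
      \<comment> \<open>The inverse is known only pointwise; applying the injective family
        \<open>M\<close> to it gives the second projection, which is continuous.\<close>
      show "cont_real ?T (\<lambda>z. G (fst z) (snd z) j)"
      proof (rule continuous_map_cancel_injective [where A = "\<lambda>z. M (fst z)" and p = ?n and q = ?n, OF McN ME' _ _ _ j])
        show "v = (\<lambda>i. 0)" if "z \<in> topspace ?T" "v \<in> E ?n" "lmap ?n (M (fst z)) v = (\<lambda>i. 0)" for z v
          using N(3) that unfolding top by (auto simp del: topspace_prod_topology)
        show "G (fst z) (snd z) \<in> E ?n" if "z \<in> topspace ?T" for z using that GE(1) unfolding top by auto
        show "cont_real ?T (\<lambda>z. lmap ?n (M (fst z)) (G (fst z) (snd z)) i)" for i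
          by (rule continuous_map_eq [OF snd_c]) (use GE(2) in \<open>auto simp: tN simp del: topspace_subtopology\<close>)
      qed
    qed
  qed
  have "homeomorphic_maps ?T ?T (\<lambda>z. (fst z, lmap ?n (M (fst z)) (snd z))) (\<lambda>z. (fst z, G (fst z) (snd z)))"
    unfolding homeomorphic_maps_def top using c1 c2 GM GE(2) by auto
  then have "homeomorphic_map ?T ?T (\<lambda>z. (fst z, lmap ?n (M (fst z)) (snd z)))"
    using homeomorphic_map_maps by blast
  then have vb: "vb_iso ?XN ?n (\<lambda>z. (fst z, lmap ?n (M (fst z)) (snd z)))"
    unfolding vb_iso_def tN using lmap_linear_maps [of ?n "M y" ?n for y] ME NW by (auto simp: subset_iff)
  have eq: "(fst (\<phi> a), lmap ?n (M (fst (\<phi> a))) (snd (\<phi> a))) = \<psi> a" if a: "a \<in> over B N" for a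
  proof -
    have aW: "a \<in> over B W" "a \<in> over B U" "a \<in> over B V" "proj B a \<in> W"
      using a NW W(2) by (auto simp: over_def)
    define y v where "y = proj B a" and "v = snd (\<phi> a)"
    have v: "v \<in> E ?n" using local_triv_E [OF s aW(2)] E_mono [of k ?n] by (auto simp: v_def)
    have Kv: "lmap ?n (K' y) v = snd (\<psi> a)" and Lw: "lmap ?n (L' y) (snd (\<psi> a)) = v"
      using K'(3) L'(3) aW(1) by (simp_all add: y_def v_def)
    have "lmap ?n (M y) v = H y v" using HM [OF _ v] aW(4) by (simp add: y_def)
    \<comment> \<open>On values of \<phi> the vector \<open>v - L K v\<close> is zero, so the
      correction \<open>Z\<close> has no effect.\<close>
    also have "\<dots> = snd (\<psi> a)" unfolding H_def Kv Lw by (simp add: lmap_def)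
    finally have "lmap ?n (M y) v = snd (\<psi> a)" .
    then show ?thesis
      using local_triv_fst [OF s aW(2)] local_triv_fst [OF t aW(3)] by (simp add: y_def v_def prod_eq_iff)
  qed
  have "N \<subseteq> U \<inter> V" using NW W(2) by blast
  with oN N(2) vb eq show "\<exists>W H. openin (stop (bas B)) W \<and> x \<in> W \<and> W \<subseteq> U \<inter> V \<and>
      vb_iso (subtopology (stop (bas B)) W) ?n H \<and> (\<forall>a\<in>over B W. H (\<phi> a) = \<psi> a)"
    by (intro exI conjI ballI) assumption+
qed

lemma transition_trans:
  assumes K: "transition B (k, U, \<phi>) (l, V, \<psi>) W K" and L: "transition B (l, V, \<psi>) (m, Y, \<omega>) W' L"
  shows "transition B (k, U, \<phi>) (m, Y, \<omega>) (W \<inter> W') (\<lambda>y j. lmap l (L y) (K y j))"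
  unfolding transition_def prod.case
proof (intro conjI allI impI ballI)
  note K = K [unfolded transition_def prod.case] and L = L [unfolded transition_def prod.case]
  show "openin (stop (bas B)) (W \<inter> W')" using K L by (intro openin_Int) blast+
  show "W \<inter> W' \<subseteq> U \<inter> Y" using K L by blast
  show "lmap l (L y) (K y j) \<in> E m" if "y \<in> W \<inter> W'" "j < k" for y j
    using L that by (intro lmap_E) blast
  show "cont_real (subtopology (stop (bas B)) (W \<inter> W')) (\<lambda>y. lmap l (L y) (K y j) i)"
    if "j < k" "i < m" for j i
  proof (intro continuous_map_lmap)
    fix n assume "n < l"
    then have "cont_real (subtopology (stop (bas B)) W') (\<lambda>y. L y n i)"
      "cont_real (subtopology (stop (bas B)) W) (\<lambda>y. K y j n)" using K L that by blast+
    then show "cont_real (subtopology (stop (bas B)) (W \<inter> W')) (\<lambda>y. L y n i)"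
      "cont_real (subtopology (stop (bas B)) (W \<inter> W')) (\<lambda>y. K y j n)"
      by (auto intro: continuous_map_from_subtopology_mono)
  qed
  fix a assume a: "a \<in> over B (W \<inter> W')"
  then have aW: "a \<in> over B W" "a \<in> over B W'" "proj B a \<in> W" by (auto simp: over_def)
  have "lmap k (\<lambda>j. lmap l (L (proj B a)) (K (proj B a) j)) (snd (\<phi> a))
      = lmap l (L (proj B a)) (lmap k (K (proj B a)) (snd (\<phi> a)))"
    using K aW(3) by (intro lmap_lmap [symmetric, of k _ l]) blast
  also have "\<dots> = snd (\<omega> a)" using K L aW by simp
  finally show "lmap k (\<lambda>j. lmap l (L (proj B a)) (K (proj B a) j)) (snd (\<phi> a)) = snd (\<omega> a)" .
qed

text \<open>Transition families come in both directions, so the roles can be exchanged.\<close>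

lemma compatible_sym:
  assumes "local_triv B s" "local_triv B t" "compatible B s t"
  shows "compatible B t s"
proof -
  obtain k U \<phi> l V \<psi> where st: "s = (k, U, \<phi>)" "t = (l, V, \<psi>)" by (metis prod_cases3)
  show ?thesis
    unfolding st
    by (rule transition_imp_compatible [OF assms(2) [unfolded st] assms(1) [unfolded st]])
      (use compatible_imp_transition [OF assms [unfolded st]] in blast)
qed

text \<open>The intermediate trivialization may need more coordinates than the two outer ones, and
  then the composed isomorphisms live on too large a space. Transition families do compose, and the
  dimension in the middle disappears in the matrix product.\<close>

lemma compatible_trans_via:
  assumes s: "local_triv B s" and t: "local_triv B t"
    and G: "\<And>x. x \<in> spt (bas B) \<Longrightarrow> \<exists>n Y \<omega>. x \<in> Y \<and> local_triv B (n, Y, \<omega>) \<and>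
      compatible B s (n, Y, \<omega>) \<and> compatible B (n, Y, \<omega>) t"
  shows "compatible B s t"
proof -
  obtain k U \<phi> l V \<psi> where st: "s = (k, U, \<phi>)" "t = (l, V, \<psi>)" by (metis prod_cases3)
  note s = s [unfolded st] and t = t [unfolded st]
  show ?thesis
    unfolding st
  proof (rule transition_imp_compatible [OF s t])
    fix x assume x: "x \<in> U" "x \<in> V"
    then have "x \<in> spt (bas B)" using openin_subset [OF local_triv_open [OF s]] by blast
    from G [OF this] obtain n Y \<omega> where g: "x \<in> Y" "local_triv B (n, Y, \<omega>)"
      "compatible B (k, U, \<phi>) (n, Y, \<omega>)" "compatible B (n, Y, \<omega>) (l, V, \<psi>)"
      unfolding st by (elim exE conjE)
    from compatible_imp_transition [OF s g(2,3) x(1) g(1)] obtain W K L where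
      1: "x \<in> W" "transition B (k, U, \<phi>) (n, Y, \<omega>) W K" "transition B (n, Y, \<omega>) (k, U, \<phi>) W L"
      by (elim exE conjE)
    from compatible_imp_transition [OF g(2) t g(4) g(1) x(2)] obtain W' K' L' where
      2: "x \<in> W'" "transition B (n, Y, \<omega>) (l, V, \<psi>) W' K'" "transition B (l, V, \<psi>) (n, Y, \<omega>) W' L'"
      by (elim exE conjE)
    have "transition B (l, V, \<psi>) (k, U, \<phi>) (W \<inter> W') (\<lambda>y j. lmap n (L y) (L' y j))"
      using transition_trans [OF 2(3) 1(3)] by (simp add: Int_commute)
    with transition_trans [OF 1(2) 2(2)] 1(1) 2(1)
    show "\<exists>W K L. x \<in> W \<and> transition B (k, U, \<phi>) (l, V, \<psi>) W K \<and> transition B (l, V, \<psi>) (k, U, \<phi>) W L"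
      by (intro exI [of _ "W \<inter> W'"] exI conjI) auto
  qed
qed

text \<open>As for maximal smooth atlases: trivializations compatible with all generators are
  compatible with each other, since some generator is defined about each point.\<close>

lemma injective_structure_generated:
  assumes loc: "\<And>t. t \<in> \<G> \<Longrightarrow> local_triv B t" and cover: "(\<Union>(n, U, \<phi>)\<in>\<G>. U) = spt (bas B)"
    and comp: "\<And>s t. s \<in> \<G> \<Longrightarrow> t \<in> \<G> \<Longrightarrow> compatible B s t"
  shows "injective_structure B (generated_structure B \<G>)"
proof -
  have sub: "\<G> \<subseteq> generated_structure B \<G>" using loc comp by (auto simp: generated_structure_def)
  have lt: "local_triv B t" if "t \<in> generated_structure B \<G>" for t using that by (simp add: generated_structure_def)
  have "(\<Union>(n, U, \<phi>)\<in>generated_structure B \<G>. U) = spt (bas B)"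
  proof
    show "(\<Union>(n, U, \<phi>)\<in>generated_structure B \<G>. U) \<subseteq> spt (bas B)"
    proof
      fix x assume "x \<in> (\<Union>(n, U, \<phi>)\<in>generated_structure B \<G>. U)"
      then obtain n U \<phi> where t: "(n, U, \<phi>) \<in> generated_structure B \<G>" "x \<in> U" by blast
      show "x \<in> spt (bas B)" using openin_subset [OF local_triv_open [OF lt [OF t(1)]]] t(2) by blast
    qed
    show "spt (bas B) \<subseteq> (\<Union>(n, U, \<phi>)\<in>generated_structure B \<G>. U)" using sub unfolding cover [symmetric] by blast
  qed
  moreover have "compatible B s t" if s: "s \<in> generated_structure B \<G>" and t: "t \<in> generated_structure B \<G>" for s t
  proof (rule compatible_trans_via [OF lt [OF s] lt [OF t]])
    fix x assume "x \<in> spt (bas B)"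
    then obtain n Y \<omega> where g: "(n, Y, \<omega>) \<in> \<G>" "x \<in> Y" unfolding cover [symmetric] by blast
    have "compatible B (n, Y, \<omega>) s" "compatible B (n, Y, \<omega>) t"
      using s t g(1) by (simp_all add: generated_structure_def)
    then show "\<exists>n Y \<omega>. x \<in> Y \<and> local_triv B (n, Y, \<omega>) \<and> compatible B s (n, Y, \<omega>) \<and> compatible B (n, Y, \<omega>) t"
      using g loc [OF g(1)] compatible_sym [OF loc [OF g(1)] lt [OF s]] by blast
  qed
  moreover have "t \<in> generated_structure B \<G>"
    if "local_triv B t \<and> (\<forall>s\<in>generated_structure B \<G>. compatible B s t)" for t
    unfolding generated_structure_def using that sub by blast
  ultimately show ?thesis
    unfolding injective_structure_def by (intro conjI ballI allI impI lt)
qed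

lemma second_countable_euclidean: "second_countable (euclidean :: 'a :: second_countable_topology topology)"
proof -
  obtain \<B> :: "'a set set" where \<B>: "countable \<B>" "\<And>C. C \<in> \<B> \<Longrightarrow> open C"
      "\<And>S. open S \<Longrightarrow> \<exists>\<U>. \<U> \<subseteq> \<B> \<and> S = \<Union>\<U>"
    by (rule univ_second_countable) blast
  show ?thesis
    unfolding second_countable_def
  proof (intro exI [of _ \<B>] conjI ballI allI impI)
    show "openin euclidean V" if "V \<in> \<B>" for V using \<B>(2) that by simp
    fix U x assume U: "openin euclidean U \<and> x \<in> (U :: 'a set)"
    then have "open U" by simp
    from \<B>(3) [OF this] obtain \<U> where "\<U> \<subseteq> \<B>" "U = \<Union>\<U>" by (elim exE conjE)
    with U show "\<exists>V\<in>\<B>. x \<in> V \<and> V \<subseteq> U" by blast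
  qed (rule \<B>(1))
qed

lemma second_countable_prod_topology:
  assumes "second_countable S" "second_countable T"
  shows "second_countable (prod_topology S T)"
proof -
  obtain \<B> where \<B>: "countable \<B>" "\<forall>V\<in>\<B>. openin S V" "\<forall>U x. openin S U \<and> x \<in> U \<longrightarrow> (\<exists>V\<in>\<B>. x \<in> V \<and> V \<subseteq> U)"
    using assms(1) unfolding second_countable_def by (elim exE conjE)
  obtain \<C> where \<C>: "countable \<C>" "\<forall>V\<in>\<C>. openin T V" "\<forall>U x. openin T U \<and> x \<in> U \<longrightarrow> (\<exists>V\<in>\<C>. x \<in> V \<and> V \<subseteq> U)"
    using assms(2) unfolding second_countable_def by (elim exE conjE)
  show ?thesis
    unfolding second_countable_def
  proof (intro exI [of _ "(\<lambda>(U, V). U \<times> V) ` (\<B> \<times> \<C>)"] conjI ballI allI impI)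
    show "countable ((\<lambda>(U, V). U \<times> V) ` (\<B> \<times> \<C>))" using \<B>(1) \<C>(1) by simp
    show "openin (prod_topology S T) V" if "V \<in> (\<lambda>(U, V). U \<times> V) ` (\<B> \<times> \<C>)" for V
      using that \<B>(2) \<C>(2) by (auto simp: openin_prod_Times_iff)
    fix U z assume U: "openin (prod_topology S T) U \<and> z \<in> U"
    obtain x y where z: "z = (x, y)" by (metis surj_pair)
    obtain V W where VW: "openin S V" "openin T W" "x \<in> V" "y \<in> W" "V \<times> W \<subseteq> U"
      using U unfolding z openin_prod_topology_alt by blast
    obtain V' where V': "V' \<in> \<B>" "x \<in> V'" "V' \<subseteq> V" using \<B>(3) VW(1,3) by blast
    obtain W' where W': "W' \<in> \<C>" "y \<in> W'" "W' \<subseteq> W" using \<C>(3) VW(2,4) by blast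
    have "V' \<times> W' \<in> (\<lambda>(U, V). U \<times> V) ` (\<B> \<times> \<C>)" using V'(1) W'(1) by blast
    moreover have "z \<in> V' \<times> W'" "V' \<times> W' \<subseteq> U" using V' W' VW(5) z by blast+
    ultimately show "\<exists>V\<in>(\<lambda>(U, V). U \<times> V) ` (\<B> \<times> \<C>). z \<in> V \<and> V \<subseteq> U" by blast
  qed
qed

section \<open>The topology of \<open>F(A)\<close>\<close>

locale whitney_functor = coordinate_functor emb F
  for emb :: "vec \<Rightarrow> 'v" and F :: "('v, unit) vs_functor" +
  fixes B :: "('v, 'x) svb" and \<A> :: "('v, 'x) triv set"
  assumes whitney: "whitney_A_bundle B \<A>"
begin

abbreviation "X \<equiv> stop (bas B)"
abbreviation "\<S> \<equiv> strata (bas B)"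
abbreviation "XM V \<equiv> sub_mfd (bas B) V"
abbreviation "TM V k \<equiv> prod_mfd (XM V) (euc_mfd k)"
abbreviation "AM V \<equiv> sub_mfd (tot B) (over B V)"
abbreviation "topA V \<equiv> subtopology (stop (tot B)) (over B V)"
abbreviation "prodT U m \<equiv> prod_topology (subtopology X U) (Eu m)"
abbreviation "FT \<equiv> functor_topology emb F B \<A>"
abbreviation "FB \<equiv> functor_bundle emb F B \<A>"

definition FS :: "'x set \<Rightarrow> ('x \<times> 'v) set"
  where "FS U = functor_tot F B \<inter> fst -` U"

abbreviation "FM V \<equiv> sub_mfd (tot FB) (FS V)"
abbreviation "FTS U \<equiv> subtopology FT (FS U)"

lemma svb: "stratified_vector_bundle B" and inj_struct: "injective_structure B \<A>"
  using whitney by (simp_all add: whitney_A_bundle_def)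

lemma strat_tot: "stratified_space (tot B)" and strat_bas: "stratified_space (bas B)"
  using svb by (simp_all add: stratified_vector_bundle_def)

lemma part_bas: "partition_on (topspace X) (\<S>)"
  and Hausdorff_X: "Hausdorff_space X" and second_X: "second_countable X" and paracompact_X: "paracompact_space X"
  using strat_bas by (simp_all add: stratified_space_def)

lemma stratum_subset: "S \<in> \<S> \<Longrightarrow> S \<subseteq> topspace X"
  using part_bas by (auto simp: partition_on_def)

lemma stratum_of: "x \<in> topspace X \<Longrightarrow> \<exists>S\<in>\<S>. x \<in> S"
  using part_bas by (auto simp: partition_on_def)

lemma smooth_vb_stratum:
  assumes "S \<in> \<S>"
  shows "over B S \<in> strata (tot B)" "\<exists>r. smooth_vb B S r"
  using svb assms by (simp_all add: stratified_vector_bundle_def)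

lemma fd_fibre: "x \<in> topspace X \<Longrightarrow> fd_vspace (fibre B x)"
  using stratum_of smooth_vb_stratum(2) unfolding smooth_vb_def by blast

lemma triv_local: "t \<in> \<A> \<Longrightarrow> local_triv B t"
  using inj_struct by (simp add: injective_structure_def)

lemmas triv_embedding = local_triv_embedding [OF triv_local]
  and triv_inj_fibre = local_triv_inj_fibre [OF triv_local]
  and triv_linear = local_triv_linear [OF triv_local]
  and triv_open = local_triv_open [OF triv_local]

lemma triv_cover: "x \<in> topspace X \<Longrightarrow> \<exists>k U \<phi>. (k, U, \<phi>) \<in> \<A> \<and> x \<in> U"
proof -
  assume "x \<in> topspace X"
  then have "x \<in> (\<Union>(n, U, \<phi>)\<in>\<A>. U)" using inj_struct by (simp add: injective_structure_def)
  then show ?thesis by blast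
qed

lemma triv_compatible: "s \<in> \<A> \<Longrightarrow> t \<in> \<A> \<Longrightarrow> compatible B s t"
  using inj_struct by (simp add: injective_structure_def)

lemma triv_subset: "(k, U, \<phi>) \<in> \<A> \<Longrightarrow> U \<subseteq> topspace X"
  using openin_subset [OF local_triv_open [OF triv_local]] .

text \<open>The common ground of the injective local trivializations and the smooth ones, so that
  \<open>Fl\<close> and its rules serve both.\<close>

definition fibre_linear :: "'x set \<Rightarrow> nat \<Rightarrow> ('v \<Rightarrow> 'x \<times> vec) \<Rightarrow> bool"
  where "fibre_linear V k \<phi> \<longleftrightarrow> V \<subseteq> topspace X \<and> (\<forall>x\<in>V. (\<lambda>a. snd (\<phi> a)) \<in> linear_maps (fibre B x) (Euc k))"

lemma triv_fibre_linear: "(k, U, \<phi>) \<in> \<A> \<Longrightarrow> fibre_linear U k \<phi>"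
  unfolding fibre_linear_def using triv_subset local_triv_linear [OF triv_local] by blast

definition Fl :: "nat \<Rightarrow> ('v \<Rightarrow> vec) \<Rightarrow> ('v \<Rightarrow> 'x \<times> vec) \<Rightarrow> 'x \<times> 'v \<Rightarrow> vec"
  where "Fl k I \<phi> z = flift (fibre B (fst z)) k I (\<lambda>a. snd (\<phi> a)) (snd z)"

abbreviation "FL k I \<phi> \<equiv> \<lambda>z. (fst z, Fl k I \<phi> z)"

lemma functor_lift_eq: "functor_lift emb F B k I \<phi> = (FL k I \<phi>)"
  by (simp add: functor_lift_def Fl_def flift_def ap_def fun_eq_iff)

lemma FS_iff: "z \<in> FS U \<longleftrightarrow> fst z \<in> topspace X \<and> fst z \<in> U \<and> snd z \<in> carrier (fobj F (fibre B (fst z)))"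
  by (cases z) (auto simp: FS_def functor_tot_def)

lemma FS_mono: "U \<subseteq> V \<Longrightarrow> FS U \<subseteq> FS V"
  by (auto simp: FS_def)

lemma FS_Int: "FS (U \<inter> V) = FS U \<inter> FS V"
  by (auto simp: FS_def)

lemma FS_UNIV: "functor_tot F B = FS UNIV" "functor_tot F B = FS (topspace X)"
  by (auto simp: FS_def functor_tot_def)

lemma Fl_E: "fibre_linear V k \<phi> \<Longrightarrow> ident k m I \<Longrightarrow> z \<in> FS V \<Longrightarrow> Fl k I \<phi> z \<in> E m"
  unfolding Fl_def FS_iff by (rule flift_E [OF fd_fibre]) (auto simp: fibre_linear_def)

lemmas triv_Fl_E = Fl_E [OF triv_fibre_linear]

text \<open>Functoriality inside one fibre: \<open>M\<close> has to carry \<phi> to \<psi> over the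
  single point \<open>fst z\<close> only, so that it may vary with the base point.\<close>

lemma Fl_transf:
  assumes "fibre_linear V k \<phi>" "ident k m I" "z \<in> FS V" "M \<in> linear_maps (Euc k) (Euc l)"
    and eq: "\<And>a. a \<in> over B {fst z} \<Longrightarrow> M (snd (\<phi> a)) = snd (\<psi> a)"
  shows "transf k l I I' M (Fl k I \<phi> z) = Fl l I' \<psi> z"
proof -
  have fd: "fd_vspace (fibre B (fst z))" using assms(3) by (simp add: FS_iff fd_fibre)
  have "transf k l I I' M (Fl k I \<phi> z) = flift (fibre B (fst z)) l I' (\<lambda>a. M (snd (\<phi> a))) (snd z)"
    unfolding Fl_def using assms(1,3)
    by (intro transf_flift [OF fd _ assms(4,2)]) (auto simp: fibre_linear_def FS_iff)
  also have "flift (fibre B (fst z)) l I' (\<lambda>a. M (snd (\<phi> a))) = flift (fibre B (fst z)) l I' (\<lambda>a. snd (\<psi> a))"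
    by (rule flift_cong [OF fd]) (use eq in \<open>simp add: fibre_def\<close>)
  finally show ?thesis by (simp add: Fl_def)
qed

lemma Fl_inj:
  assumes "fibre_linear V k \<phi>" "ident k m I" and inj: "\<And>x. x \<in> V \<Longrightarrow> inj_on (\<lambda>a. snd (\<phi> a)) (carrier (fibre B x))"
    and z: "z \<in> FS V" "z' \<in> FS V" "fst z = fst z'" "Fl k I \<phi> z = Fl k I \<phi> z'"
  shows "z = z'"
proof -
  have "inj_on (flift (fibre B (fst z)) k I (\<lambda>a. snd (\<phi> a))) (carrier (fobj F (fibre B (fst z))))"
    using assms(1-3) z(1) by (intro flift_inj [OF fd_fibre]) (auto simp: fibre_linear_def FS_iff)
  then have "snd z = snd z'"
    by (rule inj_onD) (use z in \<open>auto simp: FS_iff Fl_def\<close>)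
  with z(3) show ?thesis by (simp add: prod_eq_iff)
qed

lemma triv_Fl_inj:
  assumes "(k, U, \<phi>) \<in> \<A>" "ident k m I" "z \<in> FS U" "z' \<in> FS U" "fst z = fst z'" "Fl k I \<phi> z = Fl k I \<phi> z'"
  shows "z = z'"
  by (rule Fl_inj [OF triv_fibre_linear [OF assms(1)] assms(2) triv_inj_fibre [OF assms(1)] assms(3-6)])

lemma Fl_add:
  assumes "fibre_linear V k \<phi>" "ident k m I" "(x, u) \<in> FS V" "(x, v) \<in> FS V"
  shows "Fl k I \<phi> (x, u \<oplus>\<^bsub>fobj F (fibre B x)\<^esub> v) = (\<lambda>i. Fl k I \<phi> (x, u) i + Fl k I \<phi> (x, v) i)"
proof -
  have "flift (fibre B x) k I (\<lambda>a. snd (\<phi> a)) \<in> linear_maps (fobj F (fibre B x)) (Euc m)"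
    using assms by (intro flift_linear [OF fd_fibre]) (auto simp: fibre_linear_def FS_iff)
  then show ?thesis using assms(3,4) by (simp add: linear_maps_iff Fl_def FS_iff)
qed

lemma Fl_scale:
  assumes "fibre_linear V k \<phi>" "ident k m I" "(x, u) \<in> FS V"
  shows "Fl k I \<phi> (x, c \<odot>\<^bsub>fobj F (fibre B x)\<^esub> u) = (\<lambda>i. c * Fl k I \<phi> (x, u) i)"
proof -
  have "flift (fibre B x) k I (\<lambda>a. snd (\<phi> a)) \<in> linear_maps (fobj F (fibre B x)) (Euc m)"
    using assms by (intro flift_linear [OF fd_fibre]) (auto simp: fibre_linear_def FS_iff)
  then show ?thesis using assms(3) by (simp add: linear_maps_iff Fl_def FS_iff)
qed

lemma module_Ffibre: "x \<in> topspace X \<Longrightarrow> module real_ring (fobj F (fibre B x))"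
  by (intro fd_vspace_module fd_fobj fd_fibre)

lemma Fl_zero:
  assumes "fibre_linear V k \<phi>" "ident k m I" "x \<in> V"
  shows "Fl k I \<phi> (x, \<zero>\<^bsub>fobj F (fibre B x)\<^esub>) = (\<lambda>i. 0)"
proof -
  have x: "x \<in> topspace X" using assms by (auto simp: fibre_linear_def)
  have "flift (fibre B x) k I (\<lambda>a. snd (\<phi> a)) \<in> linear_maps (fobj F (fibre B x)) (Euc m)"
    using assms by (intro flift_linear [OF fd_fibre [OF x]]) (auto simp: fibre_linear_def)
  from linear_maps_zero [OF this module_Ffibre [OF x] module_Euc] show ?thesis by (simp add: Fl_def)
qed

lemma zero_FS: "x \<in> topspace X \<Longrightarrow> x \<in> U \<Longrightarrow> (x, \<zero>\<^bsub>fobj F (fibre B x)\<^esub>) \<in> FS U"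
  by (simp add: FS_iff module_zero_closed [OF module_Ffibre])

lemma scale_FS: "(x, u) \<in> FS U \<Longrightarrow> (x, c \<odot>\<^bsub>fobj F (fibre B x)\<^esub> u) \<in> FS U"
  by (simp add: FS_iff module_smult_closed [OF module_Ffibre])

lemma functor_trivs_iff: "(m, U, h) \<in> functor_trivs emb F B \<A> \<longleftrightarrow>
    (\<exists>k I \<phi>. (k, U, \<phi>) \<in> \<A> \<and> ident k m I \<and> h = (FL k I \<phi>))"
  unfolding functor_trivs_def functor_lift_eq ident_def by blast

section \<open>Neighbourhoods and continuity in lifted trivializations\<close>

definition subbase :: "('x \<times> 'v) set set"
  where "subbase = {FS G | G. openin X G} \<union> {FS U \<inter> (FL k I \<phi>) -` G | k U \<phi> m I G.
    (k, U, \<phi>) \<in> \<A> \<and> ident k m I \<and> openin (prodT U m) G}"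

lemma FT_subbase: "FT = topology_generated_by subbase"
proof -
  have "{functor_tot F B \<inter> fst -` G | G. openin X G} \<union>
     {functor_tot F B \<inter> fst -` U \<inter> h -` G | m U h G. (m, U, h) \<in> functor_trivs emb F B \<A> \<and>
        openin (prodT U m) G} = subbase"
    unfolding subbase_def functor_trivs_iff FS_def by blast
  then show ?thesis by (simp add: functor_topology_def)
qed

lemma openin_FS: "openin X G \<Longrightarrow> openin FT (FS G)"
  unfolding FT_subbase by (rule topology_generated_by_Basis) (auto simp: subbase_def)

lemma openin_Fl:
  assumes "(k, U, \<phi>) \<in> \<A>" "ident k m I" "openin (prodT U m) G"
  shows "openin FT (FS U \<inter> (FL k I \<phi>) -` G)"
  unfolding FT_subbase by (rule topology_generated_by_Basis) (use assms in \<open>unfold subbase_def, blast\<close>)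

lemma topspace_FT: "topspace FT = FS UNIV"
proof
  have "s \<subseteq> FS UNIV" if "s \<in> subbase" for s using that FS_mono [OF subset_UNIV] unfolding subbase_def by blast
  then show "topspace FT \<subseteq> FS UNIV" unfolding FT_subbase topology_generated_by_topspace by blast
  have "FS UNIV = FS (topspace X)" using FS_UNIV by simp
  then show "FS UNIV \<subseteq> topspace FT" using openin_subset [OF openin_FS [OF openin_topspace]] by simp
qed

lemma fst_FS: "z \<in> FS U \<Longrightarrow> fst z \<in> U" "z \<in> FS U \<Longrightarrow> fst z \<in> topspace X"
  by (simp_all add: FS_iff)

lemma FS_topspace: "FS U \<subseteq> topspace FT"
  unfolding topspace_FT by (rule FS_mono) simp

lemma topspace_sub_FS [simp]: "topspace (FTS U) = FS U"
  using FS_topspace by auto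

lemma continuous_map_FT_fst: "continuous_map FT X fst"
  unfolding continuous_map_def
proof (intro conjI allI impI)
  show "fst \<in> topspace FT \<rightarrow> topspace X" unfolding topspace_FT using fst_FS(2) by blast
  fix G assume "openin X G"
  moreover have "{x \<in> topspace FT. fst x \<in> G} = FS G" unfolding topspace_FT by (auto simp: FS_def)
  ultimately show "openin FT {x \<in> topspace FT. fst x \<in> G}" using openin_FS by simp
qed

lemma continuous_map_FS_fst: "continuous_map (FTS U) (subtopology X U) fst"
  using continuous_map_from_subtopology [OF continuous_map_FT_fst] fst_FS(1)
  by (auto simp: continuous_map_in_subtopology)

lemma continuous_map_lift:
  assumes t: "(k, U, \<phi>) \<in> \<A>" and I: "ident k m I"
  shows "continuous_map (FTS U) (prodT U m) (FL k I \<phi>)"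
  unfolding continuous_map_def topspace_sub_FS
proof (intro conjI allI impI)
  show "(FL k I \<phi>) \<in> FS U \<rightarrow> topspace (prodT U m)"
    using fst_FS triv_Fl_E [OF t I] by fastforce
  fix G assume "openin (prodT U m) G"
  from openin_Fl [OF t I this] have o: "openin FT (FS U \<inter> (FL k I \<phi>) -` G)" .
  have "{x \<in> FS U. (fst x, Fl k I \<phi> x) \<in> G} = (FS U \<inter> (FL k I \<phi>) -` G) \<inter> FS U" by auto
  then show "openin (FTS U) {x \<in> FS U. (fst x, Fl k I \<phi> x) \<in> G}"
    using o unfolding openin_subtopology by blast
qed

lemma lift_topspace:
  assumes "(k, U, \<phi>) \<in> \<A>" "ident k m I" "z \<in> FS U"
  shows "(fst z, Fl k I \<phi> z) \<in> topspace (prodT U m)"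
  using fst_FS [OF assms(3)] triv_Fl_E [OF assms(1) assms(2,3)] by simp

text \<open>By \<open>transf_matrix\<close>, each coordinate is a finite sum of products of entries
  of \<open>K z\<close>, coordinates of \<open>w z\<close> and constants.\<close>

lemma continuous_map_transf:
  assumes K: "\<And>j i. j < k \<Longrightarrow> i < l \<Longrightarrow> cont_real Z (\<lambda>z. K z j i)"
    and KE: "\<And>z j. z \<in> topspace Z \<Longrightarrow> j < k \<Longrightarrow> K z j \<in> E l"
    and I: "ident k m I" "ident l m' I'"
    and w: "\<And>z. z \<in> topspace Z \<Longrightarrow> w z \<in> E m" "\<And>s. s < m \<Longrightarrow> cont_real Z (\<lambda>z. w z s)"
  shows "cont_real Z (\<lambda>z. transf k l I I' (lmap k (K z)) (w z) i)"
proof (rule continuous_map_eq)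
  let ?f = "\<lambda>z. \<Sum>s<m. w z s * (\<Sum>t\<in>{..<k} \<times> {..<l}. K z (fst t) (snd t) *
    transf k l I I' (matrix_unit t) (unit_vec s) i)"
  show "cont_real Z ?f"
    by (intro continuous_map_sum continuous_map_real_mult w K) auto
  fix z assume z: "z \<in> topspace Z"
  have "lmap k (K z) \<in> linear_maps (Euc k) (Euc l)" using KE [OF z] by (rule lmap_linear_maps)
  from transf_matrix [OF this I w(1) [OF z]] show "?f z = transf k l I I' (lmap k (K z)) (w z) i"
    by (auto simp: lmap_unit_vec intro!: sum.cong)
qed

text \<open>Induction over the generation of \<open>Q\<close> from the subbase. The essential case
  is a subbasic set that comes from another trivialization: near \<open>z\<close> its lift is a
  continuous function of the given one.\<close>

lemma FT_local_base:
  assumes Q: "openin FT Q" and z: "z \<in> Q" and t: "(k, U, \<phi>) \<in> \<A>" and x: "fst z \<in> U" and I: "ident k m I"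
  shows "\<exists>G. openin (prodT U m) G \<and> (fst z, Fl k I \<phi> z) \<in> G \<and>
    FS U \<inter> (FL k I \<phi>) -` G \<subseteq> Q"
proof -
  let ?T = "prodT U m" and ?h = "FL k I \<phi>"
  note lt = triv_local [OF t]
  have Uo: "openin X U" by (rule local_triv_open [OF lt])
  have "generate_topology_on subbase Q"
    using Q unfolding FT_subbase openin_topology_generated_by_iff .
  then show ?thesis
    using z x
  proof (induction arbitrary: z)
    case Empty
    then show ?case by blast
  next
    case (Int a b)
    have zab: "z \<in> a" "z \<in> b" using Int.prems(1) by blast+
    obtain G where G: "openin ?T G" "?h z \<in> G" "FS U \<inter> ?h -` G \<subseteq> a"
      using Int.IH(1) [OF zab(1) Int.prems(2)] by (elim exE conjE)
    obtain G' where G': "openin ?T G'" "?h z \<in> G'" "FS U \<inter> ?h -` G' \<subseteq> b"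
      using Int.IH(2) [OF zab(2) Int.prems(2)] by (elim exE conjE)
    show ?case
    proof (intro exI [of _ "G \<inter> G'"] conjI)
      show "openin ?T (G \<inter> G')" by (rule openin_Int [OF G(1) G'(1)])
      show "?h z \<in> G \<inter> G'" using G(2) G'(2) by (rule IntI)
      show "FS U \<inter> ?h -` (G \<inter> G') \<subseteq> a \<inter> b" using G(3) G'(3) by fast
    qed
  next
    case (UN K)
    then obtain Q' where "Q' \<in> K" "z \<in> Q'" by blast
    obtain G where G: "openin ?T G" "?h z \<in> G" "FS U \<inter> ?h -` G \<subseteq> Q'"
      using UN.IH [OF \<open>Q' \<in> K\<close> \<open>z \<in> Q'\<close> UN.prems(2)] by (elim exE conjE)
    show ?case
    proof (intro exI conjI)
      show "FS U \<inter> ?h -` G \<subseteq> \<Union>K" using G(3) \<open>Q' \<in> K\<close> by (meson Union_upper subset_trans)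
    qed (fact G)+
  next
    case (Basis s)
    from Basis.hyps consider G where "s = FS G" "openin X G" |
      k' U' \<phi>' m' I' G where "s = FS U' \<inter> (\<lambda>z. (fst z, Fl k' I' \<phi>' z)) -` G" "(k', U', \<phi>') \<in> \<A>" "ident k' m' I'"
        "openin (prod_topology (subtopology X U') (Eu m')) G"
      unfolding subbase_def by blast
    then show ?case
    proof cases
      case 1
      have zs: "z \<in> FS G" "z \<in> FS U" using Basis.prems 1 by (auto simp: FS_iff)
      show ?thesis
      proof (intro exI [of _ "(U \<inter> G) \<times> E m"] conjI)
        have "openin (subtopology X U) (U \<inter> G)" using 1(2) by (rule openin_subtopology_Int2)
        then show "openin ?T ((U \<inter> G) \<times> E m)" by (simp add: openin_prod_Times_iff)
        show "?h z \<in> (U \<inter> G) \<times> E m" using zs fst_FS triv_Fl_E [OF t I] by simp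
        show "FS U \<inter> ?h -` ((U \<inter> G) \<times> E m) \<subseteq> s" unfolding 1(1) by (auto simp: FS_iff)
      qed
    next
      case 2
      have zs: "z \<in> FS U'" "z \<in> FS U" "(fst z, Fl k' I' \<phi>' z) \<in> G" using Basis.prems 2(1) by (auto simp: FS_iff)
      obtain W K L where "fst z \<in> W" and K: "transition B (k, U, \<phi>) (k', U', \<phi>') W K"
        using compatible_imp_transition [OF lt triv_local [OF 2(2)] triv_compatible [OF t 2(2)] fst_FS(1) [OF zs(2)] fst_FS(1) [OF zs(1)]]
        by (elim exE conjE)
      have W: "openin X W" "W \<subseteq> U \<inter> U'" and KE: "\<And>y j. y \<in> W \<Longrightarrow> j < k \<Longrightarrow> K y j \<in> E k'"
        and Kc: "\<And>j i. j < k \<Longrightarrow> i < k' \<Longrightarrow> cont_real (subtopology X W) (\<lambda>y. K y j i)"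
        and Ka: "\<And>a. a \<in> over B W \<Longrightarrow> lmap k (K (proj B a)) (snd (\<phi> a)) = snd (\<phi>' a)"
        using K unfolding transition_def prod.case by blast+
      have tW: "topspace (subtopology X W) = W" using openin_subset [OF W(1)] by auto
      let ?TW = "prodT W m"
      \<comment> \<open>The change of lifted trivializations over \<open>W\<close>: the transition
        family pushed through \<open>F\<close>, acting on the fibre coordinate. It is continuous in
        both variables jointly.\<close>
      define g where "g = (\<lambda>z. (fst z, transf k k' I I' (lmap k (K (fst z))) (snd z)))"
      have "continuous_map ?TW (prod_topology (subtopology X U') (Eu m')) g"
        unfolding g_def
      proof (intro continuous_map_pairedI)
        have "continuous_map (subtopology X W) (subtopology X U') (\<lambda>x. x)"
          using W tW continuous_map_from_subtopology [OF continuous_map_id [unfolded id_def]]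
          by (auto simp: continuous_map_in_subtopology)
        from continuous_map_compose [OF continuous_map_fst this]
        show "continuous_map ?TW (subtopology X U') fst" by (simp add: o_def)
        have KE': "K (fst z) j \<in> E k'" if "z \<in> topspace ?TW" "j < k" for z j
          using that tW KE by auto
        show "continuous_map ?TW (Eu m') (\<lambda>z. transf k k' I I' (lmap k (K (fst z))) (snd z))"
          unfolding continuous_map_Euc_iff
        proof (intro conjI ballI allI impI)
          show "transf k k' I I' (lmap k (K (fst z))) (snd z) \<in> E m'" if z: "z \<in> topspace ?TW" for z
            by (rule linear_maps_E [OF transf_linear [OF lmap_linear_maps [OF KE' [OF z]] I 2(3)]]) (use z in auto)
          show "cont_real ?TW (\<lambda>z. transf k k' I I' (lmap k (K (fst z))) (snd z) i)" for i
          proof (rule continuous_map_transf [OF _ KE' I 2(3)])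
            show "cont_real ?TW (\<lambda>z. K (fst z) j i)" if "j < k" "i < k'" for j i
              using continuous_map_compose [OF continuous_map_fst Kc [OF that]] by (simp add: o_def)
            show "cont_real ?TW (\<lambda>z. snd z s)" for s
              using continuous_map_compose [OF continuous_map_snd continuous_map_coord] by (simp add: o_def)
          qed auto
        qed
      qed
      from openin_continuous_map_preimage [OF this 2(4)]
      have oW: "openin ?TW {z \<in> topspace ?TW. g z \<in> G}" .
      have TW: "?TW = subtopology ?T (W \<times> E m)"
      proof -
        have "subtopology ?T (W \<times> E m) = prod_topology (subtopology (subtopology X U) W) (subtopology (Eu m) (E m))"
          by (rule subtopology_Times)
        also have "subtopology (subtopology X U) W = subtopology X W"
          using W(2) by (simp add: subtopology_subtopology inf_absorb2)
        finally show ?thesis by simp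
      qed
      have "openin (subtopology X U) W" using W Uo by (simp add: openin_open_subtopology)
      then have "openin ?T (W \<times> E m)" by (simp add: openin_prod_Times_iff)
      then have oT: "openin ?T {z \<in> topspace ?TW. g z \<in> G}" using oW unfolding TW by (rule openin_trans_full [rotated])
      have gh: "g (?h y) = (fst y, Fl k' I' \<phi>' y)" if y: "y \<in> FS W" for y
      proof -
        have yU: "y \<in> FS U" using y W(2) FS_mono [of W U] by blast
        have yW: "fst y \<in> W" using y by (rule fst_FS)
        have "transf k k' I I' (lmap k (K (fst y))) (Fl k I \<phi> y) = Fl k' I' \<phi>' y"
        proof (rule Fl_transf [OF triv_fibre_linear [OF t] I yU lmap_linear_maps])
          show "K (fst y) j \<in> E k'" if "j < k" for j by (rule KE [OF yW that])
          fix a assume "a \<in> over B {fst y}"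
          then have aW: "a \<in> over B W" and ay: "proj B a = fst y" using yW by (auto simp: over_def)
          from Ka [OF aW] show "lmap k (K (fst y)) (snd (\<phi> a)) = snd (\<phi>' a)" unfolding ay .
        qed
        then show ?thesis by (simp add: g_def)
      qed
      have zW: "z \<in> FS W" using zs(2) \<open>fst z \<in> W\<close> by (simp add: FS_iff)
      show ?thesis
      proof (intro exI conjI)
        show "openin ?T {z \<in> topspace ?TW. g z \<in> G}" by (rule oT)
        show "?h z \<in> {z \<in> topspace ?TW. g z \<in> G}"
          using gh [OF zW] zs(3) triv_Fl_E [OF t I zs(2)] \<open>fst z \<in> W\<close> fst_FS(2) [OF zW] by simp
        show "FS U \<inter> ?h -` {z \<in> topspace ?TW. g z \<in> G} \<subseteq> s"
        proof
          fix y assume y: "y \<in> FS U \<inter> ?h -` {z \<in> topspace ?TW. g z \<in> G}"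
          then have "fst y \<in> W" "g (?h y) \<in> G" by auto
          moreover have yW: "y \<in> FS W" using y \<open>fst y \<in> W\<close> by (auto simp: FS_iff)
          ultimately have "(fst y, Fl k' I' \<phi>' y) \<in> G" using gh [OF yW] by simp
          moreover have "y \<in> FS U'" using yW W(2) FS_mono [of W U'] by blast
          ultimately show "y \<in> s" unfolding 2(1) by blast
        qed
      qed
    qed
  qed
qed

text \<open>By \<open>FT_local_base\<close>, one lifted trivialization about each point is enough to
  test continuity, although the topology is defined by all of them.\<close>

lemma continuous_map_into_FT:
  assumes f: "\<And>z. z \<in> topspace Z \<Longrightarrow> f z \<in> FS UNIV" and fst: "continuous_map Z X (\<lambda>z. fst (f z))"
    and loc: "\<And>z. z \<in> topspace Z \<Longrightarrow> \<exists>k U \<phi> m I N. (k, U, \<phi>) \<in> \<A> \<and> ident k m I \<and> openin Z N \<and> z \<in> N \<and>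
      (\<forall>y\<in>N. fst (f y) \<in> U) \<and> (\<forall>i<m. cont_real (subtopology Z N) (\<lambda>y. Fl k I \<phi> (f y) i))"
  shows "continuous_map Z FT f"
  unfolding continuous_map_def
proof (intro conjI allI impI)
  show "f \<in> topspace Z \<rightarrow> topspace FT" unfolding topspace_FT using f by blast
  fix Q assume Q: "openin FT Q"
  show "openin Z {z \<in> topspace Z. f z \<in> Q}"
  proof (subst openin_subopen, intro ballI)
    fix z assume "z \<in> {z \<in> topspace Z. f z \<in> Q}"
    then have z: "z \<in> topspace Z" "f z \<in> Q" by auto
    from loc [OF z(1)] obtain k U \<phi> m I N where t: "(k, U, \<phi>) \<in> \<A>" and I: "ident k m I" and N: "openin Z N" "z \<in> N"
      and NU: "\<forall>y\<in>N. fst (f y) \<in> U" and c: "\<forall>i<m. cont_real (subtopology Z N) (\<lambda>y. Fl k I \<phi> (f y) i)"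
      by (elim exE conjE)
    have tN: "topspace (subtopology Z N) = N" using openin_subset [OF N(1)] by auto
    have fU: "f y \<in> FS U" if "y \<in> N" for y
      using f [of y] NU that openin_subset [OF N(1)] by (auto simp: FS_iff)
    obtain G where G: "openin (prodT U m) G" "(fst (f z), Fl k I \<phi> (f z)) \<in> G"
        "FS U \<inter> (FL k I \<phi>) -` G \<subseteq> Q"
      using FT_local_base [OF Q z(2) t fst_FS(1) [OF fU [OF N(2)]] I] by (elim exE conjE)
    have "continuous_map (subtopology Z N) (prodT U m) (\<lambda>y. (fst (f y), Fl k I \<phi> (f y)))"
    proof (intro continuous_map_pairedI)
      show "continuous_map (subtopology Z N) (subtopology X U) (\<lambda>y. fst (f y))"
        using continuous_map_from_subtopology [OF fst] NU by (auto simp: continuous_map_in_subtopology)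
      show "continuous_map (subtopology Z N) (Eu m) (\<lambda>y. Fl k I \<phi> (f y))"
        unfolding continuous_map_Euc_iff tN using c triv_Fl_E [OF t I fU] by blast
    qed
    from openin_continuous_map_preimage [OF this G(1)]
    have "openin (subtopology Z N) {y \<in> N. (fst (f y), Fl k I \<phi> (f y)) \<in> G}" unfolding tN .
    then have "openin Z {y \<in> N. (fst (f y), Fl k I \<phi> (f y)) \<in> G}" using N(1) openin_trans_full by blast
    moreover have "{y \<in> N. (fst (f y), Fl k I \<phi> (f y)) \<in> G} \<subseteq> {z \<in> topspace Z. f z \<in> Q}"
      using G(3) fU openin_subset [OF N(1)] by blast
    ultimately show "\<exists>T. openin Z T \<and> z \<in> T \<and> T \<subseteq> {z \<in> topspace Z. f z \<in> Q}"
      using G(2) N(2) by (intro exI conjI) auto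
  qed
qed

text \<open>Continuity of the inverse is tested in the same lift, where the inverse is represented
  by the second projection.\<close>

lemma embedding_map_lift:
  assumes t: "(k, U, \<phi>) \<in> \<A>" and I: "ident k m I"
  shows "embedding_map (FTS U) (prodT U m) (FL k I \<phi>)"
proof -
  let ?h = "FL k I \<phi>"
  let ?Z = "subtopology (prodT U m) (?h ` FS U)"
  have inj: "inj_on ?h (FS U)" by (rule inj_onI) (use triv_Fl_inj [OF t I] in auto)
  have g: "the_inv_into (FS U) ?h w \<in> FS U" "?h (the_inv_into (FS U) ?h w) = w" if "w \<in> ?h ` FS U" for w
    using that the_inv_into_into [OF inj that subset_refl] f_the_inv_into_f [OF inj that] by auto
  have gfst: "fst (the_inv_into (FS U) ?h w) = fst w" and gsnd: "Fl k I \<phi> (the_inv_into (FS U) ?h w) = snd w"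
    if "w \<in> ?h ` FS U" for w
    using arg_cong [OF g(2) [OF that], of fst] arg_cong [OF g(2) [OF that], of snd]
    unfolding fst_conv snd_conv .
  have tZ: "topspace ?Z = ?h ` FS U"
    unfolding topspace_subtopology using lift_topspace [OF t I] by blast
  have c: "continuous_map ?Z FT (the_inv_into (FS U) ?h)"
  proof (rule continuous_map_into_FT)
    show "the_inv_into (FS U) ?h z \<in> FS UNIV" if "z \<in> topspace ?Z" for z
      using g(1) [of z] that FS_mono [OF subset_UNIV] unfolding tZ by blast
    have "continuous_map ?Z X fst"
      using continuous_map_from_subtopology [OF continuous_map_fst] continuous_map_into_fulltopology by blast
    then show "continuous_map ?Z X (\<lambda>z. fst (the_inv_into (FS U) ?h z))"
      by (rule continuous_map_eq) (simp only: tZ gfst)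
    fix z assume z: "z \<in> topspace ?Z"
    have "cont_real ?Z (\<lambda>y. Fl k I \<phi> (the_inv_into (FS U) ?h y) i)" for i
    proof (rule continuous_map_eq)
      show "cont_real ?Z (\<lambda>y. snd y i)"
        using continuous_map_from_subtopology [OF continuous_map_compose [OF continuous_map_snd continuous_map_coord]]
        by (simp add: o_def)
      show "snd y i = Fl k I \<phi> (the_inv_into (FS U) ?h y) i" if "y \<in> topspace ?Z" for y
        using that unfolding tZ by (simp only: gsnd)
    qed
    moreover have "fst (the_inv_into (FS U) ?h y) \<in> U" if "y \<in> topspace ?Z" for y
      using g(1) [of y] that fst_FS(1) unfolding tZ by blast
    ultimately show "\<exists>k U' \<phi>' m I N. (k, U', \<phi>') \<in> \<A> \<and> ident k m I \<and> openin ?Z N \<and> z \<in> N \<and>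
      (\<forall>y\<in>N. fst (the_inv_into (FS U) ?h y) \<in> U') \<and>
      (\<forall>i<m. cont_real (subtopology ?Z N) (\<lambda>y. Fl k I \<phi>' (the_inv_into (FS U) ?h y) i))"
      using t I z by (intro exI [of _ k] exI [of _ U] exI [of _ \<phi>] exI [of _ m] exI [of _ I] exI [of _ "topspace ?Z"] conjI ballI allI impI)
        (auto simp only: openin_topspace subtopology_topspace)
  qed
  show ?thesis
  proof (rule embedding_mapI [OF continuous_map_lift [OF t I]])
    show "continuous_map (subtopology (prodT U m) (?h ` topspace (FTS U)))
        (FTS U) (the_inv_into (FS U) ?h)"
      unfolding topspace_sub_FS continuous_map_in_subtopology
      using c g(1) unfolding tZ by blast
    show "the_inv_into (FS U) ?h (?h z) = z" if "z \<in> topspace (FTS U)" for z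
      using that the_inv_into_f_f [OF inj] by simp
  qed
qed

section \<open>Separation, countability and connectedness\<close>

lemma Hausdorff_FT: "Hausdorff_space FT"
  unfolding Hausdorff_space_def
proof (intro allI impI)
  fix a b assume ab: "a \<in> topspace FT \<and> b \<in> topspace FT \<and> a \<noteq> b"
  then have abF: "a \<in> FS UNIV" "b \<in> FS UNIV" by (simp_all add: topspace_FT)
  show "\<exists>U V. openin FT U \<and> openin FT V \<and> a \<in> U \<and> b \<in> V \<and> disjnt U V"
  proof (cases "fst a = fst b")
    case False
    then obtain U V where UV: "openin X U" "openin X V" "fst a \<in> U" "fst b \<in> V" "disjnt U V"
      using Hausdorff_X fst_FS(2) [OF abF(1)] fst_FS(2) [OF abF(2)] unfolding Hausdorff_space_def by blast
    have "a \<in> FS U" "b \<in> FS V" using abF UV by (auto simp: FS_iff)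
    moreover have "disjnt (FS U) (FS V)" using UV(5) by (auto simp: disjnt_def FS_def)
    ultimately show ?thesis using openin_FS UV(1,2) by blast
  next
    case True
    obtain k U \<phi> where t: "(k, U, \<phi>) \<in> \<A>" "fst a \<in> U" using triv_cover [OF fst_FS(2) [OF abF(1)]] by blast
    obtain m I where I: "ident k m I" using ex_ident by blast
    let ?T = "prodT U m"
    let ?h = "FL k I \<phi>"
    have aU: "a \<in> FS U" "b \<in> FS U" using abF t(2) True by (auto simp: FS_iff)
    then have "?h a \<noteq> ?h b" using triv_Fl_inj [OF t(1) I aU True] ab by auto
    moreover have "Hausdorff_space ?T"
      using Hausdorff_space_subtopology [OF Hausdorff_X] Hausdorff_Euclidean_space by (simp add: Hausdorff_space_prod_topology)
    moreover have "?h a \<in> topspace ?T" "?h b \<in> topspace ?T"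
      using lift_topspace [OF t(1) I] aU by blast+
    ultimately obtain G G' where G: "openin ?T G" "openin ?T G'" "?h a \<in> G" "?h b \<in> G'" "disjnt G G'"
      unfolding Hausdorff_space_def by blast
    show ?thesis
    proof (intro exI conjI)
      show "openin FT (FS U \<inter> ?h -` G)" "openin FT (FS U \<inter> ?h -` G')"
        using openin_Fl [OF t(1) I] G by blast+
    qed (use G aU in \<open>auto simp: disjnt_def\<close>)
  qed
qed

text \<open>The base is Lindelof, so countably many trivializations cover it; over the domain of
  each, \<open>F(A)\<close> embeds into a product of second countable spaces.\<close>

lemma second_countable_FT: "second_countable FT"
proof -
  have L: "Lindelof_space X" by (rule second_countable_imp_Lindelof_space [OF second_X])
  let ?\<U> = "{U. \<exists>k \<phi>. (k, U, \<phi>) \<in> \<A>}"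
  have op: "openin X U" if "U \<in> ?\<U>" for U using that local_triv_open [OF triv_local] by blast
  have cover: "\<Union>?\<U> = topspace X" using triv_cover triv_subset by blast
  obtain \<C> where \<C>: "countable \<C>" "\<C> \<subseteq> ?\<U>" "\<Union>\<C> = topspace X"
  proof -
    have "\<exists>\<V>. countable \<V> \<and> \<V> \<subseteq> ?\<U> \<and> \<Union>\<V> = topspace X"
      by (rule Lindelof_spaceD [OF L _ cover]) (rule op)
    then show thesis using that by (elim exE conjE)
  qed
  show ?thesis
  proof (rule second_countable_cover [of "FS ` \<C>"])
    show "countable (FS ` \<C>)" using \<C>(1) by simp
    show "\<Union>(FS ` \<C>) = topspace FT"
    proof
      show "\<Union>(FS ` \<C>) \<subseteq> topspace FT" unfolding topspace_FT using FS_mono [OF subset_UNIV] by blast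
      show "topspace FT \<subseteq> \<Union>(FS ` \<C>)"
      proof
        fix z assume "z \<in> topspace FT"
        then have z: "z \<in> FS UNIV" unfolding topspace_FT .
        then obtain U where "U \<in> \<C>" "fst z \<in> U" using fst_FS(2) [OF z] unfolding \<C>(3) [symmetric] by (elim UnionE)
        moreover from this z have "z \<in> FS U" unfolding FS_iff by blast
        ultimately show "z \<in> \<Union>(FS ` \<C>)" by blast
      qed
    qed
    fix Q assume "Q \<in> FS ` \<C>"
    then obtain U k \<phi> where t: "(k, U, \<phi>) \<in> \<A>" "Q = FS U" using \<C>(2) by blast
    obtain m I where I: "ident k m I" using ex_ident by blast
    let ?h = "FL k I \<phi>"
    have "second_countable (powertop_real (UNIV :: nat set))"
      unfolding euclidean_product_topology by (rule second_countable_euclidean)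
    then have "second_countable (Eu m)"
      unfolding Euclidean_space_def by (rule second_countable_subtopology)
    then have "second_countable (subtopology (prodT U m) (?h ` FS U))"
      by (intro second_countable_subtopology) (rule second_countable_prod_topology [OF second_countable_subtopology [OF second_X]])
    moreover have "FTS U homeomorphic_space subtopology (prodT U m) (?h ` FS U)"
      using embedding_map_imp_homeomorphic_space [OF embedding_map_lift [OF t(1) I]] unfolding topspace_sub_FS .
    ultimately have "second_countable (FTS U)"
      using homeomorphic_space_second_countability by blast
    then show "openin FT Q \<and> second_countable (subtopology FT Q)"
      unfolding t(2) using openin_FS triv_open [OF t(1)] by blast
  qed
qed

text \<open>Regularity is clear over the domain \<open>U\<close> of one trivialization, but a set
  that is closed over \<open>U\<close> need not be closed in \<open>F(A)\<close>. Regularity of the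
  base supplies a closed \<open>C1\<close> inside \<open>U\<close> that keeps the neighbourhood away
  from the boundary of \<open>U\<close>.\<close>

lemma regular_FT: "regular_space FT"
  unfolding neighbourhood_base_of_closedin [symmetric] neighbourhood_base_of
proof (intro allI impI)
  fix Q a assume Q: "openin FT Q \<and> a \<in> Q"
  have regX: "regular_space X" by (rule paracompact_Hausdorff_imp_regular [OF paracompact_X Hausdorff_X])
  have aF: "a \<in> FS UNIV" using Q openin_subset topspace_FT by blast
  obtain k U \<phi> where t: "(k, U, \<phi>) \<in> \<A>" "fst a \<in> U" using triv_cover [OF fst_FS(2) [OF aF]] by blast
  have Uo: "openin X U" by (rule triv_open [OF t(1)])
  obtain m I where I: "ident k m I" using ex_ident by blast
  let ?h = "FL k I \<phi>"
  have "regular_space (Eu m)"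
    by (rule metrizable_imp_regular_space [OF metrizable_Euclidean_space])
  then have "regular_space (subtopology (prodT U m) (?h ` FS U))"
    by (intro regular_space_subtopology) (simp add: regular_space_prod_topology regular_space_subtopology regX)
  moreover have "FTS U homeomorphic_space subtopology (prodT U m) (?h ` FS U)"
    using embedding_map_imp_homeomorphic_space [OF embedding_map_lift [OF t(1) I]] unfolding topspace_sub_FS .
  ultimately have reg: "regular_space (FTS U)"
    using homeomorphic_regular_space by blast
  obtain V1 C1 where V1: "openin X V1" "closedin X C1" "fst a \<in> V1" "V1 \<subseteq> C1" "C1 \<subseteq> U"
    using regX Uo t(2) unfolding neighbourhood_base_of_closedin [symmetric] neighbourhood_base_of by metis
  have aV: "a \<in> FS V1" using aF V1(3) by (simp add: FS_iff)
  have "openin FT (Q \<inter> FS V1)" using Q openin_FS [OF V1(1)] by (simp add: openin_Int)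
  moreover have "Q \<inter> FS V1 \<subseteq> FS U" using V1(4,5) FS_mono [of V1 U] by blast
  ultimately have "openin (FTS U) (Q \<inter> FS V1)"
    using openin_FS [OF Uo] by (simp add: openin_open_subtopology)
  then obtain V2 C2 where V2: "openin (FTS U) V2" "closedin (FTS U) C2"
      "a \<in> V2" "V2 \<subseteq> C2" "C2 \<subseteq> Q \<inter> FS V1"
    using reg Q aV unfolding neighbourhood_base_of_closedin [symmetric] neighbourhood_base_of by (metis IntI)
  have "openin FT V2" using V2(1) openin_FS [OF Uo] openin_trans_full by blast
  \<comment> \<open>\<open>C2\<close> lies over \<open>C1\<close>, and all points over
    \<open>C1\<close> lie over \<open>U\<close>; so \<open>C2\<close> is the intersection of the
    closed set \<open>D\<close> with the closed preimage of \<open>C1\<close>.\<close>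
  moreover have "closedin FT C2"
  proof -
    obtain D where D: "closedin FT D" "C2 = D \<inter> FS U" using V2(2) unfolding closedin_subtopology by blast
    have "closedin FT {z \<in> topspace FT. fst z \<in> C1}"
      by (rule closedin_continuous_map_preimage [OF continuous_map_FT_fst V1(2)])
    then have "closedin FT (D \<inter> {z \<in> topspace FT. fst z \<in> C1})" by (rule closedin_Int [OF D(1)])
    moreover have "D \<inter> {z \<in> topspace FT. fst z \<in> C1} = C2"
    proof
      show "C2 \<subseteq> D \<inter> {z \<in> topspace FT. fst z \<in> C1}"
        using D(2) V2(5) V1(4) fst_FS(1) FS_topspace by fast
      show "D \<inter> {z \<in> topspace FT. fst z \<in> C1} \<subseteq> C2"
        using D(2) V1(5) unfolding topspace_FT by (auto simp: FS_iff)
    qed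
    ultimately show ?thesis by simp
  qed
  ultimately show "\<exists>U V. openin FT U \<and> closedin FT V \<and> a \<in> U \<and> U \<subseteq> V \<and> V \<subseteq> Q"
    using V2(3-5) by blast
qed

lemma paracompact_FT: "paracompact_space FT"
  by (rule regular_Lindelof_imp_paracompact [OF regular_FT second_countable_imp_Lindelof_space [OF second_countable_FT]])

lemma continuous_map_zero_section: "continuous_map X FT (\<lambda>x. (x, \<zero>\<^bsub>fobj F (fibre B x)\<^esub>))"
proof (rule continuous_map_into_FT)
  show "(x, \<zero>\<^bsub>fobj F (fibre B x)\<^esub>) \<in> FS UNIV" if "x \<in> topspace X" for x using zero_FS that by blast
  show "continuous_map X X (\<lambda>x. fst (x, \<zero>\<^bsub>fobj F (fibre B x)\<^esub>))" by (simp add: continuous_map_id [unfolded id_def])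
  fix x assume x: "x \<in> topspace X"
  obtain k U \<phi> where t: "(k, U, \<phi>) \<in> \<A>" "x \<in> U" using triv_cover [OF x] by blast
  obtain m I where I: "ident k m I" using ex_ident by blast
  have Uo: "openin X U" by (rule triv_open [OF t(1)])
  have "cont_real (subtopology X U) (\<lambda>y. Fl k I \<phi> (y, \<zero>\<^bsub>fobj F (fibre B y)\<^esub>) i)" for i
    by (rule continuous_map_eq [where f = "\<lambda>y. 0"]) (auto simp: Fl_zero [OF triv_fibre_linear [OF t(1)] I])
  with t I Uo show "\<exists>k U \<phi> m I N. (k, U, \<phi>) \<in> \<A> \<and> ident k m I \<and> openin X N \<and> x \<in> N \<and>
      (\<forall>y\<in>N. fst (y, \<zero>\<^bsub>fobj F (fibre B y)\<^esub>) \<in> U) \<and>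
      (\<forall>i<m. cont_real (subtopology X N) (\<lambda>y. Fl k I \<phi> (y, \<zero>\<^bsub>fobj F (fibre B y)\<^esub>) i))"
    by (intro exI [of _ k] exI [of _ U] exI [of _ \<phi>] exI [of _ m] exI [of _ I] exI [of _ U]) simp
qed

lemma fsmult_FB: "fsmult FB c z = (fst z, c \<odot>\<^bsub>fobj F (fibre B (fst z))\<^esub> snd z)"
  by (simp add: functor_bundle_def case_prod_unfold)

lemma continuous_map_fsmult: "continuous_map (prod_topology euclideanreal FT) FT (\<lambda>(c, z). fsmult FB c z)"
proof (rule continuous_map_into_FT)
  let ?Z = "prod_topology euclideanreal FT"
  show "(case w of (c, z) \<Rightarrow> fsmult FB c z) \<in> FS UNIV" if "w \<in> topspace ?Z" for w
    using that scale_FS [of "fst (snd w)" "snd (snd w)" UNIV "fst w"]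
    by (auto simp: topspace_FT fsmult_FB split: prod.splits)
  show "continuous_map ?Z X (\<lambda>w. fst (case w of (c, z) \<Rightarrow> fsmult FB c z))"
    using continuous_map_compose [OF continuous_map_snd continuous_map_FT_fst]
    by (simp add: o_def fsmult_FB case_prod_unfold)
  fix w assume w: "w \<in> topspace ?Z"
  then have "snd w \<in> FS UNIV" by (auto simp: topspace_FT)
  from fst_FS(2) [OF this] obtain k U \<phi> where t: "(k, U, \<phi>) \<in> \<A>" "fst (snd w) \<in> U" using triv_cover by blast
  obtain m I where I: "ident k m I" using ex_ident by blast
  have Uo: "openin X U" by (rule triv_open [OF t(1)])
  have No: "openin ?Z (UNIV \<times> FS U)" using openin_FS [OF Uo] by (simp add: openin_prod_Times_iff)
  have ZN: "subtopology ?Z (UNIV \<times> FS U) = prod_topology euclideanreal (FTS U)"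
    by (simp add: subtopology_Times)
  have "cont_real (FTS U) (\<lambda>z. Fl k I \<phi> z i)" for i
    using continuous_map_compose [OF continuous_map_compose [OF continuous_map_lift [OF t(1) I] continuous_map_snd] continuous_map_coord]
    by (simp add: o_def)
  from continuous_map_compose [OF continuous_map_snd this]
  have c: "cont_real (prod_topology euclideanreal (FTS U)) (\<lambda>w. fst w * Fl k I \<phi> (snd w) i)" for i
    by (intro continuous_map_real_mult continuous_map_fst) (simp add: o_def)
  have "cont_real (subtopology ?Z (UNIV \<times> FS U)) (\<lambda>w. Fl k I \<phi> (case w of (c, z) \<Rightarrow> fsmult FB c z) i)" for i
    unfolding ZN
  proof (rule continuous_map_eq [OF c])
    fix w assume "w \<in> topspace (prod_topology euclideanreal (FTS U))"
    then have "(fst (snd w), snd (snd w)) \<in> FS U" by auto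
    from Fl_scale [OF triv_fibre_linear [OF t(1)] I this]
    show "fst w * Fl k I \<phi> (snd w) i = Fl k I \<phi> (case w of (c, z) \<Rightarrow> fsmult FB c z) i"
      by (simp add: fsmult_FB case_prod_unfold)
  qed
  moreover have "w \<in> UNIV \<times> FS U" using w t(2) by (auto simp: topspace_FT FS_iff)
  moreover have "\<forall>y\<in>UNIV \<times> FS U. fst (case y of (c, z) \<Rightarrow> fsmult FB c z) \<in> U"
    using fst_FS(1) by (auto simp: fsmult_FB)
  ultimately show "\<exists>k U \<phi> m I N. (k, U, \<phi>) \<in> \<A> \<and> ident k m I \<and> openin ?Z N \<and> w \<in> N \<and>
      (\<forall>y\<in>N. fst (case y of (c, z) \<Rightarrow> fsmult FB c z) \<in> U) \<and>
      (\<forall>i<m. cont_real (subtopology ?Z N) (\<lambda>y. Fl k I \<phi> (case y of (c, z) \<Rightarrow> fsmult FB c z) i))"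
    using t(1) I No by (intro exI conjI allI impI) assumption+
qed

text \<open>The zero section over \<open>S\<close> is connected, and each vector is joined to it by
  the line of its multiples; all the sets \<open>C z\<close> share the zero section.\<close>

lemma connectedin_FS:
  assumes S: "connectedin X S"
  shows "connectedin FT (FS S)"
proof -
  let ?z = "\<lambda>x. (x, \<zero>\<^bsub>fobj F (fibre B x)\<^esub>)"
  have SX: "S \<subseteq> topspace X" by (rule connectedin_subset_topspace [OF S])
  have zS: "connectedin FT (?z ` S)" by (rule connectedin_continuous_map_image [OF continuous_map_zero_section S])
  define C where "C z = ?z ` S \<union> range (\<lambda>c. fsmult FB c z)" for z
  have C: "connectedin FT (C z)" "z \<in> C z" "C z \<subseteq> FS S" if z: "z \<in> FS S" for z
  proof -
    have zF: "z \<in> topspace FT" using z FS_topspace by blast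
    have "continuous_map euclideanreal (prod_topology euclideanreal FT) (\<lambda>c. (c, z))"
      using zF by (intro continuous_map_pairedI) (auto simp: continuous_map_id [unfolded id_def])
    from continuous_map_compose [OF this continuous_map_fsmult]
    have "continuous_map euclideanreal FT (\<lambda>c. fsmult FB c z)" by (simp add: o_def)
    moreover have "connectedin euclideanreal UNIV" by (simp add: connectedin_iff_connected)
    ultimately have r: "connectedin FT (range (\<lambda>c. fsmult FB c z))"
      by (rule connectedin_continuous_map_image)
    note m = module_Ffibre [OF fst_FS(2) [OF z]]
    have cz: "snd z \<in> carrier (fobj F (fibre B (fst z)))" using z by (simp add: FS_iff)
    have 0: "fsmult FB 0 z = ?z (fst z)" unfolding fsmult_FB module_smult_zero [OF m cz] ..
    have "?z (fst z) \<in> range (\<lambda>c. fsmult FB c z)" by (rule range_eqI [where x = 0]) (rule 0 [symmetric])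
    moreover have "?z (fst z) \<in> ?z ` S" using fst_FS(1) [OF z] by (rule imageI)
    ultimately have ne: "?z ` S \<inter> range (\<lambda>c. fsmult FB c z) \<noteq> {}" by (simp only: disjoint_iff) blast
    show "connectedin FT (C z)" unfolding C_def by (rule connectedin_Un [OF zS r ne])
    have 1: "fsmult FB 1 z = z" unfolding fsmult_FB module_smult_one [OF m cz] by simp
    show "z \<in> C z" unfolding C_def by (rule UnI2, rule range_eqI [where x = 1]) (rule 1 [symmetric])
    show "C z \<subseteq> FS S"
      unfolding C_def using zero_FS SX scale_FS [of "fst z" "snd z" S] z by (auto simp: fsmult_FB)
  qed
  have "connectedin FT (\<Union>(C ` FS S))"
  proof (cases "S = {}")
    case True
    then have "FS S = {}" by (auto simp: FS_iff)
    then show ?thesis by simp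
  next
    case False
    then obtain x where "x \<in> S" by blast
    then have "?z x \<in> \<Inter>(C ` FS S)" by (simp add: C_def)
    then have ne: "\<Inter>(C ` FS S) \<noteq> {}" by (metis empty_iff)
    show ?thesis
    proof (rule connectedin_Union [OF _ ne])
      fix Q assume "Q \<in> C ` FS S"
      then obtain z where "z \<in> FS S" "Q = C z" by (rule imageE)
      with C(1) show "connectedin FT Q" by simp
    qed
  qed
  moreover have "\<Union>(C ` FS S) = FS S"
  proof
    show "\<Union>(C ` FS S) \<subseteq> FS S" using C(3) by (rule UN_least)
    show "FS S \<subseteq> \<Union>(C ` FS S)" using C(2) by (intro subsetI UN_I)
  qed
  ultimately show ?thesis by simp
qed

end

section \<open>The smooth structure of \<open>F(A)\<close>\<close>

lemma chart_smooth_cong: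
  assumes a: "is_chart T (d, U, c)" and op: "openin T (U \<inter> f -` V)" and eq: "\<And>x. x \<in> U \<Longrightarrow> f x = g x"
    and s: "chart_smooth f (d, U, c) (e, V, b)"
  shows "chart_smooth g (d, U, c) (e, V, b)"
proof -
  have U: "U \<inter> f -` V = U \<inter> g -` V" using eq by auto
  obtain h where h: "smooth_on d e (c ` (U \<inter> f -` V)) h" "\<forall>x\<in>U. h (c x) = b (f x)"
    using chart_smoothD [OF a s] by (elim exE conjE)
  show ?thesis
    by (rule chart_smoothI [OF a op [unfolded U] h(1) [unfolded U]]) (use h(2) eq in simp)
qed

lemma fst_prod_mfd': "fst (prod_mfd M N) = prod_topology (fst M) (fst N)"
  by (simp add: prod_mfd_def split: prod.splits)

lemma inv_into_eq_the_inv_into: "inj_on f A \<Longrightarrow> N \<subseteq> A \<Longrightarrow> y \<in> f ` N \<Longrightarrow> the_inv_into N f y = the_inv_into A f y"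
  by (metis (no_types, opaque_lifting) image_iff inj_on_subset subset_iff the_inv_into_f_f)

context whitney_functor
begin

lemma smooth_bas: "S \<in> \<S> \<Longrightarrow> smooth_manifold (XM S)"
  using strat_bas by (simp add: stratified_space_def)

lemma smooth_tot: "S \<in> \<S> \<Longrightarrow> smooth_manifold (AM S)"
  using strat_tot smooth_vb_stratum(1) by (simp add: stratified_space_def)

lemma continuous_map_proj: "continuous_map (stop (tot B)) X (proj B)"
  using svb by (simp add: stratified_vector_bundle_def strat_morphism_def)

lemma openin_over:
  assumes V: "openin (subtopology X S) V"
  shows "openin (topA S) (over B V)"
proof -
  obtain G where G: "openin X G" "V = G \<inter> S" using V unfolding openin_subtopology by blast
  have "openin (stop (tot B)) {a \<in> spt (tot B). proj B a \<in> G}"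
    by (rule openin_continuous_map_preimage [OF continuous_map_proj G(1)])
  moreover have "over B V = {a \<in> spt (tot B). proj B a \<in> G} \<inter> over B S" unfolding over_def G(2) by blast
  ultimately show ?thesis unfolding openin_subtopology by blast
qed

lemma over_mono: "U \<subseteq> V \<Longrightarrow> over B U \<subseteq> over B V"
  by (auto simp: over_def)

lemma topspace_sub_over [simp]: "topspace (topA V) = over B V"
  by (auto simp: over_def)

lemma topspace_sub_X: "V \<subseteq> topspace X \<Longrightarrow> topspace (subtopology X V) = V"
  by auto

lemma strata_disjoint: "disjoint (\<S>)"
  using part_bas by (auto simp: partition_on_def)

section \<open>Smooth trivializations over a stratum and their lifts\<close>

definition fibre_inv :: "('v \<Rightarrow> 'x \<times> vec) \<Rightarrow> 'x set \<Rightarrow> 'x \<Rightarrow> vec \<Rightarrow> 'v"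
  where "fibre_inv \<tau> V x v = the_inv_into (over B V) \<tau> (x, v)"

context
  fixes S V r \<tau>
  assumes S: "S \<in> \<S>" and slt: "smooth_local_triv B S r V \<tau>"
begin

lemma slt_open: "openin (subtopology X S) V"
  using slt by (simp add: smooth_local_triv_def)

lemma slt_subset: "V \<subseteq> S" "V \<subseteq> topspace X"
  using openin_subset [OF slt_open] stratum_subset [OF S] by auto

lemma slt_bij: "bij_betw \<tau> (over B V) (V \<times> E r)"
proof -
  have "bij_betw \<tau> (topspace (fst (AM V))) (topspace (fst (TM V r)))"
    using slt by (simp add: smooth_local_triv_def diffeo_def)
  then show ?thesis
    unfolding fst_prod_mfd' by (simp add: sub_mfd_def euc_mfd_def topspace_sub_X [OF slt_subset(2)] del: topspace_subtopology)
qed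

lemma slt_smooth:
  "smooth_map (AM V) (TM V r) \<tau>"
  "smooth_map (TM V r) (AM V) (the_inv_into (over B V) \<tau>)"
proof -
  have top: "topspace (fst (AM V)) = over B V"
    unfolding sub_mfd_def fst_conv topspace_sub_over ..
  show "smooth_map (AM V) (TM V r) \<tau>"
    "smooth_map (TM V r) (AM V) (the_inv_into (over B V) \<tau>)"
    using slt unfolding smooth_local_triv_def diffeo_def top by blast+
qed

lemma slt_fst: "a \<in> over B V \<Longrightarrow> fst (\<tau> a) = proj B a"
  using slt by (simp add: smooth_local_triv_def)

lemma slt_iso: "x \<in> V \<Longrightarrow> linear_iso (fibre B x) (Euc r) (\<lambda>a. snd (\<tau> a))"
  using slt by (simp add: smooth_local_triv_def o_def)

lemma slt_fibre_linear: "fibre_linear V r \<tau>"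
  using slt_subset(2) slt_iso by (simp add: fibre_linear_def linear_iso_def)

lemma slt_inj_fibre: "x \<in> V \<Longrightarrow> inj_on (\<lambda>a. snd (\<tau> a)) (carrier (fibre B x))"
  using slt_iso by (simp add: linear_iso_def bij_betw_def)

lemma fibre_inv:
  assumes "x \<in> V" "v \<in> E r"
  shows "fibre_inv \<tau> V x v \<in> over B V" "\<tau> (fibre_inv \<tau> V x v) = (x, v)" "proj B (fibre_inv \<tau> V x v) = x"
proof -
  have xv: "(x, v) \<in> \<tau> ` over B V" and inj: "inj_on \<tau> (over B V)" using slt_bij assms by (auto simp: bij_betw_def)
  show 1: "fibre_inv \<tau> V x v \<in> over B V"
    unfolding fibre_inv_def by (rule the_inv_into_into [OF inj xv subset_refl])
  show 2: "\<tau> (fibre_inv \<tau> V x v) = (x, v)" unfolding fibre_inv_def by (rule f_the_inv_into_f [OF inj xv])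
  show "proj B (fibre_inv \<tau> V x v) = x" using slt_fst [OF 1] 2 by simp
qed

text \<open>The matrix of \<open>g\<close> relative to the frame given by \<open>\<tau>\<close>.\<close>

definition fmat :: "('v \<Rightarrow> 'x \<times> vec) \<Rightarrow> 'x \<Rightarrow> nat \<Rightarrow> vec"
  where "fmat g x j = snd (g (fibre_inv \<tau> V x (unit_vec j)))"

lemma fmat:
  assumes g: "(\<lambda>a. snd (g a)) \<in> linear_maps (fibre B x) (Euc k)" and x: "x \<in> V" and a: "a \<in> over B {x}"
  shows "lmap r (fmat g x) (snd (\<tau> a)) = snd (g a)"
proof -
  let ?f = "\<lambda>a. snd (\<tau> a)" and ?\<eta> = "inv_into (carrier (fibre B x)) (\<lambda>a. snd (\<tau> a))"
  have xX: "x \<in> topspace X" using x slt_subset by blast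
  have \<eta>: "linear_iso (Euc r) (fibre B x) ?\<eta>"
    by (rule linear_iso_inverse [OF slt_iso [OF x] fd_vspace_module [OF fd_fibre [OF xX]] module_Euc])
  then have \<eta>l: "?\<eta> \<in> linear_maps (Euc r) (fibre B x)" by (simp add: linear_iso_def)
  have inj: "inj_on ?f (carrier (fibre B x))" by (rule slt_inj_fibre [OF x])
  have \<eta>f: "?\<eta> (?f b) = b" if "b \<in> over B {x}" for b
    by (rule inv_into_f_f [OF inj]) (use that in \<open>simp add: fibre_def\<close>)
  have fi: "fibre_inv \<tau> V x (unit_vec j) = ?\<eta> (unit_vec j)" if j: "j < r" for j
  proof -
    have "unit_vec j \<in> E r" using j by simp
    note fi = fibre_inv [OF x this]
    have "fibre_inv \<tau> V x (unit_vec j) \<in> over B {x}" using fi(1,3) by (simp add: over_def)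
    from \<eta>f [OF this] show ?thesis unfolding fi(2) snd_conv ..
  qed
  have fa: "?f a \<in> E r"
    using linear_maps_closed [OF _ , of ?f "fibre B x" "Euc r" a] slt_iso [OF x] a by (simp add: linear_iso_def fibre_def)
  have "snd (g a) = snd (g (?\<eta> (?f a)))" unfolding \<eta>f [OF a] ..
  also have "\<dots> = lmap r (\<lambda>j. snd (g (?\<eta> (unit_vec j)))) (?f a)"
    by (rule linear_maps_eq_lmap [OF linear_maps_comp [OF \<eta>l g] fa])
  also have "\<dots> = lmap r (fmat g x) (?f a)"
    unfolding fmat_def by (rule fun_cong [OF lmap_cong]) (simp add: fi)
  finally show ?thesis ..
qed

lemma fmat_E:
  assumes g: "(\<lambda>a. snd (g a)) \<in> linear_maps (fibre B x) (Euc k)" and x: "x \<in> V" and j: "j < r"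
  shows "fmat g x j \<in> E k"
proof -
  have "unit_vec j \<in> E r" using j by simp
  note fi = fibre_inv [OF x this]
  have "fibre_inv \<tau> V x (unit_vec j) \<in> carrier (fibre B x)" using fi by (simp add: over_def fibre_def)
  from linear_maps_closed [OF g this] show ?thesis by (simp add: fmat_def)
qed

text \<open>Over \<open>V\<close>, the lift of \<open>g\<close> is the lift of \<tau> followed by
  \<open>F\<close> of a matrix. Continuity and smoothness of lifts over a stratum are thereby
  reduced to the entries of \<open>fmat g\<close>.\<close>

lemma Fl_fmat:
  assumes g: "(\<lambda>a. snd (g a)) \<in> linear_maps (fibre B (fst z)) (Euc k)" and z: "z \<in> FS V"
    and I: "ident r m I"
  shows "transf r k I I' (lmap r (fmat g (fst z))) (Fl r I \<tau> z) = Fl k I' g z"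
  by (rule Fl_transf [OF slt_fibre_linear I z lmap_linear_maps [OF fmat_E [OF g fst_FS(1) [OF z]]] fmat [OF g fst_FS(1) [OF z]]])

lemma continuous_map_section:
  assumes v: "v \<in> E r"
  shows "continuous_map (subtopology X V) (topA V) (\<lambda>x. fibre_inv \<tau> V x v)"
proof -
  have "continuous_map (fst (TM V r)) (fst (AM V)) (the_inv_into (over B V) \<tau>)"
    using slt_smooth(2) by (simp add: smooth_map_def case_prod_unfold)
  then have c: "continuous_map (prodT V r) (topA V) (the_inv_into (over B V) \<tau>)"
    unfolding fst_prod_mfd' by (simp add: sub_mfd_def euc_mfd_def)
  have "continuous_map (subtopology X V) (prodT V r) (\<lambda>x. (x, v))"
    using v by (intro continuous_map_pairedI) (auto simp: continuous_map_id [unfolded id_def])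
  from continuous_map_compose [OF this c] show ?thesis by (simp add: o_def fibre_inv_def)
qed

text \<open>The lift of \<open>g\<close> is injective on the fibre by \<open>flift_inj\<close>, and
  the lift of \<tau> is bijective there; hence the matrix that links them is injective.\<close>

lemma fmat_injective:
  assumes g: "(\<lambda>a. snd (g a)) \<in> linear_maps (fibre B x) (Euc k)" and inj: "inj_on (\<lambda>a. snd (g a)) (carrier (fibre B x))"
    and x: "x \<in> V" and I: "ident r m I" "ident k m' I'" and w: "w \<in> E m"
    and eq: "transf r k I I' (lmap r (fmat g x)) w = (\<lambda>i. 0)"
  shows "w = (\<lambda>i. 0)"
proof -
  have xX: "x \<in> topspace X" using x slt_subset by blast
  have "linear_iso (fobj F (fibre B x)) (Euc m) (flift (fibre B x) r I (\<lambda>a. snd (\<tau> a)))"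
    by (rule flift_iso [OF fd_fibre [OF xX] slt_iso [OF x] I(1)])
  then obtain u where u: "u \<in> carrier (fobj F (fibre B x))" "w = Fl r I \<tau> (x, u)"
    using w by (auto simp: linear_iso_def bij_betw_def Fl_def)
  have uF: "(x, u) \<in> FS {x}" using u(1) xX by (simp add: FS_iff)
  have uV: "(x, u) \<in> FS V" using uF x by (simp add: FS_iff)
  have fl: "fibre_linear {x} k g" using g xX by (simp add: fibre_linear_def)
  have "Fl k I' g (x, u) = (\<lambda>i. 0)" using Fl_fmat [of g "(x, u)" k m I I'] g uV I(1) eq u(2) by simp
  also have "\<dots> = Fl k I' g (x, \<zero>\<^bsub>fobj F (fibre B x)\<^esub>)" using Fl_zero [OF fl I(2)] by simp
  finally have "(x, u) = (x, \<zero>\<^bsub>fobj F (fibre B x)\<^esub>)"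
    by (intro Fl_inj [OF fl I(2) _ uF zero_FS [OF xX]]) (use inj in auto)
  then have "w = Fl r I \<tau> (x, \<zero>\<^bsub>fobj F (fibre B x)\<^esub>)" using u(2) by simp
  then show ?thesis using Fl_zero [OF slt_fibre_linear I(1) x] by simp
qed

lemma continuous_map_fmat_triv:
  assumes t: "(k, U, \<phi>) \<in> \<A>" and j: "j < r"
  shows "cont_real (subtopology X (V \<inter> U)) (\<lambda>x. fmat \<phi> x j i)"
proof -
  have v: "unit_vec j \<in> E r" using j by simp
  have "continuous_map (subtopology X (V \<inter> U)) (stop (tot B)) (\<lambda>x. fibre_inv \<tau> V x (unit_vec j))"
    using continuous_map_from_subtopology_mono [OF continuous_map_into_fulltopology [OF continuous_map_section [OF v]]] by blast
  moreover have "fibre_inv \<tau> V x (unit_vec j) \<in> over B U" if "x \<in> V" "x \<in> U" for x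
    using fibre_inv [OF that(1) v] that(2) by (simp add: over_def)
  ultimately have 1: "continuous_map (subtopology X (V \<inter> U)) (topA U) (\<lambda>x. fibre_inv \<tau> V x (unit_vec j))"
    by (auto simp: continuous_map_in_subtopology)
  have "homeomorphic_map (topA U)
      (subtopology (prodT U k) (\<phi> ` topspace (topA U))) \<phi>"
    using triv_embedding [OF t] unfolding embedding_map_def .
  then have 2: "continuous_map (topA U) (prodT U k) \<phi>"
    using homeomorphic_imp_continuous_map continuous_map_into_fulltopology by blast
  from continuous_map_compose [OF continuous_map_compose [OF continuous_map_compose [OF 1 2] continuous_map_snd] continuous_map_coord]
  show ?thesis by (simp add: o_def fmat_def)
qed

text \<open>The topology knows only lifts of injective trivializations \<phi>. Near a point such a
  lift is continuous and equals an injective matrix, continuous in the base point, applied to the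
  lift of \<tau>; the matrix is cancelled. The fibre dimension over the stratum may be smaller than
  that of the target of \<phi>, so the matrix has in general no inverse.\<close>

lemma continuous_map_Fl_smooth_triv:
  assumes I: "ident r m I" and s: "s < m"
  shows "cont_real (FTS V) (\<lambda>z. Fl r I \<tau> z s)"
proof (rule continuous_map_localI)
  fix z0 assume "z0 \<in> topspace (FTS V)"
  then have z0: "z0 \<in> FS V" by simp
  obtain k U \<phi> where t: "(k, U, \<phi>) \<in> \<A>" "fst z0 \<in> U" using triv_cover [OF fst_FS(2) [OF z0]] by blast
  obtain m' I' where I': "ident k m' I'" using ex_ident by blast
  have Uo: "openin X U" by (rule triv_open [OF t(1)])
  have VU: "FS (V \<inter> U) = FS V \<inter> FS U" by (rule FS_Int)
  have No: "openin (FTS V) (FS (V \<inter> U))"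
    unfolding VU by (rule openin_subtopology_Int2 [OF openin_FS [OF Uo]])
  have N0: "z0 \<in> FS (V \<inter> U)" using z0 t(2) by (simp add: FS_iff)
  let ?Z = "FTS (V \<inter> U)"
  have Zeq: "subtopology (FTS V) (FS (V \<inter> U)) = ?Z"
    unfolding VU by (simp add: subtopology_subtopology inf.assoc [symmetric])
  have lin: "(\<lambda>a. snd (\<phi> a)) \<in> linear_maps (fibre B x) (Euc k)" if "x \<in> U" for x
    by (rule triv_linear [OF t(1) that])
  have zVU: "fst z \<in> V" "fst z \<in> U" "z \<in> FS V" "z \<in> FS U" if "z \<in> topspace ?Z" for z
    using that unfolding topspace_sub_FS VU by (auto simp: FS_iff)
  \<comment> \<open>The columns of \<open>F\<close> of the matrix of \<phi> relative to \<tau>, in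
    the chosen identifications.\<close>
  let ?A = "\<lambda>z s. transf r k I I' (lmap r (fmat \<phi> (fst z))) (unit_vec s)"
  have lm: "lmap r (fmat \<phi> (fst z)) \<in> linear_maps (Euc r) (Euc k)" if "z \<in> topspace ?Z" for z
    by (rule lmap_linear_maps [OF fmat_E [OF lin [OF zVU(2) [OF that]] zVU(1) [OF that]]])
  have lA: "lmap m (?A z) w = transf r k I I' (lmap r (fmat \<phi> (fst z))) w" if "z \<in> topspace ?Z" "w \<in> E m" for z w
    using linear_maps_eq_lmap [OF transf_linear [OF lm [OF that(1)] I I'] that(2)] by simp
  have fc: "cont_real ?Z (\<lambda>z. fmat \<phi> (fst z) j i)" if "j < r" for j i
  proof -
    from continuous_map_compose [OF continuous_map_FS_fst continuous_map_fmat_triv [OF t(1) that]]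
    show ?thesis by (simp add: o_def)
  qed
  have "cont_real ?Z (\<lambda>z. Fl r I \<tau> z s)"
  proof (rule continuous_map_cancel_injective [where A = ?A and p = m and q = m'])
    show "cont_real ?Z (\<lambda>z. ?A z s' i)" if "s' < m" "i < m'" for s' i
    proof (rule continuous_map_transf [OF _ _ I I'])
      show "cont_real ?Z (\<lambda>z. fmat \<phi> (fst z) j i)" if "j < r" for j i by (rule fc [OF that])
      show "fmat \<phi> (fst z) j \<in> E k" if "z \<in> topspace ?Z" "j < r" for z j
        by (rule fmat_E [OF lin [OF zVU(2) [OF that(1)]] zVU(1) [OF that(1)] that(2)])
    qed (use that in auto)
    show "?A z s' \<in> E m'" if "z \<in> topspace ?Z" "s' < m" for z s'
      by (rule linear_maps_E [OF transf_linear [OF lm [OF that(1)] I I']]) (use that in simp)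
    show "w = (\<lambda>i. 0)" if z: "z \<in> topspace ?Z" and w: "w \<in> E m" "lmap m (?A z) w = (\<lambda>i. 0)" for z w
      by (rule fmat_injective [OF lin [OF zVU(2) [OF z]] triv_inj_fibre [OF t(1) zVU(2) [OF z]]
            zVU(1) [OF z] I I' w(1)]) (use lA [OF z w(1)] w(2) in simp)
    show "Fl r I \<tau> z \<in> E m" if "z \<in> topspace ?Z" for z by (rule Fl_E [OF slt_fibre_linear I zVU(3) [OF that]])
    fix i
    have "cont_real (FTS U) (\<lambda>z. Fl k I' \<phi> z i)"
      using continuous_map_compose [OF continuous_map_compose [OF continuous_map_lift [OF t(1) I'] continuous_map_snd] continuous_map_coord]
      by (simp add: o_def)
    then have "cont_real ?Z (\<lambda>z. Fl k I' \<phi> z i)"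
      by (rule continuous_map_from_subtopology_mono) (simp add: VU)
    then show "cont_real ?Z (\<lambda>z. lmap m (?A z) (Fl r I \<tau> z) i)"
    proof (rule continuous_map_eq)
      fix z assume z: "z \<in> topspace ?Z"
      show "Fl k I' \<phi> z i = lmap m (?A z) (Fl r I \<tau> z) i"
        unfolding lA [OF z Fl_E [OF slt_fibre_linear I zVU(3) [OF z]]] Fl_fmat [OF lin [OF zVU(2) [OF z]] zVU(3) [OF z] I] ..
    qed
  qed (rule s)
  then show "\<exists>N. openin (FTS V) N \<and> z0 \<in> N \<and>
      cont_real (subtopology (FTS V) N) (\<lambda>z. Fl r I \<tau> z s)"
    using No N0 Zeq by (intro exI [of _ "FS (V \<inter> U)"]) simp
qed

lemma slt_Fl_surj:
  assumes I: "ident r m I" and xw: "x \<in> V" "w \<in> E m"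
  shows "\<exists>z\<in>FS V. fst z = x \<and> Fl r I \<tau> z = w"
proof -
  have xX: "x \<in> topspace X" using xw slt_subset by blast
  have "linear_iso (fobj F (fibre B x)) (Euc m) (flift (fibre B x) r I (\<lambda>a. snd (\<tau> a)))"
    by (rule flift_iso [OF fd_fibre [OF xX] slt_iso [OF xw(1)] I])
  then obtain u where "u \<in> carrier (fobj F (fibre B x))" "w = Fl r I \<tau> (x, u)"
    using xw by (auto simp: linear_iso_def bij_betw_def Fl_def)
  with xw xX show ?thesis by (intro bexI [of _ "(x, u)"]) (auto simp: FS_iff)
qed

lemma slt_Fl_inj:
  assumes "ident r m I" "z \<in> FS V" "z' \<in> FS V" "fst z = fst z'" "Fl r I \<tau> z = Fl r I \<tau> z'"
  shows "z = z'"
  by (rule Fl_inj [OF slt_fibre_linear assms(1) slt_inj_fibre assms(2-5)])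

text \<open>For the inverse, continuity is tested in the lift of some \<phi>, where it becomes
  \<open>F\<close> of the matrix of \<phi> relative to \<tau>, applied to the fibre
  coordinate.\<close>

lemma slt_lift_homeomorphic:
  assumes I: "ident r m I"
  shows "homeomorphic_map (FTS V) (prodT V m) (FL r I \<tau>)"
proof -
  let ?h = "FL r I \<tau>" and ?T = "prodT V m"
  have tT: "topspace ?T = V \<times> E m" using topspace_sub_X [OF slt_subset(2)] by simp
  have inj: "inj_on ?h (FS V)" by (rule inj_onI) (use slt_Fl_inj [OF I] in auto)
  have surj: "?h ` FS V = V \<times> E m"
  proof
    show "?h ` FS V \<subseteq> V \<times> E m" using fst_FS(1) Fl_E [OF slt_fibre_linear I] by blast
    show "V \<times> E m \<subseteq> ?h ` FS V"
    proof
      fix p assume "p \<in> V \<times> E m"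
      then have "fst p \<in> V" "snd p \<in> E m" by auto
      from slt_Fl_surj [OF I this] obtain z where "z \<in> FS V" "fst z = fst p" "Fl r I \<tau> z = snd p" by blast
      then show "p \<in> ?h ` FS V" by (intro image_eqI [of _ _ z]) auto
    qed
  qed
  define g where "g = the_inv_into (FS V) ?h"
  have g: "g p \<in> FS V" "?h (g p) = p" if "p \<in> V \<times> E m" for p
    using that the_inv_into_into [OF inj _ subset_refl] f_the_inv_into_f [OF inj] unfolding surj g_def by auto
  have gfst: "fst (g p) = fst p" and gsnd: "Fl r I \<tau> (g p) = snd p" if "p \<in> V \<times> E m" for p
    using arg_cong [OF g(2) [OF that], of fst] arg_cong [OF g(2) [OF that], of snd] unfolding fst_conv snd_conv .
  have gh: "g (?h z) = z" if "z \<in> FS V" for z unfolding g_def using the_inv_into_f_f [OF inj that] .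
  have c1: "continuous_map (FTS V) ?T ?h"
  proof (intro continuous_map_pairedI continuous_map_FS_fst)
    show "continuous_map (FTS V) (Eu m) (\<lambda>z. Fl r I \<tau> z)"
      unfolding continuous_map_Euc_iff topspace_sub_FS
      using Fl_E [OF slt_fibre_linear I] continuous_map_Fl_smooth_triv [OF I] by blast
  qed
  have c2: "continuous_map ?T FT g"
  proof (rule continuous_map_into_FT)
    show "g p \<in> FS UNIV" if "p \<in> topspace ?T" for p
      using g(1) [of p] that FS_mono [OF subset_UNIV] unfolding tT by blast
    have "continuous_map ?T X fst"
      using continuous_map_fst continuous_map_into_fulltopology by blast
    then show "continuous_map ?T X (\<lambda>p. fst (g p))"
      by (rule continuous_map_eq) (simp only: tT gfst)
    fix p assume p: "p \<in> topspace ?T"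
    then have "fst p \<in> V" unfolding tT by auto
    then obtain k U \<phi> where t: "(k, U, \<phi>) \<in> \<A>" "fst p \<in> U" using triv_cover slt_subset by blast
    obtain m' I' where I': "ident k m' I'" using ex_ident by blast
    have Uo: "openin X U" by (rule triv_open [OF t(1)])
    have lin: "(\<lambda>a. snd (\<phi> a)) \<in> linear_maps (fibre B x) (Euc k)" if "x \<in> U" for x
      by (rule triv_linear [OF t(1) that])
    let ?N = "(V \<inter> U) \<times> E m"
    have "openin (subtopology X V) (V \<inter> U)" using Uo by (rule openin_subtopology_Int2)
    then have No: "openin ?T ?N" by (simp add: openin_prod_Times_iff)
    have TN: "subtopology ?T ?N = prodT (V \<inter> U) m"
      by (simp add: subtopology_Times subtopology_subtopology inf.assoc [symmetric])
    have tN: "topspace (prodT (V \<inter> U) m) = ?N"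
      using slt_subset by auto
    have "cont_real (subtopology ?T ?N) (\<lambda>p. Fl k I' \<phi> (g p) i)" for i
      unfolding TN
    proof (rule continuous_map_eq)
      show "cont_real (prodT (V \<inter> U) m)
          (\<lambda>p. transf r k I I' (lmap r (fmat \<phi> (fst p))) (snd p) i)"
      proof (rule continuous_map_transf [OF _ _ I I'])
        show "cont_real (prodT (V \<inter> U) m) (\<lambda>p. fmat \<phi> (fst p) j i)"
          if "j < r" for j i
          using continuous_map_compose [OF continuous_map_fst continuous_map_fmat_triv [OF t(1) that]] by (simp add: o_def)
        show "fmat \<phi> (fst p) j \<in> E k" if "p \<in> topspace (prodT (V \<inter> U) m)" "j < r" for p j
          using that unfolding tN by (intro fmat_E [OF lin]) auto
        show "snd p \<in> E m" if "p \<in> topspace (prodT (V \<inter> U) m)" for p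
          using that by auto
        show "cont_real (prodT (V \<inter> U) m) (\<lambda>p. snd p s)" for s
          using continuous_map_compose [OF continuous_map_snd continuous_map_coord] by (simp add: o_def)
      qed
      fix q assume "q \<in> topspace (prodT (V \<inter> U) m)"
      then have q: "q \<in> V \<times> E m" "fst q \<in> U" unfolding tN by auto
      have l: "(\<lambda>a. snd (\<phi> a)) \<in> linear_maps (fibre B (fst (g q))) (Euc k)" unfolding gfst [OF q(1)] by (rule lin [OF q(2)])
      show "transf r k I I' (lmap r (fmat \<phi> (fst q))) (snd q) i = Fl k I' \<phi> (g q) i"
        using Fl_fmat [OF l g(1) [OF q(1)] I, of I'] unfolding gfst [OF q(1)] gsnd [OF q(1)] by simp
    qed
    moreover have "fst (g q) \<in> U" if "q \<in> ?N" for q using gfst [of q] that by auto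
    moreover have "p \<in> ?N" using p t(2) unfolding tT by auto
    ultimately show "\<exists>k U \<phi> m' I N. (k, U, \<phi>) \<in> \<A> \<and> ident k m' I \<and> openin ?T N \<and> p \<in> N \<and>
      (\<forall>y\<in>N. fst (g y) \<in> U) \<and> (\<forall>i<m'. cont_real (subtopology ?T N) (\<lambda>y. Fl k I \<phi> (g y) i))"
      using t(1) I' No by (intro exI conjI ballI allI impI) assumption+
  qed
  have "homeomorphic_maps (FTS V) ?T ?h g"
    unfolding homeomorphic_maps_def tT topspace_sub_FS
  proof (intro conjI ballI)
    show "continuous_map ?T (FTS V) g"
      unfolding continuous_map_in_subtopology tT using c2 g(1) by blast
  qed (use c1 gh g(2) in auto)
  then show ?thesis using homeomorphic_map_maps by blast
qed

end

end

lemma smooth_on_tail: "smooth_on n (d + k) D h \<Longrightarrow> smooth_on n k D (\<lambda>u. pr2 d (h u))"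
  by (simp add: smooth_on_def pr2_def)

lemma smooth_on_id: "smooth_on n m D (\<lambda>x. x)"
  by (simp add: smooth_on_def Ck_coord)

lemma smooth_on_const: "smooth_on n m D (\<lambda>x. v)"
  by (simp add: smooth_on_def Ck_const)

lemma smooth_on_empty: "smooth_on n m {} f"
  by (rule smooth_on_local) auto

lemma fst_euc_mfd [simp]: "fst (euc_mfd k) = Eu k"
  by (simp add: euc_mfd_def)

lemma prod_euc_mfd:
  assumes "atlas (fst M) (snd M)"
  shows "fst (prod_mfd M (euc_mfd k)) = prod_topology (fst M) (Eu k)"
    and "atlas (prod_topology (fst M) (Eu k)) (snd (prod_mfd M (euc_mfd k)))"
    and "(d, U, c) \<in> snd M \<Longrightarrow> (d + k, U \<times> E k, \<lambda>(x, v). append_coords d (c x) v) \<in> snd (prod_mfd M (euc_mfd k))"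
proof -
  obtain T \<A> where M: "M = (T, \<A>)" by (metis surj_pair)
  have e: "euc_mfd k = (Eu k, snd (euc_mfd k))" by (simp add: euc_mfd_def)
  note * = prod_mfd_props [OF assms [unfolded M fst_conv snd_conv] atlas_euc_mfd [of k]]
  show "fst (prod_mfd M (euc_mfd k)) = prod_topology (fst M) (Eu k)"
    unfolding fst_prod_mfd' by simp
  show "atlas (prod_topology (fst M) (Eu k)) (snd (prod_mfd M (euc_mfd k)))"
    using *(2) unfolding M e [symmetric] by simp
  show "(d + k, U \<times> E k, \<lambda>(x, v). append_coords d (c x) v) \<in> snd (prod_mfd M (euc_mfd k))"
    if "(d, U, c) \<in> snd M"
    using *(3) [OF _ euc_chart_mem, of d U c] that unfolding M e [symmetric] by simp
qed

context whitney_functor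
begin

lemma atlas_bas:
  assumes "S \<in> \<S>" "openin (subtopology X S) V"
  shows "atlas (subtopology X V) (snd (XM V))"
  by (rule atlas_sub_mfd(1) [OF smooth_bas [OF assms(1)] assms(2)])

lemma atlas_tot:
  assumes "S \<in> \<S>" "openin (subtopology X S) V"
  shows "atlas (topA V) (snd (AM V))"
  by (rule atlas_sub_mfd(1) [OF smooth_tot [OF assms(1)] openin_over [OF assms(2)]])

lemma fst_sub_mfd [simp]: "fst (sub_mfd Y V) = subtopology (stop Y) V"
  by (simp add: sub_mfd_def)

lemma bas_chart_open:
  assumes S: "S \<in> \<S>" and c: "(d, U, c) \<in> charts (bas B)" "U \<subseteq> S"
  shows "openin (subtopology X S) U"
proof -
  have "(d, U, c) \<in> snd (XM S)" using c by (simp add: sub_mfd_charts)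
  then show ?thesis using chart_open [OF atlas_chart [OF atlas_bas [OF S]]] by (metis openin_subtopology_self openin_subset openin_topspace stratum_subset [OF S] topspace_sub_X)
qed

lemma bas_chart:
  assumes S: "S \<in> \<S>" and V: "openin (subtopology X S) V" and c: "(d, U, c) \<in> charts (bas B)" "U \<subseteq> V"
  shows "is_chart (subtopology X V) (d, U, c)"
  by (rule atlas_chart [OF atlas_bas [OF S V]]) (use c in \<open>simp add: sub_mfd_charts\<close>)

lemma bas_chart_restrict:
  assumes S: "S \<in> \<S>" and c: "(d, U, c) \<in> charts (bas B)" "U \<subseteq> S"
    and N: "openin (subtopology X S) N" "N \<subseteq> U"
  shows "(d, N, c) \<in> charts (bas B)"
  using atlas_sub_mfd(2) [OF smooth_bas [OF S] N(1), of d U c N] c N by (simp add: sub_mfd_charts)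

subsection \<open>Smoothness of matrix entries\<close>

text \<open>Smoothness of the fibre component alone, stated in charts of the total space; it can be
  stated in the same way for injective trivializations restricted to a stratum and for smooth
  ones.\<close>

definition fibre_smooth :: "'x set \<Rightarrow> nat \<Rightarrow> ('v \<Rightarrow> 'x \<times> vec) \<Rightarrow> bool"
  where "fibre_smooth V k g \<longleftrightarrow> (\<forall>e N b. (e, N, b) \<in> charts (tot B) \<and> N \<subseteq> over B V \<longrightarrow>
    (\<exists>h. smooth_on e k (b ` N) h \<and> (\<forall>a\<in>N. h (b a) = snd (g a))))"

text \<open>Product charts list the \<open>d\<close> base coordinates first, so the fibre component
  is the tail of a smooth map.\<close>

lemma fibre_smoothI:
  assumes S: "S \<in> \<S>" and V: "openin (subtopology X S) V"
    and g: "smooth_map (AM V) (TM V k) g"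
    and c: "(d, V0, c) \<in> charts (bas B)" "V0 \<subseteq> V"
    and ga: "\<And>a. a \<in> over B V0 \<Longrightarrow> fst (g a) = proj B a" "\<And>a. a \<in> over B V0 \<Longrightarrow> snd (g a) \<in> E k"
  shows "fibre_smooth V0 k g"
  unfolding fibre_smooth_def
proof (intro allI impI)
  fix e N b assume N: "(e, N, b) \<in> charts (tot B) \<and> N \<subseteq> over B V0"
  have NV: "N \<subseteq> over B V" using N over_mono [OF c(2)] by blast
  have nm: "(e, N, b) \<in> snd (AM V)" using N NV by (simp add: sub_mfd_charts)
  have pm: "(d + k, V0 \<times> E k, \<lambda>(x, v). append_coords d (c x) v) \<in> snd (TM V k)"
    by (rule prod_euc_mfd(3)) (use atlas_bas [OF S V] c in \<open>simp_all add: sub_mfd_charts\<close>)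
  obtain h where h: "smooth_on e (d + k) (b ` (N \<inter> g -` (V0 \<times> E k))) h"
      "\<forall>a\<in>N. h (b a) = (case g a of (x, v) \<Rightarrow> append_coords d (c x) v)"
    using chart_smoothD [OF atlas_chart [OF atlas_tot [OF S V] nm] smooth_mapD [OF g nm pm]] by (elim exE conjE)
  have "g a \<in> V0 \<times> E k" if "a \<in> N" for a
  proof -
    have "a \<in> over B V0" using that N by blast
    then show ?thesis using ga [of a] by (simp add: mem_Times_iff over_def)
  qed
  then have "N \<inter> g -` (V0 \<times> E k) = N" by blast
  with h(1) have "smooth_on e (d + k) (b ` N) h" by simp
  then have "smooth_on e k (b ` N) (\<lambda>u. pr2 d (h u))" by (rule smooth_on_tail)
  moreover have "\<forall>a\<in>N. pr2 d (h (b a)) = snd (g a)" using h(2) by (simp add: case_prod_unfold)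
  ultimately show "\<exists>h. smooth_on e k (b ` N) h \<and> (\<forall>a\<in>N. h (b a) = snd (g a))" by blast
qed

lemma slt_fibre_smooth:
  assumes S: "S \<in> \<S>" and slt: "smooth_local_triv B S r V \<tau>" and c: "(d, V0, c) \<in> charts (bas B)" "V0 \<subseteq> V"
  shows "fibre_smooth V0 r \<tau>"
proof (rule fibre_smoothI [OF S slt_open [OF S slt] slt_smooth(1) [OF S slt] c])
  fix a assume "a \<in> over B V0"
  then have a: "a \<in> over B V" using over_mono [OF c(2)] by blast
  show "fst (\<tau> a) = proj B a" by (rule slt_fst [OF S slt a])
  have "\<tau> a \<in> V \<times> E r" using slt_bij [OF S slt] a by (auto simp: bij_betw_def)
  then show "snd (\<tau> a) \<in> E r" by auto
qed

lemma sub_mfd_target: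
  assumes S: "S \<in> \<S>" and ne: "S \<inter> U \<noteq> {}"
  shows "sub_mfd (strat_prod (strat_restrict (bas B) U) (one_stratum (euc_mfd k))) ((S \<inter> U) \<times> E k)
    = TM (S \<inter> U) k"
proof -
  have e: "euc_mfd k = (Eu k, snd (euc_mfd k))" by (simp add: euc_mfd_def)
  have "disjoint (strata (strat_restrict (bas B) U))"
    using strata_disjoint unfolding disjoint_def strat_restrict_def by auto
  moreover have "disjoint (strata (one_stratum (euc_mfd k)))" by (simp add: one_stratum_def disjoint_def)
  moreover have "S \<inter> U \<in> strata (strat_restrict (bas B) U)" using S ne by (auto simp: strat_restrict_def)
  moreover have "E k \<in> strata (one_stratum (euc_mfd k))" by (simp add: one_stratum_def)
  ultimately have "sub_mfd (strat_prod (strat_restrict (bas B) U) (one_stratum (euc_mfd k))) ((S \<inter> U) \<times> E k)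
      = prod_mfd (sub_mfd (strat_restrict (bas B) U) (S \<inter> U)) (sub_mfd (one_stratum (euc_mfd k)) (E k))"
    by (rule sub_mfd_strat_prod)
  also have "sub_mfd (strat_restrict (bas B) U) (S \<inter> U) = XM (S \<inter> U)"
    by (rule sub_mfd_strat_restrict) simp
  also have "sub_mfd (one_stratum (euc_mfd k)) (E k) = euc_mfd k"
    using sub_mfd_one_stratum [OF atlas_euc_mfd [of k]] unfolding e [symmetric] .
  finally show ?thesis .
qed

lemma openin_stratum_Int: "openin X U \<Longrightarrow> openin (subtopology X S) (S \<inter> U)"
  by (rule openin_subtopology_Int2)

lemma triv_fibre_smooth:
  assumes S: "S \<in> \<S>" and t: "(k, U, \<phi>) \<in> \<A>" and c: "(d, V0, c) \<in> charts (bas B)" "V0 \<subseteq> S \<inter> U"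
  shows "fibre_smooth V0 k \<phi>"
proof (cases "V0 = {}")
  case True
  then have "over B V0 = {}" by (simp add: over_def)
  then show ?thesis unfolding fibre_smooth_def using smooth_on_empty by auto
next
  case False
  note lt = triv_local [OF t]
  obtain x where x: "x \<in> S" "x \<in> U" using False c(2) by blast
  then have xX: "x \<in> topspace X" using stratum_subset [OF S] by blast
  have "\<zero>\<^bsub>fibre B x\<^esub> \<in> carrier (fibre B x)" by (rule module_zero_closed [OF fd_vspace_module [OF fd_fibre [OF xX]]])
  then obtain a where a: "a \<in> over B {x}" by (auto simp: fibre_def)
  have ov: "over B S \<inter> over B U = over B (S \<inter> U)" by (auto simp: over_def)
  have aSU: "a \<in> over B (S \<inter> U)" "a \<in> over B U" "proj B a = x" using a x by (auto simp: over_def)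
  have "over B (S \<inter> U) \<in> strata (strat_restrict (tot B) (over B U))"
    unfolding strat_restrict_def using smooth_vb_stratum(1) [OF S] ov aSU(1) by auto
  then obtain T where T: "T \<in> strata (strat_prod (strat_restrict (bas B) U) (one_stratum (euc_mfd k)))"
    "\<phi> ` over B (S \<inter> U) \<subseteq> T" "smooth_map (sub_mfd (strat_restrict (tot B) (over B U)) (over B (S \<inter> U)))
      (sub_mfd (strat_prod (strat_restrict (bas B) U) (one_stratum (euc_mfd k))) T) \<phi>"
    using local_triv_morphism [OF lt] unfolding strat_morphism_def by blast
  \<comment> \<open>The morphism property provides only some stratum \<open>T\<close> of the target.
    The vector \<open>a\<close> over \<open>x\<close> shows that the base factor of \<open>T\<close>
    meets \<open>S\<close>, hence is \<open>S\<close>.\<close>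
  from T(1) obtain S' where S': "S' \<in> \<S>" "T = (S' \<inter> U) \<times> E k"
    by (auto simp: strat_prod_def strat_restrict_def one_stratum_def)
  have "\<phi> a \<in> T" using T(2) aSU(1) by blast
  then have "x \<in> S'" using local_triv_fst [OF lt aSU(2)] aSU(3) S'(2) by auto
  then have SS: "S' = S" using S'(1) S x(1) strata_disjoint unfolding disjoint_def by blast
  have "sub_mfd (strat_restrict (tot B) (over B U)) (over B (S \<inter> U)) = AM (S \<inter> U)"
    by (rule sub_mfd_strat_restrict) (auto simp: over_def)
  moreover have "sub_mfd (strat_prod (strat_restrict (bas B) U) (one_stratum (euc_mfd k))) T
      = TM (S \<inter> U) k"
    unfolding S'(2) SS by (rule sub_mfd_target [OF S]) (use x in blast)
  ultimately have g: "smooth_map (AM (S \<inter> U)) (TM (S \<inter> U) k) \<phi>"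
    using T(3) by simp
  show ?thesis
  proof (rule fibre_smoothI [OF S openin_stratum_Int [OF local_triv_open [OF lt]] g c])
    fix a assume "a \<in> over B V0"
    then have aU: "a \<in> over B U" using c(2) by (auto simp: over_def)
    show "fst (\<phi> a) = proj B a" "snd (\<phi> a) \<in> E k" by (rule local_triv_fst [OF lt aU], rule local_triv_E [OF lt aU])
  qed
qed

text \<open>The entry is a composite of smooth maps in charts: attach the constant fibre coordinate
  \<open>unit_vec j\<close>, apply the inverse of \<tau>, then the fibre component of
  \<open>g\<close>. Charts of the total space are available only locally, so the argument is made
  around each point.\<close>

lemma fmat_smooth:
  assumes S: "S \<in> \<S>" and slt: "smooth_local_triv B S r V \<tau>" and c: "(d, V0, c) \<in> charts (bas B)" "V0 \<subseteq> V"
    and g: "fibre_smooth V0 k g" and j: "j < r"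
  shows "\<exists>h. smooth_on d k (c ` V0) h \<and> (\<forall>x\<in>V0. h (c x) = fmat V \<tau> g x j)"
proof -
  note Vo = slt_open [OF S slt]
  have ca: "is_chart (subtopology X V) (d, V0, c)" by (rule bas_chart [OF S Vo c])
  have VS: "V \<subseteq> S" by (rule slt_subset(1) [OF S slt])
  have V0o: "openin (subtopology X S) V0" using bas_chart_open [OF S c(1)] c(2) VS by blast
  define s where "s x = fibre_inv \<tau> V x (unit_vec j)" for x
  have ej: "unit_vec j \<in> E r" using j by simp
  define H where "H u = snd (g (s (the_inv_into V0 c u)))" for u
  have Hc: "H (c x) = fmat V \<tau> g x j" if "x \<in> V0" for x
    unfolding H_def s_def fmat_def [OF S slt] the_inv_into_f_f [OF chart_inj [OF ca] that] ..
  have "smooth_on d k (c ` V0) H"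
  proof (rule smooth_on_local)
    show "openin (Eu d) (c ` V0)" by (rule chart_image_open [OF ca chart_open [OF ca] subset_refl])
    fix y assume "y \<in> c ` V0"
    then obtain x where x: "x \<in> V0" "y = c x" by blast
    have xV: "x \<in> V" using x c(2) by blast
    have sx: "s x \<in> over B V" "proj B (s x) = x" unfolding s_def by (rule fibre_inv [OF S slt xV ej])+
    then have sx0: "s x \<in> over B V0" using x by (simp add: over_def)
    have at: "atlas (topA S) (snd (AM S))"
      by (rule atlas_tot [OF S]) (use openin_topspace [of "subtopology X S"] topspace_sub_X [OF stratum_subset [OF S]] in simp)
    have "s x \<in> topspace (topA S)"
      unfolding topspace_sub_over using sx over_mono [OF VS] by blast
    from atlas_cover [OF at this] obtain e N1 b where N1: "(e, N1, b) \<in> snd (AM S)" "s x \<in> N1"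
      by (elim exE conjE)
    \<comment> \<open>\<open>fibre_smooth\<close> speaks of charts over \<open>V0\<close> only, so
      the chart about \<open>s x\<close> is cut down to the part over \<open>V0\<close>.\<close>
    define N where "N = N1 \<inter> over B V0"
    have No: "openin (topA S) N"
      unfolding N_def by (rule openin_Int [OF chart_open [OF atlas_chart [OF at N1(1)]] openin_over [OF V0o]])
    have NV: "N \<subseteq> over B V" unfolding N_def using over_mono [OF c(2)] by blast
    have Nm: "(e, N, b) \<in> snd (AM V)"
      by (rule atlas_sub_mfd(2) [OF smooth_tot [OF S] openin_over [OF Vo] N1(1) No _ NV]) (simp add: N_def)
    have cN: "is_chart (topA V) (e, N, b)"
      by (rule atlas_chart [OF atlas_tot [OF S Vo] Nm])
    have pm: "(d + r, V0 \<times> E r, \<lambda>(x, v). append_coords d (c x) v) \<in> snd (TM V r)"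
      by (rule prod_euc_mfd(3)) (use atlas_bas [OF S Vo] c in \<open>simp_all add: sub_mfd_charts\<close>)
    let ?i = "the_inv_into (over B V) \<tau>" and ?p = "\<lambda>(x, v). append_coords d (c x) v"
    have pmc: "is_chart (prodT V r) (d + r, V0 \<times> E r, ?p)"
      using atlas_chart [OF prod_euc_mfd(2) pm] atlas_bas [OF S Vo] by simp
    obtain h1 where h1: "smooth_on (d + r) e (?p ` (V0 \<times> E r \<inter> ?i -` N)) h1" "\<forall>q\<in>V0 \<times> E r. h1 (?p q) = b (?i q)"
      using chart_smoothD [OF pmc smooth_mapD [OF slt_smooth(2) [OF S slt] pm Nm]] by (elim exE conjE)
    have is': "?i (x, unit_vec j) = s x" for x by (simp add: s_def fibre_inv_def)
    have ci: "continuous_map (prodT V r) (topA V) ?i"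
      using smooth_map_cont [OF slt_smooth(2) [OF S slt]] unfolding fst_prod_mfd' by simp
    have op1: "openin (Eu (d + r)) (?p ` (V0 \<times> E r \<inter> ?i -` N))"
      by (rule chart_image_open [OF pmc openin_chart_vimage [OF ci pmc cN]]) blast
    have cs: "continuous_map (subtopology X V) (topA V) s"
      unfolding s_def by (rule continuous_map_section [OF S slt ej])
    define W where "W = V0 \<inter> s -` N"
    have Wo: "openin (subtopology X V) W" unfolding W_def by (rule openin_chart_vimage [OF cs ca cN])
    have cW: "openin (Eu d) (c ` W)" by (rule chart_image_open [OF ca Wo]) (simp add: W_def)
    have h0: "smooth_on d (d + r) (c ` W) (\<lambda>u. append_coords d u (unit_vec j))"
      by (rule smooth_on_append [OF smooth_on_id smooth_on_const])
    have m0: "append_coords d u (unit_vec j) \<in> ?p ` (V0 \<times> E r \<inter> ?i -` N)" if u: "u \<in> c ` W" for u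
    proof -
      obtain x' where x': "x' \<in> W" "u = c x'" using u by blast
      then have "(x', unit_vec j) \<in> V0 \<times> E r \<inter> ?i -` N" using is' ej by (simp add: W_def)
      then show ?thesis unfolding x'(2) by (intro image_eqI [of _ _ "(x', unit_vec j)"]) simp
    qed
    have s1: "smooth_on d e (c ` W) (\<lambda>u. h1 (append_coords d u (unit_vec j)))"
      by (rule smooth_on_compose [OF cW op1 m0 h0 h1(1)])
    have v1: "h1 (append_coords d (c x') (unit_vec j)) = b (s x')" if "x' \<in> W" for x'
      using bspec [OF h1(2), of "(x', unit_vec j)"] that ej is' by (simp add: W_def)
    obtain h2 where h2: "smooth_on e k (b ` N) h2" "\<forall>a\<in>N. h2 (b a) = snd (g a)"
    proof -
      have "(e, N, b) \<in> charts (tot B) \<and> N \<subseteq> over B V0" using Nm by (simp add: sub_mfd_charts N_def)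
      then show thesis using g that unfolding fibre_smooth_def by blast
    qed
    have opN: "openin (Eu e) (b ` N)" by (rule chart_image_open [OF cN chart_open [OF cN] subset_refl])
    have m1: "h1 (append_coords d u (unit_vec j)) \<in> b ` N" if u: "u \<in> c ` W" for u
    proof -
      obtain x' where x': "x' \<in> W" "u = c x'" using u by blast
      show ?thesis unfolding x'(2) v1 [OF x'(1)] using x'(1) by (simp add: W_def)
    qed
    have "smooth_on d k (c ` W) (\<lambda>u. h2 (h1 (append_coords d u (unit_vec j))))"
      by (rule smooth_on_compose [OF cW opN m1 s1 h2(1)])
    then have sW: "smooth_on d k (c ` W) H"
    proof (rule smooth_on_cong [OF cW])
      fix u i assume "u \<in> c ` W"
      then obtain x' where x': "x' \<in> W" "u = c x'" by blast
      then have "x' \<in> V0" "s x' \<in> N" by (auto simp: W_def)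
      then show "h2 (h1 (append_coords d u (unit_vec j))) i = H u i"
        unfolding x'(2) v1 [OF x'(1)] H_def using h2(2) the_inv_into_f_f [OF chart_inj [OF ca]] by simp
    qed
    show "\<exists>D'. openin (Eu d) D' \<and> y \<in> D' \<and> D' \<subseteq> c ` V0 \<and> smooth_on d k D' H"
    proof (intro exI [of _ "c ` W"] conjI cW sW)
      have "x \<in> W" using x(1) sx0 N1(2) by (simp add: W_def N_def)
      then show "y \<in> c ` W" unfolding x(2) by (rule imageI)
      show "c ` W \<subseteq> c ` V0" by (auto simp: W_def)
    qed
  qed
  with Hc show ?thesis by (intro exI [of _ H] conjI ballI)
qed

text \<open>In the chart of \<open>F(A)\<close> given by \<open>c\<close> and \<open>F(\<tau>)\<close>, the map \<open>F(g)\<close> is linear in the fibre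
  coordinates, with coefficients that are linear in the smooth entries of \<open>fmat V \<tau> g\<close>.\<close>

lemma Fl_smooth:
  assumes S: "S \<in> \<S>" and slt: "smooth_local_triv B S r V \<tau>" and c: "(d, V0, c) \<in> charts (bas B)" "V0 \<subseteq> V"
    and g: "fibre_smooth V0 k g" "fibre_linear V0 k g" and I: "ident r m I" "ident k m' I'"
  shows "\<exists>h. smooth_on (d + m) m' {w \<in> E (d + m). pr1 d w \<in> c ` V0} h \<and>
    (\<forall>z\<in>FS V0. h (append_coords d (c (fst z)) (Fl r I \<tau> z)) = Fl k I' g z)"
proof -
  note Vo = slt_open [OF S slt]
  have ca: "is_chart (subtopology X V) (d, V0, c)" by (rule bas_chart [OF S Vo c])
  let ?D = "{w \<in> E (d + m). pr1 d w \<in> c ` V0}"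
  have cV: "openin (Eu d) (c ` V0)" by (rule chart_image_open [OF ca chart_open [OF ca] subset_refl])
  have Do: "openin (Eu (d + m)) ?D"
    by (rule openin_continuous_map_preimage [OF continuous_map_pr1 cV])
  have "\<forall>j\<in>{..<r}. \<exists>h. smooth_on d k (c ` V0) h \<and> (\<forall>x\<in>V0. h (c x) = fmat V \<tau> g x j)"
    using fmat_smooth [OF S slt c g(1)] by simp
  from bchoice [OF this] obtain hj where hj: "\<And>j. j < r \<Longrightarrow> smooth_on d k (c ` V0) (hj j)"
      "\<And>j x. j < r \<Longrightarrow> x \<in> V0 \<Longrightarrow> hj j (c x) = fmat V \<tau> g x j" by auto
  define h where "h w = (\<lambda>i. \<Sum>s<m. pr2 d w s * (\<Sum>t\<in>{..<r} \<times> {..<k}. hj (fst t) (pr1 d w) (snd t) *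
    transf r k I I' (matrix_unit t) (unit_vec s) i))" for w
  have "smooth_on (d + m) m' ?D h"
    unfolding smooth_on_def h_def
  proof (intro allI impI Ck_sum Ck_mult)
    fix q s
    show "Ck q (d + m) ?D (\<lambda>w. pr2 d w s)" unfolding pr2_def by (rule Ck_coord)
  next
    fix q s t assume t: "t \<in> {..<r} \<times> {..<k}"
    show "Ck q (d + m) ?D (\<lambda>w. hj (fst t) (pr1 d w) (snd t))"
    proof (rule Ck_compose [OF Do cV, where f = "\<lambda>u. hj (fst t) u (snd t)" and h = "pr1 d"])
      show "Ck q (d + m) ?D (\<lambda>w. pr1 d w j)" if "j < d" for j using that unfolding pr1_def by (simp add: Ck_coord)
      show "Ck q d (c ` V0) (\<lambda>u. hj (fst t) u (snd t))" using hj(1) [of "fst t"] t by (auto simp: smooth_on_def)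
    qed simp
  qed (rule Ck_const)
  moreover have "h (append_coords d (c (fst z)) (Fl r I \<tau> z)) = Fl k I' g z" if z: "z \<in> FS V0" for z
  proof
    fix i
    have zV: "z \<in> FS V" "fst z \<in> V" "fst z \<in> V0" using z c(2) FS_mono [OF c(2)] fst_FS(1) by blast+
    have gl: "(\<lambda>a. snd (g a)) \<in> linear_maps (fibre B (fst z)) (Euc k)"
      using g(2) zV(3) by (simp add: fibre_linear_def)
    have lm: "lmap r (fmat V \<tau> g (fst z)) \<in> linear_maps (Euc r) (Euc k)"
      by (rule lmap_linear_maps [OF fmat_E [OF S slt gl zV(2)]])
    have w: "Fl r I \<tau> z \<in> E m" by (rule Fl_E [OF slt_fibre_linear [OF S slt] I(1) zV(1)])
    have cz: "c (fst z) \<in> E d" by (rule chart_E [OF ca zV(3)])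
    have "Fl k I' g z i = transf r k I I' (lmap r (fmat V \<tau> g (fst z))) (Fl r I \<tau> z) i"
      using Fl_fmat [OF S slt gl zV(1) I(1), of I'] by simp
    also have "\<dots> = (\<Sum>s<m. Fl r I \<tau> z s * (\<Sum>t\<in>{..<r} \<times> {..<k}. fmat V \<tau> g (fst z) (fst t) (snd t) *
        transf r k I I' (matrix_unit t) (unit_vec s) i))"
      unfolding transf_matrix [OF lm I w] by (auto simp: lmap_unit_vec intro!: sum.cong)
    also have "\<dots> = h (append_coords d (c (fst z)) (Fl r I \<tau> z)) i"
      unfolding h_def pr1_append [OF cz] pr2_append by (rule sum.cong [OF refl]) (use hj(2) zV(3) in \<open>auto intro!: sum.cong\<close>)
    finally show "h (append_coords d (c (fst z)) (Fl r I \<tau> z)) i = Fl k I' g z i" ..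
  qed
  ultimately show ?thesis by (intro exI [of _ h] conjI ballI)
qed

subsection \<open>Charts of \<open>F(A)\<close>\<close>

definition Fchart :: "nat \<Rightarrow> ('x \<Rightarrow> vec) \<Rightarrow> nat \<Rightarrow> ('v \<Rightarrow> vec) \<Rightarrow> ('v \<Rightarrow> 'x \<times> vec) \<Rightarrow> 'x \<times> 'v \<Rightarrow> vec"
  where "Fchart d c r I \<tau> z = append_coords d (c (fst z)) (Fl r I \<tau> z)"

lemma functor_charts_iff: "a \<in> functor_charts emb F B S \<longleftrightarrow> (\<exists>d V c r \<tau> m I. a = (d + m, FS V, Fchart d c r I \<tau>) \<and>
    (d, V, c) \<in> charts (bas B) \<and> V \<subseteq> S \<and> smooth_local_triv B S r V \<tau> \<and> ident r m I)"
proof -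
  have eq: "(\<lambda>(x, v). append_coords d (c x) (snd (functor_lift emb F B r I \<tau> (x, v)))) = Fchart d c r I \<tau>" for d c r I \<tau>
    unfolding functor_lift_eq by (auto simp: Fchart_def)
  then show ?thesis
    unfolding functor_charts_def FS_def [symmetric] sub_mfd_charts ident_def mem_Collect_eq eq by blast
qed

lemma Fchart_image:
  assumes S: "S \<in> \<S>" and slt: "smooth_local_triv B S r V \<tau>" and c: "(d, V0, c) \<in> charts (bas B)" "V0 \<subseteq> V"
    and I: "ident r m I"
  shows "Fchart d c r I \<tau> ` FS V0 = {w \<in> E (d + m). pr1 d w \<in> c ` V0}"
proof (intro equalityI subsetI)
  have ca: "is_chart (subtopology X V) (d, V0, c)" by (rule bas_chart [OF S slt_open [OF S slt] c])
  {
    fix w assume "w \<in> Fchart d c r I \<tau> ` FS V0"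
    then obtain z where z: "z \<in> FS V0" "w = Fchart d c r I \<tau> z" by blast
    have zV: "z \<in> FS V" "fst z \<in> V0" using z(1) FS_mono [OF c(2)] fst_FS(1) by blast+
    show "w \<in> {w \<in> E (d + m). pr1 d w \<in> c ` V0}"
      unfolding z(2) Fchart_def using append_coords_E [OF Fl_E [OF slt_fibre_linear [OF S slt] I zV(1)]]
        pr1_append [OF chart_E [OF ca zV(2)]] zV(2) by simp
  next
    fix w assume w: "w \<in> {w \<in> E (d + m). pr1 d w \<in> c ` V0}"
    then obtain x where x: "x \<in> V0" "pr1 d w = c x" by blast
    have xV: "x \<in> V" using x(1) c(2) by blast
    have "pr2 d w \<in> E m" using w by (simp add: pr2_E)
    from slt_Fl_surj [OF S slt I xV this] obtain z where z: "z \<in> FS V" "fst z = x" "Fl r I \<tau> z = pr2 d w" by blast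
    have "z \<in> FS V0" using z x(1) by (simp add: FS_iff)
    moreover have "w = Fchart d c r I \<tau> z" unfolding Fchart_def z(2,3) x(2) [symmetric] append_pr ..
    ultimately show "w \<in> Fchart d c r I \<tau> ` FS V0" by blast
  }
qed

lemma openin_FS_stratum:
  assumes "openin (subtopology X S) V"
  shows "openin (FTS S) (FS V)"
proof -
  obtain G where G: "openin X G" "V = G \<inter> S" using assms unfolding openin_subtopology by blast
  show ?thesis unfolding G(2) FS_Int openin_subtopology using openin_FS [OF G(1)] by blast
qed

text \<open>The homeomorphism onto \<open>V \<times> \<real>^m\<close> from
  \<open>slt_lift_homeomorphic\<close>, followed by a product chart. This is where the topology of
  \<open>F(A)\<close> and its intended smooth structure are seen to agree.\<close>

lemma is_chart_Fchart:
  assumes S: "S \<in> \<S>" and slt: "smooth_local_triv B S r V \<tau>" and c: "(d, V, c) \<in> charts (bas B)"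
    and I: "ident r m I" and W: "V \<subseteq> W" "openin (subtopology X S) W"
  shows "is_chart (FTS W) (d + m, FS V, Fchart d c r I \<tau>)"
  unfolding is_chart_iff
proof (intro conjI)
  note Vo = slt_open [OF S slt]
  have WS: "W \<subseteq> S" using openin_subset [OF W(2)] by simp
  have ca: "is_chart (subtopology X V) (d, V, c)" by (rule bas_chart [OF S Vo c subset_refl])
  have WX: "openin (FTS S) (FS V)" by (rule openin_FS_stratum [OF Vo])
  show "openin (FTS W) (FS V)"
  proof -
    obtain G where G: "openin FT G" "FS V = G \<inter> FS S" using WX unfolding openin_subtopology by blast
    then have "FS V = G \<inter> FS W" using FS_mono [OF W(1)] FS_mono [OF WS] by blast
    with G(1) show ?thesis unfolding openin_subtopology by blast
  qed
  show "openin (Eu (d + m)) (Fchart d c r I \<tau> ` FS V)"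
    unfolding Fchart_image [OF S slt c subset_refl I]
    by (rule openin_continuous_map_preimage [OF continuous_map_pr1 chart_image_open [OF ca chart_open [OF ca] subset_refl]])
  have st: "subtopology (FTS W) (FS V) = FTS V"
    using FS_mono [OF W(1)] by (simp add: subtopology_subtopology inf_absorb2)
  let ?T = "prodT V m" and ?h = "FL r I \<tau>"
  note hom = slt_lift_homeomorphic [OF S slt I]
  have tT: "topspace ?T = V \<times> E m" using topspace_sub_X [OF slt_subset(2) [OF S slt]] by simp
  have e1: "embedding_map (FTS V) ?T ?h"
  proof -
    have surj: "?h ` topspace (FTS V) = topspace ?T" by (rule homeomorphic_imp_surjective_map [OF hom])
    show ?thesis unfolding embedding_map_def surj subtopology_topspace by (rule hom)
  qed
  have "is_chart ?T (d + m, V \<times> E m, \<lambda>(x, v). append_coords d (c x) v)"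
    using is_chart_prod [OF ca atlas_chart [OF atlas_euc_mfd euc_chart_mem]] by simp
  then have "embedding_map (subtopology ?T (V \<times> E m)) (Eu (d + m)) (\<lambda>(x, v). append_coords d (c x) v)"
    unfolding is_chart_iff by blast
  then have e2: "embedding_map ?T (Eu (d + m)) (\<lambda>(x, v). append_coords d (c x) v)"
    unfolding tT [symmetric] subtopology_topspace .
  have "(\<lambda>(x, v). append_coords d (c x) v) \<circ> ?h = Fchart d c r I \<tau>" by (auto simp: Fchart_def)
  with embedding_map_compose [OF e1 e2]
  show "embedding_map (subtopology (FTS W) (FS V)) (Eu (d + m)) (Fchart d c r I \<tau>)"
    unfolding st by simp
qed

text \<open>The generating charts of \<open>F(A)\<close> need a base chart and a smooth
  trivialization over one and the same set; shrinking the trivialization to the common part of the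
  two domains provides it.\<close>

lemma slt_restrict:
  assumes S: "S \<in> \<S>" and slt: "smooth_local_triv B S r V \<tau>"
    and V0: "openin (subtopology X S) V0" "V0 \<subseteq> V"
  shows "smooth_local_triv B S r V0 \<tau>"
proof -
  note Vo = slt_open [OF S slt]
  have oV: "over B V0 \<subseteq> over B V" by (rule over_mono [OF V0(2)])
  have bij: "bij_betw \<tau> (over B V) (V \<times> E r)" by (rule slt_bij [OF S slt])
  then have inj: "inj_on \<tau> (over B V)" by (simp add: bij_betw_def)
  have fi: "fibre_inv \<tau> V x v \<in> over B V0" "\<tau> (fibre_inv \<tau> V x v) = (x, v)" if "x \<in> V0" "v \<in> E r" for x v
    using fibre_inv [OF S slt, of x v] that V0(2) by (auto simp: over_def)
  have img: "\<tau> ` over B V0 = V0 \<times> E r"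
  proof
    show "\<tau> ` over B V0 \<subseteq> V0 \<times> E r"
    proof
      fix p assume "p \<in> \<tau> ` over B V0"
      then obtain a where a: "a \<in> over B V0" "p = \<tau> a" by blast
      have "\<tau> a \<in> V \<times> E r" using bij a(1) oV by (auto simp: bij_betw_def)
      moreover have "fst (\<tau> a) \<in> V0" using slt_fst [OF S slt] a(1) oV by (auto simp: over_def)
      ultimately show "p \<in> V0 \<times> E r" unfolding a(2) by auto
    qed
    show "V0 \<times> E r \<subseteq> \<tau> ` over B V0"
    proof
      fix p assume "p \<in> V0 \<times> E r"
      then obtain x v where "p = (x, v)" "x \<in> V0" "v \<in> E r" by blast
      with fi show "p \<in> \<tau> ` over B V0" by (metis imageI)
    qed
  qed
  have bij0: "bij_betw \<tau> (over B V0) (V0 \<times> E r)" unfolding bij_betw_def using inj_on_subset [OF inj oV] img by blast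
  have inv: "the_inv_into (over B V0) \<tau> p = the_inv_into (over B V) \<tau> p" if "p \<in> V0 \<times> E r" for p
    by (rule inv_into_eq_the_inv_into [OF inj oV]) (use that img in simp)
  let ?M = "AM V0" and ?N = "TM V0 r"
  have V0X: "V0 \<subseteq> topspace X" using V0(2) slt_subset(2) [OF S slt] by blast
  have atb: "atlas (fst (XM V0)) (snd (XM V0))" using atlas_bas [OF S V0(1)] by simp
  have atbV: "atlas (fst (XM V)) (snd (XM V))" using atlas_bas [OF S Vo] by simp
  have M: "atlas (fst ?M) (snd ?M)" using atlas_tot [OF S V0(1)] by simp
  have fN: "fst ?N = prodT V0 r" using prod_euc_mfd(1) [OF atb] by simp
  have N: "atlas (fst ?N) (snd ?N)" unfolding fN using prod_euc_mfd(2) [OF atb] by simp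
  have tM: "topspace (fst ?M) = over B V0" unfolding fst_sub_mfd topspace_sub_over ..
  have tN: "topspace (fst ?N) = V0 \<times> E r" unfolding fN using topspace_sub_X [OF V0X] by simp
  have fV: "fst (TM V r) = prodT V r"
    using prod_euc_mfd(1) [OF atbV] by simp
  have pm: "(d + r, U \<times> E r, \<lambda>(x, v). append_coords d (c x) v) \<in> snd ?N"
    "(d + r, U \<times> E r, \<lambda>(x, v). append_coords d (c x) v) \<in> snd (TM V r)"
    if "(d, U, c) \<in> snd (XM V0)" for d U c
    using prod_euc_mfd(3) [OF atb that] prod_euc_mfd(3) [OF atbV, of d U c] that V0(2) by (auto simp: sub_mfd_charts)
  have tm: "a \<in> snd (AM V)" if "a \<in> snd ?M" for a
    using that oV by (cases a) (auto simp: sub_mfd_charts)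
  have c1: "continuous_map (topA V) (prodT V r) \<tau>"
    using smooth_map_cont [OF slt_smooth(1) [OF S slt]] unfolding fV by simp
  have c2: "continuous_map (prodT V r) (topA V) (the_inv_into (over B V) \<tau>)"
    using smooth_map_cont [OF slt_smooth(2) [OF S slt]] unfolding fV by simp
  have ptop: "prodT V0 r = subtopology (prodT V r) (V0 \<times> E r)"
    using V0(2) by (simp add: subtopology_Times subtopology_subtopology inf_absorb2)
  have c1': "continuous_map (fst ?M) (fst ?N) \<tau>"
    unfolding fN ptop fst_sub_mfd
    using continuous_map_from_subtopology_mono [OF c1 oV] img by (auto simp: continuous_map_in_subtopology)
  have c2': "continuous_map (fst ?N) (fst ?M) (the_inv_into (over B V0) \<tau>)"
  proof -
    have "continuous_map (fst ?N) (stop (tot B)) (the_inv_into (over B V) \<tau>)"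
      unfolding fN ptop using continuous_map_from_subtopology [OF continuous_map_into_fulltopology [OF c2]] .
    then have "continuous_map (fst ?N) (stop (tot B)) (the_inv_into (over B V0) \<tau>)"
      by (rule continuous_map_eq) (simp only: tN inv)
    moreover have "the_inv_into (over B V0) \<tau> p \<in> over B V0" if "p \<in> V0 \<times> E r" for p
      using the_inv_into_into [of \<tau> "over B V0" p "over B V0"] bij0 that by (auto simp: bij_betw_def)
    ultimately show ?thesis unfolding fst_sub_mfd continuous_map_in_subtopology tN by blast
  qed
  have "smooth_map ?M ?N \<tau>"
  proof (rule smooth_mapI [OF M N c1'])
    fix a assume "a \<in> topspace (fst ?M)"
    then have a: "a \<in> over B V0" unfolding tM .
    then have "\<tau> a \<in> topspace (fst ?N)" unfolding tN using img by blast
    then have p: "fst (\<tau> a) \<in> V0" "snd (\<tau> a) \<in> E r" unfolding tN by auto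
    obtain e Q b where Q: "(e, Q, b) \<in> snd ?M" "a \<in> Q" using atlas_cover [OF M, of a] a unfolding tM by blast
    have "fst (\<tau> a) \<in> topspace (fst (XM V0))" using p(1) V0X by auto
    then obtain d U c where U: "(d, U, c) \<in> snd (XM V0)" "fst (\<tau> a) \<in> U" using atlas_cover [OF atb] by blast
    have "chart_smooth \<tau> (e, Q, b) (d + r, U \<times> E r, \<lambda>(x, v). append_coords d (c x) v)"
      by (rule smooth_mapD [OF slt_smooth(1) [OF S slt] tm [OF Q(1)] pm(2) [OF U(1)]])
    with Q pm(1) [OF U(1)] U(2) p(2) show "smooth_at ?M ?N \<tau> a"
      by (intro smooth_atI) (auto simp: mem_Times_iff)
  qed
  moreover have "smooth_map ?N ?M (the_inv_into (over B V0) \<tau>)"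
  proof (rule smooth_mapI [OF N M c2'])
    fix p assume "p \<in> topspace (fst ?N)"
    then have p: "p \<in> V0 \<times> E r" unfolding tN .
    let ?i = "the_inv_into (over B V0) \<tau>"
    have "?i p \<in> topspace (fst ?M)" using c2' \<open>p \<in> topspace (fst ?N)\<close> unfolding continuous_map_def by blast
    then obtain e Q b where Q: "(e, Q, b) \<in> snd ?M" "?i p \<in> Q" using atlas_cover [OF M] by blast
    have "fst p \<in> topspace (fst (XM V0))" using p V0X by auto
    then obtain d U c where U: "(d, U, c) \<in> snd (XM V0)" "fst p \<in> U" using atlas_cover [OF atb] by blast
    let ?pc = "\<lambda>(x, v). append_coords d (c x) v"
    have s: "chart_smooth (the_inv_into (over B V) \<tau>) (d + r, U \<times> E r, ?pc) (e, Q, b)"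
      by (rule smooth_mapD [OF slt_smooth(2) [OF S slt] pm(2) [OF U(1)] tm [OF Q(1)]])
    have chp: "is_chart (prodT V r) (d + r, U \<times> E r, ?pc)"
      using atlas_chart [OF prod_euc_mfd(2) [OF atbV] pm(2) [OF U(1)]] by simp
    have chQ: "is_chart (topA V) (e, Q, b)"
      by (rule atlas_chart [OF atlas_tot [OF S Vo] tm [OF Q(1)]])
    have "chart_smooth ?i (d + r, U \<times> E r, ?pc) (e, Q, b)"
    proof (rule chart_smooth_cong [OF chp openin_chart_vimage [OF c2 chp chQ] _ s])
      fix q assume "q \<in> U \<times> E r"
      then have "q \<in> V0 \<times> E r" using U(1) by (auto simp: sub_mfd_charts)
      then show "the_inv_into (over B V) \<tau> q = ?i q" using inv by simp
    qed
    with Q pm(1) [OF U(1)] U(2) p show "smooth_at ?N ?M ?i p"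
      by (intro smooth_atI) (auto simp: mem_Times_iff)
  qed
  ultimately have "diffeo ?M ?N \<tau>" unfolding diffeo_def tM tN using bij0 by blast
  then show ?thesis
    using slt V0 oV unfolding smooth_local_triv_def by (auto simp: subset_iff)
qed

text \<open>The base coordinates change as in the stratum. The new fibre coordinates are a smooth
  function of all old ones, by \<open>Fl_smooth\<close> for the second trivialization.\<close>

lemma chart_smooth_Fchart:
  assumes S: "S \<in> \<S>" and slt: "smooth_local_triv B S r V \<tau>" and c: "(d, V, c) \<in> charts (bas B)"
    and I: "ident r m I" and slt': "smooth_local_triv B S r' V' \<tau>'" and c': "(d', V', c') \<in> charts (bas B)"
    and I': "ident r' m' I'"
  shows "chart_smooth (\<lambda>z. z) (d + m, FS V, Fchart d c r I \<tau>) (d' + m', FS V', Fchart d' c' r' I' \<tau>')"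
proof -
  note Vo = slt_open [OF S slt] and Vo' = slt_open [OF S slt']
  have VS: "V \<subseteq> S" "V' \<subseteq> S" using slt_subset(1) [OF S slt] slt_subset(1) [OF S slt'] .
  have So: "openin (subtopology X S) S"
    using openin_topspace [of "subtopology X S"] topspace_sub_X [OF stratum_subset [OF S]] by simp
  have VVo: "openin (subtopology X S) (V \<inter> V')" by (rule openin_Int [OF Vo Vo'])
  have c0: "(d, V \<inter> V', c) \<in> charts (bas B)" by (rule bas_chart_restrict [OF S c VS(1) VVo]) simp
  have c0': "(d', V \<inter> V', c') \<in> charts (bas B)" by (rule bas_chart_restrict [OF S c' VS(2) VVo]) simp
  have ch: "is_chart (subtopology X S) (d, V, c)" by (rule bas_chart [OF S So c VS(1)])
  have "chart_compat (d, V, c) (d', V', c')"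
    by (rule atlas_compatible [OF atlas_bas [OF S So]]) (use c c' VS in \<open>simp_all add: sub_mfd_charts\<close>)
  from chart_smoothD [OF ch this] obtain h1 where h1: "smooth_on d d' (c ` (V \<inter> V')) h1" "\<forall>x\<in>V. h1 (c x) = c' x"
    unfolding vimage_ident by (elim exE conjE)
  have fl': "fibre_linear (V \<inter> V') r' \<tau>'" using slt_fibre_linear [OF S slt'] by (auto simp: fibre_linear_def)
  have fs': "fibre_smooth (V \<inter> V') r' \<tau>'" by (rule slt_fibre_smooth [OF S slt' c0']) simp
  obtain h2 where h2: "smooth_on (d + m) m' {w \<in> E (d + m). pr1 d w \<in> c ` (V \<inter> V')} h2"
      "\<forall>z\<in>FS (V \<inter> V'). h2 (append_coords d (c (fst z)) (Fl r I \<tau> z)) = Fl r' I' \<tau>' z"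
    using Fl_smooth [OF S slt c0 Int_lower1 fs' fl' I I'] by (elim exE conjE)
  let ?D = "{w \<in> E (d + m). pr1 d w \<in> c ` (V \<inter> V')}"
  have cVV: "openin (Eu d) (c ` (V \<inter> V'))" by (rule chart_image_open [OF ch VVo]) simp
  have Do: "openin (Eu (d + m)) ?D" by (rule openin_continuous_map_preimage [OF continuous_map_pr1 cVV])
  have FC: "is_chart (FTS S) (d + m, FS V, Fchart d c r I \<tau>)"
    by (rule is_chart_Fchart [OF S slt c I VS(1) So])
  have im: "Fchart d c r I \<tau> ` (FS V \<inter> (\<lambda>z. z) -` FS V') = ?D"
    using Fchart_image [OF S slt c0 _ I] by (simp add: FS_Int)
  show ?thesis
  proof (rule chart_smoothI [OF FC])
    show "openin (FTS S) (FS V \<inter> (\<lambda>z. z) -` FS V')"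
      using openin_FS_stratum [OF VVo] by (simp add: FS_Int)
    have s1: "smooth_on (d + m) d' ?D (\<lambda>w. h1 (pr1 d w))"
      by (rule smooth_on_compose [OF Do cVV _ smooth_on_pr1 h1(1)]) simp
    show "smooth_on (d + m) (d' + m') (Fchart d c r I \<tau> ` (FS V \<inter> (\<lambda>z. z) -` FS V')) (\<lambda>w. append_coords d' (h1 (pr1 d w)) (h2 w))"
      unfolding im by (rule smooth_on_append [OF s1 h2(1)])
    fix z j assume z: "z \<in> FS V" "z \<in> FS V'"
    then have zV: "z \<in> FS (V \<inter> V')" "fst z \<in> V" using fst_FS(1) by (auto simp: FS_Int)
    have cz: "c (fst z) \<in> E d" by (rule chart_E [OF ch zV(2)])
    show "append_coords d' (h1 (pr1 d (Fchart d c r I \<tau> z))) (h2 (Fchart d c r I \<tau> z)) j = Fchart d' c' r' I' \<tau>' z j"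
      using h2(2) h1(2) zV unfolding Fchart_def pr1_append [OF cz] by simp
  qed
qed

lemma smooth_triv_chart_at:
  assumes S: "S \<in> \<S>" and W: "openin (subtopology X S) W" and vb: "smooth_vb B S r" and x: "x \<in> W"
  shows "\<exists>d V c \<tau>. (d, V, c) \<in> charts (bas B) \<and> x \<in> V \<and> V \<subseteq> W \<and> smooth_local_triv B S r V \<tau>"
proof -
  have WS: "W \<subseteq> S" using openin_subset [OF W] by simp
  obtain V1 \<tau> where \<tau>: "x \<in> V1" "smooth_local_triv B S r V1 \<tau>" using vb x WS unfolding smooth_vb_def by blast
  note V1o = slt_open [OF S \<tau>(2)]
  have "x \<in> topspace (subtopology X W)" using x WS stratum_subset [OF S] by auto
  from atlas_cover [OF atlas_bas [OF S W] this] obtain d U c where U: "(d, U, c) \<in> charts (bas B)" "U \<subseteq> W" "x \<in> U"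
    unfolding sub_mfd_charts by (elim exE conjE)
  have US: "U \<subseteq> S" using U(2) WS by blast
  have Vo: "openin (subtopology X S) (U \<inter> V1)" by (rule openin_Int [OF bas_chart_open [OF S U(1) US] V1o])
  have "(d, U \<inter> V1, c) \<in> charts (bas B)" by (rule bas_chart_restrict [OF S U(1) US Vo]) simp
  moreover have "smooth_local_triv B S r (U \<inter> V1) \<tau>" by (rule slt_restrict [OF S \<tau>(2) Vo]) simp
  ultimately show ?thesis using U \<tau>(1) by (intro exI conjI) auto
qed

lemma atlas_functor_charts:
  assumes S: "S \<in> \<S>"
  shows "atlas (FTS S) (functor_charts emb F B S)"
proof -
  have So: "openin (subtopology X S) S"
    using openin_topspace [of "subtopology X S"] topspace_sub_X [OF stratum_subset [OF S]] by simp
  have "is_chart (FTS S) a" if "a \<in> functor_charts emb F B S" for a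
    using that is_chart_Fchart [OF S _ _ _ _ So] unfolding functor_charts_iff by blast
  moreover have cs: "chart_smooth (\<lambda>z. z) a b" if "a \<in> functor_charts emb F B S" "b \<in> functor_charts emb F B S" for a b
    using that chart_smooth_Fchart [OF S] unfolding functor_charts_iff by (elim exE conjE) simp
  moreover have "\<exists>d U c. (d, U, c) \<in> functor_charts emb F B S \<and> z \<in> U" if "z \<in> topspace (FTS S)" for z
  proof -
    have z: "z \<in> FS S" using that unfolding topspace_sub_FS .
    obtain r where r: "smooth_vb B S r" using smooth_vb_stratum(2) [OF S] by blast
    obtain m I where I: "ident r m I" using ex_ident by blast
    obtain d V c \<tau> where V: "(d, V, c) \<in> charts (bas B)" "fst z \<in> V" "V \<subseteq> S" "smooth_local_triv B S r V \<tau>"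
      using smooth_triv_chart_at [OF S So r fst_FS(1) [OF z]] by (elim exE conjE)
    have "(d + m, FS V, Fchart d c r I \<tau>) \<in> functor_charts emb F B S"
      unfolding functor_charts_iff using V I by blast
    moreover have "z \<in> FS V" using z V(2) by (simp add: FS_iff)
    ultimately show ?thesis by blast
  qed
  ultimately show ?thesis unfolding atlas_def smoothly_compatible_iff by blast
qed

end

section \<open>The stratified vector bundle \<open>F(A)\<close>\<close>

context whitney_functor
begin

lemma FB_simps [simp]: "stop (tot FB) = FT" "strata (tot FB) = FS ` \<S>" "bas FB = bas B" "proj FB = fst"
  by (auto simp: functor_bundle_def FS_def)

lemma over_FB [simp]: "over FB S = FS S"
  by (auto simp: over_def topspace_FT FS_iff)

lemma charts_FB: "charts (tot FB) = (\<Union>S\<in>\<S>. max_atlas (FTS S) (functor_charts emb F B S))"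
  by (simp add: functor_bundle_def FS_def)

lemma strata_eq: "S \<in> \<S> \<Longrightarrow> S' \<in> \<S> \<Longrightarrow> S \<inter> S' \<noteq> {} \<Longrightarrow> S = S'"
  using strata_disjoint unfolding disjoint_def by blast

lemma sub_mfd_FB:
  assumes S: "S \<in> \<S>"
  shows "FM S = (FTS S, max_atlas (FTS S) (functor_charts emb F B S))"
proof -
  have "snd (FM S) = max_atlas (subtopology (stop (tot FB)) (FS S)) (functor_charts emb F B S)"
  proof (rule sub_mfd_disjoint [OF _ _ S])
    show "charts (tot FB) = (\<Union>S\<in>\<S>. max_atlas (subtopology (stop (tot FB)) (FS S)) (functor_charts emb F B S))"
      unfolding FB_simps by (rule charts_FB)
    fix i j assume ij: "i \<in> \<S>" "j \<in> \<S>" "FS i \<inter> FS j \<noteq> {}"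
    then have "i \<inter> j \<noteq> {}" using fst_FS(1) by blast
    from strata_eq [OF ij(1,2) this] show "FS i = FS j \<and> functor_charts emb F B i = functor_charts emb F B j" by simp
  qed
  then show ?thesis by (intro prod_eqI) simp_all
qed

lemma smooth_tot_FB: "S \<in> \<S> \<Longrightarrow> smooth_manifold (FM S)"
  unfolding sub_mfd_FB
  by (intro smooth_manifold_max_atlas atlas_functor_charts Hausdorff_space_subtopology Hausdorff_FT
      second_countable_subtopology second_countable_FT)

lemma atlas_FB:
  assumes "S \<in> \<S>" "openin (subtopology X S) V"
  shows "atlas (FTS V) (snd (FM V))"
  using atlas_sub_mfd(1) [OF smooth_tot_FB [OF assms(1)], of "FS V"] openin_FS_stratum [OF assms(2)] by simp

lemma Fchart_mem:
  assumes S: "S \<in> \<S>" and slt: "smooth_local_triv B S r V \<tau>" and c: "(d, V, c) \<in> charts (bas B)"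
    and I: "ident r m I" and W: "V \<subseteq> W"
  shows "(d + m, FS V, Fchart d c r I \<tau>) \<in> snd (FM W)"
proof -
  have "(d + m, FS V, Fchart d c r I \<tau>) \<in> functor_charts emb F B S"
    unfolding functor_charts_iff using slt c I slt_subset(1) [OF S slt] by blast
  then have "(d + m, FS V, Fchart d c r I \<tau>) \<in> charts (tot FB)"
    unfolding charts_FB using max_atlas_atlas(2) [OF atlas_functor_charts [OF S]] S by blast
  then show ?thesis unfolding sub_mfd_charts using FS_mono [OF W] by blast
qed

lemma stratum_open: "S \<in> \<S> \<Longrightarrow> openin (subtopology X S) S"
  using openin_topspace [of "subtopology X S"] topspace_sub_X [OF stratum_subset] by simp

lemma Fchart_at:
  assumes S: "S \<in> \<S>" and W: "openin (subtopology X S) W" and z: "z \<in> FS W"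
  shows "\<exists>d V c r \<tau> m I. (d, V, c) \<in> charts (bas B) \<and> z \<in> FS V \<and> V \<subseteq> W \<and> smooth_local_triv B S r V \<tau> \<and> ident r m I"
proof -
  obtain r where r: "smooth_vb B S r" using smooth_vb_stratum(2) [OF S] by blast
  obtain m I where I: "ident r m I" using ex_ident by blast
  obtain d V c \<tau> where V: "(d, V, c) \<in> charts (bas B)" "fst z \<in> V" "V \<subseteq> W" "smooth_local_triv B S r V \<tau>"
    using smooth_triv_chart_at [OF S W r fst_FS(1) [OF z]] by (elim exE conjE)
  have "z \<in> FS V" using z V(2) by (simp add: FS_iff)
  with V I show ?thesis by (intro exI conjI)
qed

lemma fibre_FB:
  "carrier (fibre FB x) = FS {x}" "u \<oplus>\<^bsub>fibre FB x\<^esub> v = fadd FB u v" "c \<odot>\<^bsub>fibre FB x\<^esub> v = fsmult FB c v"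
  "\<zero>\<^bsub>fibre FB x\<^esub> = (x, \<zero>\<^bsub>fobj F (fibre B x)\<^esub>)"
  by (simp_all add: fibre_def [of FB]) (simp add: functor_bundle_def)

lemma fadd_FB: "fadd FB (x, u) (x, v) = (x, u \<oplus>\<^bsub>fobj F (fibre B x)\<^esub> v)"
  by (simp add: functor_bundle_def)

lemma fibre_FB_iso:
  assumes "x \<in> topspace X"
  shows "linear_iso (fobj F (fibre B x)) (fibre FB x) (Pair x)"
  unfolding linear_iso_def linear_maps_iff fibre_FB bij_betw_def
  using assms by (auto simp: FS_iff fadd_FB fsmult_FB inj_on_def image_iff)

lemma fd_fibre_FB: "x \<in> topspace X \<Longrightarrow> fd_vspace (fibre FB x)"
  by (rule fd_vspace_transport [OF fd_fobj [OF fd_fibre] fibre_FB_iso]) (simp_all add: fibre_FB)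

lemma Fl_linear_FB:
  assumes \<phi>: "fibre_linear V k \<phi>" and I: "ident k m I" and x: "x \<in> V"
  shows "Fl k I \<phi> \<in> linear_maps (fibre FB x) (Euc m)"
  unfolding linear_maps_iff fibre_FB
proof (intro conjI ballI allI)
  have sub: "FS {x} \<subseteq> FS V" using x by (intro FS_mono) simp
  fix z assume z: "z \<in> FS {x}"
  then have zx: "z = (x, snd z)" using fst_FS(1) [OF z] by (simp add: prod_eq_iff)
  show "Fl k I \<phi> z \<in> carrier (Euc m)" using Fl_E [OF \<phi> I subsetD [OF sub z]] by simp
  show "Fl k I \<phi> (fsmult FB c z) = c \<odot>\<^bsub>Euc m\<^esub> Fl k I \<phi> z" for c
    using Fl_scale [OF \<phi> I, of x "snd z" c] subsetD [OF sub z]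
    by (simp only: zx [symmetric]) (simp add: fsmult_FB fst_FS(1) [OF z, simplified])
  fix z' assume z': "z' \<in> FS {x}"
  then have zx': "z' = (x, snd z')" using fst_FS(1) [OF z'] by (simp add: prod_eq_iff)
  have "(x, snd z) \<in> FS V" "(x, snd z') \<in> FS V" using z z' zx zx' sub by auto
  from Fl_add [OF \<phi> I this] show "Fl k I \<phi> (fadd FB z z') = Fl k I \<phi> z \<oplus>\<^bsub>Euc m\<^esub> Fl k I \<phi> z'"
    using fadd_FB [of x "snd z" "snd z'"] by (simp only: zx [symmetric] zx' [symmetric]) simp
qed

lemma smooth_map_proj_FB:
  assumes S: "S \<in> \<S>"
  shows "smooth_map (FM S) (XM S) fst"
proof (rule smooth_mapI)
  note So = stratum_open [OF S]
  show "atlas (fst (FM S)) (snd (FM S))" using atlas_FB [OF S So] by simp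
  show "atlas (fst (XM S)) (snd (XM S))" using atlas_bas [OF S So] by simp
  show "continuous_map (fst (FM S)) (fst (XM S)) fst"
    using continuous_map_FS_fst by simp
  fix z assume "z \<in> topspace (fst (FM S))"
  then have z: "z \<in> FS S" using topspace_sub_FS unfolding fst_sub_mfd FB_simps by blast
  obtain d V c r \<tau> m I where V: "(d, V, c) \<in> charts (bas B)" "z \<in> FS V" "V \<subseteq> S" and slt: "smooth_local_triv B S r V \<tau>"
    and I: "ident r m I" using Fchart_at [OF S So z] by (elim exE conjE)
  have a: "is_chart (FTS S) (d + m, FS V, Fchart d c r I \<tau>)"
    by (rule is_chart_Fchart [OF S slt V(1) I V(3) So])
  have b: "is_chart (subtopology X S) (d, V, c)" by (rule bas_chart [OF S So V(1,3)])
  have "chart_smooth fst (d + m, FS V, Fchart d c r I \<tau>) (d, V, c)"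
  proof (rule chart_smoothI [OF a openin_chart_vimage [OF continuous_map_FS_fst a b] smooth_on_pr1])
    fix y j assume "y \<in> FS V"
    then have "c (fst y) \<in> E d" using chart_E [OF b] fst_FS(1) by blast
    then show "pr1 d (Fchart d c r I \<tau> y) j = c (fst y) j" unfolding Fchart_def by (simp add: pr1_append)
  qed
  moreover have "(d, V, c) \<in> snd (XM S)" using V by (simp add: sub_mfd_charts)
  ultimately show "smooth_at (FM S) (XM S) fst z"
    using Fchart_mem [OF S slt V(1) I V(3)] V(2) fst_FS(1) [OF V(2)] by (intro smooth_atI)
qed

text \<open>In the charts built from \<open>c\<close> and \<tau>, the lifted trivialization and its
  inverse are both represented by the identity.\<close>

lemma smooth_local_triv_FB:
  assumes S: "S \<in> \<S>" and slt: "smooth_local_triv B S r V \<tau>" and c: "(d, V, c) \<in> charts (bas B)"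
    and I: "ident r m I"
  shows "smooth_local_triv FB S m V (FL r I \<tau>)"
proof -
  let ?h = "FL r I \<tau>" and ?M = "FM V" and ?N = "TM V m"
  let ?T = "prodT V m" and ?pc = "\<lambda>(x, v). append_coords d (c x) v"
  let ?g = "the_inv_into (FS V) ?h"
  note Vo = slt_open [OF S slt] and hom = slt_lift_homeomorphic [OF S slt I]
  have VX: "V \<subseteq> topspace X" by (rule slt_subset(2) [OF S slt])
  have atb: "atlas (fst (XM V)) (snd (XM V))" using atlas_bas [OF S Vo] by simp
  have fN: "fst ?N = ?T" using prod_euc_mfd(1) [OF atb] by simp
  have tT: "topspace ?T = V \<times> E m" using topspace_sub_X [OF VX] by simp
  have fM: "fst ?M = FTS V" by simp
  have M: "atlas (fst ?M) (snd ?M)" using atlas_FB [OF S Vo] by simp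
  have N: "atlas (fst ?N) (snd ?N)" using prod_euc_mfd(2) [OF atb] unfolding fN by simp
  have cV: "(d, V, c) \<in> snd (XM V)" using c by (simp add: sub_mfd_charts)
  have pcN: "(d + m, V \<times> E m, ?pc) \<in> snd ?N" by (rule prod_euc_mfd(3) [OF atb cV])
  have FM: "(d + m, FS V, Fchart d c r I \<tau>) \<in> snd ?M" by (rule Fchart_mem [OF S slt c I subset_refl])
  have cM: "is_chart (FTS V) (d + m, FS V, Fchart d c r I \<tau>)" using atlas_chart [OF M FM] unfolding fM .
  have cN: "is_chart ?T (d + m, V \<times> E m, ?pc)" using atlas_chart [OF N pcN] unfolding fN .
  have inj: "inj_on ?h (FS V)" using homeomorphic_imp_injective_map [OF hom] unfolding topspace_sub_FS .
  have surj: "?h ` FS V = V \<times> E m" using homeomorphic_imp_surjective_map [OF hom] unfolding topspace_sub_FS tT .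
  obtain g where g: "homeomorphic_maps (FTS V) ?T ?h g" using hom homeomorphic_map_maps by blast
  have cg: "continuous_map ?T (FTS V) g" using g unfolding homeomorphic_maps_def by blast
  have gp: "g p = ?g p" if p: "p \<in> V \<times> E m" for p
  proof -
    have 1: "g p \<in> FS V" using cg p tT unfolding continuous_map_def topspace_sub_FS by blast
    have 2: "?h (g p) = p" using g p unfolding homeomorphic_maps_def tT by blast
    show ?thesis using the_inv_into_f_f [OF inj 1] unfolding 2 ..
  qed
  have ch: "continuous_map (FTS V) ?T ?h" by (rule homeomorphic_imp_continuous_map [OF hom])
  have cg': "continuous_map ?T (FTS V) ?g"
    by (rule continuous_map_eq [OF cg]) (simp only: tT gp)
  have "smooth_map ?M ?N ?h"
  proof (rule smooth_mapI [OF M N])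
    show "continuous_map (fst ?M) (fst ?N) ?h" unfolding fM fN by (rule ch)
    fix z assume "z \<in> topspace (fst ?M)"
    then have z: "z \<in> FS V" unfolding fM topspace_sub_FS .
    have "chart_smooth ?h (d + m, FS V, Fchart d c r I \<tau>) (d + m, V \<times> E m, ?pc)"
      by (rule chart_smoothI [OF cM openin_chart_vimage [OF ch cM cN] smooth_on_id]) (simp add: Fchart_def)
    moreover have "?h z \<in> V \<times> E m" using z surj by blast
    ultimately show "smooth_at ?M ?N ?h z"
      using FM pcN z by (intro smooth_atI)
  qed
  moreover have "smooth_map ?N ?M ?g"
  proof (rule smooth_mapI [OF N M])
    show "continuous_map (fst ?N) (fst ?M) ?g" unfolding fM fN by (rule cg')
    fix p assume "p \<in> topspace (fst ?N)"
    then have p: "p \<in> V \<times> E m" unfolding fN tT .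
    have gF: "?g p \<in> FS V" by (rule the_inv_into_into [OF inj _ subset_refl]) (simp only: surj p)
    have "chart_smooth ?g (d + m, V \<times> E m, ?pc) (d + m, FS V, Fchart d c r I \<tau>)"
    proof (rule chart_smoothI [OF cN openin_chart_vimage [OF cg' cN cM] smooth_on_id])
      fix q j assume q: "q \<in> V \<times> E m"
      then have "?h (?g q) = q" by (intro f_the_inv_into_f [OF inj]) (simp only: surj)
      then have "fst (?g q) = fst q" "Fl r I \<tau> (?g q) = snd q" by (simp_all only: prod_eq_iff fst_conv snd_conv)
      then show "?pc q j = Fchart d c r I \<tau> (?g q) j" by (simp add: Fchart_def case_prod_unfold)
    qed
    then show "smooth_at ?N ?M ?g p"
      using FM pcN p gF by (intro smooth_atI)
  qed
  moreover have "bij_betw ?h (FS V) (V \<times> E m)" using inj surj by (simp add: bij_betw_def)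
  ultimately have df: "diffeo ?M ?N ?h" unfolding diffeo_def fM fN tT topspace_sub_FS by blast
  have "linear_iso (fibre FB x) (Euc m) (snd \<circ> ?h)" if x: "x \<in> V" for x
  proof -
    have sub: "FS {x} \<subseteq> FS V" using x by (intro FS_mono) simp
    have "Fl r I \<tau> ` FS {x} = E m"
    proof
      show "Fl r I \<tau> ` FS {x} \<subseteq> E m" using Fl_E [OF slt_fibre_linear [OF S slt] I] sub by blast
      show "E m \<subseteq> Fl r I \<tau> ` FS {x}"
      proof
        fix w assume "w \<in> E m"
        from slt_Fl_surj [OF S slt I x this] obtain z where z: "z \<in> FS V" "fst z = x" "Fl r I \<tau> z = w" by blast
        then have "z \<in> FS {x}" by (simp add: FS_iff)
        with z(3) show "w \<in> Fl r I \<tau> ` FS {x}" by blast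
      qed
    qed
    moreover have "inj_on (Fl r I \<tau>) (FS {x})"
    proof (rule inj_onI)
      fix z z' assume zz: "z \<in> FS {x}" "z' \<in> FS {x}" "Fl r I \<tau> z = Fl r I \<tau> z'"
      have "fst z = fst z'" using fst_FS(1) [OF zz(1)] fst_FS(1) [OF zz(2)] by simp
      then show "z = z'" using slt_Fl_inj [OF S slt I _ _ _ zz(3)] zz sub by blast
    qed
    ultimately show ?thesis
      using Fl_linear_FB [OF slt_fibre_linear [OF S slt] I x]
      by (simp add: linear_iso_def bij_betw_def fibre_FB o_def)
  qed
  then show ?thesis
    unfolding smooth_local_triv_def over_FB FB_simps using Vo df by simp
qed

lemma smooth_vb_FB:
  assumes S: "S \<in> \<S>" and vb: "smooth_vb B S r" and I: "ident r m I"
  shows "smooth_vb FB S m"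
  unfolding smooth_vb_def over_FB FB_simps
proof (intro conjI ballI)
  show "smooth_map (FM S) (XM S) fst" by (rule smooth_map_proj_FB [OF S])
  fix x assume x: "x \<in> S"
  then show "fd_vspace (fibre FB x)" using fd_fibre_FB stratum_subset [OF S] by blast
  obtain d V c \<tau> where V: "(d, V, c) \<in> charts (bas B)" "x \<in> V" "V \<subseteq> S" "smooth_local_triv B S r V \<tau>"
    using smooth_triv_chart_at [OF S stratum_open [OF S] vb x] by (elim exE conjE)
  with smooth_local_triv_FB [OF S V(4,1) I] show "\<exists>V \<tau>. x \<in> V \<and> smooth_local_triv FB S m V \<tau>"
    by (intro exI conjI)
qed

lemma strat_morphism_proj_FB: "strat_morphism (tot FB) (bas FB) (proj FB)"
  unfolding strat_morphism_def FB_simps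
proof (intro conjI ballI)
  show "continuous_map FT X fst" by (rule continuous_map_FT_fst)
  fix Q assume "Q \<in> FS ` \<S>"
  then obtain S where S: "S \<in> \<S>" "Q = FS S" by blast
  have "fst ` FS S \<subseteq> S" using fst_FS(1) by blast
  with smooth_map_proj_FB [OF S(1)] S
  show "\<exists>T\<in>\<S>. fst ` Q \<subseteq> T \<and> smooth_map (sub_mfd (tot FB) Q) (XM T) fst" by blast
qed

lemma disjoint_strata_FB: "disjoint (strata (tot FB))"
  unfolding FB_simps disjoint_def
proof (intro ballI impI)
  fix P Q assume PQ: "P \<in> FS ` \<S>" "Q \<in> FS ` \<S>" "P \<noteq> Q"
  then obtain S S' where S: "S \<in> \<S>" "P = FS S" "S' \<in> \<S>" "Q = FS S'" by blast
  show "P \<inter> Q = {}"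
  proof (rule ccontr)
    assume "P \<inter> Q \<noteq> {}"
    then have "S \<inter> S' \<noteq> {}" using fst_FS(1) unfolding S by blast
    with strata_eq [OF S(1,3)] PQ(3) S show False by blast
  qed
qed

text \<open>In charts, scalar multiplication leaves the base coordinates alone and multiplies the
  fibre coordinates by the scalar, because lifts are linear on fibres.\<close>

lemma strat_morphism_smult_FB:
  "strat_morphism (strat_prod (one_stratum real_mfd) (tot FB)) (tot FB) (\<lambda>(c, a). fsmult FB c a)"
proof -
  let ?f = "\<lambda>(c, a). fsmult FB c a"
  have rm: "real_mfd = (euclideanreal, snd real_mfd)" by (simp add: real_mfd_def)
  have fr: "fst real_mfd = euclideanreal" by (simp add: real_mfd_def)
  have st: "stop (strat_prod (one_stratum real_mfd) (tot FB)) = prod_topology euclideanreal FT"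
    by (simp add: strat_prod_def one_stratum_def fr)
  have one: "sub_mfd (one_stratum real_mfd) UNIV = real_mfd"
    using sub_mfd_one_stratum [OF atlas_real_mfd] unfolding rm [symmetric] topspace_euclidean .
  have strat: "strata (strat_prod (one_stratum real_mfd) (tot FB)) = {UNIV \<times> FS S | S. S \<in> \<S>}"
    by (auto simp: strat_prod_def one_stratum_def fr)
  have sm: "smooth_map (sub_mfd (strat_prod (one_stratum real_mfd) (tot FB)) (UNIV \<times> FS S)) (FM S) ?f"
    if S: "S \<in> \<S>" for S
  proof -
    note So = stratum_open [OF S]
    have dj: "disjoint (strata (one_stratum real_mfd))" by (simp add: one_stratum_def disjoint_def)
    have u: "UNIV \<in> strata (one_stratum real_mfd)" by (simp add: one_stratum_def fr)
    have s: "FS S \<in> strata (tot FB)" using S by simp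
    let ?A = "snd (FM S)"
    have sp: "FM S = (FTS S, ?A)" by (intro prod_eqI) simp_all
    let ?P = "prod_mfd (euclideanreal, snd real_mfd) (FTS S, ?A)"
    have eq: "sub_mfd (strat_prod (one_stratum real_mfd) (tot FB)) (UNIV \<times> FS S) = ?P"
      using sub_mfd_strat_prod [OF dj disjoint_strata_FB u s] unfolding one rm [symmetric] sp [symmetric] .
    note pp = prod_mfd_props [OF atlas_real_mfd atlas_FB [OF S So]]
    have cont: "continuous_map (prod_topology euclideanreal (FTS S)) (FTS S) ?f"
    proof -
      have "prod_topology euclideanreal (FTS S) = subtopology (prod_topology euclideanreal FT) (UNIV \<times> FS S)"
        by (simp add: subtopology_Times)
      then have "continuous_map (prod_topology euclideanreal (FTS S)) FT ?f"
        using continuous_map_from_subtopology [OF continuous_map_fsmult] by simp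
      moreover have "?f w \<in> FS S" if "w \<in> UNIV \<times> FS S" for w
        using that scale_FS [of "fst (snd w)" "snd (snd w)" S "fst w"] by (auto simp: fsmult_FB)
      ultimately show ?thesis unfolding continuous_map_in_subtopology by auto
    qed
    show ?thesis
      unfolding eq
    proof (rule smooth_mapI)
      show "atlas (fst ?P) (snd ?P)" unfolding pp(1) by (rule pp(2))
      show "atlas (fst (FM S)) ?A" using atlas_FB [OF S So] by simp
      show "continuous_map (fst ?P) (fst (FM S)) ?f" unfolding pp(1) using cont by simp
      fix w assume "w \<in> topspace (fst ?P)"
      then have w: "snd w \<in> FS S" unfolding pp(1) by auto
      obtain d V c r \<tau> m I where V: "(d, V, c) \<in> charts (bas B)" "snd w \<in> FS V" "V \<subseteq> S" and slt: "smooth_local_triv B S r V \<tau>"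
        and I: "ident r m I" using Fchart_at [OF S So w] by (elim exE conjE)
      let ?F = "Fchart d c r I \<tau>"
      let ?pc = "\<lambda>(x, y). append_coords 1 (real_coord x) (?F y)"
      note FM = Fchart_mem [OF S slt V(1) I V(3)]
      have pm: "(1 + (d + m), UNIV \<times> FS V, ?pc) \<in> snd ?P" by (rule pp(3) [OF real_chart_mem FM])
      have a: "is_chart (prod_topology euclideanreal (FTS S)) (1 + (d + m), UNIV \<times> FS V, ?pc)"
        by (rule atlas_chart [OF pp(2) pm])
      have b: "is_chart (FTS S) (d + m, FS V, ?F)" by (rule atlas_chart [OF atlas_FB [OF S So] FM])
      have "chart_smooth ?f (1 + (d + m), UNIV \<times> FS V, ?pc) (d + m, FS V, ?F)"
      proof (rule chart_smoothI [OF a openin_chart_vimage [OF cont a b]])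
        \<comment> \<open>Index 0 holds the scalar, the next \<open>d\<close> indices the base point
          and the last \<open>m\<close> the vector.\<close>
        show "smooth_on (1 + (d + m)) (d + m) D (\<lambda>w. append_coords d (pr1 d (pr2 1 w)) (\<lambda>i. w 0 * pr2 d (pr2 1 w) i))" for D
        proof (rule smooth_on_append)
          show "smooth_on (1 + (d + m)) d D (\<lambda>w. pr1 d (pr2 1 w))"
            unfolding smooth_on_def pr1_def pr2_def using Ck_coord by auto
          show "smooth_on (1 + (d + m)) m D (\<lambda>w i. w 0 * pr2 d (pr2 1 w) i)"
            unfolding smooth_on_def pr2_def by (intro allI impI Ck_mult Ck_coord)
        qed
        fix p :: "real \<times> 'x \<times> 'v" and j assume p: "p \<in> UNIV \<times> FS V"
        then have z: "(fst (snd p), snd (snd p)) \<in> FS V" by auto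
        have cE: "c (fst (snd p)) \<in> E d" using chart_E [OF bas_chart [OF S So V(1,3)] fst_FS(1) [OF z]] by simp
        have q: "pr2 1 (?pc p) = ?F (snd p)" by (simp add: case_prod_unfold)
        have p0: "?pc p 0 = fst p" by (simp add: case_prod_unfold append_coords_def)
        have q1: "pr1 d (?F (snd p)) = c (fst (snd p))" unfolding Fchart_def by (rule pr1_append [OF cE])
        have q2: "pr2 d (?F (snd p)) = Fl r I \<tau> (snd p)" unfolding Fchart_def by simp
        show "append_coords d (pr1 d (pr2 1 (?pc p))) (\<lambda>i. ?pc p 0 * pr2 d (pr2 1 (?pc p)) i) j = ?F (?f p) j"
          unfolding q p0 q1 q2
          using Fl_scale [OF slt_fibre_linear [OF S slt] I z, of "fst p"]
          by (simp add: case_prod_unfold Fchart_def fsmult_FB)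
      qed
      moreover have "w \<in> UNIV \<times> FS V" using V(2) by (simp add: mem_Times_iff)
      moreover have "?f w \<in> FS V"
        using V(2) scale_FS [of "fst (snd w)" "snd (snd w)" V "fst w"] by (simp add: case_prod_unfold fsmult_FB)
      ultimately show "smooth_at ?P (FM S) ?f w"
        using pm FM by (intro smooth_atI)
    qed
  qed
  show ?thesis
    unfolding strat_morphism_def st strat
  proof (intro conjI ballI)
    show "continuous_map (prod_topology euclideanreal FT) (stop (tot FB)) ?f" using continuous_map_fsmult by simp
    fix Q :: "(real \<times> 'x \<times> 'v) set" assume "Q \<in> {UNIV \<times> FS S | S. S \<in> \<S>}"
    then obtain S where S: "S \<in> \<S>" "Q = UNIV \<times> FS S" by blast
    have "?f ` Q \<subseteq> FS S" unfolding S(2) using scale_FS by (auto simp: fsmult_FB)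
    with sm [OF S(1)] S show "\<exists>T\<in>strata (tot FB). ?f ` Q \<subseteq> T \<and> smooth_map (sub_mfd (strat_prod (one_stratum real_mfd) (tot FB)) Q) (sub_mfd (tot FB) T) ?f"
      by auto
  qed
qed

subsection \<open>Local trivializations and transition maps\<close>

text \<open>An injective trivialization is smooth on each stratum, so \<open>Fl_smooth\<close>
  applies to it; the base coordinates are passed on unchanged.\<close>

lemma smooth_map_lift:
  assumes S: "S \<in> \<S>" and t: "(k, U, \<phi>) \<in> \<A>" and I: "ident k m I"
  shows "smooth_map (FM (S \<inter> U)) (TM (S \<inter> U) m) (FL k I \<phi>)"
proof -
  let ?h = "FL k I \<phi>" and ?M = "FM (S \<inter> U)"
  let ?N = "TM (S \<inter> U) m"
  let ?T = "prodT (S \<inter> U) m"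
  have W: "openin (subtopology X S) (S \<inter> U)" by (rule openin_stratum_Int [OF triv_open [OF t]])
  have atb: "atlas (fst (XM (S \<inter> U))) (snd (XM (S \<inter> U)))" using atlas_bas [OF S W] by simp
  have fN: "fst ?N = ?T" using prod_euc_mfd(1) [OF atb] by simp
  have fM: "fst ?M = FTS (S \<inter> U)" by simp
  have M: "atlas (fst ?M) (snd ?M)" using atlas_FB [OF S W] by simp
  have N: "atlas (fst ?N) (snd ?N)" using prod_euc_mfd(2) [OF atb] unfolding fN by simp
  have "continuous_map (FTS (S \<inter> U)) (Eu m) (Fl k I \<phi>)"
    using continuous_map_from_subtopology_mono [OF continuous_map_compose [OF continuous_map_lift [OF t I] continuous_map_snd] FS_mono [of "S \<inter> U" U]]
    by (simp add: o_def)
  then have ch: "continuous_map (FTS (S \<inter> U)) ?T ?h"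
    by (intro continuous_map_pairedI continuous_map_FS_fst)
  show ?thesis
  proof (rule smooth_mapI [OF M N])
    show "continuous_map (fst ?M) (fst ?N) ?h" unfolding fM fN by (rule ch)
    fix z assume "z \<in> topspace (fst ?M)"
    then have z: "z \<in> FS (S \<inter> U)" unfolding fM topspace_sub_FS .
    obtain d V c r \<tau> m' I' where V: "(d, V, c) \<in> charts (bas B)" "z \<in> FS V" "V \<subseteq> S \<inter> U" and slt: "smooth_local_triv B S r V \<tau>"
      and I': "ident r m' I'" using Fchart_at [OF S W z] by (elim exE conjE)
    let ?F = "Fchart d c r I' \<tau>" and ?pc = "\<lambda>(x, v). append_coords d (c x) v"
    have fl: "fibre_linear V k \<phi>" using triv_fibre_linear [OF t] V(3) by (auto simp: fibre_linear_def)
    obtain h2 where h2: "smooth_on (d + m') m {w \<in> E (d + m'). pr1 d w \<in> c ` V} h2"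
        "\<forall>z\<in>FS V. h2 (append_coords d (c (fst z)) (Fl r I' \<tau> z)) = Fl k I \<phi> z"
      using Fl_smooth [OF S slt V(1) subset_refl triv_fibre_smooth [OF S t V(1,3)] fl I' I] by (elim exE conjE)
    have cV: "(d, V, c) \<in> snd (XM (S \<inter> U))" using V by (simp add: sub_mfd_charts)
    have pcN: "(d + m, V \<times> E m, ?pc) \<in> snd ?N" by (rule prod_euc_mfd(3) [OF atb cV])
    have FM: "(d + m', FS V, ?F) \<in> snd ?M" by (rule Fchart_mem [OF S slt V(1) I' V(3)])
    have cM: "is_chart (FTS (S \<inter> U)) (d + m', FS V, ?F)" using atlas_chart [OF M FM] unfolding fM .
    have cN: "is_chart ?T (d + m, V \<times> E m, ?pc)" using atlas_chart [OF N pcN] unfolding fN .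
    have "chart_smooth ?h (d + m', FS V, ?F) (d + m, V \<times> E m, ?pc)"
    proof (rule chart_smoothI [OF cM openin_chart_vimage [OF ch cM cN]])
      have "?F ` (FS V \<inter> ?h -` (V \<times> E m)) \<subseteq> {w \<in> E (d + m'). pr1 d w \<in> c ` V}"
        using Fchart_image [OF S slt V(1) subset_refl I'] by blast
      from smooth_on_append [OF smooth_on_pr1 smooth_on_subset [OF h2(1) this]]
      show "smooth_on (d + m') (d + m) (?F ` (FS V \<inter> ?h -` (V \<times> E m))) (\<lambda>w. append_coords d (pr1 d w) (h2 w))" .
      fix y j assume y: "y \<in> FS V"
      have cE: "c (fst y) \<in> E d" by (rule chart_E [OF bas_chart [OF S W V(1,3)] fst_FS(1) [OF y]])
      show "append_coords d (pr1 d (?F y)) (h2 (?F y)) j = ?pc (?h y) j"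
        using h2(2) y unfolding Fchart_def by (simp add: pr1_append [OF cE])
    qed
    moreover have "?h z \<in> V \<times> E m" using fst_FS(1) [OF V(2)] Fl_E [OF fl I V(2)] by simp
    ultimately show "smooth_at ?M ?N ?h z"
      using FM pcN V(2) by (intro smooth_atI)
  qed
qed

lemma smooth_map_bas_id:
  assumes S: "S \<in> \<S>" and U: "openin (subtopology X S) U"
  shows "smooth_map (XM U) (XM U) (\<lambda>x. x)"
proof (rule smooth_mapI)
  show at: "atlas (fst (XM U)) (snd (XM U))" using atlas_bas [OF S U] by simp
  then show "atlas (fst (XM U)) (snd (XM U))" .
  show "continuous_map (fst (XM U)) (fst (XM U)) (\<lambda>x. x)"
    by (simp add: continuous_map_id [unfolded id_def])
  fix x assume "x \<in> topspace (fst (XM U))"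
  from atlas_cover [OF at this] obtain d W c where W: "(d, W, c) \<in> snd (XM U)" "x \<in> W" by (elim exE conjE)
  with atlas_compatible [OF at W(1) W(1)]
  show "smooth_at (XM U) (XM U) (\<lambda>x. x) x"
    by (intro smooth_atI)
qed

lemma local_triv_lift:
  assumes t: "(k, U, \<phi>) \<in> \<A>" and I: "ident k m I"
  shows "local_triv FB (m, U, FL k I \<phi>)"
proof -
  let ?h = "FL k I \<phi>" and ?R = "svb_restrict FB U"
  let ?C = "trivial_svb (bas ?R) m"
  have Uo: "openin X U" by (rule triv_open [OF t])
  have R: "tot ?R = strat_restrict (tot FB) (FS U)" "bas ?R = strat_restrict (bas B) U" "proj ?R = fst"
    by (simp_all add: svb_restrict_def)
  have C: "tot ?C = strat_prod (strat_restrict (bas B) U) (one_stratum (euc_mfd m))" "bas ?C = strat_restrict (bas B) U" "proj ?C = fst"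
    by (simp_all add: trivial_svb_def R)
  have sR: "stop (tot ?R) = FTS U" "stop (bas ?R) = subtopology X U"
    unfolding R by (simp_all add: strat_restrict_def)
  have sC: "stop (tot ?C) = prodT U m"
    unfolding C by (simp add: strat_prod_def one_stratum_def strat_restrict_def)
  have tR: "spt (tot ?R) = FS U" unfolding sR topspace_sub_FS ..
  have strR: "strata (tot ?R) = {FS (S \<inter> U) | S. S \<in> \<S> \<and> FS (S \<inter> U) \<noteq> {}}"
    unfolding R strat_restrict_def by (auto simp: FS_Int)
  have 1: "strat_morphism (tot ?R) (tot ?C) ?h"
    unfolding strat_morphism_def strR
  proof (intro conjI ballI)
    show "continuous_map (stop (tot ?R)) (stop (tot ?C)) ?h" unfolding sR sC by (rule continuous_map_lift [OF t I])
    fix Q assume "Q \<in> {FS (S \<inter> U) | S. S \<in> \<S> \<and> FS (S \<inter> U) \<noteq> {}}"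
    then obtain S where S: "S \<in> \<S>" "FS (S \<inter> U) \<noteq> {}" "Q = FS (S \<inter> U)" by blast
    have ne: "S \<inter> U \<noteq> {}" using S(2) fst_FS(1) by blast
    have "(S \<inter> U) \<times> E m \<in> strata (tot ?C)"
      unfolding C using S(1) ne by (auto simp: strat_prod_def strat_restrict_def one_stratum_def)
    moreover have "?h ` Q \<subseteq> (S \<inter> U) \<times> E m"
    proof
      fix p assume "p \<in> ?h ` Q"
      then obtain z where z: "z \<in> FS (S \<inter> U)" "p = ?h z" unfolding S(3) by blast
      have "z \<in> FS U" using z(1) FS_mono [of "S \<inter> U" U] by blast
      then show "p \<in> (S \<inter> U) \<times> E m" using z fst_FS(1) [OF z(1)] triv_Fl_E [OF t I] by simp
    qed
    moreover have "smooth_map (sub_mfd (tot ?R) Q) (sub_mfd (tot ?C) ((S \<inter> U) \<times> E m)) ?h"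
    proof -
      have e: "sub_mfd (tot ?R) Q = FM (S \<inter> U)"
        unfolding R S(3) by (rule sub_mfd_strat_restrict [OF FS_mono]) simp
      show ?thesis unfolding e C sub_mfd_target [OF S(1) ne] by (rule smooth_map_lift [OF S(1) t I])
    qed
    ultimately show "\<exists>T\<in>strata (tot ?C). ?h ` Q \<subseteq> T \<and> smooth_map (sub_mfd (tot ?R) Q) (sub_mfd (tot ?C) T) ?h"
      by (intro bexI conjI)
  qed
  have 2: "strat_morphism (bas ?R) (bas ?C) (\<lambda>x. x)"
    unfolding strat_morphism_def C(2) unfolding R
  proof (intro conjI ballI)
    show "continuous_map (stop (strat_restrict (bas B) U)) (stop (strat_restrict (bas B) U)) (\<lambda>x. x)"
      by (simp add: continuous_map_id [unfolded id_def])
    fix Q assume Q: "Q \<in> strata (strat_restrict (bas B) U)"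
    then obtain S where S: "S \<in> \<S>" "Q = S \<inter> U" by (auto simp: strat_restrict_def)
    have "sub_mfd (strat_restrict (bas B) U) Q = XM Q" by (rule sub_mfd_strat_restrict) (simp add: S)
    moreover have "smooth_map (XM Q) (XM Q) (\<lambda>x. x)"
      unfolding S(2) by (rule smooth_map_bas_id [OF S(1) openin_stratum_Int [OF Uo]])
    ultimately have "smooth_map (sub_mfd (strat_restrict (bas B) U) Q) (sub_mfd (strat_restrict (bas B) U) Q) (\<lambda>x. x)" by simp
    then show "\<exists>T\<in>strata (strat_restrict (bas B) U). (\<lambda>x. x) ` Q \<subseteq> T \<and>
        smooth_map (sub_mfd (strat_restrict (bas B) U) Q) (sub_mfd (strat_restrict (bas B) U) T) (\<lambda>x. x)"
      using Q by (intro bexI [of _ Q] conjI) auto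
  qed
  have 3: "?h \<in> linear_maps (fibre ?R x) (fibre ?C x)" if x: "x \<in> spt (bas ?R)" for x
  proof -
    have xU: "x \<in> U" "x \<in> topspace X" using x unfolding sR by auto
    have f: "fibre ?R x = fibre FB x"
      using xU by (auto simp: fibre_def svb_restrict_def over_def strat_restrict_def topspace_FT FS_iff)
    have o: "over ?C {x} = {x} \<times> E m"
      unfolding over_def sC C(3) using xU by auto
    have g: "carrier (fibre ?C x) = {x} \<times> E m" "u \<oplus>\<^bsub>fibre ?C x\<^esub> v = fadd ?C u v" "c \<odot>\<^bsub>fibre ?C x\<^esub> v = fsmult ?C c v"
      for u v c by (simp_all only: fibre_def o module.simps monoid.simps partial_object.simps ring.simps)
    have ga: "fadd ?C = (\<lambda>(x, u) (y, v). (x, \<lambda>i. u i + v i))" "fsmult ?C = (\<lambda>c (x, u). (x, \<lambda>i. c * u i))"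
      by (simp_all add: trivial_svb_def)
    have l: "Fl k I \<phi> \<in> linear_maps (fibre FB x) (Euc m)" by (rule Fl_linear_FB [OF triv_fibre_linear [OF t] I xU(1)])
    have fx: "fst z = x" if "z \<in> carrier (fibre FB x)" for z using that fst_FS(1) unfolding fibre_FB by blast
    have "fst (u \<oplus>\<^bsub>fibre FB x\<^esub> v) = x" if "u \<in> carrier (fibre FB x)" "v \<in> carrier (fibre FB x)" for u v
      using fx [OF that(1)] fx [OF that(2)] by (cases u; cases v) (simp add: fibre_FB fadd_FB)
    moreover have "fst (c \<odot>\<^bsub>fibre FB x\<^esub> v) = x" if "v \<in> carrier (fibre FB x)" for c v
      using fx [OF that] by (simp add: fibre_FB fsmult_FB)
    ultimately show ?thesis
      unfolding f using l fx unfolding linear_maps_iff g ga by simp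
  qed
  have 4: "inj_on ?h (spt (tot ?R))"
    unfolding tR by (rule inj_onI) (use triv_Fl_inj [OF t I] in auto)
  have "svb_morphism ?R ?C ?h (\<lambda>x. x)"
    unfolding svb_morphism_def using 1 2 3 by (simp add: C(3) R(3))
  then have "trivialization ?R m ?h"
    unfolding trivialization_def using 4 embedding_map_lift [OF t I] unfolding sR sC by blast
  then show ?thesis unfolding local_triv_def prod.case FB_simps using Uo by blast
qed

text \<open>\<open>F\<close> can be applied to the family directly, as no invertibility is asked.
  Square matrices obtained by padding with zeros would not do: \<open>F\<close> of the padding need
  not be padding in the coordinates of the identifications.\<close>

lemma transition_lift:
  assumes s: "(k, U, \<phi>) \<in> \<A>" and t: "(l, V, \<psi>) \<in> \<A>" and I: "ident k m I" "ident l m' I'"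
    and K: "transition B (k, U, \<phi>) (l, V, \<psi>) W K"
  shows "transition FB (m, U, FL k I \<phi>) (m', V, FL l I' \<psi>) W
    (\<lambda>y s. transf k l I I' (lmap k (K y)) (unit_vec s))"
proof -
  have W: "openin X W" "W \<subseteq> U \<inter> V" and KE: "\<And>y j. y \<in> W \<Longrightarrow> j < k \<Longrightarrow> K y j \<in> E l"
    and Kc: "\<And>j i. j < k \<Longrightarrow> i < l \<Longrightarrow> cont_real (subtopology X W) (\<lambda>y. K y j i)"
    and Ke: "\<And>a. a \<in> over B W \<Longrightarrow> lmap k (K (proj B a)) (snd (\<phi> a)) = snd (\<psi> a)"
    using K unfolding transition_def by auto
  have lin: "lmap k (K y) \<in> linear_maps (Euc k) (Euc l)" if "y \<in> W" for y
    by (rule lmap_linear_maps) (rule KE [OF that])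
  note tl = transf_linear [OF lin I]
  show ?thesis
    unfolding transition_def prod.case FB_simps over_FB fst_conv snd_conv
  proof (intro conjI ballI allI impI W)
    fix y s assume "y \<in> W" "s < m"
    then show "transf k l I I' (lmap k (K y)) (unit_vec s) \<in> E m'" using linear_maps_E [OF tl] by simp
  next
    fix s i assume s: "s < m" "i < m'"
    show "cont_real (subtopology X W) (\<lambda>y. transf k l I I' (lmap k (K y)) (unit_vec s) i)"
    proof (rule continuous_map_transf [where m = m and l = l and m' = m', OF _ _ I])
      show "K z j \<in> E l" if z: "z \<in> topspace (subtopology X W)" "j < k" for z j using z KE by simp
    qed (use s Kc in simp_all)
  next
    fix z assume z: "z \<in> FS W"
    have zW: "fst z \<in> W" by (rule fst_FS(1) [OF z])
    have zU: "z \<in> FS U" using z FS_mono [of W U] W(2) by blast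
    have "lmap m (\<lambda>s. transf k l I I' (lmap k (K (fst z))) (unit_vec s)) (Fl k I \<phi> z) = transf k l I I' (lmap k (K (fst z))) (Fl k I \<phi> z)"
      by (rule linear_maps_eq_lmap [OF tl [OF zW] triv_Fl_E [OF s I(1) zU], symmetric])
    also have "\<dots> = Fl l I' \<psi> z"
    proof (rule Fl_transf [OF triv_fibre_linear [OF s] I(1) zU lin [OF zW]])
      fix a assume "a \<in> over B {fst z}"
      then show "lmap k (K (fst z)) (snd (\<phi> a)) = snd (\<psi> a)" using Ke [of a] zW by (auto simp: over_def)
    qed
    finally show "lmap m (\<lambda>s. transf k l I I' (lmap k (K (fst z))) (unit_vec s)) (Fl k I \<phi> z) = Fl l I' \<psi> z" .
  qed
qed

lemma injective_structure_FB: "injective_structure FB (generated_structure FB (functor_trivs emb F B \<A>))"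
proof (rule injective_structure_generated)
  fix t assume t: "t \<in> functor_trivs emb F B \<A>"
  obtain m U h where m: "t = (m, U, h)" by (metis prod_cases3)
  show "local_triv FB t" using t local_triv_lift unfolding m functor_trivs_iff by blast
next
  show "(\<Union>(n, U, \<phi>)\<in>functor_trivs emb F B \<A>. U) = spt (bas FB)"
    unfolding FB_simps
  proof
    show "(\<Union>(n, U, \<phi>)\<in>functor_trivs emb F B \<A>. U) \<subseteq> topspace X"
      using functor_trivs_iff triv_subset by blast
    show "topspace X \<subseteq> (\<Union>(n, U, \<phi>)\<in>functor_trivs emb F B \<A>. U)"
    proof
      fix x assume "x \<in> topspace X"
      then obtain k U \<phi> where t: "(k, U, \<phi>) \<in> \<A>" "x \<in> U" using triv_cover by blast
      obtain m I where "ident k m I" using ex_ident by blast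
      then have "(m, U, FL k I \<phi>) \<in> functor_trivs emb F B \<A>" using t(1) functor_trivs_iff by blast
      with t(2) show "x \<in> (\<Union>(n, U, \<phi>)\<in>functor_trivs emb F B \<A>. U)" by blast
    qed
  qed
next
  fix s t assume st: "s \<in> functor_trivs emb F B \<A>" "t \<in> functor_trivs emb F B \<A>"
  obtain m U h m' V h' where e: "s = (m, U, h)" "t = (m', V, h')" by (metis prod_cases3)
  obtain k I \<phi> where s: "(k, U, \<phi>) \<in> \<A>" "ident k m I" "h = (FL k I \<phi>)"
    using st(1) unfolding e functor_trivs_iff by (elim exE conjE)
  obtain l I' \<psi> where t: "(l, V, \<psi>) \<in> \<A>" "ident l m' I'" "h' = (FL l I' \<psi>)"
    using st(2) unfolding e functor_trivs_iff by (elim exE conjE)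
  show "compatible FB s t"
    unfolding e s(3) t(3)
  proof (rule transition_imp_compatible [OF local_triv_lift [OF s(1,2)] local_triv_lift [OF t(1,2)]])
    fix x assume x: "x \<in> U" "x \<in> V"
    from compatible_imp_transition [OF triv_local [OF s(1)] triv_local [OF t(1)] triv_compatible [OF s(1) t(1)] x]
    obtain W K L where W: "x \<in> W" "transition B (k, U, \<phi>) (l, V, \<psi>) W K" "transition B (l, V, \<psi>) (k, U, \<phi>) W L"
      by (elim exE conjE)
    with transition_lift [OF s(1) t(1) s(2) t(2) W(2)] transition_lift [OF t(1) s(1) t(2) s(2) W(3)]
    show "\<exists>W K L. x \<in> W \<and> transition FB (m, U, FL k I \<phi>) (m', V, FL l I' \<psi>) W K \<and>
        transition FB (m', V, FL l I' \<psi>) (m, U, FL k I \<phi>) W L"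
      by (intro exI conjI)
  qed
qed

end

section \<open>Whitney's condition A\<close>

text \<open>The usual argument for first countable spaces.\<close>

lemma closure_of_sequence:
  assumes T: "second_countable T" and x: "x \<in> T closure_of R"
  shows "\<exists>xs. range xs \<subseteq> R \<and> limitin T xs x sequentially"
proof -
  have xT: "x \<in> topspace T" and meet: "\<forall>G. x \<in> G \<and> openin T G \<longrightarrow> (\<exists>y. y \<in> R \<and> y \<in> G)"
    using x unfolding in_closure_of by simp_all
  obtain \<B> where \<B>: "countable \<B>" "\<forall>V\<in>\<B>. openin T V" "\<forall>U x. openin T U \<and> x \<in> U \<longrightarrow> (\<exists>V\<in>\<B>. x \<in> V \<and> V \<subseteq> U)"
    using T unfolding second_countable_def by (elim exE conjE)
  define \<C> where "\<C> = {V \<in> \<B>. x \<in> V}"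
  have "\<C> \<noteq> {}" using \<B>(3) [rule_format, OF conjI [OF openin_topspace xT]] by (auto simp: \<C>_def)
  moreover have "countable \<C>" unfolding \<C>_def using \<B>(1) by (rule countable_subset [rotated]) blast
  ultimately have rng: "range (from_nat_into \<C>) = \<C>" by (rule range_from_nat_into)
  \<comment> \<open>Finite intersections turn the enumerated neighbourhoods of \<open>x\<close> into
    a decreasing sequence, so that a later member lies in all earlier ones.\<close>
  define W where "W n = (\<Inter>j\<in>{..n}. from_nat_into \<C> j)" for n :: nat
  have "openin T (W n) \<and> x \<in> W n" for n
  proof -
    have "openin T (from_nat_into \<C> j) \<and> x \<in> from_nat_into \<C> j" for j
      using rangeI [of "from_nat_into \<C>" j] \<B>(2) unfolding rng by (simp add: \<C>_def)
    then show ?thesis unfolding W_def by (auto intro!: openin_INT2)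
  qed
  then have "\<forall>n. \<exists>y. y \<in> R \<and> y \<in> W n" using meet by blast
  from choice [OF this] obtain xs where xs: "\<forall>n. xs n \<in> R \<and> xs n \<in> W n" by (rule exE)
  have "limitin T xs x sequentially"
    unfolding limitin_sequentially
  proof (intro conjI allI impI xT)
    fix U assume U: "openin T U \<and> x \<in> U"
    then obtain V where "V \<in> \<B>" "x \<in> V" "V \<subseteq> U" using \<B>(3) by blast
    then have "V \<in> range (from_nat_into \<C>)" unfolding rng by (simp add: \<C>_def)
    then obtain N where "V = from_nat_into \<C> N" by blast
    then have "xs n \<in> U" if n: "N \<le> n" for n
      using xs n \<open>V \<subseteq> U\<close> unfolding W_def by blast
    then show "\<exists>N. \<forall>n. N \<le> n \<longrightarrow> xs n \<in> U" by blast
  qed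
  then show ?thesis using xs by blast
qed

lemma limitin_Euclidean_space:
  assumes "\<And>n. f n \<in> E m" "v \<in> E m" "\<And>i. i < m \<Longrightarrow> (\<lambda>n. f n i) \<longlonglongrightarrow> v i"
  shows "limitin (Eu m) f v sequentially"
proof -
  have "(\<lambda>n. f n i) \<longlonglongrightarrow> v i" for i
    using assms by (cases "i < m") (auto simp: E_iff)
  then show ?thesis
    using assms(1,2) unfolding Euclidean_space_def limitin_subtopology
    by (auto simp: limitin_componentwise topspace_Euclidean_space)
qed

section \<open>Orthonormal frames and projections\<close>

definition orthonormal :: "nat \<Rightarrow> nat \<Rightarrow> (nat \<Rightarrow> vec) \<Rightarrow> bool"
  where "orthonormal r k b \<longleftrightarrow> (\<forall>j<r. b j \<in> E k) \<and>
    (\<forall>j<r. \<forall>l<r. (\<Sum>i<k. b j i * b l i) = (if j = l then 1 else 0))"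

lemma orthonormal_coefficient:
  assumes "orthonormal r k b" "l < r"
  shows "(\<Sum>i<k. (\<Sum>j<r. c j * b j i) * b l i) = c l"
proof -
  have "(\<Sum>i<k. (\<Sum>j<r. c j * b j i) * b l i) = (\<Sum>i<k. \<Sum>j<r. c j * (b j i * b l i))"
    by (simp add: sum_distrib_right mult.assoc)
  also have "\<dots> = (\<Sum>j<r. c j * (\<Sum>i<k. b j i * b l i))"
    by (subst sum.swap) (simp add: sum_distrib_left)
  also have "\<dots> = (\<Sum>j<r. c j * (if j = l then 1 else 0))"
    by (rule sum.cong [OF refl]) (use assms in \<open>simp add: orthonormal_def\<close>)
  also have "\<dots> = c l" using assms(2) by (simp add: if_distrib [of "\<lambda>x. _ * x"] sum.delta cong: if_cong)
  finally show ?thesis .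
qed

text \<open>Points of \<open>frames\<close> are extensional tuples, whence the restriction.
  Independence is read off from inner products with the frame vectors.\<close>

lemma orthonormal_frames:
  assumes b: "orthonormal r k b"
  shows "restrict b {..<r} \<in> topspace (frames r k)"
proof -
  have "v = (\<lambda>i. 0)" if v: "v \<in> E r" "lmap r (restrict b {..<r}) v = (\<lambda>i. 0)" for v
  proof
    fix l show "v l = 0"
    proof (cases "l < r")
      case True
      have "(\<Sum>j<r. v j * b j i) = 0" for i using fun_cong [OF v(2), of i] by (simp add: lmap_def)
      with orthonormal_coefficient [OF b True, of v] show ?thesis by simp
    qed (use v(1) in \<open>simp add: E_iff\<close>)
  qed
  moreover have "restrict b {..<r} \<in> (\<Pi>\<^sub>E j\<in>{..<r}. E k)" using b by (auto simp: orthonormal_def)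
  ultimately show ?thesis unfolding topspace_frames by blast
qed

lemma frame_span_restrict: "frame_span r (restrict b {..<r}) = frame_span r b"
  by (simp add: frame_span_def)

lemma orthonormal_bound:
  assumes b: "orthonormal r k b" and j: "j < r" and i: "i < k"
  shows "\<bar>b j i\<bar> \<le> 1"
proof -
  have "b j i * b j i \<le> (\<Sum>i<k. b j i * b j i)"
    by (rule member_le_sum) (use i in auto)
  also have "\<dots> = 1" using b j by (simp add: orthonormal_def)
  finally have "(b j i)\<^sup>2 \<le> 1" by (simp add: power2_eq_square)
  then show ?thesis by (simp add: abs_square_le_1)
qed

text \<open>The columns of the orthogonal projection onto the span of an orthonormal frame.\<close>

definition projection_columns :: "nat \<Rightarrow> (nat \<Rightarrow> vec) \<Rightarrow> nat \<Rightarrow> vec"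
  where "projection_columns r b j = (\<lambda>i. \<Sum>l<r. b l j * b l i)"

lemma lmap_projection: "lmap k (projection_columns r b) v = (\<lambda>i. \<Sum>l<r. (\<Sum>j<k. v j * b l j) * b l i)"
proof
  fix i
  have "(\<Sum>j<k. v j * (\<Sum>l<r. b l j * b l i)) = (\<Sum>j<k. \<Sum>l<r. v j * b l j * b l i)"
    by (simp add: sum_distrib_left mult.assoc)
  also have "\<dots> = (\<Sum>l<r. (\<Sum>j<k. v j * b l j) * b l i)"
    by (subst sum.swap) (simp add: sum_distrib_right)
  finally show "lmap k (projection_columns r b) v i = (\<Sum>l<r. (\<Sum>j<k. v j * b l j) * b l i)"
    by (simp add: lmap_def projection_columns_def)
qed

lemma projection_in_span: "lmap k (projection_columns r b) v \<in> frame_span r b"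
  unfolding lmap_projection frame_span_def by (rule range_eqI [where x = "\<lambda>l. \<Sum>j<k. v j * b l j"]) simp

lemma projection_fixes:
  assumes "orthonormal r k b" "w \<in> frame_span r b"
  shows "lmap k (projection_columns r b) w = w"
proof -
  obtain c where c: "w = (\<lambda>i. \<Sum>j<r. c j * b j i)" using assms(2) by (auto simp: frame_span_def)
  have "(\<Sum>j<k. w j * b l j) = c l" if "l < r" for l
    unfolding c by (rule orthonormal_coefficient [OF assms(1) that])
  then show ?thesis unfolding lmap_projection by (simp add: c)
qed

text \<open>A linear map with values in the image of an injective linear map factors through it, and
  injectivity makes the factor linear.\<close>

lemma linear_maps_lift:
  fixes V (structure)
  assumes V: "module real_ring V" and \<psi>: "\<psi> \<in> linear_maps V (Euc k)" "inj_on \<psi> (carrier V)"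
    and N: "N \<in> linear_maps (Euc p) (Euc k)" "\<And>v. v \<in> E p \<Longrightarrow> N v \<in> \<psi> ` carrier V"
  shows "(\<lambda>v. inv_into (carrier V) \<psi> (N v)) \<in> linear_maps (Euc p) V"
    and "v \<in> E p \<Longrightarrow> \<psi> (inv_into (carrier V) \<psi> (N v)) = N v"
proof -
  let ?g = "\<lambda>v. inv_into (carrier V) \<psi> (N v)"
  have g: "?g v \<in> carrier V" "\<psi> (?g v) = N v" if "v \<in> E p" for v
    using inv_into_into [OF N(2) [OF that]] f_inv_into_f [OF N(2) [OF that]] .
  show "v \<in> E p \<Longrightarrow> \<psi> (?g v) = N v" by (rule g(2))
  have eqI: "a = b" if "a \<in> carrier V" "b \<in> carrier V" "\<psi> a = \<psi> b" for a b
    using \<psi>(2) that by (simp add: inj_on_def)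
  show "?g \<in> linear_maps (Euc p) V"
    unfolding linear_maps_iff Euc_simps
  proof (intro conjI ballI allI)
    fix u assume u: "u \<in> E p"
    show "?g u \<in> carrier V" by (rule g(1) [OF u])
    show "?g (\<lambda>i. c * u i) = c \<odot> ?g u" for c
    proof (rule eqI)
      have cu: "(\<lambda>i. c * u i) \<in> E p" by (rule E_scale [OF u])
      show "?g (\<lambda>i. c * u i) \<in> carrier V" by (rule g(1) [OF cu])
      show "c \<odot> ?g u \<in> carrier V" by (rule module_smult_closed [OF V g(1) [OF u]])
      have "\<psi> (?g (\<lambda>i. c * u i)) = N (\<lambda>i. c * u i)" by (rule g(2) [OF cu])
      also have "\<dots> = (\<lambda>i. c * N u i)" by (rule linear_maps_scale [OF N(1) u])
      also have "\<dots> = (\<lambda>i. c * \<psi> (?g u) i)" unfolding g(2) [OF u] ..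
      also have "\<dots> = \<psi> (c \<odot> ?g u)" using \<psi>(1) g(1) [OF u] by (simp add: linear_maps_iff)
      finally show "\<psi> (?g (\<lambda>i. c * u i)) = \<psi> (c \<odot> ?g u)" .
    qed
    fix v assume v: "v \<in> E p"
    show "?g (\<lambda>i. u i + v i) = ?g u \<oplus> ?g v"
    proof (rule eqI)
      have uv: "(\<lambda>i. u i + v i) \<in> E p" by (rule E_add [OF u v])
      show "?g (\<lambda>i. u i + v i) \<in> carrier V" by (rule g(1) [OF uv])
      show "?g u \<oplus> ?g v \<in> carrier V" by (rule module_add_closed [OF V g(1) [OF u] g(1) [OF v]])
      have "\<psi> (?g (\<lambda>i. u i + v i)) = N (\<lambda>i. u i + v i)" by (rule g(2) [OF uv])
      also have "\<dots> = (\<lambda>i. N u i + N v i)" by (rule linear_maps_add [OF N(1) u v])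
      also have "\<dots> = (\<lambda>i. \<psi> (?g u) i + \<psi> (?g v) i)" unfolding g(2) [OF u] g(2) [OF v] ..
      also have "\<dots> = \<psi> (?g u \<oplus> ?g v)"
        using \<psi>(1) g(1) [OF u] g(1) [OF v] by (simp add: linear_maps_iff)
      finally show "\<psi> (?g (\<lambda>i. u i + v i)) = \<psi> (?g u \<oplus> ?g v)" .
    qed
  qed
qed

section \<open>Limits of fibres and condition A for the lifted bundle\<close>

context whitney_functor
begin

lemma whitney_pair:
  assumes "S \<in> \<S>" "R \<in> \<S>" "S \<subseteq> X closure_of R"
  shows "whitney_A_pair B \<A> S R"
  using whitney assms unfolding whitney_A_bundle_def by blast

text \<open>The rank \<open>r\<close> belongs to the stratum \<open>R\<close>, so frames at all
  points of a sequence in \<open>R\<close> have the same length and can be compared.\<close>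

lemma fibre_orthonormal_frame:
  assumes R: "R \<in> \<S>" and vb: "smooth_vb B R r" and t: "(k, U, \<phi>) \<in> \<A>" and x: "x \<in> R" "x \<in> U"
  shows "\<exists>b. orthonormal r k b \<and> frame_span r b = (\<lambda>a. snd (\<phi> a)) ` over B {x}"
proof -
  let ?\<phi> = "\<lambda>a. snd (\<phi> a)"
  obtain V \<tau> where \<tau>: "x \<in> V" "smooth_local_triv B R r V \<tau>" using vb x(1) unfolding smooth_vb_def by blast
  have xX: "x \<in> topspace X" using stratum_subset [OF R] x(1) by blast
  have mf: "module real_ring (fibre B x)" by (rule fd_vspace_module [OF fd_fibre [OF xX]])
  have cf: "carrier (fibre B x) = over B {x}" by (simp add: fibre_def)
  obtain \<eta> where \<eta>: "linear_iso (Euc r) (fibre B x) \<eta>"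
    using linear_iso_inverse [OF slt_iso [OF R \<tau>(2,1)] mf module_Euc] by blast
  then have \<eta>l: "\<eta> \<in> linear_maps (Euc r) (fibre B x)" and \<eta>b: "bij_betw \<eta> (E r) (over B {x})"
    by (simp_all add: linear_iso_def cf)
  have \<phi>l: "?\<phi> \<in> linear_maps (fibre B x) (Euc k)" by (rule triv_linear [OF t x(2)])
  have \<phi>i: "inj_on ?\<phi> (over B {x})" using triv_inj_fibre [OF t x(2)] unfolding cf .
  note M = linear_maps_comp [OF \<eta>l \<phi>l]
  define A where "A j = ?\<phi> (\<eta> (unit_vec j))" for j
  have MA: "?\<phi> (\<eta> v) = lmap r A v" if "v \<in> E r" for v
    unfolding A_def by (rule linear_maps_eq_lmap [OF M that])
  have AE: "A j \<in> E k" if "j < r" for j unfolding A_def by (rule linear_maps_E [OF M]) (simp add: that)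
  have inj: "v = (\<lambda>i. 0)" if v: "v \<in> E r" "lmap r A v = (\<lambda>i. 0)" for v
  proof -
    have z: "(\<lambda>i. 0) \<in> E r" by (simp add: E_iff)
    have "?\<phi> (\<eta> v) = ?\<phi> (\<eta> (\<lambda>i. 0))" unfolding MA [OF v(1)] MA [OF z] v(2) by simp
    moreover have "\<eta> v \<in> over B {x}" "\<eta> (\<lambda>i. 0) \<in> over B {x}" using \<eta>b v(1) z by (auto simp: bij_betw_def)
    ultimately have "\<eta> v = \<eta> (\<lambda>i. 0)" using \<phi>i by (simp add: inj_on_def)
    then show ?thesis using \<eta>b v(1) z by (simp add: bij_betw_def inj_on_def)
  qed
  have "\<exists>b. (\<forall>j<r. b j \<in> E k) \<and> (\<forall>j<r. \<forall>l<r. (\<Sum>i<k. b j i * b l i) = (if j = l then 1 else 0)) \<and>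
      frame_span r b = lmap r A ` E r"
    by (rule orthonormal_frame [OF AE inj])
  then obtain b where b: "\<forall>j<r. b j \<in> E k" "\<forall>j<r. \<forall>l<r. (\<Sum>i<k. b j i * b l i) = (if j = l then 1 else 0)"
      "frame_span r b = lmap r A ` E r"
    by (elim exE conjE)
  have "lmap r A ` E r = (\<lambda>v. ?\<phi> (\<eta> v)) ` E r" using MA by simp
  also have "\<dots> = ?\<phi> ` (\<eta> ` E r)" by (simp add: image_image)
  also have "\<eta> ` E r = over B {x}" using \<eta>b by (simp add: bij_betw_def)
  finally have "frame_span r b = ?\<phi> ` over B {x}" using b(3) by simp
  moreover have "orthonormal r k b" using b(1,2) by (simp add: orthonormal_def)
  ultimately show ?thesis by blast
qed

text \<open>Orthonormal frames of the fibres over the sequence subconverge; by condition A the limit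
  of the orthogonal projections fixes the fibre over the limit point.\<close>

lemma whitney_projections:
  assumes S: "S \<in> \<S>" and R: "R \<in> \<S>" and SR: "S \<subseteq> X closure_of R"
    and t: "(k, U, \<phi>) \<in> \<A>" and x0: "x0 \<in> S" "x0 \<in> U" and xs: "\<And>n. xs n \<in> R" "\<And>n. xs n \<in> U"
    and lim: "limitin X xs x0 sequentially"
  shows "\<exists>s g P. strict_mono s \<and> (\<forall>n. g n \<in> linear_maps (Euc k) (fibre B (xs (s n)))) \<and> (\<forall>j<k. P j \<in> E k) \<and>
    (\<forall>j<k. \<forall>i<k. (\<lambda>n. snd (\<phi> (g n (unit_vec j))) i) \<longlonglongrightarrow> P j i) \<and>
    (\<forall>a\<in>over B {x0}. lmap k P (snd (\<phi> a)) = snd (\<phi> a))"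
proof -
  obtain r where vb: "smooth_vb B R r" using smooth_vb_stratum(2) [OF R] by blast
  have "\<forall>n. \<exists>b. orthonormal r k b \<and> frame_span r b = (\<lambda>a. snd (\<phi> a)) ` over B {xs n}"
    using fibre_orthonormal_frame [OF R vb t xs] by blast
  from choice [OF this] obtain b where
    b: "\<And>n. orthonormal r k (b n)" "\<And>n. frame_span r (b n) = (\<lambda>a. snd (\<phi> a)) ` over B {xs n}" by blast
  obtain s where s: "strict_mono s" "\<forall>p\<in>{..<r} \<times> {..<k}. \<exists>l. (\<lambda>n. b (s n) (fst p) (snd p)) \<longlonglongrightarrow> l"
    using convergent_subsequence_finite [of "{..<r} \<times> {..<k}" "\<lambda>n p. b n (fst p) (snd p)" 1] orthonormal_bound [OF b(1)]
    by auto
  from bchoice [OF s(2)] obtain L where L: "\<forall>p\<in>{..<r} \<times> {..<k}. (\<lambda>n. b (s n) (fst p) (snd p)) \<longlonglongrightarrow> L p" by (rule exE)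
  \<comment> \<open>The limits \<open>L\<close> are specified for indices below \<open>k\<close>
    only; the value 0 beyond puts \<open>b0 j\<close> into \<open>E k\<close>.\<close>
  define b0 where "b0 j i = (if i < k then L (j, i) else 0)" for j i
  have b0: "(\<lambda>n. b (s n) j i) \<longlonglongrightarrow> b0 j i" if ji: "j < r" "i < k" for j i
    using bspec [OF L, of "(j, i)"] ji by (simp add: b0_def)
  have "(\<Sum>i<k. b0 j i * b0 l i) = (if j = l then 1 else 0)" if jl: "j < r" "l < r" for j l
  proof (rule LIMSEQ_unique)
    show "(\<lambda>n. \<Sum>i<k. b (s n) j i * b (s n) l i) \<longlonglongrightarrow> (\<Sum>i<k. b0 j i * b0 l i)"
      using jl b0 by (intro tendsto_sum tendsto_mult) auto
    have "(\<Sum>i<k. b (s n) j i * b (s n) l i) = (if j = l then 1 else 0)" for n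
      using b(1) jl by (simp add: orthonormal_def)
    then show "(\<lambda>n. \<Sum>i<k. b (s n) j i * b (s n) l i) \<longlonglongrightarrow> (if j = l then 1 else 0)" by simp
  qed
  then have ob0: "orthonormal r k b0" by (simp add: orthonormal_def b0_def E_iff)
  have sxs: "limitin X (\<lambda>n. xs (s n)) x0 sequentially" using limitin_subsequence [OF s(1) lim] by (simp add: o_def)
  have "limitin (grassmannian r k) (\<lambda>n. frame_span r (restrict (b (s n)) {..<r})) (frame_span r (restrict b0 {..<r})) sequentially"
    by (rule frame_span_limit) (use orthonormal_frames [OF b(1)] orthonormal_frames [OF ob0] b0 in auto)
  then have "limitin (grassmannian r k) (\<lambda>n. snd ` \<phi> ` over B {xs (s n)}) (frame_span r b0) sequentially"
    unfolding frame_span_restrict b(2) image_image .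
  with sxs have pl: "limitin (prod_topology X (grassmannian r k)) (\<lambda>n. (xs (s n), snd ` \<phi> ` over B {xs (s n)})) (x0, frame_span r b0) sequentially"
    unfolding limitin_pairwise by (simp add: o_def)
  \<comment> \<open>Condition A for \<open>A\<close> asks for convergence of the whole fibres in the
    Grassmannian; it is available along the subsequence \<open>s\<close>, with limit the span of
    \<open>b0\<close>.\<close>
  have "snd ` \<phi> ` over B {x0} \<subseteq> frame_span r b0"
    using whitney_pair [OF S R SR, unfolded whitney_A_pair_def, rule_format, OF x0(1) t, unfolded prod.case, rule_format,
        OF x0(2), of r "\<lambda>n. xs (s n)" "frame_span r b0"] vb xs(1) sxs pl by blast
  then have fix0: "lmap k (projection_columns r b0) (snd (\<phi> a)) = snd (\<phi> a)" if a: "a \<in> over B {x0}" for a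
    using a by (intro projection_fixes [OF ob0]) blast
  define P where "P n = lmap k (projection_columns r (b (s n)))" for n
  have cE: "projection_columns r c j \<in> E k" if "orthonormal r k c" for c j
    unfolding projection_columns_def by (rule E_sum) (use that in \<open>simp add: orthonormal_def\<close>)
  have Pl: "P n \<in> linear_maps (Euc k) (Euc k)" for n unfolding P_def by (rule lmap_linear_maps) (rule cE [OF b(1)])
  \<comment> \<open>The projection \<open>P n\<close> has its values in the image of the fibre, so
    it factors as \<phi> after \<open>g n\<close>. The factorization is what \<open>F\<close> can
    use, while only the composite converges.\<close>
  define g where "g n v = inv_into (carrier (fibre B (xs (s n)))) (\<lambda>a. snd (\<phi> a)) (P n v)" for n v
  have mf: "module real_ring (fibre B (xs (s n)))" for n
    by (rule fd_vspace_module [OF fd_fibre]) (use stratum_subset [OF R] xs(1) in blast)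
  have Pin: "P n v \<in> (\<lambda>a. snd (\<phi> a)) ` carrier (fibre B (xs (s n)))" for n v
    using projection_in_span [of k r "b (s n)" v] unfolding b(2) by (simp add: P_def fibre_def)
  note lift = linear_maps_lift [OF mf triv_linear [OF t xs(2)] triv_inj_fibre [OF t xs(2)] Pl Pin]
  have gl: "g n \<in> linear_maps (Euc k) (fibre B (xs (s n)))" for n
    using lift(1) [of n] unfolding g_def .
  have g\<phi>: "snd (\<phi> (g n (unit_vec j))) = projection_columns r (b (s n)) j" if j: "j < k" for n j
  proof -
    have "snd (\<phi> (g n (unit_vec j))) = P n (unit_vec j)" unfolding g_def by (rule lift(2)) (simp add: j)
    then show ?thesis using j by (simp add: P_def lmap_unit_vec)
  qed
  have "(\<lambda>n. snd (\<phi> (g n (unit_vec j))) i) \<longlonglongrightarrow> projection_columns r b0 j i" if ji: "j < k" "i < k" for j i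
    unfolding g\<phi> [OF ji(1)] projection_columns_def using ji b0 by (intro tendsto_sum tendsto_mult) auto
  then show ?thesis using s(1) gl fix0 cE [OF ob0] by (intro exI [of _ s] exI [of _ g] exI [of _ "projection_columns r b0"]) blast
qed

text \<open>The subsequence is forced by the compactness argument for the projections. It does no
  harm in the applications: membership in a closure and limits in the Grassmannian are
  inherited.\<close>

lemma whitney_sequence_FB:
  assumes S: "S \<in> \<S>" and R: "R \<in> \<S>" and SR: "S \<subseteq> X closure_of R"
    and z: "z \<in> FS S" and xs: "range xs \<subseteq> R" and lim: "limitin X xs (fst z) sequentially"
  shows "\<exists>s zs. strict_mono s \<and> (\<forall>n. zs n \<in> FS {xs (s n)}) \<and> limitin FT zs z sequentially"
proof -
  have x0: "fst z \<in> S" "fst z \<in> topspace X" by (rule fst_FS [OF z])+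
  obtain k U \<phi> where t: "(k, U, \<phi>) \<in> \<A>" and xU: "fst z \<in> U" using triv_cover [OF x0(2)] by blast
  obtain m I where I: "ident k m I" using ex_ident by blast
  have Uo: "openin X U" by (rule triv_open [OF t])
  \<comment> \<open>The sequence enters the domain \<open>U\<close> only from some index on, hence
    the shift by \<open>N\<close> throughout.\<close>
  obtain N where N: "\<forall>n. N \<le> n \<longrightarrow> xs n \<in> U" using lim Uo xU unfolding limitin_sequentially by blast
  have limN: "limitin X (\<lambda>n. xs (n + N)) (fst z) sequentially" by (rule limitin_sequentially_offset [OF lim])
  have RN: "xs (n + N) \<in> R" "xs (n + N) \<in> U" for n using xs N by auto
  obtain s g P where s: "strict_mono s" and g: "\<forall>n. g n \<in> linear_maps (Euc k) (fibre B (xs (s n + N)))"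
    and PE: "\<forall>j<k. P j \<in> E k" and gP: "\<forall>j<k. \<forall>i<k. (\<lambda>n. snd (\<phi> (g n (unit_vec j))) i) \<longlonglongrightarrow> P j i"
    and fix0: "\<forall>a\<in>over B {fst z}. lmap k P (snd (\<phi> a)) = snd (\<phi> a)"
    using whitney_projections [OF S R SR t x0(1) xU, of "\<lambda>n. xs (n + N)", OF RN limN] by (elim exE conjE)
  define y where "y n = xs (s n + N)" for n
  have yX: "y n \<in> topspace X" "y n \<in> U" for n using RN stratum_subset [OF R] by (auto simp: y_def)
  have zU: "z \<in> FS U" using z xU by (simp add: FS_iff)
  define w where "w = Fl k I \<phi> z"
  have wE: "w \<in> E m" unfolding w_def by (rule triv_Fl_E [OF t I zU])
  \<comment> \<open>\<open>F(g n)\<close> applied to the coordinate vector \<open>w\<close> of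
    \<open>z\<close>. By \<open>flift_section\<close> the coordinates of the result are
    \<open>F(P n) w\<close>, where \<open>P n\<close> is the projection onto the fibre over
    \<open>y n\<close>.\<close>
  define zs where "zs n = (y n, ap (eo k) (fibre B (y n)) (\<lambda>u. g n (iemb u)) (unident k I w))" for n
  have gy: "g n \<in> linear_maps (Euc k) (fibre B (y n))" for n using g by (simp add: y_def)
  have \<phi>l: "(\<lambda>a. snd (\<phi> a)) \<in> linear_maps (fibre B (y n)) (Euc k)" for n by (rule triv_linear [OF t yX(2)])
  have zsF: "zs n \<in> FS {y n}" for n
    using flift_section_closed [OF fd_fibre [OF yX(1)] gy I wE] yX(1) by (simp add: FS_iff zs_def)
  have zsU: "zs n \<in> FS U" for n using zsF [of n] FS_mono [of "{y n}" U] yX(2) by blast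
  have e: "Fl k I \<phi> (zs n) = transf k k I I (\<lambda>u. snd (\<phi> (g n u))) w" for n
    unfolding flift_section [OF fd_fibre [OF yX(1)] \<phi>l gy I wE] by (simp add: Fl_def zs_def)
  have Pl: "lmap k P \<in> linear_maps (Euc k) (Euc k)" by (rule lmap_linear_maps) (use PE in blast)
  \<comment> \<open>The limit projection fixes the image of the fibre over \<open>fst z\<close>, so
    by functoriality it fixes \<open>w\<close>; therefore the points \<open>zs n\<close> converge to
    \<open>z\<close> itself.\<close>
  have Pw: "transf k k I I (lmap k P) w = w"
    unfolding w_def by (rule Fl_transf [OF triv_fibre_linear [OF t] I zU Pl]) (use fix0 in blast)
  have conv: "(\<lambda>n. Fl k I \<phi> (zs n) i) \<longlonglongrightarrow> Fl k I \<phi> z i" for i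
  proof -
    have "(\<lambda>n. transf k k I I (\<lambda>u. snd (\<phi> (g n u))) w i) \<longlonglongrightarrow> transf k k I I (lmap k P) w i"
      unfolding transf_matrix [OF linear_maps_comp [OF gy \<phi>l] I I wE] transf_matrix [OF Pl I I wE]
      by (intro tendsto_sum tendsto_mult tendsto_const) (use gP in \<open>auto simp: lmap_unit_vec\<close>)
    then show ?thesis unfolding e Pw by (simp add: w_def)
  qed
  have "limitin FT zs z sequentially"
    unfolding limitin_def
  proof (intro conjI allI impI)
    show "z \<in> topspace FT" using z FS_topspace by blast
    fix Q assume Q: "openin FT Q \<and> z \<in> Q"
    obtain G where G: "openin (prodT U m) G" "(fst z, Fl k I \<phi> z) \<in> G"
        "FS U \<inter> (FL k I \<phi>) -` G \<subseteq> Q"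
      using FT_local_base [OF conjunct1 [OF Q] conjunct2 [OF Q] t xU I] by (elim exE conjE)
    have "limitin X (\<lambda>n. y n) (fst z) sequentially"
      using limitin_subsequence [OF s limN] by (simp add: o_def y_def)
    then have "limitin (subtopology X U) y (fst z) sequentially"
      unfolding limitin_subtopology using xU yX(2) by simp
    moreover have "limitin (Eu m) (\<lambda>n. Fl k I \<phi> (zs n)) (Fl k I \<phi> z) sequentially"
      by (rule limitin_Euclidean_space [OF triv_Fl_E [OF t I zsU] triv_Fl_E [OF t I zU] conv])
    ultimately have "limitin (prodT U m) (\<lambda>n. (y n, Fl k I \<phi> (zs n))) (fst z, Fl k I \<phi> z) sequentially"
      unfolding limitin_pairwise by (simp add: o_def)
    from limitinD [OF this G(1,2)] show "\<forall>\<^sub>F n in sequentially. zs n \<in> Q"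
    proof (rule eventually_mono)
      fix n assume "(y n, Fl k I \<phi> (zs n)) \<in> G"
      then have "zs n \<in> FS U \<inter> (FL k I \<phi>) -` G" using zsU [of n] by (simp add: zs_def)
      then show "zs n \<in> Q" using G(3) by blast
    qed
  qed
  moreover have "strict_mono (\<lambda>n. s n + N)" using s by (simp add: strict_mono_def)
  ultimately show ?thesis using zsF unfolding y_def by (intro exI [of _ "\<lambda>n. s n + N"] exI [of _ zs]) simp
qed

lemma frontier_bas:
  "S \<in> \<S> \<Longrightarrow> R \<in> \<S> \<Longrightarrow> S \<inter> X closure_of R \<noteq> {} \<Longrightarrow> S \<subseteq> X closure_of R"
  using strat_bas unfolding stratified_space_def by blast

text \<open>One common point projects to a point of \<open>S\<close> in the closure of
  \<open>R\<close>, so the frontier condition of the base applies. Conversely, every point over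
  \<open>S\<close> is then approached by points over \<open>R\<close>, first in the base and then in
  the fibres.\<close>

lemma frontier_FB:
  assumes S: "S \<in> \<S>" and R: "R \<in> \<S>" and ne: "FS S \<inter> FT closure_of FS R \<noteq> {}"
  shows "FS S \<subseteq> FT closure_of FS R"
proof
  obtain z0 where z0: "z0 \<in> FS S" "z0 \<in> FT closure_of FS R" using ne by blast
  have "fst z0 \<in> X closure_of (fst ` FS R)"
    using continuous_map_image_closure_subset [OF continuous_map_FT_fst] z0(2) by blast
  moreover have "X closure_of (fst ` FS R) \<subseteq> X closure_of R" using fst_FS(1) by (intro closure_of_mono) blast
  ultimately have SR: "S \<subseteq> X closure_of R" using frontier_bas [OF S R] fst_FS(1) [OF z0(1)] by blast
  fix z assume z: "z \<in> FS S"
  have "fst z \<in> X closure_of R" using SR fst_FS(1) [OF z] by blast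
  from closure_of_sequence [OF second_X this] obtain xs where
    xs: "range xs \<subseteq> R" "limitin X xs (fst z) sequentially" by blast
  obtain s zs where zs: "\<forall>n. zs n \<in> FS {xs (s n)}" "limitin FT zs z sequentially"
    using whitney_sequence_FB [OF S R SR z xs] by (elim exE conjE)
  have zsR: "zs n \<in> FS R" for n using zs(1) FS_mono [of "{xs (s n)}" R] xs(1) by blast
  show "z \<in> FT closure_of FS R"
    by (rule limitin_closedin [OF zs(2) closedin_closure_of])
      (use zsR closure_of_subset [OF FS_topspace] in \<open>auto intro!: always_eventually\<close>)
qed

lemma stratified_space_FB: "stratified_space (tot FB)"
  unfolding stratified_space_def FB_simps
proof (intro conjI ballI)
  show "Hausdorff_space FT" by (rule Hausdorff_FT)
  show "second_countable FT" by (rule second_countable_FT)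
  show "paracompact_space FT" by (rule paracompact_FT)
  show "partition_on (topspace FT) (FS ` \<S>)"
    unfolding partition_on_def
  proof (intro conjI)
    show "\<Union>(FS ` \<S>) = topspace FT"
    proof
      show "\<Union>(FS ` \<S>) \<subseteq> topspace FT" using FS_topspace by blast
      show "topspace FT \<subseteq> \<Union>(FS ` \<S>)"
      proof
        fix z assume z: "z \<in> topspace FT"
        then have "fst z \<in> topspace X" using fst_FS(2) unfolding topspace_FT by blast
        then obtain S where "S \<in> \<S>" "fst z \<in> S" using stratum_of by blast
        moreover from this have "z \<in> FS S" using z unfolding topspace_FT by (simp add: FS_iff)
        ultimately show "z \<in> \<Union>(FS ` \<S>)" by blast
      qed
    qed
    show "disjoint (FS ` \<S>)" using disjoint_strata_FB by simp
    have "FS S \<noteq> {}" if S: "S \<in> \<S>" for S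
    proof -
      have "S \<noteq> {}" using part_bas S unfolding partition_on_def by blast
      then obtain x where "x \<in> S" by blast
      then show ?thesis using zero_FS [of x S] stratum_subset [OF S] by blast
    qed
    then show "{} \<notin> FS ` \<S>" by blast
  qed
  show "locally_finite_in FT (FS ` \<S>)"
    unfolding locally_finite_in_def
  proof (intro conjI ballI)
    show "\<Union>(FS ` \<S>) \<subseteq> topspace FT" using FS_topspace by blast
    fix z assume "z \<in> topspace FT"
    then have z: "z \<in> FS UNIV" unfolding topspace_FT .
    have "locally_finite_in X (\<S>)" using strat_bas unfolding stratified_space_def by blast
    then obtain N where N: "openin X N" "fst z \<in> N" "finite {S \<in> \<S>. S \<inter> N \<noteq> {}}"
      using fst_FS(2) [OF z] unfolding locally_finite_in_def by blast
    have "{Q \<in> FS ` \<S>. Q \<inter> FS N \<noteq> {}} \<subseteq> FS ` {S \<in> \<S>. S \<inter> N \<noteq> {}}"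
      using fst_FS(1) by blast
    then have "finite {Q \<in> FS ` \<S>. Q \<inter> FS N \<noteq> {}}" by (rule finite_subset) (rule finite_imageI [OF N(3)])
    moreover have "z \<in> FS N" using z N(2) by (simp add: FS_iff)
    ultimately show "\<exists>V. openin FT V \<and> z \<in> V \<and> finite {Q \<in> FS ` \<S>. Q \<inter> V \<noteq> {}}"
      using openin_FS [OF N(1)] by blast
  qed
next
  fix Q assume "Q \<in> FS ` \<S>"
  then obtain S where S: "S \<in> \<S>" "Q = FS S" by blast
  have SX: "connectedin X S" "\<exists>U C. openin X U \<and> closedin X C \<and> S = U \<inter> C"
    using strat_bas S(1) unfolding stratified_space_def by blast+
  show "connectedin FT Q" unfolding S(2) by (rule connectedin_FS [OF SX(1)])
  obtain U C where U: "openin X U" "closedin X C" "S = U \<inter> C" using SX(2) by blast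
  have "{z \<in> topspace FT. fst z \<in> C} = FS C" unfolding topspace_FT by (auto simp: FS_iff)
  then have "closedin FT (FS C)" using closedin_continuous_map_preimage [OF continuous_map_FT_fst U(2)] by simp
  moreover have "Q = FS U \<inter> FS C" unfolding S(2) U(3) FS_Int ..
  ultimately show "\<exists>U C. openin FT U \<and> closedin FT C \<and> Q = U \<inter> C" using openin_FS [OF U(1)] by blast
  show "smooth_manifold (sub_mfd (tot FB) Q)" unfolding S(2) by (rule smooth_tot_FB [OF S(1)])
next
  fix a assume "a \<in> charts (tot FB)"
  then obtain S where S: "S \<in> \<S>" "a \<in> max_atlas (FTS S) (functor_charts emb F B S)"
    unfolding charts_FB by blast
  obtain d U c where a: "a = (d, U, c)" by (metis prod_cases3)
  have "is_chart (FTS S) (d, U, c)" using S(2) unfolding a max_atlas_def by blast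
  from openin_subset [OF chart_open [OF this]] have "U \<subseteq> FS S" unfolding topspace_sub_FS .
  then show "case a of (d, U, c) \<Rightarrow> \<exists>S\<in>FS ` \<S>. U \<subseteq> S" unfolding a prod.case using S(1) by blast
next
  fix P Q assume PQ: "P \<in> FS ` \<S>" "Q \<in> FS ` \<S>"
  then obtain S R where "S \<in> \<S>" "P = FS S" "R \<in> \<S>" "Q = FS R" by blast
  then show "P \<inter> FT closure_of Q \<noteq> {} \<longrightarrow> P \<subseteq> FT closure_of Q" using frontier_FB by blast
qed

lemma stratified_vector_bundle_FB: "stratified_vector_bundle FB"
  unfolding stratified_vector_bundle_def
proof (intro conjI ballI)
  show "stratified_space (tot FB)" by (rule stratified_space_FB)
  show "stratified_space (bas FB)" using strat_bas by simp
  show "strat_morphism (tot FB) (bas FB) (proj FB)" by (rule strat_morphism_proj_FB)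
  show "strat_morphism (strat_prod (one_stratum real_mfd) (tot FB)) (tot FB) (\<lambda>(c, a). fsmult FB c a)"
    by (rule strat_morphism_smult_FB)
  fix S assume "S \<in> strata (bas FB)"
  then have S: "S \<in> \<S>" by simp
  then show "over FB S \<in> strata (tot FB)" by simp
  obtain r where r: "smooth_vb B S r" using smooth_vb_stratum(2) [OF S] by blast
  obtain m I where "ident r m I" using ex_ident by blast
  from smooth_vb_FB [OF S r this] show "\<exists>r. smooth_vb FB S r" by blast
qed

text \<open>The member \<open>h\<close> of the generated structure may be no lift, but it is
  continuous. Points over the sequence that converge to \<open>z\<close> are therefore sent to
  vectors in the given subspaces that converge to the image of \<open>z\<close>, and
  \<open>grassmannian_limit\<close> puts this limit into \<open>W\<close>.\<close>

lemma whitney_A_pair_FB: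
  assumes S: "S \<in> \<S>" and R: "R \<in> \<S>" and SR: "S \<subseteq> X closure_of R"
  shows "whitney_A_pair FB (generated_structure FB (functor_trivs emb F B \<A>)) S R"
  unfolding whitney_A_pair_def over_FB FB_simps
proof (intro ballI, unfold split_paired_all prod.case, intro impI allI)
  fix x0 k U h xs r W
  assume x0: "x0 \<in> S" "x0 \<in> U" and h: "(k, U, h) \<in> generated_structure FB (functor_trivs emb F B \<A>)"
    and *: "smooth_vb FB R r \<and> range xs \<subseteq> R \<and> limitin X xs x0 sequentially \<and>
      limitin (prod_topology X (grassmannian r k)) (\<lambda>n. (xs n, snd ` h ` FS {xs n})) (x0, W) sequentially"
  have lt: "local_triv FB (k, U, h)" using h unfolding generated_structure_def by blast
  have limW: "limitin (grassmannian r k) (\<lambda>n. snd ` h ` FS {xs n}) W sequentially"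
    using * unfolding limitin_pairwise by (simp add: o_def)
  show "snd ` h ` FS {x0} \<subseteq> W"
  proof
    fix w assume "w \<in> snd ` h ` FS {x0}"
    then obtain z where z: "z \<in> FS {x0}" "w = snd (h z)" by blast
    have fz: "fst z = x0" using fst_FS(1) [OF z(1)] by simp
    have zS: "z \<in> FS S" and zU: "z \<in> FS U" using z(1) FS_mono [of "{x0}"] x0 by blast+
    obtain s zs where s: "strict_mono s" and zs: "\<forall>n. zs n \<in> FS {xs (s n)}" "limitin FT zs z sequentially"
      using whitney_sequence_FB [OF S R SR zS] * unfolding fz by (elim exE conjE) blast
    have "openin X U" using local_triv_open [OF lt] by simp
    from limitinD [OF zs(2) openin_FS [OF this] zU]
    have "limitin (FTS U) zs z sequentially" using zs(2) zU by (simp add: limitin_subtopology)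
    moreover have "continuous_map (FTS U) (prodT U k) h"
      using local_triv_embedding [OF lt] unfolding embedding_map_def over_FB FB_simps
      by (intro continuous_map_into_fulltopology [OF homeomorphic_imp_continuous_map])
    ultimately have "limitin (prodT U k) (h \<circ> zs) (h z) sequentially"
      by (rule continuous_map_limit [rotated])
    then have "limitin (Eu k) (\<lambda>n. snd (h (zs n))) w sequentially"
      unfolding limitin_pairwise z(2) by (simp add: o_def)
    from continuous_map_limit [OF continuous_map_coord this]
    have conv: "(\<lambda>n. snd (h (zs n)) i) \<longlonglongrightarrow> w i" for i by (simp add: o_def)
    show "w \<in> W"
    proof (rule grassmannian_limit [OF _ _ conv])
      show "limitin (grassmannian r k) (\<lambda>n. snd ` h ` FS {xs (s n)}) W sequentially"
        using limitin_subsequence [OF s limW] by (simp add: o_def)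
      show "snd (h (zs n)) \<in> snd ` h ` FS {xs (s n)}" for n using zs(1) by blast
      show "w \<in> E k" unfolding z(2) by (rule local_triv_E [OF lt]) (simp add: zU)
    qed
  qed
qed

lemma whitney_A_bundle_FB: "whitney_A_bundle FB (generated_structure FB (functor_trivs emb F B \<A>))"
  unfolding whitney_A_bundle_def
  using stratified_vector_bundle_FB injective_structure_FB whitney_A_pair_FB by simp

end

theorem theorem4p1:
  fixes B :: "('v, 'x) svb"
    and \<A> :: "('v, 'x) triv set"
    and F :: "('v, unit) vs_functor"
    and emb :: "(nat \<Rightarrow> real) \<Rightarrow> 'v"
  assumes "inj emb"
    and "whitney_A_bundle B \<A>"
    and "linear_functor fd_vspace F"
    and "orthogonalizable F"
  shows "whitney_A_bundle (functor_bundle emb F B \<A>)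
    (generated_structure (functor_bundle emb F B \<A>) (functor_trivs emb F B \<A>))"
proof -
  interpret whitney_functor emb F B \<A>
    using assms(1-3) by unfold_locales
  show ?thesis by (rule whitney_A_bundle_FB)
qed

end
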